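(* Let $0<\theta<\pi/2$. Suppose $\{\varphi^0_\theta,\varphi^1_\theta,\varphi^2_\theta,\varphi^3_\theta\}\in(L^2(\mathbb{R}))^4$ satisfies, for every $j\in\{0,1,2,3\}$ (indices mod 4, so $\varphi^{-1}_\theta=\varphi^3_\theta$, $\varphi^4_\theta=\varphi^0_\theta$), $\varphi^j_\theta(t)=SD_\theta\varphi^{j-1}_\theta(t)$ for $t<-a$, $\varphi^j_\theta(t)=D_\theta S\varphi^{j+1}_\theta(t)$ for $t>a$, and $\varphi^j_\theta(t)=0$ for $-a<t<a$. Then $\varphi^j_\theta=0$ for all $j\in\{0,1,2,3\}$.
   Context: Fix $a>0$ and $k>0$. Square roots are principal ($\mathrm{Arg}\in(-\pi,\pi]$), $R(w,z)=(w^2+z^2)^{1/2}$, $h(x_1,x_2)=\frac{ikx_1}{2}\frac{H_1^{(1)}(kR(x_1,x_2))}{R(x_1,x_2)}$. $\tau_\theta(s)=-a+(s+a)e^{i\theta}$ for $s<-a$, $s$ for $|s|\le a$, $a+(s-a)e^{i\theta}$ for $s>a$. $S\psi(t)=\psi(-t)$, and $D_\theta\psi(t)=\int_{\mathbb{R}}h(\tau_\theta(t)-a,a-\tau_\theta(s))\psi(s)\tau_\theta'(s)\,\mathrm{d}s$ for $t>a$, $D_\theta\psi(t)=0$ for $t\le a$. *)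

theory Defs
  imports "HOL-Analysis.Analysis"
begin

definition bessel_J1 :: "complex \<Rightarrow> complex" where
  "bessel_J1 z = (\<Sum>m. (-1)^m * (z/2)^(2*m+1) / (fact m * fact (m+1)))"

(* Bessel function of the second kind of order 1, principal branch (DLMF 10.8.1, n = 1),
   with principal logarithm Ln (Arg in (-pi,pi]). *)
definition bessel_Y1 :: "complex \<Rightarrow> complex" where
  "bessel_Y1 z = - 2 / (of_real pi * z)
     + (2 / of_real pi) * Ln (z/2) * bessel_J1 z
     - (1 / of_real pi) * (\<Sum>m. (Digamma (of_nat m + 1) + Digamma (of_nat m + 2))
                                  * (-1)^m * (z/2)^(2*m+1) / (fact m * fact (m+1)))"

definition hankel1 :: "complex \<Rightarrow> complex" where
  "hankel1 z = bessel_J1 z + \<i> * bessel_Y1 z"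

definition Rfun :: "complex \<Rightarrow> complex \<Rightarrow> complex" where
  "Rfun w z = csqrt (w^2 + z^2)"

definition hker :: "real \<Rightarrow> complex \<Rightarrow> complex \<Rightarrow> complex" where
  "hker k x1 x2 = (\<i> * of_real k * x1 / 2) * hankel1 (of_real k * Rfun x1 x2) / Rfun x1 x2"

definition tau :: "real \<Rightarrow> real \<Rightarrow> real \<Rightarrow> complex" where
  "tau a \<theta> s = (if s < -a then - of_real a + of_real (s + a) * cis \<theta>
                 else if s \<le> a then of_real s
                 else of_real a + of_real (s - a) * cis \<theta>)"

(* derivative of tau; at the two kinks s = -a, a (a null set) the value 1 is chosen *)
definition tau' :: "real \<Rightarrow> real \<Rightarrow> real \<Rightarrow> complex" where
  "tau' a \<theta> s = (if \<bar>s\<bar> \<le> a then 1 else cis \<theta>)"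

definition Sop :: "(real \<Rightarrow> complex) \<Rightarrow> real \<Rightarrow> complex" where
  "Sop \<psi> t = \<psi> (-t)"

definition Dop :: "real \<Rightarrow> real \<Rightarrow> real \<Rightarrow> (real \<Rightarrow> complex) \<Rightarrow> real \<Rightarrow> complex" where
  "Dop a k \<theta> \<psi> t = (if t > a then
      (LINT s|lborel. hker k (tau a \<theta> t - of_real a) (of_real a - tau a \<theta> s) * \<psi> s * tau' a \<theta> s)
     else 0)"

end

theory Submission
  imports Defs "HOL-Complex_Analysis.Complex_Analysis" "HOL-Real_Asymp.Real_Asymp" "HOL-Probability.Sinc_Integral"
begin

text \<open>The values of $\varphi^j$ on the two half-lines beyond $\pm a$ are the Dirichlet data of a Helmholtz solution $U_j$ on the
  half-plane of side $j$, written through the kernel \<open>h\<close> with complex-scaled arguments. The four equations say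
  that neighbouring $U_j$ have the same traces on the two quadrant edges where their half-planes overlap, and the
  Poisson representation of \<open>h\<close> on a half-plane turns this into equality along the diagonal through the common
  corner. Near a corner the coupling operator is a contraction ($3/\pi < 1$), so the data are $O(\sqrt r)$.

  Let $v_j$ be the normal derivative of $U_j$ on side $j$ of the square. Green's identity on the sector between the
  diagonals at both ends of the side, summed over $j$, loses the diagonal terms: the single layer potential of $v$ over
  the boundary of the square vanishes inside and equals $-U_j$ outside. On the boundary it is zero too; pairing it
  with $\overline v$ and taking imaginary parts replaces $H_0^{(1)}$ by $J_0$, an average of plane waves over the
  circle of directions, so the far field of $v$ vanishes on that circle and hence at all complex directions.
  By the plane wave representation of $H_0^{(1)}$ the potential vanishes for large complex-scaled arguments,
  by analytic continuation it vanishes everywhere outside, and $U_j = 0$ at the corners gives zero data.\<close>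

text \<open>Complex scaling takes over the role of a radiation condition: differences of contour
  points lie in a set where sums of two squares stay off the negative axis, so the kernels decay
  exponentially, principal logarithms never meet their cut, and Green's identity has no term at
  infinity. The price is that the half-plane solutions are available only at complex-scaled points.
  Hence the sectors have complex edges, and an area integral is replaced by shifting a path by
  multiples of \<open>om\<close>. The other obstacle is that L2 data are too weak at the corners for
  exchanging source and path integrals. The bound by \<open>sqrt r\<close> repairs this: normal
  derivatives become O(r^(-5/8)) near the ends of a side, which is integrable and leaves room for
  the logarithm of the fundamental solution. The constant 3/pi is the product of 9/(8 pi), a slight
  enlargement of the factor 1/pi of the Poisson kernel, and 8/3, a bound for the Poisson integral on
  both weights r^(-1/2) and r^(1/2). Because one constant serves both weights, iteration wears down
  the singular weight supplied by L2 and keeps the other.\<close>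

lemma has_derivative_lebesgue_integral:
 fixes f :: "'a::{real_normed_vector,perfect_space} => 'b => complex" and e :: "'a => complex"
 assumes S: "open S" "x0 \<in> S"
  and e: "bounded_linear e" "!!h. norm (e h) <= norm h"
  and int: "!!x. x \<in> S ==> integrable M (f x)"
  and meas: "f' x0 \<in> borel_measurable M"
  and der: "!!x s. x \<in> S ==> s \<in> space M ==> ((%x. f x s) has_derivative (%h. e h * f' x s)) (at x)"
  and bd: "!!x s. x \<in> S ==> s \<in> space M ==> norm (f' x s) <= g s"
  and g: "integrable M g"
 shows "((%x. LINT s|M. f x s) has_derivative (%h. e h * (LINT s|M. f' x0 s))) (at x0)"
proof -
 obtain r where r: "r > 0" "ball x0 r \<subseteq> S"
  using S by (meson open_contains_ball_eq)
 have f'int: "integrable M (f' x0)"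
  by (rule Bochner_Integration.integrable_bound[OF g meas]) (use bd[OF S(2)] in \<open>auto intro!: AE_I2 order.trans[OF _ abs_ge_self]\<close>)
 \<comment> \<open>\<open>Q\<close> is the normalised first-order remainder. The mean value
   inequality bounds it by \<open>2 * g\<close> on a ball, so dominated convergence along sequences
   carries its pointwise limit 0 through the integral.\<close>
 define Q where "Q = (%x s. (1 / norm (x - x0)) *\<^sub>R (f x s - (f x0 s + e (x - x0) * f' x0 s)))"
 have Qlim: "((%x. Q x s) \<longlongrightarrow> 0) (at x0)" if "s \<in> space M" for s
  using conjunct2[OF der[OF S(2) that, unfolded has_derivative_within]] unfolding Q_def .
 have Qbd: "norm (Q x s) <= 2 * g s" if x: "x \<in> ball x0 r" "x ~= x0" and s: "s \<in> space M" for x s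
 proof -
  have "norm (f x s - f x0 s) <= g s * norm (x - x0)"
  proof (rule differentiable_bound[of "ball x0 r" "%x. f x s" "%x h. e h * f' x s"])
   fix y assume y: "y \<in> ball x0 r"
   then have yS: "y \<in> S" using r by auto
   show "((%x. f x s) has_derivative (%h. e h * f' y s)) (at y within ball x0 r)"
    using der[OF yS s] has_derivative_at_withinI by blast
   show "onorm (%h. e h * f' y s) <= g s"
   proof (rule onorm_le)
    fix h
    have "norm (e h) * norm (f' y s) <= norm h * g s"
     by (rule mult_mono) (use e(2) bd[OF yS s] in auto)
    then show "norm (e h * f' y s) <= g s * norm h"
     by (simp add: norm_mult mult.commute)
   qed
  qed (use x r in auto)
  moreover have "norm (e (x - x0) * f' x0 s) <= norm (x - x0) * g s"
   unfolding norm_mult by (rule mult_mono) (use e(2) bd[OF S(2) s] in auto)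
  ultimately have "norm (f x s - f x0 s - e (x - x0) * f' x0 s) <= 2 * g s * norm (x - x0)"
   using norm_triangle_ineq4[of "f x s - f x0 s" "e (x - x0) * f' x0 s"] by (simp add: algebra_simps)
  then show ?thesis using x by (simp add: Q_def divide_simps mult.commute diff_diff_eq)
 qed
 have "((%x. LINT s|M. Q x s) \<longlongrightarrow> 0) (at x0)"
  unfolding tendsto_at_iff_sequentially
 proof (intro allI impI)
  fix X :: "nat => 'a"
  assume X: "\<forall>i. X i \<in> UNIV - {x0}" "X \<longlonglongrightarrow> x0"
  then have "eventually (%n. X n \<in> ball x0 r) sequentially"
   using r(1) by (metis (full_types) centre_in_ball open_ball topological_tendstoD)
  then obtain N where N: "!!n. n >= N ==> X n \<in> ball x0 r"
   by (auto simp: eventually_sequentially)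
  have XS: "X (n + N) \<in> S" for n using N[of "n+N"] r by auto
  have "(%n. LINT s|M. Q (X (n + N)) s) \<longlonglongrightarrow> (LINT s|M. (0::complex))"
  proof (rule integral_dominated_convergence[where w = "%s. 2 * g s"])
   show "AE s in M. (%n. Q (X (n + N)) s) \<longlonglongrightarrow> 0"
   proof (rule AE_I2)
    fix s assume "s \<in> space M"
    from Qlim[OF this] have "(%n. Q (X n) s) \<longlonglongrightarrow> 0"
     using X unfolding tendsto_at_iff_sequentially comp_def by blast
    then show "(%n. Q (X (n + N)) s) \<longlonglongrightarrow> 0" by (rule LIMSEQ_ignore_initial_segment)
   qed
   show "AE s in M. norm (Q (X (n + N)) s) <= 2 * g s" for n
    by (intro AE_I2 Qbd) (use N[of "n+N"] X(1) in auto)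
   show "Q (X (n + N)) \<in> borel_measurable M" for n
    unfolding Q_def using int[OF XS[of n]] int[OF S(2)] meas
    by (intro borel_measurable_scaleR borel_measurable_diff borel_measurable_add borel_measurable_times)
      (auto dest: borel_measurable_integrable)
  qed (use g in auto)
  then have "(%n. LINT s|M. Q (X (n + N)) s) \<longlonglongrightarrow> 0" by simp
  from LIMSEQ_offset[OF this]
  show "((%x. LINT s|M. Q x s) \<circ> X) \<longlonglongrightarrow> 0" by (simp add: comp_def)
 qed
 moreover have "\<forall>\<^sub>F x in at x0. (LINT s|M. Q x s) =
   (1 / norm (x - x0)) *\<^sub>R ((LINT s|M. f x s) - ((LINT s|M. f x0 s) + e (x - x0) * (LINT s|M. f' x0 s)))"
 proof -
  have "(LINT s|M. Q x s) = (1 / norm (x - x0)) *\<^sub>R ((LINT s|M. f x s) - ((LINT s|M. f x0 s) + e (x - x0) * (LINT s|M. f' x0 s)))"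
   if "x \<in> S" for x
   unfolding Q_def using int[OF that] int[OF S(2)] f'int
   by simp
  then show ?thesis using S by (auto simp: eventually_at_topological)
 qed
 ultimately have "((%x. (1 / norm (x - x0)) *\<^sub>R ((LINT s|M. f x s) - ((LINT s|M. f x0 s) + e (x - x0) * (LINT s|M. f' x0 s)))) \<longlongrightarrow> 0) (at x0)"
  by (rule Lim_transform_eventually)
 then show ?thesis
  unfolding has_derivative_within by (intro conjI bounded_linear_mult_const e(1))
qed

text \<open>The linear map \<open>e\<close> of the previous lemma lets a complex and a real
  parameter share one proof: here it is the identity, in the next corollary it is
  \<open>of_real\<close>.\<close>

corollary has_field_derivative_lebesgue_integral:
 fixes f :: "complex => 'b => complex"
 assumes S: "open S" "z0 \<in> S"
  and int: "!!z. z \<in> S ==> integrable M (f z)"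
  and meas: "f' z0 \<in> borel_measurable M"
  and der: "!!z s. z \<in> S ==> s \<in> space M ==> ((%z. f z s) has_field_derivative f' z s) (at z)"
  and bd: "!!z s. z \<in> S ==> s \<in> space M ==> norm (f' z s) <= g s"
  and g: "integrable M g"
 shows "((%z. LINT s|M. f z s) has_field_derivative (LINT s|M. f' z0 s)) (at z0)"
proof -
 have "((%x. LINT s|M. f x s) has_derivative (%h. h * (LINT s|M. f' z0 s))) (at z0)"
  by (rule has_derivative_lebesgue_integral[where S=S and g=g])
    (use assms in \<open>auto simp: has_field_derivative_def mult_commute_abs intro: bounded_linear_ident\<close>)
 then show ?thesis by (simp add: has_field_derivative_def mult_commute_abs)
qed

corollary has_vector_derivative_lebesgue_integral:
 fixes f :: "real => 'b => complex"
 assumes S: "open S" "x0 \<in> S"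
  and int: "!!x. x \<in> S ==> integrable M (f x)"
  and meas: "f' x0 \<in> borel_measurable M"
  and der: "!!x s. x \<in> S ==> s \<in> space M ==> ((%x. f x s) has_vector_derivative f' x s) (at x)"
  and bd: "!!x s. x \<in> S ==> s \<in> space M ==> norm (f' x s) <= g s"
  and g: "integrable M g"
 shows "((%x. LINT s|M. f x s) has_vector_derivative (LINT s|M. f' x0 s)) (at x0)"
proof -
 have "((%x. LINT s|M. f x s) has_derivative (%h. of_real h * (LINT s|M. f' x0 s))) (at x0)"
  by (rule has_derivative_lebesgue_integral[where S=S and g=g])
    (use assms in \<open>auto simp: has_vector_derivative_def scaleR_conv_of_real intro: bounded_linear_of_real\<close>)
 then show ?thesis by (simp add: has_vector_derivative_def scaleR_conv_of_real)
qed

text \<open>Only the integrand itself has to be dominated locally: Cauchy's inequality on discs of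
  radius \<open>r/2\<close> converts this into a dominating function for the derivative, whose
  measurability comes from difference quotients along a sequence.\<close>

lemma holomorphic_on_lebesgue_integral:
 fixes f :: "complex => 'b => complex"
 assumes S: "open S"
  and meas: "!!z. z \<in> S ==> f z \<in> borel_measurable M"
  and hol: "!!s. s \<in> space M ==> (%z. f z s) holomorphic_on S"
  and bd: "!!w. w \<in> S ==> \<exists>r>0. \<exists>g. integrable M g & (\<forall>z\<in>ball w r. \<forall>s\<in>space M. norm (f z s) <= g s)"
 shows "(%z. LINT s|M. f z s) holomorphic_on S"
  and "!!w. w \<in> S ==> deriv (%z. LINT s|M. f z s) w = (LINT s|M. deriv (%z. f z s) w)"
proof -
 have *: "((%z. LINT s|M. f z s) has_field_derivative (LINT s|M. deriv (%z. f z s) w)) (at w)"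
  if w: "w \<in> S" for w
 proof -
  obtain r0 g where r0: "r0 > 0" and g: "integrable M g"
   and fg: "!!z s. z \<in> ball w r0 ==> s \<in> space M ==> norm (f z s) <= g s"
   using bd[OF w] by blast
  obtain r1 where r1: "r1 > 0" "ball w r1 \<subseteq> S" using S w by (meson open_contains_ball_eq)
  define r where "r = min r0 r1 / 2"
  have r: "r > 0" "!!z. z \<in> ball w r ==> cball z (r/2) \<subseteq> ball w (min r0 r1)"
   using r0 r1(1)
  proof -
   show "r > 0" using r0 r1 by (simp add: r_def)
   show "cball z (r/2) \<subseteq> ball w (min r0 r1)" if "z \<in> ball w r" for z
   proof
    fix y assume "y \<in> cball z (r/2)"
    then have "dist w y < r + r/2"
     using that dist_triangle[of w y z] by simp
    then show "y \<in> ball w (min r0 r1)"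
     using \<open>r > 0\<close> unfolding r_def mem_ball by linarith
   qed
  qed
  have inS: "z \<in> S" "z \<in> ball w r0" if "z \<in> ball w r" for z
  proof -
   have "z \<in> cball z (r/2)" using r(1) by simp
   with r(2)[OF that] have "z \<in> ball w (min r0 r1)" by blast
   then show "z \<in> S" "z \<in> ball w r0" using r1(2) by auto
  qed
  show ?thesis
  proof (rule has_field_derivative_lebesgue_integral[where S="ball w r" and g="%s. g s / (r/2)" and f'="%z s. deriv (%z. f z s) z"])
   show "integrable M (f z)" if "z \<in> ball w r" for z
    by (rule Bochner_Integration.integrable_bound[OF g meas[OF inS(1)[OF that]]])
      (use fg[OF inS(2)[OF that]] in \<open>auto intro!: AE_I2 order.trans[OF _ abs_ge_self]\<close>)
   show der: "((%z. f z s) has_field_derivative deriv (%z. f z s) z) (at z)"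
    if "z \<in> ball w r" "s \<in> space M" for z s
    using holomorphic_derivI[OF hol[OF that(2)] S inS(1)[OF that(1)]] .
   show "norm (deriv (%z. f z s) z) <= g s / (r/2)" if z: "z \<in> ball w r" and s: "s \<in> space M" for z s
   proof -
    have "norm ((deriv ^^ 1) (%z. f z s) z) <= fact 1 * g s / (r/2) ^ 1"
    proof (rule Cauchy_inequality)
     have sub: "cball z (r/2) \<subseteq> S" using r(2)[OF z] r1(2) subset_ball[of "min r0 r1" r1 w] by force
     show "(%z. f z s) holomorphic_on ball z (r/2)"
      using hol[OF s] sub by (meson ball_subset_cball holomorphic_on_subset subset_trans)
     show "continuous_on (cball z (r/2)) (%z. f z s)"
      using holomorphic_on_imp_continuous_on[OF hol[OF s]] sub continuous_on_subset by blast
     show "norm (f x s) <= g s" if "norm (z - x) = r/2" for x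
      by (rule fg) (use r(2)[OF z] that s in \<open>auto simp: dist_norm subset_iff\<close>)
    qed (use r in auto)
    then show ?thesis by simp
   qed
   show "(%s. deriv (%z. f z s) w) \<in> borel_measurable M"
   proof (rule borel_measurable_LIMSEQ_metric)
    define X where "X = (%n::nat. of_real (r / 2 * inverse (real (Suc n))) :: complex)"
    have X0: "X n ~= 0" "w + X n \<in> ball w r" for n
    proof -
     have "r / 2 * inverse (real (Suc n)) <= r / 2 * 1"
      using r(1) by (intro mult_left_mono) (auto simp: divide_simps)
     moreover have "r / 2 * inverse (real (Suc n)) > 0" using r(1) by simp
     ultimately show "X n ~= 0" "w + X n \<in> ball w r"
      using r(1) unfolding X_def by (auto simp: dist_norm simp del: of_real_mult of_real_inverse)
    qed
    show "(%s. (f (w + X n) s - f w s) / X n) \<in> borel_measurable M" for n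
     using meas[OF inS(1)[OF X0(2)[of n]]] meas[OF w] by measurable
    fix s assume s: "s \<in> space M"
    have "((%h. (f (w + h) s - f w s) / h) \<longlongrightarrow> deriv (%z. f z s) w) (at 0)"
     using der[OF _ s, of w] r(1) by (simp add: DERIV_def)
    moreover have "filterlim X (at 0) sequentially"
    proof (rule filterlim_atI)
     have "(%n. r / 2 * inverse (real (Suc n))) \<longlonglongrightarrow> r / 2 * 0"
      by (intro tendsto_intros LIMSEQ_inverse_real_of_nat)
     then show "X \<longlonglongrightarrow> 0" unfolding X_def using tendsto_of_real[of "%n. r / 2 * inverse (real (Suc n))" 0 sequentially, where ?'a=complex] by simp
    qed (use X0 in auto)
    ultimately show "(%n. (f (w + X n) s - f w s) / X n) \<longlonglongrightarrow> deriv (%z. f z s) w"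
     by (rule filterlim_compose)
   qed
  qed (use r g in auto)
 qed
 show "(%z. LINT s|M. f z s) holomorphic_on S"
  using * S holomorphic_on_open by blast
 show "!!w. w \<in> S ==> deriv (%z. LINT s|M. f z s) w = (LINT s|M. deriv (%z. f z s) w)"
  using * DERIV_imp_deriv by blast
qed

text \<open>Both sides are the double integral of \<open>D\<close> over the rectangle. This is the
  divergence theorem in the form needed later: \<open>D\<close> is at once the
  \<open>l\<close>-derivative of \<open>F\<close> and the \<open>s\<close>-derivative of
  \<open>E\<close>.\<close>

lemma integral_diff_swap:
 fixes F E D :: "real => real => complex"
 assumes le: "l0 <= l1" "s0 <= s1"
  and F: "!!l s. l \<in> {l0..l1} ==> s \<in> {s0..s1} ==> ((%l. F l s) has_vector_derivative D l s) (at l within {l0..l1})"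
  and E: "!!l s. l \<in> {l0..l1} ==> s \<in> {s0..s1} ==> ((%s. E l s) has_vector_derivative D l s) (at s within {s0..s1})"
  and D: "continuous_on ({l0..l1} \<times> {s0..s1}) (%(l, s). D l s)"
 shows "integral {s0..s1} (%s. F l1 s - F l0 s) = integral {l0..l1} (%l. E l s1 - E l s0)"
proof -
 have "integral {s0..s1} (%s. F l1 s - F l0 s) = integral {s0..s1} (%s. integral {l0..l1} (%l. D l s))"
  by (rule integral_cong, rule sym, rule integral_unique, rule fundamental_theorem_of_calculus) (use le F in auto)
 also have "... = integral {l0..l1} (%l. integral {s0..s1} (%s. D l s))"
  using integral_swap_continuous[of l0 s0 l1 s1 D] D by (simp add: cbox_Pair_eq)
 also have "... = integral {l0..l1} (%l. E l s1 - E l s0)"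
  by (rule integral_cong, rule integral_unique, rule fundamental_theorem_of_calculus) (use le E in auto)
 finally show ?thesis .
qed

section \<open>Power series of the Bessel functions of order zero\<close>

lemma summable_bounded_coeff_fact:
 fixes c :: "nat => complex"
 assumes "!!m. norm (c m) <= C / fact m"
 shows "summable (%m. c m * y ^ m)"
proof (rule summable_comparison_test')
 show "summable (%m. C * (norm y ^ m /\<^sub>R fact m))"
  by (intro summable_mult summable_exp_generic)
 show "norm (c m * y ^ m) <= C * (norm y ^ m /\<^sub>R fact m)" if "m >= 0" for m
  using mult_right_mono[OF assms[of m], of "norm y ^ m"]
  by (simp add: norm_mult norm_power divide_inverse mult_ac)
qed

text \<open>Coefficients in the variable \<open>x = w^2 / 4\<close>: the series \<open>bI\<close> is
  I_0(w), and K_0(w) equals \<open>- Ln (w/2) * bI x + bL x\<close>. At \<open>x = - z^2 / 4\<close>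
  the function \<open>bI\<close> becomes J_0(z).\<close>

definition cI :: "nat => complex" where "cI m = 1 / (fact m)^2"
definition cL :: "nat => complex" where "cL m = Digamma (of_nat m + 1) / (fact m)^2"

lemma norm_cI: "norm (cI m) <= 1 / fact m"
 by (simp add: cI_def norm_divide norm_mult divide_simps power2_eq_square mult_le_cancel_left1 fact_ge_1)

lemma norm_cL: "norm (cL m) <= 3 / fact m"
proof -
 have D: "Digamma (of_nat m + 1 :: complex) = of_real (harm m - euler_mascheroni)"
  using Digamma_of_nat[of m, where ?'a=complex] by (simp add: add.commute of_real_harm)
 have "harm m <= (real m)"
 proof (induction m)
  case (Suc m)
  have "inverse (real (Suc m)) <= 1" by (simp add: divide_simps)
  with Suc show ?case by (simp add: harm_Suc del: of_nat_Suc)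
 qed (simp add: harm_def)
 then have h: "harm m <= (real m)" "harm m >= (0::real)" by (auto intro: harm_nonneg)
 have "\<bar>harm m - euler_mascheroni\<bar> <= real m + 1"
  using h euler_mascheroni_less_13_over_22 euler_mascheroni_pos by linarith
 moreover have "real m + 1 <= 3 * fact m"
 proof -
  have "real m <= fact m" using fact_ge_self[of m] by (metis of_nat_fact of_nat_le_iff)
  then show ?thesis using fact_ge_1[of m, where ?'a=real] by linarith
 qed
 ultimately have "\<bar>harm m - euler_mascheroni\<bar> <= (3 * fact m :: real)" by linarith
 then show ?thesis
  unfolding cL_def D norm_divide norm_of_real norm_power
  by (simp add: divide_simps power2_eq_square norm_mult)
qed

definition bI :: "complex => complex" where "bI x = (\<Sum>m. cI m * x ^ m)"
definition bL :: "complex => complex" where "bL x = (\<Sum>m. cL m * x ^ m)"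
definition bI' :: "complex => complex" where "bI' x = (\<Sum>m. diffs cI m * x ^ m)"
definition bL' :: "complex => complex" where "bL' x = (\<Sum>m. diffs cL m * x ^ m)"

lemma summable_cI: "summable (%m. cI m * y ^ m)" and summable_cL: "summable (%m. cL m * y ^ m)"
 using summable_bounded_coeff_fact norm_cI norm_cL by blast+

lemma summable_diffs_cI: "summable (%m. diffs cI m * y ^ m)"
 and summable_diffs_cL: "summable (%m. diffs cL m * y ^ m)"
 using termdiff_converges_all[of cI y] termdiff_converges_all[of cL y] summable_cI summable_cL by blast+

lemma DERIV_bI: "(bI has_field_derivative bI' x) (at x)"
 unfolding bI_def bI'_def using termdiffs_strong_converges_everywhere[OF summable_cI] .

lemma DERIV_bL: "(bL has_field_derivative bL' x) (at x)"
 unfolding bL_def bL'_def using termdiffs_strong_converges_everywhere[OF summable_cL] .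

text \<open>Applying x d/dx multiplies the m-th coefficient by m, and one further derivative shifts
  the index, whence the factor \<open>of_nat (Suc m)^2\<close>. This operator is the principal part
  of Bessel's equation of order zero in the variable w^2/4.\<close>

lemma powser_euler_derivative:
 fixes c :: "nat => complex"
 assumes s: "!!y. summable (%m. c m * y ^ m)"
 shows "((%x. x * (\<Sum>m. diffs c m * x ^ m)) has_field_derivative (\<Sum>m. of_nat (Suc m)^2 * c (Suc m) * x ^ m)) (at x)"
proof -
 have sd: "summable (%m. diffs c m * y ^ m)" for y
  using termdiff_converges_all s by blast
 have eq: "(%m. (of_nat m * c m) * y ^ m) sums (y * (\<Sum>m. diffs c m * y ^ m))" for y
 proof -
  have "(%m. y * (diffs c m * y ^ m)) sums (y * (\<Sum>m. diffs c m * y ^ m))"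
   by (intro sums_mult summable_sums sd)
  then have "(%m. (of_nat (Suc m) * c (Suc m)) * y ^ (Suc m)) sums (y * (\<Sum>m. diffs c m * y ^ m))"
   by (simp add: diffs_def mult_ac)
  then show ?thesis using sums_Suc_iff[of "%m. (of_nat m * c m) * y ^ m"] by simp
 qed
 have "((%x. \<Sum>m. (of_nat m * c m) * x ^ m) has_field_derivative (\<Sum>m. diffs (%m. of_nat m * c m) m * x ^ m)) (at x)"
  by (rule termdiffs_strong_converges_everywhere) (use eq in \<open>auto simp: sums_iff\<close>)
 moreover have "(%x. \<Sum>m. (of_nat m * c m) * x ^ m) = (%x. x * (\<Sum>m. diffs c m * x ^ m))"
  using eq by (auto simp: sums_iff fun_eq_iff)
 ultimately show ?thesis by (simp add: diffs_def power2_eq_square mult_ac)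
qed

lemma DERIV_x_bI': "((%x. x * bI' x) has_field_derivative bI x) (at x)"
proof -
 have "of_nat (Suc m)^2 * cI (Suc m) = cI m" for m
  by (simp add: cI_def divide_simps power_mult_distrib del: of_nat_Suc)
 then show ?thesis
  using powser_euler_derivative[OF summable_cI, of x] by (simp add: bI'_def bI_def del: of_nat_Suc)
qed

text \<open>Companion of the equation for \<open>bI\<close>: the recurrence of
  \<open>Digamma\<close> contributes the inhomogeneous term \<open>bI'\<close>, which cancels
  against the derivative of the logarithm in \<open>- Ln (w/2) * bI + bL\<close>, so that this
  combination solves Bessel's equation.\<close>

lemma DERIV_x_bL': "((%x. x * bL' x) has_field_derivative bL x + bI' x) (at x)"
proof -
 have "of_nat (Suc m)^2 * cL (Suc m) = cL m + diffs cI m" for m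
 proof -
  define N :: complex where "N = of_nat (Suc m)"
  define f :: complex where "f = fact m"
  have N: "N ~= 0" "f ~= 0" "of_nat m + 1 = N" by (simp_all add: N_def f_def del: of_nat_Suc) simp
  have fS: "fact (Suc m) = N * f" by (simp add: N_def f_def)
  have D: "Digamma (N + 1) = Digamma N + 1 / N" by (rule Digamma_plus1) (rule N)
  show ?thesis
   unfolding cL_def cI_def diffs_def fS N_def[symmetric] N(3) f_def[symmetric] D
   using N(1,2) by (simp add: field_simps power2_eq_square)
 qed
 moreover have "bL x + bI' x = (\<Sum>m. (cL m + diffs cI m) * x ^ m)"
  unfolding bL_def bI'_def distrib_right
  by (rule suminf_add[OF summable_cL summable_diffs_cI])
 ultimately show ?thesis
  using powser_euler_derivative[OF summable_cL, of x] by (simp add: bL'_def del: of_nat_Suc)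
qed

lemma bI_0 [simp]: "bI 0 = 1" and bL_0: "bL 0 = - euler_mascheroni"
 using powser_zero[of cI] powser_zero[of cL] by (simp_all only: bI_def bL_def) (simp_all add: cI_def cL_def)

lemma holomorphic_bI: "bI holomorphic_on A" and holomorphic_bL: "bL holomorphic_on A"
 using DERIV_bI DERIV_bL by (meson holomorphic_on_subset holomorphic_on_open open_UNIV subset_UNIV)+

lemma deriv_bI: "deriv bI = bI'" and deriv_bL: "deriv bL = bL'"
 using DERIV_bI DERIV_bL by (auto intro!: DERIV_imp_deriv)

lemma holomorphic_bI': "bI' holomorphic_on A" and holomorphic_bL': "bL' holomorphic_on A"
 using holomorphic_deriv[OF holomorphic_bI[of UNIV]] holomorphic_deriv[OF holomorphic_bL[of UNIV]]
 by (auto simp: deriv_bI deriv_bL intro: holomorphic_on_subset)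

text \<open>Reflects the relation H_1 = - H_0': the order-one series are the derivatives
  \<open>bI'\<close> and \<open>bL'\<close> of the order-zero ones, and differentiating the
  logarithm produces the term \<open>- 2 * bI X / z\<close>.\<close>

lemma hankel1_eq:
 assumes z: "z ~= 0"
 defines "X \<equiv> - (z^2) / 4"
 shows "hankel1 z = (\<i> / of_real pi) * (- 2 * bI X / z + z * ((Ln (z/2) - \<i> * of_real pi / 2) * bI' X - bL' X))"
proof -
 let ?D = "%m. Digamma (of_nat m + 1) + Digamma (of_nat m + 2)"
 have pw: "(-1)^m * (z/2)^(2*m+1) = (z/2) * X ^ m" for m
 proof -
  have "(z/2)^(2*m+1) = (z/2) * ((z/2)^2)^m" by (simp add: power_mult)
  moreover have "(-1)^m * ((z/2)^2)^m = X^m"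
   by (simp add: X_def power_mult_distrib[symmetric] power2_eq_square)
  ultimately show ?thesis by (metis mult.left_commute)
 qed
 have dI: "diffs cI m = 1 / (fact m * fact (m+1))" for m
  by (simp add: diffs_def cI_def divide_simps power2_eq_square del: of_nat_Suc)
 have J: "bessel_J1 z = (z/2) * bI' X"
 proof -
  have "bessel_J1 z = (\<Sum>m. (z/2) * (diffs cI m * X ^ m))"
   unfolding bessel_J1_def pw dI by (simp add: mult_ac)
  then show ?thesis by (simp only: suminf_mult[OF summable_diffs_cI] bI'_def)
 qed
 define e where "e = (%m. cI (Suc m) :: complex)"
 have X0: "X ~= 0" using z by (simp add: X_def)
 have e_sums: "(%m. e m * X ^ m) sums ((bI X - 1) / X)"
 proof -
  have "(%m. cI m * X ^ m) sums bI X" using summable_cI by (simp add: bI_def summable_sums)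
  then have "(%m. cI (Suc m) * X ^ Suc m) sums (bI X - 1)"
   by (subst sums_Suc_iff) (simp add: cI_def)
  from sums_divide[OF this, of X] show ?thesis using X0 by (simp add: e_def mult_ac)
 qed
 \<comment> \<open>The sum of the two \<open>Digamma\<close> values is twice the second one minus
   1/(m+1). The first part gives \<open>bL'\<close>; the correction \<open>e\<close> sums to
   \<open>(bI X - 1) / X\<close> and merges with the pole term of \<open>bessel_Y1\<close> into a
   multiple of \<open>bI X / z\<close>.\<close>
 have dg: "(?D m) / (fact m * fact (m+1)) = 2 * diffs cL m - e m" for m :: nat
 proof -
  have n0: "(of_nat m + 1 :: complex) ~= 0" by (metis of_nat_Suc of_nat_eq_0_iff nat.distinct(1) add.commute)
  have "Digamma (of_nat m + 1 + 1 :: complex) = Digamma (of_nat m + 1) + 1 / (of_nat m + 1)"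
   by (rule Digamma_plus1) (rule n0)
  then have D: "Digamma (of_nat m + 1 :: complex) = Digamma (of_nat m + 2) - 1 / (of_nat m + 1)" by (simp add: add.assoc)
  have f: "fact (m+1) = (of_nat m + 1) * (fact m :: complex)" by (simp add: add.commute)
  show ?thesis
   unfolding D using n0 by (simp add: f cL_def e_def cI_def diffs_def divide_simps power2_eq_square)
    (simp add: algebra_simps)
 qed
 have S: "(\<Sum>m. (?D m) * (-1)^m * (z/2)^(2*m+1) / (fact m * fact (m+1)))
   = (z/2) * (2 * bL' X - (bI X - 1) / X)"
 proof -
  have "(%m. 2 * (diffs cL m * X ^ m) - e m * X ^ m) sums (2 * bL' X - (bI X - 1) / X)"
   unfolding bL'_def by (intro sums_diff sums_mult e_sums summable_sums summable_diffs_cL)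
  from sums_mult[OF this, of "z/2"]
  have "(%m. (z/2) * ((2 * diffs cL m - e m) * X ^ m)) sums ((z/2) * (2 * bL' X - (bI X - 1) / X))"
   by (simp add: algebra_simps)
  moreover have "(z/2) * ((2 * diffs cL m - e m) * X ^ m) =
    (?D m) * (-1)^m * (z/2)^(2*m+1) / (fact m * fact (m+1))" for m
  proof -
   have "(?D m) * (-1)^m * (z/2)^(2*m+1) / (fact m * fact (m+1))
    = (?D m) / (fact m * fact (m+1)) * ((-1)^m * (z/2)^(2*m+1))"
    by (simp only: times_divide_eq_left times_divide_eq_right mult.assoc)
   also have "... = (2 * diffs cL m - e m) * ((z/2) * X ^ m)" by (simp only: dg pw)
   finally show ?thesis by (simp only: mult_ac)
  qed
  ultimately show ?thesis by (simp only: sums_iff)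
 qed
 have XX: "(z/2) * ((bI X - 1) / X) = - 2 * (bI X - 1) / z"
  using z by (simp add: X_def field_simps power2_eq_square)
 have "bessel_Y1 z = - 2 / (of_real pi * z) + (2 / of_real pi) * Ln (z/2) * ((z/2) * bI' X)
   - (1 / of_real pi) * (z * bL' X - (z/2) * ((bI X - 1) / X))"
  unfolding bessel_Y1_def J S by (simp add: algebra_simps)
 then have Y: "bessel_Y1 z = - 2 / (of_real pi * z) + (2 / of_real pi) * Ln (z/2) * ((z/2) * bI' X)
   - (1 / of_real pi) * (z * bL' X + 2 * (bI X - 1) / z)"
  unfolding XX by (simp add: diff_divide_distrib algebra_simps)
 show ?thesis
  unfolding hankel1_def Y J using z by (simp add: field_simps)
qed

section \<open>Improper integrals with hyperbolic cosines in the exponent\<close>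

lemma integral_deriv_eq_0:
 fixes F f :: "real => complex"
 assumes F: "!!x. (F has_vector_derivative f x) (at x)"
  and f: "continuous_on UNIV f" "integrable lborel f"
  and lim: "(F \<longlongrightarrow> 0) at_top" "(F \<longlongrightarrow> 0) at_bot"
 shows "(LINT x|lborel. f x) = 0"
proof -
 have "(LBINT x=-\<infinity>..\<infinity>. f x) = 0 - 0"
 proof (rule interval_integral_FTC_integrable[where F=F])
  show "isCont f x" for x using f(1) by (simp add: continuous_on_eq_continuous_at)
  show "set_integrable lborel (einterval (- \<infinity>) \<infinity>) f" using f(2) by (simp add: set_integrable_def)
  show "((F \<circ> real_of_ereal) \<longlongrightarrow> 0) (at_right (-\<infinity>))" "((F \<circ> real_of_ereal) \<longlongrightarrow> 0) (at_left \<infinity>)"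
   using lim by (simp_all add: ereal_tendsto_simps)
 qed (use F in auto)
 then show ?thesis by (simp add: interval_lebesgue_integral_def set_lebesgue_integral_def)
qed

lemma integrable_exp_neg_Ici:
 fixes b :: real assumes "b > 0" shows "set_integrable lborel {0..} (%t. exp (- b * t))"
proof -
 have "(%t. exp (- b * t)) absolutely_integrable_on {0..}"
  using integrable_on_exp_minus_to_infinity[OF assms, of 0]
  by (intro nonnegative_absolutely_integrable_1) auto
 then have "integrable lebesgue (%t. indicat_real {0..} t *\<^sub>R exp (- b * t))"
  by (simp add: set_integrable_def)
 then show ?thesis
  unfolding set_integrable_def by (subst (asm) integrable_completion) auto
qed

lemma integrable_exp_neg_abs:
 fixes b :: real assumes "b > 0" shows "integrable lborel (%t. exp (- b * \<bar>t\<bar>))"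
proof -
 have i: "integrable lborel (%t. indicat_real {0..} t *\<^sub>R exp (- b * t))"
  using integrable_exp_neg_Ici[OF assms] by (simp add: set_integrable_def)
 from lborel_integrable_real_affine[OF this, of "-1" 0]
 have "integrable lborel (%t. indicat_real {0..} (-t) *\<^sub>R exp (b * t))" by simp
 from Bochner_Integration.integrable_add[OF i this]
 show ?thesis
  by (rule Bochner_Integration.integrable_bound) (auto simp: indicator_def)
qed

lemma power_mult_exp_le:
 fixes b x :: real
 assumes "b > 0" "x >= 0"
 shows "x ^ Suc n * exp (- b * x) <= (real (Suc n) / b) ^ Suc n"
proof -
 have "b * x / Suc n <= exp (b * x / Suc n)"
  using exp_ge_add_one_self[of "b * x / Suc n"] by linarith
 then have "(b * x / Suc n) ^ Suc n <= exp (b * x / Suc n) ^ Suc n"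
  using assms by (intro power_mono) auto
 also have "... = exp (b * x)" by (simp add: exp_of_nat_mult[symmetric] del: of_nat_Suc power_Suc)
 finally have "x ^ Suc n * b ^ Suc n <= exp (b * x) * real (Suc n) ^ Suc n"
  by (simp add: power_mult_distrib power_divide field_simps del: power_Suc of_nat_Suc)
 then show ?thesis using assms
  by (simp add: exp_minus power_divide field_simps del: power_Suc of_nat_Suc)
qed

lemma exp_abs_le_cosh: "exp \<bar>t\<bar> <= 2 * cosh (t::real)"
 by (auto simp: cosh_def abs_if)

lemma cosh_complex_of_real: "cosh (complex_of_real t) = of_real (cosh t)"
 and sinh_complex_of_real: "sinh (complex_of_real t) = of_real (sinh t)"
 by (simp_all add: cosh_def sinh_def scaleR_conv_of_real exp_of_real[symmetric])

lemma norm_sinh_le: "\<bar>sinh t\<bar> <= cosh (t::real)"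
 using sinh_less_cosh_real[of t] sinh_less_cosh_real[of "-t"] by simp

text \<open>One extra factor \<open>cosh t\<close> is inserted and divided out again: the enlarged
  power is bounded by a constant, and \<open>1 / cosh t <= 2 * exp (- |t|)\<close> supplies the
  integrable majorant.\<close>

lemma cosh_exp_bound:
 fixes b :: real
 assumes "b > 0"
 shows "cosh t ^ n * exp (- b * cosh t) <= 2 * (real (Suc n) / b) ^ Suc n * exp (- 1 * \<bar>t\<bar>)"
proof -
 have "cosh t ^ n * exp (- b * cosh t) = (cosh t ^ Suc n * exp (- b * cosh t)) / cosh t"
  using cosh_real_pos[of t] by (simp add: field_simps)
 also have "... <= (real (Suc n) / b) ^ Suc n / cosh t"
  using power_mult_exp_le[OF assms, of "cosh t" n] cosh_real_pos[of t] by (intro divide_right_mono) auto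
 also have "... <= (real (Suc n) / b) ^ Suc n * (2 * exp (- 1 * \<bar>t\<bar>))"
 proof -
  have "1 / cosh t <= 2 * exp (- 1 * \<bar>t\<bar>)"
   using exp_abs_le_cosh[of t] cosh_real_pos[of t] by (simp add: exp_minus field_simps)
  then have "(real (Suc n) / b) ^ Suc n * (1 / cosh t) <= (real (Suc n) / b) ^ Suc n * (2 * exp (- 1 * \<bar>t\<bar>))"
   using assms by (intro mult_left_mono zero_le_power) auto
  then show ?thesis by simp
 qed
 finally show ?thesis by (simp add: mult_ac)
qed

lemma integrable_cosh_exp:
 fixes b :: real
 assumes "b > 0"
 shows "integrable lborel (%t. cosh t ^ n * exp (- b * cosh t))"
proof (rule Bochner_Integration.integrable_bound)
 show "integrable lborel (%t. 2 * (real (Suc n) / b) ^ Suc n * exp (- 1 * \<bar>t\<bar>))"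
  using integrable_exp_neg_abs[of 1] by simp
 show "AE t in lborel. norm (cosh t ^ n * exp (- b * cosh t)) <= norm (2 * (real (Suc n) / b) ^ Suc n * exp (- 1 * \<bar>t\<bar>))"
 proof (rule AE_I2)
  fix t :: real
  have "0 <= cosh t ^ n * exp (- b * cosh t)" by simp
  then show "norm (cosh t ^ n * exp (- b * cosh t)) <= norm (2 * (real (Suc n) / b) ^ Suc n * exp (- 1 * \<bar>t\<bar>))"
   using cosh_exp_bound[OF assms, of t n] unfolding real_norm_def by linarith
 qed
 show "(%t. cosh t ^ n * exp (- b * cosh t)) \<in> borel_measurable lborel"
  by (simp add: borel_measurable_continuous_onI continuous_intros)
qed

text \<open>Integral representations of the modified Bessel functions $K_0$ and $K_1$.\<close>

definition coshK :: "complex => complex" where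
 "coshK w = (LINT t|lborel. exp (- w * of_real (cosh t))) / 2"
definition coshK1 :: "complex => complex" where
 "coshK1 w = (LINT t|lborel. of_real (cosh t) * exp (- w * of_real (cosh t))) / 2"

lemma norm_exp_cosh_le:
 assumes "Re w >= b" shows "norm (exp (- w * of_real (cosh t))) <= exp (- b * cosh t)"
 using mult_right_mono[OF assms, of "cosh t"] by simp

lemma integrable_cosh_exp_complex:
 assumes "Re w > 0"
 shows "integrable lborel (%t. of_real (cosh t) ^ n * exp (- w * of_real (cosh t)))"
proof (rule Bochner_Integration.integrable_bound[OF integrable_cosh_exp[OF assms, of n]])
 show "(%t. of_real (cosh t) ^ n * exp (- w * of_real (cosh t))) \<in> borel_measurable lborel"
  by (simp add: borel_measurable_continuous_onI continuous_intros)
qed (auto simp: norm_mult norm_power)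

lemma DERIV_cosh_exp_integral:
 assumes "Re w > 0"
 shows "((%w. LINT t|lborel. of_real (cosh t) ^ n * exp (- w * of_real (cosh t)))
   has_field_derivative - (LINT t|lborel. of_real (cosh t) ^ Suc n * exp (- w * of_real (cosh t)))) (at w)"
proof -
 define S where "S = {z. Re z > Re w / 2}"
 have "((%w. LINT t|lborel. of_real (cosh t) ^ n * exp (- w * of_real (cosh t)))
   has_field_derivative (LINT t|lborel. - (of_real (cosh t) ^ Suc n * exp (- w * of_real (cosh t))))) (at w)"
 proof (rule has_field_derivative_lebesgue_integral[where S=S and g="%t. cosh t ^ Suc n * exp (- (Re w / 2) * cosh t)"])
  show "open S" unfolding S_def by (rule open_halfspace_Re_gt)
  show "w \<in> S" using assms by (simp add: S_def)
  show "integrable lborel (%t. of_real (cosh t) ^ n * exp (- z * of_real (cosh t)))" if "z \<in> S" for z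
   using that assms by (intro integrable_cosh_exp_complex) (simp add: S_def)
  show "(%t. - (of_real (cosh t) ^ Suc n * exp (- w * of_real (cosh t)))) \<in> borel_measurable lborel"
   using integrable_cosh_exp_complex[OF assms, of "Suc n"] by (intro borel_measurable_uminus) (rule borel_measurable_integrable)
  show "norm (- (of_real (cosh t) ^ Suc n * exp (- z * of_real (cosh t)))) <= cosh t ^ Suc n * exp (- (Re w / 2) * cosh t)"
   if "z \<in> S" for z t
   using norm_exp_cosh_le[of "Re w / 2" z t] that
   by (simp add: S_def norm_mult norm_power mult_left_mono del: power_Suc)
  show "integrable lborel (%t. cosh t ^ Suc n * exp (- (Re w / 2) * cosh t))"
   using assms by (intro integrable_cosh_exp) simp
 qed (auto intro!: derivative_eq_intros simp: mult_ac)
 then show ?thesis by simp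
qed

lemma DERIV_coshK: "Re w > 0 ==> (coshK has_field_derivative - coshK1 w) (at w)"
 unfolding coshK_def coshK1_def
 using DERIV_cosh_exp_integral[of w 0] by (auto intro!: derivative_eq_intros)

lemma tendsto_cosh_exp_0:
 fixes P :: "real => complex"
 assumes "Re w > 0" "!!t. norm (P t) <= cosh t ^ n" "filterlim (%t::real. \<bar>t\<bar>) at_top F"
 shows "((%t. P t * exp (- w * of_real (cosh t))) \<longlongrightarrow> 0) F"
proof (rule Lim_null_comparison)
 have bd: "norm (P t * exp (- w * of_real (cosh t))) <= 2 * (real (Suc n) / Re w) ^ Suc n * exp (- \<bar>t\<bar>)" for t
 proof -
  have "norm (P t * exp (- w * of_real (cosh t))) <= cosh t ^ n * exp (- Re w * cosh t)"
   unfolding norm_mult using assms(2)[of t] by (intro mult_mono norm_exp_cosh_le) auto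
  also have "... <= 2 * (real (Suc n) / Re w) ^ Suc n * exp (- \<bar>t\<bar>)"
   using cosh_exp_bound[OF assms(1), of t n] by simp
  finally show ?thesis .
 qed
 show "\<forall>\<^sub>F t in F. norm (P t * exp (- w * of_real (cosh t))) <= 2 * (real (Suc n) / Re w) ^ Suc n * exp (- \<bar>t\<bar>)"
  using bd by (intro always_eventually allI)
 have "filterlim (%t. - \<bar>t\<bar>) at_bot F" using assms(3) by (simp add: filterlim_uminus_at_bot)
 then have "((%t. exp (- \<bar>t\<bar>)) \<longlongrightarrow> 0) F" by (rule filterlim_compose[OF exp_at_bot])
 then show "((%t. 2 * (real (Suc n) / Re w) ^ Suc n * exp (- \<bar>t\<bar>)) \<longlongrightarrow> 0) F"
  by (rule tendsto_mult_right_zero)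
qed

lemma filterlim_abs_at_top_bot: "filterlim (%t::real. \<bar>t\<bar>) at_top at_top" "filterlim (%t::real. \<bar>t\<bar>) at_top at_bot"
 using filterlim_abs_real filterlim_compose[OF filterlim_abs_real filterlim_uminus_at_top_at_bot] by auto

text \<open>With K_1 = - K_0', Bessel's equation reads (w K_1)' = - w K_0. It comes from integrating
  the derivative of \<open>sinh t * exp (- w * cosh t)\<close> over the line, which gives 0,
  together with sinh^2 = cosh^2 - 1.\<close>

lemma DERIV_w_coshK1:
 assumes "Re w > 0"
 shows "((%w. w * coshK1 w) has_field_derivative - w * coshK w) (at w)"
proof -
 let ?c = "%t. - w * of_real (cosh t)"
 let ?I = "%n. LINT t|lborel. of_real (cosh t) ^ n * exp (?c t)"
 note int = integrable_cosh_exp_complex[OF assms]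
 have "(LINT t|lborel. of_real (cosh t) ^ 1 * exp (?c t) -
    w * (of_real (cosh t) ^ 2 * exp (?c t)) + w * (of_real (cosh t) ^ 0 * exp (?c t))) = 0"
 proof (rule integral_deriv_eq_0[where F = "%t. of_real (sinh t) * exp (?c t)"])
  have hs: "(of_real (sinh t) :: complex)^2 = of_real (cosh t)^2 - 1" for t :: real
  proof -
   have "sinh t ^ 2 = cosh t ^ 2 - 1" using hyperbolic_pythagoras[of t] by simp
   then show ?thesis by (metis of_real_1 of_real_diff of_real_power)
  qed
  show "((%t. of_real (sinh t) * exp (?c t)) has_vector_derivative
    of_real (cosh t) ^ 1 * exp (?c t) -
    w * (of_real (cosh t) ^ 2 * exp (?c t)) + w * (of_real (cosh t) ^ 0 * exp (?c t))) (at t)" for t :: real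
  proof -
   have "((%z. sinh z * exp (- w * cosh z)) has_field_derivative
     cosh (of_real t) * exp (- w * cosh (of_real t)) - w * (sinh (of_real t))^2 * exp (- w * cosh (of_real t))) (at (of_real t))"
    by (auto intro!: derivative_eq_intros simp: power2_eq_square)
   from has_vector_derivative_real_field[OF this]
   show ?thesis by (simp add: cosh_complex_of_real sinh_complex_of_real hs algebra_simps)
  qed
  show "continuous_on UNIV (%t. of_real (cosh t) ^ 1 * exp (?c t) -
    w * (of_real (cosh t) ^ 2 * exp (?c t)) + w * (of_real (cosh t) ^ 0 * exp (?c t)))"
   by (intro continuous_intros)
  show "integrable lborel (%t. of_real (cosh t) ^ 1 * exp (?c t) -
    w * (of_real (cosh t) ^ 2 * exp (?c t)) + w * (of_real (cosh t) ^ 0 * exp (?c t)))"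
   by (intro Bochner_Integration.integrable_add Bochner_Integration.integrable_diff integrable_mult_right int)
  have "norm (of_real (sinh t) :: complex) <= cosh t ^ 1" for t using norm_sinh_le[of t] by simp
  from tendsto_cosh_exp_0[OF assms this] filterlim_abs_at_top_bot
  show "((%t. of_real (sinh t) * exp (?c t)) \<longlongrightarrow> 0) at_top"
   "((%t. of_real (sinh t) * exp (?c t)) \<longlongrightarrow> 0) at_bot" by blast+
 qed
 then have eq: "?I 1 - w * ?I 2 + w * ?I 0 = 0"
  unfolding Bochner_Integration.integral_add[OF Bochner_Integration.integrable_diff[OF int[of 1]
    integrable_mult_right[OF int[of 2]]] integrable_mult_right[OF int[of 0]]]
   Bochner_Integration.integral_diff[OF int[of 1] integrable_mult_right[OF int[of 2]]]
   integral_mult_right_zero .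
 have "((%w. w * ((LINT t|lborel. of_real (cosh t) ^ 1 * exp (- w * of_real (cosh t))) / 2)) has_field_derivative
   (?I 1 - w * ?I 2) / 2) (at w)"
  by (rule DERIV_cong[OF DERIV_mult[OF DERIV_ident DERIV_cdivide[OF DERIV_cosh_exp_integral[OF assms, of 1, unfolded Suc_1]]]])
    (simp only: diff_divide_distrib minus_divide_left mult_1 mult_minus_left times_divide_eq_left mult.commute[of _ w] add_uminus_conv_diff, simp)
 moreover have "(?I 1 - w * ?I 2) / 2 = - w * coshK w"
 proof -
  have "?I 1 - w * ?I 2 = - (w * ?I 0)" using eq by (rule eq_neg_iff_add_eq_0[THEN iffD2])
  then show ?thesis by (simp add: coshK_def)
 qed
 ultimately show ?thesis unfolding coshK1_def by simp
qed

text \<open>Since \<open>cosh t >= 1\<close>, the excess \<open>Re w - b\<close> factors out of the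
  exponent as \<open>exp (b - Re w)\<close> and leaves an integral that depends on \<open>b\<close>
  only. The lower bound \<open>b\<close> must be positive because both functions are unbounded near
  0.\<close>

lemma norm_coshK_le:
 assumes "b > 0"
 shows "\<exists>C>0. \<forall>w. Re w >= b --> norm (coshK w) <= C * exp (- Re w) & norm (coshK1 w) <= C * exp (- Re w)"
proof -
 define J where "J = (%n::nat. LINT t|lborel. cosh t ^ n * exp (- b * cosh t))"
 have bd: "norm (LINT t|lborel. of_real (cosh t) ^ n * exp (- w * of_real (cosh t))) <= J n * exp b * exp (- Re w)"
  if w: "Re w >= b" for w n
 proof -
  have "norm (LINT t|lborel. of_real (cosh t) ^ n * exp (- w * of_real (cosh t)))
   <= (LINT t|lborel. cosh t ^ n * exp (- b * cosh t) * (exp b * exp (- Re w)))"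
  proof (rule Bochner_Integration.integral_norm_bound_integral)
   show "integrable lborel (%t. of_real (cosh t) ^ n * exp (- w * of_real (cosh t)))"
    using w assms by (intro integrable_cosh_exp_complex) simp
   show "integrable lborel (%t. cosh t ^ n * exp (- b * cosh t) * (exp b * exp (- Re w)))"
    by (intro integrable_mult_left integrable_cosh_exp assms)
   fix t :: real
   have "(Re w - b) * 1 <= (Re w - b) * cosh t" using w cosh_real_ge_1[of t] by (intro mult_left_mono) auto
   then have "- Re w * cosh t <= - b * cosh t + b - Re w" by (simp add: algebra_simps)
   then have "exp (- Re w * cosh t) <= exp (- b * cosh t) * (exp b * exp (- Re w))"
    by (simp add: exp_add[symmetric])
   then show "norm (of_real (cosh t) ^ n * exp (- w * of_real (cosh t))) <= cosh t ^ n * exp (- b * cosh t) * (exp b * exp (- Re w))"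
    by (simp add: norm_mult norm_power mult.assoc mult_left_mono)
  qed
  also have "... = J n * exp b * exp (- Re w)" by (simp add: J_def)
  finally show ?thesis .
 qed
 have J: "J n >= 0" for n unfolding J_def by (intro integral_nonneg_AE AE_I2) auto
 define C where "C = (J 0 + J 1) * exp b + 1"
 have "C > 0" using J[of 0] J[of 1] by (simp add: C_def add_nonneg_pos)
 moreover have "norm (coshK w) <= C * exp (- Re w)" "norm (coshK1 w) <= C * exp (- Re w)" if "Re w >= b" for w
 proof -
  have le: "J n * exp b * exp (- Re w) / 2 <= C * exp (- Re w)" if "n = 0 | n = 1" for n
  proof -
   have "J n * exp b <= (J 0 + J 1) * exp b" using that J by (intro mult_right_mono) auto
   moreover have "0 <= J n * exp b" using J[of n] by simp
   ultimately have "J n * exp b / 2 <= C" unfolding C_def by linarith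
   then have "J n * exp b / 2 * exp (- Re w) <= C * exp (- Re w)" by (intro mult_right_mono) auto
   then show ?thesis unfolding times_divide_eq_left .
  qed
  have "norm (coshK w) <= J 0 * exp b * exp (- Re w) / 2"
   using divide_right_mono[OF bd[OF that, of 0], of 2] by (simp add: coshK_def norm_divide)
  from order.trans[OF this le] show "norm (coshK w) <= C * exp (- Re w)" by blast
  have "norm (coshK1 w) <= J 1 * exp b * exp (- Re w) / 2"
   using divide_right_mono[OF bd[OF that, of 1], of 2] by (simp add: coshK1_def norm_divide)
  from order.trans[OF this le] show "norm (coshK1 w) <= C * exp (- Re w)" by blast
 qed
 ultimately show ?thesis by blast
qed

section \<open>Gamma integrals and the behaviour of K_0 at zero\<close>

lemma Gamma_exp_integral:
 fixes z :: real
 assumes "z > 0"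
 shows "integrable lborel (%s. exp (z * s - exp s))" "(LINT s|lborel. exp (z * s - exp s)) = Gamma z"
proof -
 let ?f = "%t. t powr (z - 1) / exp t"
 have hi: "(?f has_integral Gamma z) {0..}" by (rule Gamma_integral_real[OF assms])
 then have hi': "(?f has_integral Gamma z) {0<..}"
  by (rule has_integral_spike_set_eq[THEN iffD1, rotated -1]) (auto intro: negligible_subset[of "{0}"])
 then have ai: "?f absolutely_integrable_on {0<..}"
  by (intro nonnegative_absolutely_integrable_1) (auto simp: integrable_on_def)
 have img: "exp ` (UNIV::real set) = {0<..}"
  by (auto simp: image_iff) (metis exp_ln)
 have "(%x. \<bar>exp x\<bar> * ?f (exp x)) absolutely_integrable_on UNIV & integral UNIV (%x. \<bar>exp x\<bar> * ?f (exp x)) = Gamma z"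
  using ai hi' has_absolute_integral_change_of_variables_1'[of UNIV exp exp ?f "Gamma z"]
  unfolding img by (auto simp: integral_unique inj_on_def DERIV_exp intro: DERIV_exp has_field_derivative_at_within)
 moreover have "\<bar>exp x\<bar> * ?f (exp x) = exp (z * x - exp x)" for x :: real
 proof -
  have "\<bar>exp x\<bar> * ?f (exp x) = exp x * (exp ((z - 1) * x) / exp (exp x))" by (simp add: powr_def)
  also have "... = exp (x + (z - 1) * x - exp x)" by (simp add: exp_add exp_diff)
  also have "x + (z - 1) * x - exp x = z * x - exp x" by (simp add: algebra_simps)
  finally show ?thesis .
 qed
 ultimately have a: "(%x. exp (z * x - exp x)) absolutely_integrable_on UNIV"
  and b: "integral UNIV (%x. exp (z * x - exp x)) = Gamma z" by simp_all
 show i: "integrable lborel (%s. exp (z * s - exp s))"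
  using a unfolding set_integrable_def by (subst (asm) integrable_completion) auto
 show "(LINT s|lborel. exp (z * s - exp s)) = Gamma z"
  using b integral_lborel[OF i] by simp
qed

text \<open>Trades the factor \<open>s\<close> for shifts of the exponent by 1/4, so that first
  moments of \<open>exp (z * s - exp s)\<close> are again controlled by Gamma integrals.\<close>

lemma abs_le_exp_sum: "\<bar>s\<bar> <= 4 * (exp (s/4) + exp (- (s/4)))" for s :: real
proof -
 have "1 + s/4 <= exp (s/4)" "1 + - (s/4) <= exp (- (s/4))" "0 < exp (s/4)" "0 < exp (- (s/4))"
  by (rule exp_ge_add_one_self exp_gt_zero)+
 moreover have "\<bar>s\<bar> <= 4 * (A + B)" if "1 + s/4 <= A" "1 + - (s/4) <= B" "0 < A" "0 < B" for A B :: real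
  using that unfolding abs_le_iff distrib_left by linarith
 ultimately show ?thesis by blast
qed

lemma integrable_abs_exp_exp:
 fixes z :: real assumes "z > 1/4"
 shows "integrable lborel (%s. \<bar>s\<bar> * exp (z * s - exp s))"
proof (rule Bochner_Integration.integrable_bound)
 show "integrable lborel (%s. 4 * exp ((z + 1/4) * s - exp s) + 4 * exp ((z - 1/4) * s - exp s))"
  using assms by (intro Bochner_Integration.integrable_add integrable_mult_right Gamma_exp_integral(1)) auto
 show "(%s. \<bar>s\<bar> * exp (z * s - exp s)) \<in> borel_measurable lborel" by measurable
 show "AE s in lborel. norm (\<bar>s\<bar> * exp (z * s - exp s)) <= norm (4 * exp ((z + 1/4) * s - exp s) + 4 * exp ((z - 1/4) * s - exp s))"
 proof (rule AE_I2)
  fix s :: real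
  have "\<bar>s\<bar> * exp (z * s - exp s) <= 4 * (exp (s/4) + exp (- (s/4))) * exp (z * s - exp s)"
   by (intro mult_right_mono abs_le_exp_sum) auto
  also have "... = 4 * exp ((z + 1/4) * s - exp s) + 4 * exp ((z - 1/4) * s - exp s)"
   by (simp add: algebra_simps exp_add[symmetric])
  finally show "norm (\<bar>s\<bar> * exp (z * s - exp s)) <= norm (4 * exp ((z + 1/4) * s - exp s) + 4 * exp ((z - 1/4) * s - exp s))"
   by (simp add: abs_mult)
 qed
qed

text \<open>This is the derivative of the Gamma integral at 1, that is Gamma'(1). It is the source
  of Euler's constant in the expansion of K_0 at zero.\<close>

lemma integral_s_exp_exp: "(LINT s|lborel. s * exp (s - exp s)) = - (euler_mascheroni :: real)"
proof -
 have "((%z. LINT s|lborel. complex_of_real (exp (z * s - exp s))) has_vector_derivative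
   (LINT s|lborel. complex_of_real (s * exp (1 * s - exp s)))) (at 1)"
 proof (rule has_vector_derivative_lebesgue_integral[where S="{1/2<..<3/2}" and f'="%z s. complex_of_real (s * exp (z * s - exp s))"
    and g="%s. \<bar>s\<bar> * exp (1/2 * s - exp s) + \<bar>s\<bar> * exp (3/2 * s - exp s)"])
  show "integrable lborel (%s. complex_of_real (exp (z * s - exp s)))" if "z \<in> {1/2<..<3/2}" for z
   using that Gamma_exp_integral(1)[of z] by simp
  show "integrable lborel (%s::real. \<bar>s\<bar> * exp (1/2 * s - exp s) + \<bar>s\<bar> * exp (3/2 * s - exp s))"
   by (intro Bochner_Integration.integrable_add integrable_abs_exp_exp) auto
  show "((%z. complex_of_real (exp (z * s - exp s))) has_vector_derivative complex_of_real (s * exp (z * s - exp s))) (at z)" for z s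
   by (intro has_vector_derivative_of_real)
     (auto intro!: derivative_eq_intros simp: has_real_derivative_iff_has_vector_derivative[symmetric])
  show "norm (complex_of_real (s * exp (z * s - exp s))) <= \<bar>s\<bar> * exp (1/2 * s - exp s) + \<bar>s\<bar> * exp (3/2 * s - exp s)"
   if "z \<in> {1/2<..<3/2}" for z s
  proof -
   have "z * s <= 1/2 * s | z * s <= 3/2 * s"
    using that mult_right_mono[of z "3/2" s] mult_right_mono_neg[of "1/2" z s] by (cases "s >= 0") auto
   then have "exp (z * s - exp s) <= exp (1/2 * s - exp s) | exp (z * s - exp s) <= exp (3/2 * s - exp s)" by auto
   then have "exp (z * s - exp s) <= exp (1/2 * s - exp s) + exp (3/2 * s - exp s)"
    using exp_ge_zero[of "1/2 * s - exp s"] exp_ge_zero[of "3/2 * s - exp s"] by linarith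
   from mult_left_mono[OF this, of "\<bar>s\<bar>"] show ?thesis by (simp only: norm_of_real abs_mult abs_exp_cancel distrib_left)
  qed
 qed auto
 then have "((%z. complex_of_real (LINT s|lborel. exp (z * s - exp s))) has_vector_derivative
   complex_of_real (LINT s|lborel. s * exp (s - exp s))) (at 1)" by (simp only: integral_complex_of_real mult_1)
 from bounded_linear.has_vector_derivative[OF bounded_linear_Re this]
 have "((%z. LINT s|lborel. exp (z * s - exp s)) has_real_derivative (LINT s|lborel. s * exp (s - exp s))) (at 1)"
  unfolding Re_complex_of_real has_real_derivative_iff_has_vector_derivative .
 moreover have ev: "\<forall>\<^sub>F z in nhds (1::real). (LINT s|lborel. exp (z * s - exp s)) = Gamma z"
 proof -
  have "\<forall>\<^sub>F z in nhds (1::real). z > 0" using eventually_nhds_in_open[of "{0<..}" "1::real"] by simp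
  then show ?thesis by (rule eventually_mono) (rule Gamma_exp_integral(2))
 qed
 ultimately have "(Gamma has_real_derivative (LINT s|lborel. s * exp (s - exp s))) (at 1)"
  using DERIV_cong_ev[OF refl ev refl] by blast
 moreover have "(Gamma has_real_derivative Gamma 1 * Digamma 1) (at (1::real))"
  by (rule has_field_derivative_Gamma) simp
 ultimately have "(LINT s|lborel. s * exp (s - exp s)) = Gamma 1 * Digamma (1::real)" by (rule DERIV_unique)
 then show ?thesis by simp
qed

text \<open>Isolates the logarithmic singularity of K_0. Integration by parts turns the integrand
  into \<open>w * (t * sinh t * exp (- w * cosh t))\<close>; by symmetry \<open>sinh t\<close> may
  be replaced by \<open>exp t\<close>; the substitution \<open>t = s - ln (w/2)\<close> then splits
  off the logarithm. The weight \<open>h\<close> converges to \<open>exp (s - exp s)\<close>, the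
  density of the Gamma integral at 1, as \<open>w\<close> tends to 0.\<close>

lemma coshK_real_eq:
 fixes w :: real
 assumes w: "w > 0"
 defines "h \<equiv> %s. exp (s - exp s) * exp (- (w^2 / 4) * exp (- s))"
 shows "integrable lborel h" "integrable lborel (%s. s * h s)"
  "coshK (of_real w) = of_real ((LINT s|lborel. s * h s) - ln (w/2) * (LINT s|lborel. h s))"
proof -
 have hle: "0 <= h s" "h s <= exp (1 * s - exp s)" for s by (simp_all add: h_def)
 have hm: "h \<in> borel_measurable lborel" unfolding h_def by measurable
 show ih: "integrable lborel h"
  by (rule Bochner_Integration.integrable_bound[OF Gamma_exp_integral(1)[of 1] hm]) (use hle in auto)
 show ish: "integrable lborel (%s. s * h s)"
  by (rule Bochner_Integration.integrable_bound[OF integrable_abs_exp_exp[of 1]])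
    (use hm hle in \<open>auto simp: abs_mult intro!: mult_left_mono\<close>)
 let ?E = "%t. exp (- w * cosh t)"
 have abs_le: "\<bar>t\<bar> <= 2 * cosh t" for t :: real
  using exp_abs_le_cosh[of t] exp_ge_add_one_self[of "\<bar>t\<bar>"] by linarith
 have exp_le: "exp t <= 2 * cosh t" for t :: real
  using exp_abs_le_cosh[of t] order_trans[of "exp t" "exp \<bar>t\<bar>"] by simp
 have i1: "integrable lborel (%t. t * exp t * ?E t)"
 proof (rule Bochner_Integration.integrable_bound[OF integrable_mult_right[OF integrable_cosh_exp[OF w, of 2], of 4]])
  show "(%t. t * exp t * ?E t) \<in> borel_measurable lborel"
   by (simp add: borel_measurable_continuous_onI continuous_intros)
  show "AE t in lborel. norm (t * exp t * ?E t) <= norm (4 * (cosh t ^ 2 * ?E t))"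
  proof (rule AE_I2)
   fix t :: real
   have "\<bar>t\<bar> * exp t <= (2 * cosh t) * (2 * cosh t)" by (intro mult_mono abs_le exp_le) auto
   then have "\<bar>t\<bar> * exp t * ?E t <= (2 * cosh t) * (2 * cosh t) * ?E t" by (intro mult_right_mono) auto
   then show "norm (t * exp t * ?E t) <= norm (4 * (cosh t ^ 2 * ?E t))"
    by (simp add: abs_mult power2_eq_square mult_ac)
  qed
 qed
 have i2: "integrable lborel (%t. t * exp (-t) * ?E t)"
  using lborel_integrable_real_affine[OF integrable_minus[OF i1], of "-1" 0] by simp
 have r: "(LINT t|lborel. t * exp (-t) * ?E t) = - (LINT t|lborel. t * exp t * ?E t)"
  using lborel_integral_real_affine[of "-1" "%t. t * exp (-t) * ?E t" 0] by simp
 have sh: "w * (t * sinh t * ?E t) = w / 2 * (t * exp t * ?E t) - w / 2 * (t * exp (-t) * ?E t)" for t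
  by (simp add: sinh_def algebra_simps)
 have i3: "integrable lborel (%t. w * (t * sinh t * ?E t))"
  unfolding sh by (intro Bochner_Integration.integrable_diff integrable_mult_right i1 i2)
 have iE: "integrable lborel ?E" using integrable_cosh_exp[OF w, of 0] by simp
 have "(LINT t|lborel. complex_of_real (?E t - w * (t * sinh t * ?E t))) = 0"
 proof (rule integral_deriv_eq_0[where F="%t. complex_of_real (t * ?E t)"])
  show "((%t. complex_of_real (t * ?E t)) has_vector_derivative complex_of_real (?E t - w * (t * sinh t * ?E t))) (at t)" for t
   by (intro has_vector_derivative_of_real)
     (auto intro!: derivative_eq_intros simp: has_real_derivative_iff_has_vector_derivative[symmetric] algebra_simps)
  show "continuous_on UNIV (%t. complex_of_real (?E t - w * (t * sinh t * ?E t)))" by (intro continuous_intros)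
  show "integrable lborel (%t. complex_of_real (?E t - w * (t * sinh t * ?E t)))"
   using Bochner_Integration.integrable_diff[OF iE i3] by (rule integrable_of_real)
  have "((%t. of_real (t/2) * exp (- of_real w * of_real (cosh t))) \<longlongrightarrow> (0::complex)) F" if "filterlim (%t::real. \<bar>t\<bar>) at_top F" for F
   using that by (intro tendsto_cosh_exp_0[where n=1]) (use w abs_le in \<open>auto simp: norm_divide mult.commute\<close>)
  then have "((%t. 2 * (of_real (t/2) * exp (- of_real w * of_real (cosh t)))) \<longlongrightarrow> 2 * (0::complex)) F" if "filterlim (%t::real. \<bar>t\<bar>) at_top F" for F
   using that by (intro tendsto_mult tendsto_const)
  then have "((%t. complex_of_real (t * ?E t)) \<longlongrightarrow> 0) F" if "filterlim (%t::real. \<bar>t\<bar>) at_top F" for F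
   using that by (simp add: exp_of_real[symmetric])
  then show "((%t. complex_of_real (t * ?E t)) \<longlongrightarrow> 0) at_top" "((%t. complex_of_real (t * ?E t)) \<longlongrightarrow> 0) at_bot"
   using filterlim_abs_at_top_bot by blast+
 qed
 then have "(LINT t|lborel. ?E t - w * (t * sinh t * ?E t)) = 0"
  by (simp only: integral_complex_of_real of_real_eq_0_iff)
 then have "(LINT t|lborel. ?E t) = (LINT t|lborel. w * (t * sinh t * ?E t))"
  using Bochner_Integration.integral_diff[OF iE i3] by simp
 also have "... = w / 2 * (LINT t|lborel. t * exp t * ?E t) - w / 2 * (LINT t|lborel. t * exp (-t) * ?E t)"
  unfolding sh using i1 i2 by (subst Bochner_Integration.integral_diff) auto
 also have "... = w * (LINT t|lborel. t * exp t * ?E t)" unfolding r by simp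
 also have "(LINT t|lborel. t * exp t * ?E t) = (LINT s|lborel. (- ln (w/2) + 1 * s) * exp (- ln (w/2) + 1 * s) * ?E (- ln (w/2) + 1 * s))"
  by (subst lborel_integral_real_affine[of 1 _ "- ln (w/2)"]) auto
 also have "(%s. (- ln (w/2) + 1 * s) * exp (- ln (w/2) + 1 * s) * ?E (- ln (w/2) + 1 * s)) = (%s. 2 / w * (s * h s - ln (w/2) * h s))"
 proof
  fix s
  have e: "exp (- ln (w/2) + 1 * s) = 2 / w * exp s" "exp (- (- ln (w/2) + 1 * s)) = w / 2 * exp (- s)"
   using w by (simp_all add: exp_add exp_minus exp_diff field_simps)
  have "w * cosh (- ln (w/2) + 1 * s) = exp s + w^2 / 4 * exp (- s)"
   unfolding cosh_def e using w by (simp add: field_simps power2_eq_square)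
  then have E: "?E (- ln (w/2) + 1 * s) = exp (- exp s) * exp (- (w^2 / 4) * exp (- s))"
   by (simp add: exp_add[symmetric])
  show "(- ln (w/2) + 1 * s) * exp (- ln (w/2) + 1 * s) * ?E (- ln (w/2) + 1 * s) = 2 / w * (s * h s - ln (w/2) * h s)"
   unfolding e(1) E h_def exp_diff using w by (simp add: field_simps exp_minus)
 qed
 also have "(LINT s|lborel. 2 / w * (s * h s - ln (w/2) * h s)) = 2 / w * ((LINT s|lborel. s * h s) - ln (w/2) * (LINT s|lborel. h s))"
  using ih ish by simp
 finally have "(LINT t|lborel. ?E t) = 2 * ((LINT s|lborel. s * h s) - ln (w/2) * (LINT s|lborel. h s))"
  using w by simp
 then have "(LINT t|lborel. ?E t) / 2 = (LINT s|lborel. s * h s) - ln (w/2) * (LINT s|lborel. h s)"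
  by (metis nonzero_mult_div_cancel_left zero_neq_numeral)
 moreover have "coshK (of_real w) = of_real ((LINT t|lborel. ?E t) / 2)"
 proof -
  have "exp (- of_real w * of_real (cosh t)) = complex_of_real (?E t)" for t
   by (simp flip: exp_of_real)
  then show ?thesis unfolding coshK_def by simp
 qed
 ultimately show "coshK (of_real w) = of_real ((LINT s|lborel. s * h s) - ln (w/2) * (LINT s|lborel. h s))"
  by (simp only:)
qed

text \<open>The square root has the right strength: for x = (w^2/4) exp(-s) the linear bound by x
  would leave \<open>exp (- exp s)\<close> as majorant, which is not integrable at minus infinity,
  whereas the root leaves \<open>exp (s/2 - exp s)\<close>.\<close>

lemma one_minus_exp_neg_le_sqrt:
 fixes x :: real assumes "x >= 0" shows "1 - exp (- x) <= sqrt x"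
proof (cases "x <= 1")
 case True
 have "1 - exp (- x) <= x" using exp_ge_add_one_self[of "-x"] by linarith
 also have "x <= sqrt x" using assms True by (simp add: real_le_rsqrt power2_eq_square mult_left_le)
 finally show ?thesis .
next
 case False
 have "1 - exp (- x) <= 1" by simp
 also have "1 <= sqrt x" using False by simp
 finally show ?thesis .
qed

section \<open>Agreement of the series and the integral for K_0\<close>

definition bK :: "complex => complex" where
 "bK w = - Ln (w/2) * bI (w^2/4) + bL (w^2/4)"
text \<open>This is \<open>w\<close> times the derivative of \<open>bK\<close>. Paired with
  \<open>bK\<close> it turns Bessel's equation into a first-order linear system, the form in which
  uniqueness is proved.\<close>

definition wbK' :: "complex => complex" where
 "wbK' w = - bI (w^2/4) + 2 * (- Ln (w/2) * ((w^2/4) * bI' (w^2/4)) + (w^2/4) * bL' (w^2/4))"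

lemma DERIV_sq4: "((%w. w^2/4) has_field_derivative w/2) (at (w::complex))"
 by (auto intro!: derivative_eq_intros simp: power2_eq_square)

lemma DERIV_Ln_half:
 assumes "w \<notin> \<real>\<^sub>\<le>\<^sub>0"
 shows "((%w. Ln (w/2)) has_field_derivative 1 / w) (at w)"
proof -
 have "w/2 \<notin> \<real>\<^sub>\<le>\<^sub>0" "w ~= 0" using assms by (auto simp: complex_nonpos_Reals_iff)
 then show ?thesis by (auto intro!: derivative_eq_intros simp: field_simps)
qed

lemma DERIV_bK:
 assumes "w \<notin> \<real>\<^sub>\<le>\<^sub>0"
 shows "(bK has_field_derivative wbK' w / w) (at w)"
proof -
 have w0: "w ~= 0" using assms by auto
 have "(bK has_field_derivative (- (1/w)) * bI (w^2/4) + (bI' (w^2/4) * (w/2)) * (- Ln (w/2)) + bL' (w^2/4) * (w/2)) (at w)"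
  unfolding bK_def
  by (intro DERIV_add DERIV_mult DERIV_minus DERIV_Ln_half assms DERIV_chain2[OF DERIV_bI DERIV_sq4] DERIV_chain2[OF DERIV_bL DERIV_sq4])
 moreover have "(- (1/w)) * bI (w^2/4) + (bI' (w^2/4) * (w/2)) * (- Ln (w/2)) + bL' (w^2/4) * (w/2) = wbK' w / w"
  using w0 unfolding wbK'_def by (simp add: field_simps power2_eq_square)
 ultimately show ?thesis by simp
qed

lemma DERIV_wbK':
 assumes "w \<notin> \<real>\<^sub>\<le>\<^sub>0"
 shows "(wbK' has_field_derivative w * bK w) (at w)"
proof -
 have w0: "w ~= 0" using assms by auto
 have "(wbK' has_field_derivative - (bI' (w^2/4) * (w/2)) + 2 * (((- (1/w)) * ((w^2/4) * bI' (w^2/4)) + (bI (w^2/4) * (w/2)) * (- Ln (w/2)))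
   + (bL (w^2/4) + bI' (w^2/4)) * (w/2))) (at w)"
  unfolding wbK'_def
  by (intro DERIV_add DERIV_mult DERIV_minus DERIV_cmult DERIV_Ln_half assms DERIV_chain2[OF DERIV_bI DERIV_sq4]
    DERIV_chain2[OF DERIV_x_bI' DERIV_sq4] DERIV_chain2[OF DERIV_x_bL' DERIV_sq4])
 moreover have "- (bI' (w^2/4) * (w/2)) + 2 * (((- (1/w)) * ((w^2/4) * bI' (w^2/4)) + (bI (w^2/4) * (w/2)) * (- Ln (w/2)))
   + (bL (w^2/4) + bI' (w^2/4)) * (w/2)) = w * bK w"
  using w0 unfolding bK_def by (simp add: field_simps power2_eq_square)
 ultimately show ?thesis by simp
qed

definition eeh :: "real => real => real" where
 "eeh w s = exp (s - exp s) * exp (- (w^2 / 4) * exp (- s))"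

lemma eeh_diff_bounds:
 assumes "w > 0"
 shows "0 <= exp (s - exp s) - eeh w s & exp (s - exp s) - eeh w s <= (w/2) * exp (1/2 * s - exp s)"
proof -
 define h0 where "h0 = (%s::real. exp (s - exp s))"
 have "h0 s - eeh w s = h0 s * (1 - exp (- ((w^2 / 4) * exp (- s))))" by (simp add: eeh_def h0_def algebra_simps)
 moreover have "1 - exp (- ((w^2 / 4) * exp (- s))) <= sqrt ((w^2 / 4) * exp (- s))"
  by (intro one_minus_exp_neg_le_sqrt) auto
 moreover have "sqrt ((w^2 / 4) * exp (- s)) = (w/2) * exp (- s / 2)"
  using assms by (intro real_sqrt_unique) (simp_all add: power_mult_distrib power2_eq_square exp_add[symmetric])
 moreover have "h0 s * ((w/2) * exp (- s / 2)) = (w/2) * exp (1/2 * s - exp s)"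
  by (simp add: h0_def exp_add[symmetric])
 moreover have "0 <= h0 s" by (simp add: h0_def)
 moreover have "0 <= 1 - exp (- ((w^2 / 4) * exp (- s)))" by simp
 ultimately have "0 <= h0 s - eeh w s & h0 s - eeh w s <= (w/2) * exp (1/2 * s - exp s)"
  by (metis mult_left_mono mult_nonneg_nonneg)
 then show ?thesis by (simp only: h0_def)
qed

lemma eeh_integrable:
 assumes "w > 0"
 shows "integrable lborel (eeh w)" "integrable lborel (%s. s * eeh w s)"
  "coshK (of_real w) = of_real ((LINT s|lborel. s * eeh w s) - ln (w/2) * (LINT s|lborel. eeh w s))"
 using coshK_real_eq[OF assms] by (simp_all add: eeh_def[abs_def])

lemma integral_eeh_bound:
 defines "c1 \<equiv> (LINT s|lborel. exp (1/2 * s - exp s)) :: real"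
 assumes w: "w > 0"
 shows "\<bar>(LINT s|lborel. eeh w s) - 1\<bar> <= (w/2) * c1"
proof -
 have i0: "integrable lborel (%s::real. exp (s - exp s))" "(LINT s|lborel. exp (s - exp s)) = (1::real)"
  using Gamma_exp_integral[of 1] by simp_all
 have "\<bar>LINT s|lborel. exp (s - exp s) - eeh w s\<bar> <= (LINT s|lborel. (w/2) * exp (1/2 * s - exp s))"
  using integral_abs_bound_integral[of lborel "%s. exp (s - exp s) - eeh w s" "%s. (w/2) * exp (1/2 * s - exp s)"]
   i0(1) eeh_integrable(1)[OF w] Gamma_exp_integral(1)[of "1/2"] eeh_diff_bounds[OF w] by simp
 moreover have "(LINT s|lborel. exp (s - exp s) - eeh w s) = 1 - (LINT s|lborel. eeh w s)"
  using i0 eeh_integrable(1)[OF w] by simp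
 moreover have "(LINT s|lborel. (w/2) * exp (1/2 * s - exp s)) = (w/2) * c1" by (simp add: c1_def)
 ultimately show ?thesis by linarith
qed

lemma w_coshK1_real_eq:
 fixes w :: real
 assumes w: "w > 0"
 shows "of_real w * coshK1 (of_real w) = of_real (LINT s|lborel. eeh w s)"
proof -
 let ?E = "%t. exp (- w * cosh t)"
 have exp_le: "exp t <= 2 * cosh t" for t :: real
  using exp_abs_le_cosh[of t] order_trans[of "exp t" "exp \<bar>t\<bar>"] by simp
 have i1: "integrable lborel (%t. exp t * ?E t)"
 proof (rule Bochner_Integration.integrable_bound[OF integrable_mult_right[OF integrable_cosh_exp[OF w, of 1], of 2]])
  show "(%t. exp t * ?E t) \<in> borel_measurable lborel"
   by (simp add: borel_measurable_continuous_onI continuous_intros)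
  show "AE t in lborel. norm (exp t * ?E t) <= norm (2 * (cosh t ^ 1 * ?E t))"
   using exp_le by (intro AE_I2) (simp add: abs_mult)
 qed
 have i2: "integrable lborel (%t. exp (-t) * ?E t)"
  using lborel_integrable_real_affine[OF i1, of "-1" 0] by simp
 have r: "(LINT t|lborel. exp (-t) * ?E t) = (LINT t|lborel. exp t * ?E t)"
  using lborel_integral_real_affine[of "-1" "%t. exp (-t) * ?E t" 0] by simp
 have "(LINT t|lborel. cosh t * ?E t) = (LINT t|lborel. 1/2 * (exp t * ?E t) + 1/2 * (exp (-t) * ?E t))"
  by (rule Bochner_Integration.integral_cong) (simp_all add: cosh_def field_simps)
 also have "... = (LINT t|lborel. exp t * ?E t)"
  using i1 i2 r by (subst Bochner_Integration.integral_add) auto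
 also have "(LINT t|lborel. exp t * ?E t) = (LINT s|lborel. exp (- ln (w/2) + 1 * s) * ?E (- ln (w/2) + 1 * s))"
  by (subst lborel_integral_real_affine[of 1 _ "- ln (w/2)"]) auto
 also have "(%s. exp (- ln (w/2) + 1 * s) * ?E (- ln (w/2) + 1 * s)) = (%s. 2 / w * eeh w s)"
 proof
  fix s
  have e: "exp (- ln (w/2) + 1 * s) = 2 / w * exp s" "exp (- (- ln (w/2) + 1 * s)) = w / 2 * exp (- s)"
   using w by (simp_all add: exp_add exp_minus exp_diff field_simps)
  have "w * cosh (- ln (w/2) + 1 * s) = exp s + w^2 / 4 * exp (- s)"
   unfolding cosh_def e using w by (simp add: field_simps power2_eq_square)
  then have E: "?E (- ln (w/2) + 1 * s) = exp (- exp s) * exp (- (w^2 / 4) * exp (- s))"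
   by (simp add: exp_add[symmetric])
  show "exp (- ln (w/2) + 1 * s) * ?E (- ln (w/2) + 1 * s) = 2 / w * eeh w s"
   unfolding e(1) E eeh_def exp_diff using w by (simp add: field_simps exp_minus)
 qed
 finally have eq: "w * ((LINT t|lborel. cosh t * ?E t) / 2) = (LINT s|lborel. eeh w s)" using w by simp
 have "of_real (cosh t) * exp (- of_real w * of_real (cosh t)) = complex_of_real (cosh t * ?E t)" for t
  by (simp flip: exp_of_real)
 then have "coshK1 (of_real w) = (LINT t|lborel. complex_of_real (cosh t * ?E t)) / 2"
  unfolding coshK1_def by simp
 then have "coshK1 (of_real w) = of_real ((LINT t|lborel. cosh t * ?E t) / 2)"
  unfolding integral_complex_of_real by simp
 then show ?thesis unfolding eq[symmetric] by simp
qed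

text \<open>Both functions behave like \<open>- ln (w/2) - euler_mascheroni\<close> at zero. The
  weight of the integral approaches the Gamma density at rate \<open>w\<close>, and
  \<open>bI\<close> approaches 1 at rate \<open>w^2\<close>; both rates beat the logarithm.\<close>

lemma coshK_minus_bK_tendsto_0: "((%w::real. coshK (of_real w) - bK (of_real w)) \<longlongrightarrow> 0) (at_right 0)"
proof -
 let ?q = "%w. (of_real w)^2/4"
 define h where "h = eeh"
 define h0 where "h0 = (%s::real. exp (s - exp s))"
 define A where "A = (%w. LINT s|lborel. s * h w s)"
 define B where "B = (%w. LINT s|lborel. h w s)"
 have hd: "0 <= h0 s - h w s & h0 s - h w s <= (w/2) * exp (1/2 * s - exp s)" if "w > 0" for w s
  using eeh_diff_bounds[OF that] by (simp only: h_def h0_def)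
 have i0: "integrable lborel h0" "(LINT s|lborel. h0 s) = 1"
  using Gamma_exp_integral[of 1] by (simp_all add: h0_def)
 have i0s: "integrable lborel (%s. s * h0 s)"
  by (rule Bochner_Integration.integrable_bound[OF integrable_abs_exp_exp[of 1]]) (auto simp: h0_def abs_mult)
 have cr: "integrable lborel (h w)" "integrable lborel (%s. s * h w s)"
   "coshK (of_real w) = of_real (A w - ln (w/2) * B w)" if "w > 0" for w
  using eeh_integrable[OF that] by (simp_all only: h_def A_def B_def)
 define c1 :: real where "c1 = (LINT s|lborel. exp (1/2 * s - exp s))"
 define c2 :: real where "c2 = (LINT s|lborel. \<bar>s\<bar> * exp (1/2 * s - exp s))"
 have Bbd: "\<bar>B w - 1\<bar> <= (w/2) * c1" if w: "w > 0" for w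
  using integral_eeh_bound[OF that] by (simp only: B_def c1_def h_def)
 have Abd: "\<bar>A w + euler_mascheroni\<bar> <= (w/2) * c2" if w: "w > 0" for w
 proof -
  have "\<bar>LINT s|lborel. s * h0 s - s * h w s\<bar> <= (LINT s|lborel. (w/2) * (\<bar>s\<bar> * exp (1/2 * s - exp s)))"
  proof (rule integral_abs_bound_integral)
   show "integrable lborel (%s. s * h0 s - s * h w s)" using i0s cr(2)[OF w] by simp
   show "integrable lborel (%s. (w/2) * (\<bar>s\<bar> * exp (1/2 * s - exp s)))" using integrable_abs_exp_exp[of "1/2"] by simp
   fix s :: real
   have "\<bar>s * h0 s - s * h w s\<bar> = \<bar>s\<bar> * (h0 s - h w s)" using hd[OF w, of s]
    by (simp add: abs_mult[symmetric] right_diff_distrib[symmetric]) (simp add: abs_mult)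
   also have "... <= \<bar>s\<bar> * ((w/2) * exp (1/2 * s - exp s))" using hd[OF w, of s] by (intro mult_left_mono) auto
   finally show "\<bar>s * h0 s - s * h w s\<bar> <= (w/2) * (\<bar>s\<bar> * exp (1/2 * s - exp s))" by (simp only: mult_ac)
  qed
  moreover have "(LINT s|lborel. s * h0 s - s * h w s) = - euler_mascheroni - A w"
   using i0s cr(2)[OF w] integral_s_exp_exp by (simp add: A_def h0_def)
  moreover have "(LINT s|lborel. (w/2) * (\<bar>s\<bar> * exp (1/2 * s - exp s))) = (w/2) * c2" by (simp add: c2_def)
  ultimately show ?thesis by linarith
 qed
 have wlim: "((%w::real. w/2 * c) \<longlongrightarrow> 0) (at_right 0)" for c by real_asymp
 have Alim: "((%w. A w + euler_mascheroni) \<longlongrightarrow> 0) (at_right 0)"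
  by (rule Lim_null_comparison[OF _ wlim[of c2]]) (use Abd in \<open>auto simp: eventually_at_right_less intro!: eventually_at_rightI[of 0 1]\<close>)
 have Blim: "((%w. ln (w/2) * (B w - 1)) \<longlongrightarrow> 0) (at_right 0)"
 proof (rule Lim_null_comparison)
  show "\<forall>\<^sub>F w in at_right 0. norm (ln (w/2) * (B w - 1)) <= \<bar>ln (w/2)\<bar> * (w/2 * c1)"
   by (rule eventually_at_rightI[of 0 1]) (use Bbd in \<open>auto simp: abs_mult intro!: mult_left_mono\<close>)
  have "((%w::real. ln (w/2) * (w/2)) \<longlongrightarrow> 0) (at_right 0)" by real_asymp
  from tendsto_mult_right_zero[OF tendsto_rabs_zero[OF this], of "\<bar>c1\<bar>"]
  have "((%w::real. \<bar>c1\<bar> * \<bar>ln (w/2) * (w/2)\<bar>) \<longlongrightarrow> 0) (at_right 0)" .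
  moreover have "\<forall>\<^sub>F w in at_right 0. \<bar>c1\<bar> * \<bar>ln (w/2) * (w/2)\<bar> = \<bar>ln (w/2)\<bar> * (w/2 * c1)"
  proof (rule eventually_at_rightI[of 0 1])
   have "c1 >= 0" unfolding c1_def by (intro integral_nonneg_AE AE_I2) auto
   then show "\<bar>c1\<bar> * \<bar>ln (w/2) * (w/2)\<bar> = \<bar>ln (w/2)\<bar> * (w/2 * c1)" if "w \<in> {0<..<1}" for w
    using that by (simp add: abs_mult)
  qed auto
  ultimately show "((%w. \<bar>ln (w/2)\<bar> * (w/2 * c1)) \<longlongrightarrow> 0) (at_right 0)"
   by (rule Lim_transform_eventually)
 qed
 have sq: "((%w::real. (of_real w)^2/4 :: complex) \<longlongrightarrow> 0) (at_right 0)"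
  by (auto intro!: tendsto_eq_intros)
 have Ilim: "((%w::real. of_real (ln (w/2)) * (bI (?q w) - 1)) \<longlongrightarrow> 0) (at_right 0)"
 proof -
  have "((%x. (bI x - bI 0) / (x - 0)) \<longlongrightarrow> bI' 0) (at 0)"
   using DERIV_bI[of 0] by (simp add: has_field_derivative_iff)
  moreover have "filterlim (%w::real. (of_real w)^2/4 :: complex) (at 0) (at_right 0)"
   by (rule filterlim_atI[OF sq], rule eventually_at_rightI[of 0 1]) auto
  ultimately have "((%w::real. (bI (?q w) - bI 0) / ((of_real w)^2/4 - 0)) \<longlongrightarrow> bI' 0) (at_right 0)"
   by (rule filterlim_compose)
  then have "((%w::real. (bI (?q w) - 1) / (?q w)) \<longlongrightarrow> bI' 0) (at_right 0)"
   by simp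
  moreover have "((%w::real. of_real (ln (w/2) * (w^2/4)) :: complex) \<longlongrightarrow> of_real 0) (at_right 0)"
   by (intro tendsto_of_real) real_asymp
  ultimately have "((%w::real. of_real (ln (w/2) * (w^2/4)) * ((bI (?q w) - 1) / (?q w))) \<longlongrightarrow> of_real 0 * bI' 0) (at_right 0)"
   by (intro tendsto_mult)
  moreover have "\<forall>\<^sub>F w in at_right 0. of_real (ln (w/2) * (w^2/4)) * ((bI (?q w) - 1) / (?q w))
    = of_real (ln (w/2)) * (bI (?q w) - 1)"
   by (rule eventually_at_rightI[of 0 1]) auto
  ultimately show ?thesis by (auto intro: Lim_transform_eventually)
 qed
 have Llim: "((%w::real. bL (?q w) + euler_mascheroni) \<longlongrightarrow> 0) (at_right 0)"
 proof -
  have "isCont bL 0" using DERIV_bL DERIV_isCont by blast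
  from isCont_tendsto_compose[OF this sq] have "((%w::real. bL (?q w)) \<longlongrightarrow> - euler_mascheroni) (at_right 0)"
   by (simp add: bL_0)
  from tendsto_add[OF this tendsto_const[of euler_mascheroni]] show ?thesis by simp
 qed
 have "((%w. of_real (A w + euler_mascheroni) - of_real (ln (w/2) * (B w - 1))
   + of_real (ln (w/2)) * (bI (?q w) - 1) - (bL (?q w) + euler_mascheroni)) \<longlongrightarrow> of_real 0 - of_real 0 + 0 - (0::complex)) (at_right 0)"
  by (intro tendsto_intros Alim Blim Ilim Llim)
 then have l0: "((%w. of_real (A w + euler_mascheroni) - of_real (ln (w/2) * (B w - 1))
   + of_real (ln (w/2)) * (bI (?q w) - 1) - (bL (?q w) + euler_mascheroni)) \<longlongrightarrow> (0::complex)) (at_right 0)"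
  by simp
 show ?thesis
 proof (rule Lim_transform_eventually[OF l0], rule eventually_at_rightI[of 0 1])
  fix w :: real assume "w \<in> {0<..<1}"
  then have w: "w > 0" by simp
  have "Ln (of_real w / 2) = of_real (ln (w/2))" using Ln_of_real[of "w/2"] w by simp
  then show "of_real (A w + euler_mascheroni) - of_real (ln (w/2) * (B w - 1))
   + of_real (ln (w/2)) * (bI (?q w) - 1) - (bL (?q w) + euler_mascheroni) = coshK (of_real w) - bK (of_real w)"
   unfolding bK_def cr(3)[OF w] by (simp add: algebra_simps)
 qed auto
qed

lemma w_coshK1_tendsto: "((%w::real. of_real w * coshK1 (of_real w)) \<longlongrightarrow> 1) (at_right 0)"
proof -
 define c1 :: real where "c1 = (LINT s|lborel. exp (1/2 * s - exp s))"
 have "((%w. (LINT s|lborel. eeh w s) - 1) \<longlongrightarrow> 0) (at_right 0)"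
 proof (rule Lim_null_comparison)
  show "\<forall>\<^sub>F w in at_right 0. norm ((LINT s|lborel. eeh w s) - 1) <= w/2 * c1"
   by (rule eventually_at_rightI[of 0 1]) (use integral_eeh_bound in \<open>auto simp: c1_def\<close>)
  show "((%w. w/2 * c1) \<longlongrightarrow> 0) (at_right 0)" by real_asymp
 qed
 from tendsto_of_real[OF this, where ?'a=complex]
 have "((%w. complex_of_real (LINT s|lborel. eeh w s)) \<longlongrightarrow> 1) (at_right 0)"
  by (simp add: LIM_zero_iff)
 moreover have "\<forall>\<^sub>F w in at_right 0. complex_of_real (LINT s|lborel. eeh w s) = of_real w * coshK1 (of_real w)"
  by (rule eventually_at_rightI[of 0 1]) (use w_coshK1_real_eq in auto)
 ultimately show ?thesis by (rule Lim_transform_eventually)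
qed

text \<open>Uniqueness at the singular point 0. With \<open>M\<close> the maximum of
  \<open>norm y\<close>, integrating the second equation gives \<open>norm (z x) <= M * x^2\<close>,
  and integrating the first gives \<open>norm (y x) <= M / 4\<close> as long as
  \<open>x <= 1/2\<close>; hence \<open>M <= M / 4\<close>. Extension by the value 0 at the origin
  makes both functions continuous on the closed interval.\<close>

lemma bessel_ode_unique:
 fixes y z :: "real => complex"
 assumes y': "!!w. 0 < w ==> w <= 1/2 ==> (y has_vector_derivative z w / of_real w) (at w)"
  and z': "!!w. 0 < w ==> w <= 1/2 ==> (z has_vector_derivative of_real w * y w) (at w)"
  and y0: "(y \<longlongrightarrow> 0) (at_right 0)" and z0: "(z \<longlongrightarrow> 0) (at_right 0)"
  and w: "0 < w" "w <= 1/2"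
 shows "y w = 0"
proof -
 define Y where "Y = (%x. if x = 0 then 0 else y x)"
 define Z where "Z = (%x. if x = 0 then 0 else z x)"
 have cont: "continuous_on {0..1/2} (%x. if x = 0 then 0 else f x)"
  if "!!x. 0 < x ==> x <= 1/2 ==> (f has_vector_derivative f' x) (at x)" "(f \<longlongrightarrow> 0) (at_right 0)" for f f' :: "real => complex"
  unfolding continuous_on_eq_continuous_within
 proof
  fix x :: real assume x: "x \<in> {0..1/2}"
  show "continuous (at x within {0..1/2}) (%x. if x = 0 then 0 else f x)"
  proof (cases "x = 0")
   case True
   have "((%x. if x = 0 then 0 else f x) \<longlongrightarrow> 0) (at_right 0)"
    by (rule Lim_transform_eventually[OF that(2)]) (rule eventually_at_rightI[of 0 1], auto)
   then show ?thesis using True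
    by (simp add: continuous_within at_within_Icc_at_right)
  next
   case False
   then have x0: "x > 0" using x by simp
   have "isCont f x" using that(1)[of x] x x0 has_vector_derivative_continuous by auto
   moreover have "\<forall>\<^sub>F t in nhds x. f t = (if t = 0 then 0 else f t)"
    using x0 by (intro eventually_mono[OF eventually_nhds_in_open[of "{0<..}" x]]) auto
   ultimately have "isCont (%t. if t = 0 then 0 else f t) x"
    using isCont_cong[of f "%t. if t = 0 then 0 else f t" x] by blast
   then show ?thesis by (rule continuous_at_imp_continuous_at_within)
  qed
 qed
 have cY: "continuous_on {0..1/2} Y" and cZ: "continuous_on {0..1/2} Z"
  unfolding Y_def Z_def using cont[OF y' y0] cont[OF z' z0] by blast+
 have dY: "(Y has_vector_derivative Z x / of_real x) (at x)" and dZ: "(Z has_vector_derivative of_real x * Y x) (at x)"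
  if "0 < x" "x <= 1/2" for x
 proof -
  show "(Y has_vector_derivative Z x / of_real x) (at x)"
   using has_vector_derivative_transform_within_open[OF y'[OF that], of "{0<..}" Y] that(1)
   by (simp add: Y_def Z_def)
  show "(Z has_vector_derivative of_real x * Y x) (at x)"
   using has_vector_derivative_transform_within_open[OF z'[OF that], of "{0<..}" Z] that(1)
   by (simp add: Y_def Z_def)
 qed
 obtain x0 where x0: "x0 \<in> {0..1/2}" "!!x. x \<in> {0..1/2} ==> norm (Y x) <= norm (Y x0)"
  using continuous_attains_sup[of "{0..1/2::real}" "%x. norm (Y x)"] continuous_on_norm[OF cY] by auto
 define M where "M = norm (Y x0)"
 have M: "norm (Y x) <= M" if "0 <= x" "x <= 1/2" for x using x0(2)[of x] that by (simp add: M_def)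
 have M0: "M >= 0" by (simp add: M_def)
 have Zb: "norm (Z x) <= x * M * x" if x: "0 < x" "x <= 1/2" for x
 proof -
  have "norm (Z x - Z 0) <= x * M * x - x * M * 0"
  proof (rule differentiable_bound_general[where f'="%t. of_real t * Y t" and \<phi>'="%t. x * M"])
   show "continuous_on {0..x} Z" by (rule continuous_on_subset[OF cZ]) (use x in auto)
   show "norm (of_real t * Y t) <= x * M" if "0 < t" "t < x" for t
    unfolding norm_mult by (rule mult_mono) (use M[of t] that x in auto)
  qed (use x dZ in \<open>auto intro!: continuous_intros derivative_eq_intros simp: has_real_derivative_iff_has_vector_derivative[symmetric]\<close>)
  then show ?thesis by (simp add: Z_def)
 qed
 have Yb: "norm (Y x) <= M / 4" if x: "0 < x" "x <= 1/2" for x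
 proof -
  have "norm (Y x - Y 0) <= (M/2) * x - (M/2) * 0"
  proof (rule differentiable_bound_general[where f'="%t. Z t / of_real t" and \<phi>'="%t. M/2"])
   show "continuous_on {0..x} Y" by (rule continuous_on_subset[OF cY]) (use x in auto)
   show "norm (Z t / of_real t) <= M/2" if t: "0 < t" "t < x" for t
   proof -
    have "norm (Z t / of_real t) <= (t * M * t) / t"
     using divide_right_mono[OF Zb[of t], of t] t x by (simp add: norm_divide)
    also have "... = t * M" using t by simp
    also have "... <= 1/2 * M" by (intro mult_right_mono) (use t x M0 in auto)
    finally show ?thesis by simp
   qed
  qed (use x dY in \<open>auto intro!: continuous_intros derivative_eq_intros simp: has_real_derivative_iff_has_vector_derivative[symmetric]\<close>)
  then have "norm (Y x) <= (M/2) * x" by (simp add: Y_def)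
  also have "... <= (M/2) * (1/2)" by (intro mult_left_mono) (use x M0 in auto)
  finally show ?thesis by simp
 qed
 have "M <= M / 4"
 proof (cases "x0 = 0")
  case True then show ?thesis by (simp add: M_def Y_def)
 next
  case False then show ?thesis using Yb[of x0] x0(1) by (simp add: M_def)
 qed
 then have "M = 0" using M0 by simp
 then have "norm (Y w) <= 0" using M[of w] w by simp
 then show ?thesis using w by (simp add: Y_def)
qed

text \<open>For both functions the pair of value and \<open>w\<close> times derivative solves the
  same linear system, and the differences vanish at 0, so they agree on \<open>{0<..1/2}\<close>.
  The identity theorem extends this to the right half-plane.\<close>

lemma coshK_eq_bK:
 assumes "Re w > 0"
 shows "coshK w = bK w"
proof -
 let ?q = "%w. (of_real w)^2/4"
 have nn: "z \<notin> \<real>\<^sub>\<le>\<^sub>0" if "Re z > 0" for z using that by (auto simp: complex_nonpos_Reals_iff)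
 have real_eq: "coshK (of_real x) - bK (of_real x) = 0" if "0 < x" "x <= 1/2" for x :: real
 proof (rule bessel_ode_unique[where y="%x. coshK (of_real x) - bK (of_real x)" and z="%x. - (of_real x * coshK1 (of_real x)) - wbK' (of_real x)"])
  fix v :: real assume v: "0 < v"
  have "((%w. coshK w - bK w) has_field_derivative - coshK1 (of_real v) - wbK' (of_real v) / of_real v) (at (of_real v))"
   using v by (intro DERIV_diff DERIV_coshK DERIV_bK nn) auto
  from has_vector_derivative_real_field[OF this]
  show "((%x. coshK (of_real x) - bK (of_real x)) has_vector_derivative
    (- (of_real v * coshK1 (of_real v)) - wbK' (of_real v)) / of_real v) (at v)"
   using v by (simp add: diff_divide_distrib)
  have "((%w. - (w * coshK1 w) - wbK' w) has_field_derivative - (- of_real v * coshK (of_real v)) - of_real v * bK (of_real v)) (at (of_real v))"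
   using v by (intro DERIV_diff DERIV_minus DERIV_w_coshK1 DERIV_wbK' nn) auto
  from has_vector_derivative_real_field[OF this]
  show "((%x. - (of_real x * coshK1 (of_real x)) - wbK' (of_real x)) has_vector_derivative
    of_real v * (coshK (of_real v) - bK (of_real v))) (at v)"
   by (simp add: algebra_simps)
 next
  have sq: "((%w::real. (of_real w)^2/4 :: complex) \<longlongrightarrow> 0) (at_right 0)"
   by (auto intro!: tendsto_eq_intros)
  have c: "isCont bI 0" "isCont bI' 0" "isCont bL' 0"
   using DERIV_bI DERIV_isCont holomorphic_bI'[of UNIV] holomorphic_bL'[of UNIV]
   by (auto simp: holomorphic_on_imp_continuous_on continuous_on_eq_continuous_at dest!: holomorphic_on_imp_continuous_on)
  have l: "((%w::real. of_real (ln (w/2) * (w^2/4)) :: complex) \<longlongrightarrow> of_real 0) (at_right 0)"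
   by (intro tendsto_of_real) real_asymp
  have "((%w::real. - (of_real w * coshK1 (of_real w)) - (- bI (?q w) + 2 * (- of_real (ln (w/2) * (w^2/4)) * bI' (?q w)
    + (?q w) * bL' (?q w)))) \<longlongrightarrow> - 1 - (- bI 0 + 2 * (- of_real 0 * bI' 0 + 0 * bL' 0))) (at_right 0)"
   by (intro tendsto_intros w_coshK1_tendsto l sq isCont_tendsto_compose[OF c(1) sq] isCont_tendsto_compose[OF c(2) sq] isCont_tendsto_compose[OF c(3) sq])
  then have l0: "((%w::real. - (of_real w * coshK1 (of_real w)) - (- bI (?q w) + 2 * (- of_real (ln (w/2) * (w^2/4)) * bI' (?q w)
    + (?q w) * bL' (?q w)))) \<longlongrightarrow> 0) (at_right 0)" by simp
  show "((%x. - (of_real x * coshK1 (of_real x)) - wbK' (of_real x)) \<longlongrightarrow> 0) (at_right 0)"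
  proof (rule Lim_transform_eventually[OF l0], rule eventually_at_rightI[of 0 1])
   fix v :: real assume "v \<in> {0<..<1}"
   then have "Ln (of_real v / 2) = of_real (ln (v/2))" using Ln_of_real[of "v/2"] by simp
   then show "- (of_real v * coshK1 (of_real v)) - (- bI (?q v) + 2 * (- of_real (ln (v/2) * (v^2/4)) * bI' (?q v)
    + (?q v) * bL' (?q v))) = - (of_real v * coshK1 (of_real v)) - wbK' (of_real v)"
    unfolding wbK'_def by (simp add: mult.assoc)
  qed auto
 qed (use that coshK_minus_bK_tendsto_0 in auto)
 have "(%w. coshK w - bK w) w = 0"
 proof (rule analytic_continuation[where f="%w. coshK w - bK w" and S="{z. Re z > 0}" and U="complex_of_real ` {0<..1/2}" and \<xi>="of_real (1/4)"])
  show "(%w. coshK w - bK w) holomorphic_on {z. Re z > 0}"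
   using DERIV_diff[OF DERIV_coshK DERIV_bK[OF nn]] open_halfspace_Re_gt[of 0]
   by (auto simp: holomorphic_on_open)
  show "complex_of_real (1/4) islimpt complex_of_real ` {0<..1/2}"
  proof (rule islimpt_approachable[THEN iffD2], intro allI impI)
   fix e :: real assume e: "e > 0"
   define d where "d = min (1/8) (e/2)"
   have d: "0 < d" "d <= 1/8" using e by (auto simp: d_def)
   have "complex_of_real (1/4 + d) \<in> complex_of_real ` {0<..1/2}" by (intro imageI) (use d in auto)
   moreover have "complex_of_real (1/4 + d) ~= of_real (1/4)" unfolding of_real_eq_iff using d by simp
   moreover have "dist (complex_of_real (1/4 + d)) (of_real (1/4)) < e"
    using e unfolding dist_of_real by (simp add: d_def dist_real_def)
   ultimately show "\<exists>x'\<in>complex_of_real ` {0<..1/2}. x' ~= of_real (1/4) & dist x' (of_real (1/4)) < e" by blast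
  qed
  show "connected {z. Re z > 0}" by (intro convex_connected convex_halfspace_Re_gt)
  show "coshK z - bK z = 0" if "z \<in> complex_of_real ` {0<..1/2}" for z
   using that real_eq by auto
 qed (use assms in \<open>auto simp: open_halfspace_Re_gt\<close>)
 then show ?thesis by simp
qed

lemma coshK1_eq_wbK':
 assumes "Re w > 0"
 shows "coshK1 w = - wbK' w / w"
proof -
 have nn: "w \<notin> \<real>\<^sub>\<le>\<^sub>0" using assms by (auto simp: complex_nonpos_Reals_iff)
 have "\<forall>\<^sub>F z in nhds w. coshK z = bK z"
  using eventually_nhds_in_open[OF open_halfspace_Re_gt[of 0], of w] assms
  by (auto elim!: eventually_mono intro: coshK_eq_bK)
 then have "(bK has_field_derivative - coshK1 w) (at w)"
  using DERIV_cong_ev[OF refl _ refl] DERIV_coshK[OF assms] by blast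
 from DERIV_unique[OF this DERIV_bK[OF nn]] show ?thesis by (simp add: minus_equation_iff[of "coshK1 w"])
qed

section \<open>The fundamental solution as a function of the squared distance\<close>

locale hsm =
 fixes a k \<theta> :: real
 assumes a_pos: "a > 0" and k_pos: "k > 0" and theta_pos: "0 < \<theta>" and theta_less: "\<theta> < pi / 2"
begin

definition om :: complex where "om = cis \<theta>"
abbreviation rot where "rot x \<equiv> complex_of_real x * om"
text \<open>For \<open>w = - i * k * csqrt q\<close> one has \<open>w^2 / 4 = al * q\<close> and
  \<open>Ln (w/2) = Ln q / 2 + cc\<close>. The imaginary part of \<open>cc\<close> is what selects
  the outgoing solution, the Hankel function of the first kind.\<close>

definition al :: complex where "al = - ((of_real k)^2) / 4"
definition cc :: complex where "cc = of_real (ln (k/2)) - \<i> * of_real pi / 2"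

text \<open>With $q = z_1^2 + z_2^2$, \<open>NN q\<close> is the outgoing fundamental solution
  $\frac{i}{4} H_0^{(1)}(k\sqrt q)$ and \<open>PP q\<close> is $q$ times its derivative.\<close>

definition NN :: "complex => complex" where
 "NN q = (- (Ln q / 2 + cc) * bI (al * q) + bL (al * q)) / (2 * of_real pi)"
definition PP :: "complex => complex" where
 "PP q = (- bI (al * q) / 2 - (Ln q / 2 + cc) * (al * q * bI' (al * q)) + al * q * bL' (al * q)) / (2 * of_real pi)"
text \<open>Bessel's equation says that \<open>PP\<close> has derivative \<open>al * NN\<close>. It
  eliminates all higher derivatives: the first three derivatives of \<open>NN\<close> are
  combinations of \<open>NN\<close> and \<open>PP\<close> over powers of \<open>q\<close>, so that
  bounds for these two functions carry over to all kernels.\<close>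

definition N1 :: "complex => complex" where "N1 q = PP q / q"
definition N2 :: "complex => complex" where "N2 q = (al * NN q - N1 q) / q"
definition N3 :: "complex => complex" where "N3 q = (al * N1 q - 2 * N2 q) / q"

lemma DERIV_al: "((%q. al * q) has_field_derivative al) (at q)"
 by (auto intro!: derivative_eq_intros)

lemma DERIV_Ln_cc: "q \<notin> \<real>\<^sub>\<le>\<^sub>0 ==> ((%q. Ln q / 2 + cc) has_field_derivative 1 / (2 * q)) (at q)"
 by (auto intro!: derivative_eq_intros simp: field_simps)

lemma DERIV_NN:
 assumes "q \<notin> \<real>\<^sub>\<le>\<^sub>0"
 shows "(NN has_field_derivative N1 q) (at q)"
proof -
 have q0: "q ~= 0" using assms by auto
 have "(NN has_field_derivative ((- (1 / (2 * q))) * bI (al * q) + (bI' (al * q) * al) * (- (Ln q / 2 + cc)) + bL' (al * q) * al) / (2 * of_real pi)) (at q)"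
  unfolding NN_def
  by (intro DERIV_cdivide DERIV_add DERIV_mult DERIV_minus DERIV_Ln_cc assms DERIV_chain2[OF DERIV_bI DERIV_al] DERIV_chain2[OF DERIV_bL DERIV_al])
 moreover have "((- (1 / (2 * q))) * bI (al * q) + (bI' (al * q) * al) * (- (Ln q / 2 + cc)) + bL' (al * q) * al) / (2 * of_real pi) = N1 q"
  using q0 unfolding N1_def PP_def by (simp add: field_simps)
 ultimately show ?thesis by simp
qed

lemma DERIV_PP:
 assumes "q \<notin> \<real>\<^sub>\<le>\<^sub>0"
 shows "(PP has_field_derivative al * NN q) (at q)"
proof -
 have q0: "q ~= 0" using assms by auto
 have "(PP has_field_derivative ((- (bI' (al * q) * al) / 2 - ((1 / (2 * q)) * (al * q * bI' (al * q)) + (bI (al * q) * al) * (Ln q / 2 + cc))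
   + (bL (al * q) + bI' (al * q)) * al) / (2 * of_real pi))) (at q)"
  unfolding PP_def
  by (intro DERIV_cdivide DERIV_add DERIV_diff DERIV_mult DERIV_minus DERIV_Ln_cc assms DERIV_chain2[OF DERIV_bI DERIV_al]
   DERIV_chain2[OF DERIV_x_bI' DERIV_al] DERIV_chain2[OF DERIV_x_bL' DERIV_al])
 moreover have "((- (bI' (al * q) * al) / 2 - ((1 / (2 * q)) * (al * q * bI' (al * q)) + (bI (al * q) * al) * (Ln q / 2 + cc))
   + (bL (al * q) + bI' (al * q)) * al) / (2 * of_real pi)) = al * NN q"
  using q0 unfolding NN_def by (simp add: field_simps)
 ultimately show ?thesis by simp
qed

lemma DERIV_N1:
 assumes "q \<notin> \<real>\<^sub>\<le>\<^sub>0"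
 shows "(N1 has_field_derivative N2 q) (at q)"
proof -
 have q0: "q ~= 0" using assms by auto
 have "((%q. PP q / q) has_field_derivative (al * NN q * q - PP q * 1) / (q * q)) (at q)"
  using q0 by (intro DERIV_divide DERIV_PP assms DERIV_ident)
 moreover have "(al * NN q * q - PP q * 1) / (q * q) = N2 q"
  using q0 unfolding N2_def N1_def by (simp add: field_simps)
 moreover have "N1 = (%q. PP q / q)" by (simp add: N1_def fun_eq_iff)
 ultimately show ?thesis by simp
qed

lemma DERIV_N2:
 assumes "q \<notin> \<real>\<^sub>\<le>\<^sub>0"
 shows "(N2 has_field_derivative N3 q) (at q)"
proof -
 have q0: "q ~= 0" using assms by auto
 have "((%q. (al * NN q - N1 q) / q) has_field_derivative ((al * N1 q - N2 q) * q - (al * NN q - N1 q) * 1) / (q * q)) (at q)"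
  using q0 by (intro DERIV_divide DERIV_diff DERIV_cmult DERIV_NN DERIV_N1 assms DERIV_ident)
 moreover have "((al * N1 q - N2 q) * q - (al * NN q - N1 q) * 1) / (q * q) = N3 q"
  using q0 unfolding N3_def N2_def by (simp add: field_simps)
 moreover have "N2 = (%q. (al * NN q - N1 q) / q)" by (simp add: N2_def fun_eq_iff)
 ultimately show ?thesis by simp
qed

lemma Ln_csqrt: "q ~= 0 ==> Ln (csqrt q) = Ln q / 2"
proof -
 assume q: "q ~= 0"
 have "csqrt q = exp (Ln q / 2)" using csqrt_exp_Ln[OF q] by simp
 moreover have "Im (Ln q / 2) > - pi" "Im (Ln q / 2) <= pi"
  using Im_Ln_le_pi[OF q] mpi_less_Im_Ln[OF q] pi_gt_zero by auto
 ultimately show ?thesis by (simp add: Ln_exp)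
qed

text \<open>The given kernel is minus twice the \<open>z1\<close>-derivative of the fundamental
  solution, hence the Poisson kernel of the half-plane. The principal root creates no sign ambiguity
  because \<open>Ln (csqrt q) = Ln q / 2\<close> for every nonzero \<open>q\<close>.\<close>

lemma hker_eq:
 assumes "z1^2 + z2^2 ~= 0"
 shows "hker k z1 z2 = - 4 * z1 * N1 (z1^2 + z2^2)"
proof -
 define q where "q = z1^2 + z2^2"
 define R where "R = csqrt q"
 have q: "q ~= 0" "R ~= 0" "R^2 = q" using assms by (auto simp: q_def R_def)
 have RR: "R * R = q" using q(3) by (simp add: power2_eq_square)
 have k: "of_real k * R ~= 0" "complex_of_real k ~= 0" using q k_pos by auto
 have X: "- ((of_real k * R)^2) / 4 = al * q" by (simp add: al_def power_mult_distrib q(3))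
 have "of_real k * R / 2 = of_real (k/2) * R" by simp
 then have "Ln (of_real k * R / 2) = of_real (ln (k/2)) + Ln R"
  using Ln_times_of_real[of "k/2" R] Ln_of_real[of "k/2"] k_pos q(2) by simp
 then have L: "Ln (of_real k * R / 2) - \<i> * of_real pi / 2 = Ln q / 2 + cc"
  using Ln_csqrt[OF q(1)] by (simp add: cc_def R_def)
 define Y where "Y = (Ln q / 2 + cc) * bI' (al * q) - bL' (al * q)"
 have "hker k z1 z2 = (\<i> * of_real k * z1 / 2) * ((\<i> / of_real pi) * (- 2 * bI (al * q) / (of_real k * R)
   + of_real k * R * Y)) / R"
  unfolding hker_def Rfun_def q_def[symmetric] R_def[symmetric] hankel1_eq[OF k(1)] X L Y_def ..
 also have "... = - (z1 * of_real k / (2 * of_real pi)) * ((- 2 * bI (al * q) / (of_real k * R) + of_real k * R * Y) / R)"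
  by (simp add: divide_simps) (simp add: algebra_simps)
 also have "(- 2 * bI (al * q) / (of_real k * R) + of_real k * R * Y) / R = - 2 * bI (al * q) / (of_real k * q) + of_real k * Y"
  unfolding RR[symmetric] using q(2) k(2) by (simp add: field_simps)
 also have "- (z1 * of_real k / (2 * of_real pi)) * (- 2 * bI (al * q) / (of_real k * q) + of_real k * Y) = - 4 * z1 * N1 q"
 proof -
  have "PP q = (- bI (al * q) / 2 - al * q * Y) / (2 * of_real pi)"
   unfolding PP_def Y_def by (simp add: algebra_simps)
  then have "N1 q = (- bI (al * q) / 2 - al * q * Y) / (2 * of_real pi) / q" by (simp add: N1_def)
  then show ?thesis using q(1) k(2) by (simp add: al_def divide_simps power2_eq_square) (simp add: algebra_simps)
 qed
 finally show ?thesis by (simp add: q_def)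
qed

text \<open>A positive imaginary part of the root means a positive real part of
  \<open>- i * k * csqrt q\<close>, where the integral for K_0 converges. Exponential decay of the
  kernels enters here.\<close>

lemma NN_eq_coshK:
 assumes "Re (csqrt q) > 0" "Im (csqrt q) > 0"
 shows "NN q = coshK (- \<i> * of_real k * csqrt q) / (2 * of_real pi)"
  and "PP q = - (- \<i> * of_real k * csqrt q) * coshK1 (- \<i> * of_real k * csqrt q) / (4 * of_real pi)"
proof -
 define R where "R = csqrt q"
 define w where "w = - \<i> * of_real k * R"
 have R: "Re R > 0" "Im R > 0" "R ~= 0" using assms by (auto simp: R_def)
 have RR: "R^2 = q" by (simp add: R_def)
 have q0: "q ~= 0" using R(3) RR by auto
 have wRe: "Re w > 0" using R k_pos by (simp add: w_def)
 then have w0: "w ~= 0" by auto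
 have X: "w^2 / 4 = al * q" by (simp add: w_def al_def power_mult_distrib RR)
 have "Ln (- \<i> * R) = Ln R - \<i> * of_real pi / 2"
 proof (rule Ln_unique)
  show "exp (Ln R - \<i> * of_real pi / 2) = - \<i> * R"
   using R(3) exp_Euler[of "of_real (pi/2)"] by (simp add: exp_diff cos_of_real sin_of_real mult.commute)
  have "0 < Im (Ln R)" "Im (Ln R) < pi" using R Im_Ln_pos_lt_imp[of R] by auto
  then show "- pi < Im (Ln R - \<i> * of_real pi / 2)" "Im (Ln R - \<i> * of_real pi / 2) <= pi"
   using pi_gt_zero by simp_all
 qed
 moreover have "w / 2 = of_real (k/2) * (- \<i> * R)" by (simp add: w_def)
 ultimately have "Ln (w/2) = of_real (ln (k/2)) + (Ln R - \<i> * of_real pi / 2)"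
  using Ln_times_of_real[of "k/2" "- \<i> * R"] Ln_of_real[of "k/2"] k_pos R(3) by simp
 then have L: "Ln (w/2) = Ln q / 2 + cc" using Ln_csqrt[OF q0] by (simp add: R_def cc_def)
 have "NN q = bK w / (2 * of_real pi)" unfolding bK_def NN_def X L by simp
 then show "NN q = coshK (- \<i> * of_real k * csqrt q) / (2 * of_real pi)"
  using coshK_eq_bK[OF wRe] by (simp add: w_def R_def)
 have "PP q = wbK' w / (4 * of_real pi)"
  unfolding wbK'_def PP_def X L by (simp add: field_simps)
 moreover have "wbK' w = - w * coshK1 w" using coshK1_eq_wbK'[OF wRe] w0 by simp
 ultimately show "PP q = - (- \<i> * of_real k * csqrt q) * coshK1 (- \<i> * of_real k * csqrt q) / (4 * of_real pi)"
  unfolding w_def R_def by simp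
qed

lemma abs_ln_le: "x > 0 ==> \<bar>ln x\<bar> <= 8 * x powr (-1/8) + x" for x :: real
proof -
 assume x: "x > 0"
 have "ln x <= x" using ln_le_minus_one[OF x] by simp
 moreover have "ln (x powr (-1/8)) <= x powr (-1/8) - 1" by (rule ln_le_minus_one) (use x in simp)
 then have "- ln x <= 8 * x powr (-1/8)" using x by (simp add: ln_powr)
 moreover have "0 <= 8 * x powr (-1/8)" by simp
 ultimately show ?thesis using x by linarith
qed

lemma norm_Ln_le: "q ~= 0 ==> norm (Ln q) <= 8 * norm q powr (-1/8) + norm q + pi"
proof -
 assume q: "q ~= 0"
 have "norm (Ln q) <= \<bar>Re (Ln q)\<bar> + \<bar>Im (Ln q)\<bar>" by (rule cmod_le)
 moreover have "\<bar>Re (Ln q)\<bar> <= 8 * norm q powr (-1/8) + norm q"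
  using abs_ln_le[of "norm q"] q by simp
 moreover have "\<bar>Im (Ln q)\<bar> <= pi" using Im_Ln_le_pi[OF q] mpi_less_Im_Ln[OF q] by linarith
 ultimately show ?thesis by linarith
qed

lemma bounded_entire:
 assumes "f holomorphic_on UNIV"
 shows "\<exists>B\<ge>0. \<forall>z. norm z <= r --> norm (f z) <= B"
proof -
 have "compact (f ` cball 0 r)"
  using assms by (intro compact_continuous_image holomorphic_on_imp_continuous_on) (auto intro: holomorphic_on_subset)
 then have "bounded (f ` cball 0 r)" by (rule compact_imp_bounded)
 then obtain B where "!!y. y \<in> f ` cball 0 r ==> norm y <= B"
  by (auto simp: bounded_iff)
 then have "\<forall>z. norm z <= r --> norm (f z) <= max B 0" by force
 then show ?thesis by (intro exI[of _ "max B 0"]) auto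
qed

text \<open>The exponent -1/8 absorbs the logarithm at \<open>q = 0\<close>. In terms of the
  distance it is -1/4, which stays integrable together with the endpoint singularities met later.
  \<open>PP\<close> is bounded because \<open>q Ln q\<close> is.\<close>

lemma NN_local_bound:
 assumes M: "M > 0"
 shows "\<exists>C>0. \<forall>q. q ~= 0 & norm q <= M --> norm (NN q) <= C * norm q powr (-1/8) & norm (PP q) <= C"
proof -
 define r where "r = norm al * M"
 obtain B1 where B1: "B1 >= 0" "!!z. norm z <= r ==> norm (bI z) <= B1" using bounded_entire[OF holomorphic_bI] by blast
 obtain B2 where B2: "B2 >= 0" "!!z. norm z <= r ==> norm (bL z) <= B2" using bounded_entire[OF holomorphic_bL] by blast
 obtain B3 where B3: "B3 >= 0" "!!z. norm z <= r ==> norm (bI' z) <= B3" using bounded_entire[OF holomorphic_bI'] by blast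
 obtain B4 where B4: "B4 >= 0" "!!z. norm z <= r ==> norm (bL' z) <= B4" using bounded_entire[OF holomorphic_bL'] by blast
 define m where "m = M powr (1/8)"
 define K where "K = 8 + (M + pi + norm cc) * m"
 have m: "m > 0" "!!x. 0 < x ==> x <= M ==> 1 <= m * x powr (-1/8)"
 proof -
  show "m > 0" using M by (simp add: m_def)
  fix x :: real assume "0 < x" "x <= M"
  then have "x powr (1/8) <= m" unfolding m_def by (intro powr_mono2) auto
  then have "x powr (1/8) * x powr (-1/8) <= m * x powr (-1/8)" by (intro mult_right_mono) auto
  moreover have "x powr (1/8) * x powr (-1/8) = 1" using \<open>0 < x\<close> by (simp add: powr_add[symmetric])
  ultimately show "1 <= m * x powr (-1/8)" by simp
 qed
 have K: "norm (Ln q / 2 + cc) <= K * norm q powr (-1/8)" if q: "q ~= 0" "norm q <= M" for q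
 proof -
  have "norm (Ln q / 2 + cc) <= norm (Ln q / 2) + norm cc" by (rule norm_triangle_ineq)
  also have "norm (Ln q / 2) <= norm (Ln q)" by (simp add: norm_divide)
  also have "norm (Ln q) <= 8 * norm q powr (-1/8) + M + pi" using norm_Ln_le[OF q(1)] q(2) by linarith
  also have "8 * norm q powr (-1/8) + M + pi + norm cc = 8 * norm q powr (-1/8) + (M + pi + norm cc) * 1" by simp
  also have "... <= 8 * norm q powr (-1/8) + (M + pi + norm cc) * (m * norm q powr (-1/8))"
   using m(2)[of "norm q"] q M by (intro add_left_mono mult_left_mono) auto
  finally show ?thesis by (simp add: K_def algebra_simps)
 qed
 have K0: "K >= 0" using M m pi_gt_zero by (simp add: K_def)
 have x78: "x * x powr (-1/8) <= 1 + M" if "0 < x" "x <= M" for x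
 proof (cases "x <= 1")
  case True
  have "x * x powr (-1/8) = x powr (7/8)" using that by (simp add: powr_mult_base)
  also have "... <= 1 powr (7/8)" using that True by (intro powr_mono2) auto
  finally show ?thesis using M by simp
 next
  case False
  then have "x powr (-1/8) <= x powr 0" by (intro powr_mono) auto
  then have "x * x powr (-1/8) <= x * 1" using that False by (intro mult_left_mono) auto
  then show ?thesis using that by linarith
 qed
 define C1 where "C1 = K * B1 + B2 * m"
 define C2 where "C2 = B1 + K * (norm al * B3) * (1 + M) + r * B4"
 have r0: "r >= 0" using M by (simp add: r_def)
 have main: "norm (NN q) <= C1 * norm q powr (-1/8) & norm (PP q) <= C2" if q: "q ~= 0" "norm q <= M" for q
 proof -
  have aq: "norm (al * q) <= r" using q(2) unfolding r_def norm_mult by (intro mult_left_mono) auto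
  define p where "p = norm q powr (-1/8)"
  have p0: "p >= 0" by (simp add: p_def)
  have div: "norm (z / (2 * of_real pi)) <= norm z" for z :: complex
  proof -
   have "norm z / (2 * pi) <= norm z / 1" using pi_gt3 by (intro divide_left_mono) auto
   then show ?thesis by (simp add: norm_divide norm_mult)
  qed
  have "norm (- (Ln q / 2 + cc) * bI (al * q)) <= (K * p) * B1"
   unfolding norm_mult norm_minus_cancel
   using K[OF q] B1(2)[OF aq] K0 p0 by (intro mult_mono) (auto simp: p_def)
  moreover have "norm (bL (al * q)) <= B2 * (m * p)"
   using B2(2)[OF aq] mult_left_mono[OF m(2)[of "norm q"] B2(1)] q by (simp add: p_def)
  ultimately have "norm (- (Ln q / 2 + cc) * bI (al * q) + bL (al * q)) <= (K * p) * B1 + B2 * (m * p)"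
   by (rule norm_triangle_mono)
  then have 1: "norm (NN q) <= C1 * p" unfolding NN_def
   by (intro order_trans[OF div]) (simp add: C1_def algebra_simps)
  have "norm (- bI (al * q) / 2) <= B1" using B1(2)[OF aq] B1(1) by (simp add: norm_divide)
  moreover have "norm ((Ln q / 2 + cc) * (al * q * bI' (al * q))) <= K * (norm al * B3) * (1 + M)"
  proof -
   have "norm ((Ln q / 2 + cc) * (al * q * bI' (al * q))) = norm (Ln q / 2 + cc) * (norm al * norm q * norm (bI' (al * q)))"
    by (simp add: norm_mult)
   also have "... <= (K * p) * (norm al * norm q * B3)"
    using K[OF q] B3(2)[OF aq] B3(1) K0 p0 by (intro mult_mono mult_left_mono) (auto simp: p_def)
   also have "... = K * (norm al * B3) * (norm q * p)" by (simp add: mult_ac)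
   also have "... <= K * (norm al * B3) * (1 + M)"
    using x78[of "norm q"] q K0 B3(1) by (intro mult_left_mono) (auto simp: p_def)
   finally show ?thesis .
  qed
  moreover have "norm (al * q * bL' (al * q)) <= r * B4"
   unfolding norm_mult[of "al * q"] using aq B4(2)[OF aq] r0 by (intro mult_mono) auto
  ultimately have "norm (- bI (al * q) / 2 - (Ln q / 2 + cc) * (al * q * bI' (al * q)) + al * q * bL' (al * q)) <= C2"
   using norm_triangle_ineq[of "- bI (al * q) / 2 - (Ln q / 2 + cc) * (al * q * bI' (al * q))" "al * q * bL' (al * q)"]
    norm_triangle_ineq4[of "- bI (al * q) / 2" "(Ln q / 2 + cc) * (al * q * bI' (al * q))"]
   unfolding C2_def by linarith
  then have 2: "norm (PP q) <= C2" unfolding PP_def by (intro order_trans[OF div])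
  show ?thesis using 1 2 by (simp add: p_def)
 qed
 define C where "C = max C1 C2 + 1"
 have "C1 >= 0" using K0 B1 B2 m by (simp add: C1_def)
 then have "C > 0" by (simp add: C_def)
 moreover have "norm (NN q) <= C * norm q powr (-1/8) & norm (PP q) <= C" if "q ~= 0 & norm q <= M" for q
 proof -
  have "C1 * norm q powr (-1/8) <= C * norm q powr (-1/8)" by (intro mult_right_mono) (auto simp: C_def)
  moreover have "C2 <= C" by (simp add: C_def)
  ultimately show ?thesis using main[of q] that by (meson order_trans)
 qed
 ultimately show ?thesis by blast
qed

text \<open>The strength of the logarithmic pole of the fundamental solution. It yields both the
  unit jump of the flux across a pole and the factor 1/pi of the Poisson kernel near a
  corner.\<close>

lemma PP_tendsto: "(PP \<longlongrightarrow> - 1 / (4 * of_real pi)) (at 0)"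
proof -
 have c: "isCont bI 0" "isCont bI' 0" "isCont bL' 0"
  using DERIV_bI DERIV_isCont holomorphic_bI'[of UNIV] holomorphic_bL'[of UNIV]
  by (auto simp: holomorphic_on_imp_continuous_on continuous_on_eq_continuous_at dest!: holomorphic_on_imp_continuous_on)
 have t: "((%q. al * q) \<longlongrightarrow> 0) (at 0)" by (auto intro!: tendsto_eq_intros)
 have "((%q::complex. norm q * (8 * norm q powr (-1/8) + norm q + pi)) \<longlongrightarrow> 0) (at 0)"
 proof -
  have "((%x::real. x * (8 * x powr (-1/8) + x + pi)) \<longlongrightarrow> 0) (at_right 0)" by real_asymp
  moreover have "filterlim (norm :: complex => real) (at_right 0) (at 0)"
   unfolding filterlim_at by (auto simp: eventually_at_filter intro!: tendsto_eq_intros)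
  ultimately show ?thesis by (rule filterlim_compose)
 qed
 then have "((%q. q * Ln q) \<longlongrightarrow> 0) (at 0)"
 proof (rule Lim_null_comparison[rotated])
  show "\<forall>\<^sub>F q in at 0. norm (q * Ln q) <= norm q * (8 * norm q powr (-1/8) + norm q + pi)"
   unfolding eventually_at_filter norm_mult by (intro always_eventually allI impI mult_left_mono norm_Ln_le) auto
 qed
 then have "((%q. (- bI (al * q) / 2 - (al * (q * Ln q) / 2 + cc * (al * q)) * bI' (al * q) + al * q * bL' (al * q)) / (2 * of_real pi))
   \<longlongrightarrow> (- bI 0 / 2 - (al * 0 / 2 + cc * 0) * bI' 0 + 0 * bL' 0) / (2 * of_real pi)) (at 0)"
  by (intro tendsto_intros t isCont_tendsto_compose[OF c(1) t] isCont_tendsto_compose[OF c(2) t] isCont_tendsto_compose[OF c(3) t]) auto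
 moreover have "(%q. (- bI (al * q) / 2 - (al * (q * Ln q) / 2 + cc * (al * q)) * bI' (al * q) + al * q * bL' (al * q)) / (2 * of_real pi)) = PP"
  by (auto simp: PP_def fun_eq_iff algebra_simps)
 ultimately show ?thesis by simp
qed

lemma cnj_powser:
 assumes "!!m. cnj (c m) = c m" "!!y. summable (%m. c m * y ^ m)"
 shows "cnj (\<Sum>m. c m * of_real x ^ m) = (\<Sum>m. c m * of_real x ^ m)"
proof -
 have "(%m. c m * of_real x ^ m) sums (\<Sum>m. c m * of_real x ^ m)" using assms(2) by (rule summable_sums)
 then have "(%m. cnj (c m * of_real x ^ m)) sums cnj (\<Sum>m. c m * of_real x ^ m)" by (simp only: sums_cnj)
 then show ?thesis using assms by (simp add: sums_iff)
qed

text \<open>At a real distance the series are real, so only the imaginary part of \<open>cc\<close>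
  survives: the imaginary part of the fundamental solution is J_0(k r) / 4, which is regular at the
  origin.\<close>

lemma NN_minus_cnj:
 assumes r: "r > 0"
 shows "NN (of_real (r^2)) - cnj (NN (of_real (r^2))) = (\<i> / 2) * bI (- (of_real (k * r))\<^sup>2 / 4)"
proof -
 have al: "al * of_real (r^2) = of_real (- (k * r)\<^sup>2 / 4)" by (simp add: al_def power_mult_distrib)
 have cL: "cnj (cL m) = cL m" for m
 proof -
  have "Digamma (of_nat m + 1 :: complex) = of_real (harm m - euler_mascheroni)"
   using Digamma_of_nat[of m, where ?'a=complex] by (simp add: add.commute of_real_harm)
  then show ?thesis
   unfolding cL_def by (simp only: complex_cnj_divide complex_cnj_complex_of_real complex_cnj_power complex_cnj_fact)
 qed
 have I: "cnj (bI (al * of_real (r^2))) = bI (al * of_real (r^2))"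
  unfolding al bI_def by (rule cnj_powser[OF _ summable_cI]) (simp add: cI_def)
 have L: "cnj (bL (al * of_real (r^2))) = bL (al * of_real (r^2))"
  unfolding al bL_def by (rule cnj_powser[OF cL summable_cL])
 have ln: "Ln (of_real (r^2)) = of_real (ln (r^2))" using r by (intro Ln_of_real) simp
 have "cnj (NN (of_real (r^2))) = (- (Ln (of_real (r^2)) / 2 + cnj cc) * bI (al * of_real (r^2)) + bL (al * of_real (r^2))) / (2 * of_real pi)"
  unfolding NN_def complex_cnj_divide complex_cnj_add complex_cnj_mult complex_cnj_minus I L ln by simp
 then have "NN (of_real (r^2)) - cnj (NN (of_real (r^2))) = (cnj cc - cc) * bI (al * of_real (r^2)) / (2 * of_real pi)"
 proof -
  have "(- (l / 2 + cc) * A + B) / (2 * of_real pi) - (- (l / 2 + cnj cc) * A + B) / (2 * of_real pi) = (cnj cc - cc) * A / (2 * of_real pi)"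
   for l A B unfolding diff_divide_distrib[symmetric] by (simp add: algebra_simps)
  then show ?thesis using \<open>cnj (NN (of_real (r^2))) = _\<close> unfolding NN_def by simp
 qed
 moreover have "cnj cc - cc = \<i> * of_real pi" by (simp add: cc_def)
 moreover have "al * of_real (r^2) = - (of_real (k * r))\<^sup>2 / 4" by (simp add: al_def power_mult_distrib)
 ultimately show ?thesis by simp
qed

lemma cos_theta: "cos \<theta> > 0" and sin_theta: "sin \<theta> > 0"
 using theta_pos theta_less by (auto intro: cos_gt_zero_pi sin_gt_zero)

lemma Re_om [simp]: "Re om = cos \<theta>" and Im_om [simp]: "Im om = sin \<theta>" and norm_om [simp]: "norm om = 1"
 and om_nz [simp]: "om ~= 0"
 by (auto simp: om_def)

text \<open>All arguments of the kernels lie in \<open>\<plusminus>ZZ\<close>: on the complex-scaled contour, differences of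
  points are real up to size \<open>2a\<close> plus a nonnegative multiple of \<open>e\<^sup>i\<^sup>\<theta>\<close>.\<close>

definition ZZ :: "complex set" where
 "ZZ = {of_real d + rot s | d s. 0 <= d & d <= 2 * a & 0 <= s}"
definition SZ :: "complex set" where "SZ = ZZ \<union> uminus ` ZZ"

lemma ZZ_I: "0 <= d ==> d <= 2 * a ==> 0 <= s ==> of_real d + rot s \<in> ZZ"
 by (auto simp: ZZ_def)

lemma SZ_minus [simp]: "- z \<in> SZ \<longleftrightarrow> z \<in> SZ"
 by (auto simp: SZ_def image_iff) (metis minus_minus)

lemma SZ_om [simp]: "rot s \<in> SZ"
proof (cases "s >= 0")
 case True
 then show ?thesis using ZZ_I[of 0 s] a_pos by (auto simp: SZ_def)
next
 case False
 then have "rot (-s) \<in> ZZ" using ZZ_I[of 0 "-s"] a_pos by auto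
 then have "- (rot (-s)) \<in> SZ" unfolding SZ_def by blast
 moreover have "- (rot (-s)) = rot s" by simp
 ultimately show ?thesis by (simp only:)
qed

lemma SZ_cases:
 assumes "z \<in> SZ"
 obtains d s where "0 <= d" "d <= 2 * a" "0 <= s" "z = of_real d + rot s | z = - (of_real d + rot s)"
 using assms by (auto simp: SZ_def ZZ_def)

text \<open>Up to sign \<open>z\<close> has argument between 0 and \<open>\<theta>\<close>, so
  \<open>z^2 * cnj om\<close> has argument between \<open>- \<theta>\<close> and
  \<open>\<theta>\<close>, and two such squares cannot cancel. The second part measures
  \<open>z\<close> by its scaled component \<open>s\<close>, which produces imaginary part and
  thereby decay.\<close>

lemma SZ_sq:
 assumes "z \<in> SZ"
 shows "Re (z^2 * cnj om) >= cos \<theta> * (norm z)^2"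
  and "\<exists>s\<ge>0. norm z <= 2 * a + s & s * sin \<theta> <= norm z & Im (z^2) >= 2 * cos \<theta> * sin \<theta> * s^2"
proof -
 obtain d s where ds: "0 <= d" "d <= 2 * a" "0 <= s" "z = of_real d + rot s | z = - (of_real d + rot s)"
  using assms by (rule SZ_cases)
 define y where "y = complex_of_real d + rot s"
 have zy: "z^2 = y^2" "norm z = norm y" using ds(4) by (auto simp: y_def power2_eq_square norm_minus_commute simp del: minus_add_distrib)
 have Rey: "Re y = d + s * cos \<theta>" and Imy: "Im y = s * sin \<theta>" by (simp_all add: y_def)
 have ny: "(norm y)^2 = (d + s * cos \<theta>)^2 + (s * sin \<theta>)^2" by (simp add: cmod_power2 Rey Imy)
 have sc: "(sin \<theta>)^2 = 1 - (cos \<theta>)^2" by (simp add: sin_squared_eq)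
 have "Re (y^2 * cnj om) - cos \<theta> * (norm y)^2 = 2 * (sin \<theta>)^2 * s * (d + s * cos \<theta>) - 2 * cos \<theta> * (s * sin \<theta>)^2"
  unfolding ny by (simp add: power2_eq_square Rey Imy algebra_simps)
 also have "... = 2 * (sin \<theta>)^2 * s * d" by (simp add: power2_eq_square algebra_simps)
 also have "... >= 0" using ds by simp
 finally show "Re (z^2 * cnj om) >= cos \<theta> * (norm z)^2" unfolding zy by simp
 show "\<exists>s\<ge>0. norm z <= 2 * a + s & s * sin \<theta> <= norm z & Im (z^2) >= 2 * cos \<theta> * sin \<theta> * s^2"
 proof (intro exI conjI)
  have "norm y <= norm (complex_of_real d) + norm (rot s)" unfolding y_def by (rule norm_triangle_ineq)
  then show "norm z <= 2 * a + s" using ds by (simp add: zy norm_mult)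
  have "\<bar>Im y\<bar> <= norm y" by (rule abs_Im_le_cmod)
  then show "s * sin \<theta> <= norm z" unfolding zy Imy by linarith
  have "Im (y^2) = 2 * (d + s * cos \<theta>) * (s * sin \<theta>)" by (simp add: power2_eq_square Rey Imy)
  moreover have "2 * (s * cos \<theta>) * (s * sin \<theta>) <= 2 * (d + s * cos \<theta>) * (s * sin \<theta>)"
   using ds sin_theta by (intro mult_right_mono) auto
  moreover have "2 * cos \<theta> * sin \<theta> * s^2 = 2 * (s * cos \<theta>) * (s * sin \<theta>)" by (simp add: power2_eq_square)
  ultimately show "Im (z^2) >= 2 * cos \<theta> * sin \<theta> * s^2"
   unfolding zy(1) by linarith
 qed (use ds in auto)
qed

lemma SZ_q:
 assumes "z1 \<in> SZ" "z2 \<in> SZ"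
 defines "q \<equiv> z1\<^sup>2 + z2^2" and "r \<equiv> norm z1 + norm z2"
 shows "cos \<theta> / 2 * r^2 <= norm q" "norm q <= r^2" "r > 0 ==> q \<notin> \<real>\<^sub>\<le>\<^sub>0" "r > 0 ==> Re (csqrt q) > 0"
  "r >= 8 * a ==> Im (csqrt q) >= cos \<theta> * sin \<theta> / 8 * r" "norm (csqrt q) <= r"
proof -
 have "Re (q * cnj om) >= cos \<theta> * (norm z1)^2 + cos \<theta> * (norm z2)^2"
  using SZ_sq(1)[OF assms(1)] SZ_sq(1)[OF assms(2)] by (simp add: q_def distrib_right)
 moreover have "(norm z1)^2 + (norm z2)^2 >= r^2 / 2"
  using sum_squares_bound[of "norm z1" "norm z2"] by (simp add: r_def power2_eq_square algebra_simps)
 then have "cos \<theta> * ((norm z1)^2 + (norm z2)^2) >= cos \<theta> * (r^2 / 2)"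
  using cos_theta by (intro mult_left_mono) auto
 ultimately have re: "Re (q * cnj om) >= cos \<theta> / 2 * r^2" by (simp add: distrib_left)
 also have "Re (q * cnj om) <= norm (q * cnj om)" by (rule complex_Re_le_cmod)
 finally show "cos \<theta> / 2 * r^2 <= norm q" by (simp add: norm_mult)
 have "norm q <= (norm z1)^2 + (norm z2)^2" unfolding q_def by (metis norm_power norm_triangle_ineq)
 also have "... <= r^2" unfolding r_def by (simp add: power2_sum)
 finally show nq: "norm q <= r^2" .
 have r0: "r >= 0" by (simp add: r_def)
 show nR: "norm (csqrt q) <= r"
 proof (rule power2_le_imp_le)
  show "(norm (csqrt q))^2 <= r^2" using nq by (metis norm_power power2_csqrt)
 qed (rule r0)
 show nn: "q \<notin> \<real>\<^sub>\<le>\<^sub>0" if "r > 0"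
 proof
  assume "q \<in> \<real>\<^sub>\<le>\<^sub>0"
  then have "Re q <= 0" "Im q = 0" by (auto simp: complex_nonpos_Reals_iff)
  then have "Re (q * cnj om) <= 0" using cos_theta by (simp add: mult_nonpos_nonneg)
  moreover have "cos \<theta> / 2 * r^2 > 0" using cos_theta that by simp
  ultimately show False using re by linarith
 qed
 show reR: "Re (csqrt q) > 0" if "r > 0"
 proof (rule ccontr)
  assume "\<not> Re (csqrt q) > 0"
  then have R0: "Re (csqrt q) = 0" using csqrt_principal[of q] by auto
  have "x^2 \<in> \<real>\<^sub>\<le>\<^sub>0" if "Re x = 0" for x
   using that by (simp add: complex_nonpos_Reals_iff power2_eq_square)
  from this[OF R0] show False using nn[OF that] by simp
 qed
 assume r: "r >= 8 * a"
 then have rpos: "r > 0" using a_pos by linarith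
 obtain s1 s2 where s: "0 <= s1" "norm z1 <= 2 * a + s1" "Im (z1^2) >= 2 * cos \<theta> * sin \<theta> * s1^2"
   "0 <= s2" "norm z2 <= 2 * a + s2" "Im (z2^2) >= 2 * cos \<theta> * sin \<theta> * s2^2"
  using SZ_sq(2)[OF assms(1)] SZ_sq(2)[OF assms(2)] by blast
 define \<sigma> where "\<sigma> = s1 + s2"
 have cs: "cos \<theta> * sin \<theta> > 0" using cos_theta sin_theta by simp
 have \<sigma>: "r <= 4 * a + \<sigma>" "\<sigma> >= r / 2" using s r by (auto simp: r_def \<sigma>_def)
 have "\<sigma>^2 <= 2 * (s1^2 + s2^2)"
  using sum_squares_bound[of s1 s2] by (simp add: \<sigma>_def power2_eq_square algebra_simps)
 then have "cos \<theta> * sin \<theta> * \<sigma>^2 <= cos \<theta> * sin \<theta> * (2 * (s1^2 + s2^2))" using cs by (intro mult_left_mono) auto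
 also have "... <= Im q" using s by (simp add: q_def algebra_simps)
 finally have Imq: "cos \<theta> * sin \<theta> * \<sigma>^2 <= Im q" .
 have "(r/2)^2 <= \<sigma>^2" using \<sigma>(2) r0 by (intro power_mono) auto
 then have "cos \<theta> * sin \<theta> * (r/2)^2 <= cos \<theta> * sin \<theta> * \<sigma>^2" using cs by (intro mult_left_mono) auto
 then have Imq': "cos \<theta> * sin \<theta> * (r/2)^2 <= Im q" using Imq by linarith
 have "Im q = 2 * Re (csqrt q) * Im (csqrt q)"
 proof -
  have "Im (x^2) = 2 * Re x * Im x" for x by (simp add: power2_eq_square)
  from this[of "csqrt q"] show ?thesis by (simp only: power2_csqrt)
 qed
 then have Imq2: "cos \<theta> * sin \<theta> * (r/2)^2 <= 2 * Re (csqrt q) * Im (csqrt q)" using Imq' by linarith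
 have I0: "Im (csqrt q) > 0"
 proof (rule ccontr)
  assume "\<not> Im (csqrt q) > 0"
  then have "2 * Re (csqrt q) * Im (csqrt q) <= 0" using reR[OF rpos] by (simp add: mult_nonneg_nonpos)
  moreover have "cos \<theta> * sin \<theta> * (r/2)^2 > 0" using cs rpos by simp
  ultimately show False using Imq2 by linarith
 qed
 have "Re (csqrt q) <= r" using complex_Re_le_cmod[of "csqrt q"] nR by linarith
 then have "2 * Re (csqrt q) * Im (csqrt q) <= 2 * r * Im (csqrt q)" using I0 by (intro mult_right_mono) auto
 then have "r * (cos \<theta> * sin \<theta> / 8 * r) <= r * Im (csqrt q)" using Imq2 by (simp add: power2_eq_square algebra_simps)
 then show "Im (csqrt q) >= cos \<theta> * sin \<theta> / 8 * r" using rpos by (simp add: mult_le_cancel_left)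
qed

lemma NN_decay_bound:
 "\<exists>C \<mu>. C > 0 & \<mu> > 0 & (\<forall>z1\<in>SZ. \<forall>z2\<in>SZ. norm z1 + norm z2 > 0 -->
   norm (NN (z1^2 + z2^2)) <= C * (norm z1 + norm z2) powr (-1/4) * exp (- \<mu> * (norm z1 + norm z2)) &
   norm (PP (z1^2 + z2^2)) <= C * exp (- \<mu> * (norm z1 + norm z2)))"
proof -
 define M0 where "M0 = max (8 * a) 1"
 \<comment> \<open>For large \<open>r\<close> the argument \<open>w\<close> of K_0 satisfies
   \<open>Re w >= 2 * \<mu> * r\<close>. Half of this rate is kept as decay, the other half absorbs
   factors that grow like powers of \<open>r\<close>.\<close>
 define \<mu> where "\<mu> = k * cos \<theta> * sin \<theta> / 16"
 have cs: "cos \<theta> > 0" "sin \<theta> > 0" using cos_theta sin_theta by auto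
 have \<mu>: "\<mu> > 0" using cs k_pos by (simp add: \<mu>_def)
 have M0: "M0 >= 1" "M0 >= 8 * a" by (auto simp: M0_def)
 obtain C0 where C0: "C0 > 0" "!!q. q ~= 0 ==> norm q <= M0^2 ==> norm (NN q) <= C0 * norm q powr (-1/8) & norm (PP q) <= C0"
  using NN_local_bound[of "M0^2"] M0 by auto
 obtain C1 where C1: "C1 > 0" "!!w. Re w >= 2 * \<mu> * M0 ==> norm (coshK w) <= C1 * exp (- Re w) & norm (coshK1 w) <= C1 * exp (- Re w)"
  using norm_coshK_le[of "2 * \<mu> * M0"] \<mu> M0 by auto
 define A where "A = (cos \<theta> / 2) powr (-1/8) * C0 * exp (\<mu> * M0)"
 define B where "B = (1 + k) * C1 / \<mu>"
 define C where "C = A + C0 * exp (\<mu> * M0) + B"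
 have pos: "A > 0" "B > 0" using C0 C1 \<mu> cs k_pos by (auto simp: A_def B_def)
 have C: "C > 0" "A <= C" "C0 * exp (\<mu> * M0) <= C" "B <= C" using pos C0 by (auto simp: C_def add_pos_pos)
 have main: "norm (NN (z1^2 + z2^2)) <= C * (norm z1 + norm z2) powr (-1/4) * exp (- \<mu> * (norm z1 + norm z2)) &
   norm (PP (z1^2 + z2^2)) <= C * exp (- \<mu> * (norm z1 + norm z2))"
  if z: "z1 \<in> SZ" "z2 \<in> SZ" and rp: "norm z1 + norm z2 > 0" for z1 z2
 proof -
  define r where "r = norm z1 + norm z2"
  define q where "q = z1^2 + z2^2"
  have r: "r > 0" using rp by (simp add: r_def)
  note Q = SZ_q[OF z, folded q_def r_def]
  have q0: "q ~= 0" using Q(3)[OF r] by auto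
  have "norm (NN q) <= C * r powr (-1/4) * exp (- \<mu> * r) & norm (PP q) <= C * exp (- \<mu> * r)"
  proof (cases "r <= M0")
   case True
   have "norm q <= M0^2" using Q(2) power_mono[OF True, of 2] r by simp
   note b = C0(2)[OF q0 this]
   have e: "1 <= exp (\<mu> * M0) * exp (- \<mu> * r)"
    using True \<mu> by (simp add: exp_add[symmetric] algebra_simps)
   have "norm q powr (-1/8) <= (cos \<theta> / 2 * r^2) powr (-1/8)"
    using Q(1) r cs by (intro powr_mono2') auto
   also have "... = (cos \<theta> / 2) powr (-1/8) * r powr (-1/4)"
   proof -
    have "r^2 = r powr 2" using r by (simp add: powr_numeral)
    moreover have "(r powr 2) powr (-1/8) = r powr (-1/4)" by (simp add: powr_powr)
    ultimately have "(r^2) powr (-1/8) = r powr (-1/4)" by (simp only:)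
    moreover have "(cos \<theta> / 2 * r^2) powr (-1/8) = (cos \<theta> / 2) powr (-1/8) * (r^2) powr (-1/8)"
     by (rule powr_mult)
    ultimately show ?thesis by (simp only:)
   qed
   finally have "C0 * norm q powr (-1/8) <= C0 * ((cos \<theta> / 2) powr (-1/8) * r powr (-1/4))" using C0 by (intro mult_left_mono) auto
   also have "... <= (C0 * ((cos \<theta> / 2) powr (-1/8) * r powr (-1/4))) * (exp (\<mu> * M0) * exp (- \<mu> * r))"
    using mult_left_mono[OF e, of "C0 * ((cos \<theta> / 2) powr (-1/8) * r powr (-1/4))"] C0 by simp
   also have "... = A * r powr (-1/4) * exp (- \<mu> * r)" by (simp add: A_def)
   also have "... <= C * r powr (-1/4) * exp (- \<mu> * r)" using C by (intro mult_right_mono) auto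
   finally have 1: "norm (NN q) <= C * r powr (-1/4) * exp (- \<mu> * r)" using b by linarith
   have "C0 <= C0 * (exp (\<mu> * M0) * exp (- \<mu> * r))" using mult_left_mono[OF e, of C0] C0 by simp
   also have "... <= C * exp (- \<mu> * r)" unfolding mult.assoc[symmetric] using C by (intro mult_right_mono) auto
   finally show ?thesis using 1 b by linarith
  next
   case False
   then have rM: "r >= 8 * a" "r >= 1" "r >= M0" using M0 by auto
   define w where "w = - \<i> * of_real k * csqrt q"
   have "k * (cos \<theta> * sin \<theta> / 8 * r) <= k * Im (csqrt q)" using Q(5)[OF rM(1)] k_pos by (intro mult_left_mono) auto
   then have wr: "Re w >= 2 * \<mu> * r" by (simp add: w_def \<mu>_def algebra_simps)
   moreover have "2 * \<mu> * M0 <= 2 * \<mu> * r" using rM \<mu> by simp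
   ultimately have wM: "Re w >= 2 * \<mu> * M0" by linarith
   have "cos \<theta> * sin \<theta> / 8 * r > 0" using cs r by simp
   then have Im0: "Im (csqrt q) > 0" using Q(5)[OF rM(1)] by linarith
   note eq = NN_eq_coshK[OF Q(4)[OF r] Im0, folded w_def]
   have "norm w <= k * r" using Q(6) k_pos by (simp add: w_def norm_mult)
   have e: "C1 * exp (- Re w) <= C1 * exp (- (2 * \<mu> * r))" using wr C1 by simp
   have re: "r * exp (- (2 * \<mu> * r)) <= 1 / \<mu> * exp (- \<mu> * r)"
   proof -
    have "\<mu> * r <= exp (\<mu> * r)" using exp_ge_add_one_self[of "\<mu> * r"] by linarith
    then have "r <= 1 / \<mu> * exp (\<mu> * r)" using \<mu> by (simp add: field_simps)
    then have "r * exp (- (2 * \<mu> * r)) <= 1 / \<mu> * exp (\<mu> * r) * exp (- (2 * \<mu> * r))" by (intro mult_right_mono) auto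
    then show ?thesis by (simp add: mult.assoc exp_add[symmetric])
   qed
   have rq: "1 <= r * r powr (-1/4)"
   proof -
    have "r * r powr (-1/4) = r powr (3/4)" using r by (simp add: powr_mult_base)
    also have "... >= 1" using rM by (intro ge_one_powr_ge_zero) auto
    finally show ?thesis .
   qed
   have "norm (NN q) <= norm (coshK w)"
   proof -
    have "norm (coshK w) / (2 * pi) <= norm (coshK w) / 1" using pi_gt3 by (intro divide_left_mono) auto
    then show ?thesis by (simp add: eq(1) norm_divide norm_mult)
   qed
   also have "... <= C1 * exp (- (2 * \<mu> * r)) * 1" using C1(2)[OF wM] e by linarith
   also have "... <= C1 * exp (- (2 * \<mu> * r)) * (r * r powr (-1/4))" using rq C1 by (intro mult_left_mono) auto
   also have "... = C1 * r powr (-1/4) * (r * exp (- (2 * \<mu> * r)))" by (simp add: mult_ac)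
   also have "... <= C1 * r powr (-1/4) * (1 / \<mu> * exp (- \<mu> * r))" using re C1 by (intro mult_left_mono) auto
   also have "... = (C1 / \<mu>) * (r powr (-1/4) * exp (- \<mu> * r))" by simp
   also have "... <= C * (r powr (-1/4) * exp (- \<mu> * r))"
   proof (rule mult_right_mono)
    have "C1 / \<mu> <= B" using C1 k_pos \<mu> by (simp add: B_def field_simps)
    then show "C1 / \<mu> <= C" using C by linarith
   qed auto
   finally have 1: "norm (NN q) <= C * r powr (-1/4) * exp (- \<mu> * r)" by (simp add: mult.assoc)
   have "norm (PP q) <= norm w * norm (coshK1 w)"
   proof -
    have "norm w * norm (coshK1 w) / (4 * pi) <= norm w * norm (coshK1 w) / 1" using pi_gt3 by (intro divide_left_mono) auto
    then show ?thesis by (simp add: eq(2) norm_divide norm_mult)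
   qed
   also have "... <= (k * r) * (C1 * exp (- (2 * \<mu> * r)))"
    using C1(2)[OF wM] e \<open>norm w <= k * r\<close> k_pos r by (intro mult_mono) auto
   also have "... = k * C1 * (r * exp (- (2 * \<mu> * r)))" by (simp add: mult_ac)
   also have "... <= k * C1 * (1 / \<mu> * exp (- \<mu> * r))" using re C1 k_pos by (intro mult_left_mono) auto
   also have "... = (k * C1 / \<mu>) * exp (- \<mu> * r)" by simp
   also have "... <= C * exp (- \<mu> * r)"
   proof (rule mult_right_mono)
    have "k * C1 / \<mu> <= B" using C1 k_pos \<mu> by (simp add: B_def field_simps)
    then show "k * C1 / \<mu> <= C" using C by linarith
   qed auto
   finally show ?thesis using 1 by blast
  qed
  then show ?thesis by (simp only: q_def r_def)
 qed
 show ?thesis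
  by (intro exI[of _ C] exI[of _ \<mu>] conjI[OF C(1)] conjI[OF \<mu>] ballI impI main)
qed

text \<open>Digits in the names stand for partial derivatives in the first and the second argument,
  and \<open>h\<close> is minus twice \<open>G1\<close>. Writing all of them through
  \<open>NN\<close> and \<open>N1\<close> to \<open>N3\<close> makes the chain rule and the
  Helmholtz equation a matter of algebra.\<close>

definition G :: "complex => complex => complex" where "G z1 z2 = NN (z1^2 + z2^2)"
definition G1 :: "complex => complex => complex" where "G1 z1 z2 = 2 * z1 * N1 (z1^2 + z2^2)"
definition G2 :: "complex => complex => complex" where "G2 z1 z2 = 2 * z2 * N1 (z1^2 + z2^2)"
definition G11 :: "complex => complex => complex" where "G11 z1 z2 = 2 * N1 (z1^2 + z2^2) + 4 * z1^2 * N2 (z1^2 + z2^2)"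
definition G12 :: "complex => complex => complex" where "G12 z1 z2 = 4 * z1 * z2 * N2 (z1^2 + z2^2)"
definition G22 :: "complex => complex => complex" where "G22 z1 z2 = 2 * N1 (z1^2 + z2^2) + 4 * z2^2 * N2 (z1^2 + z2^2)"
definition h :: "complex => complex => complex" where "h z1 z2 = - 4 * z1 * N1 (z1^2 + z2^2)"
definition h1 :: "complex => complex => complex" where "h1 z1 z2 = - 4 * N1 (z1^2 + z2^2) - 8 * z1^2 * N2 (z1^2 + z2^2)"
definition h2 :: "complex => complex => complex" where "h2 z1 z2 = - 8 * z1 * z2 * N2 (z1^2 + z2^2)"
definition h11 :: "complex => complex => complex" where "h11 z1 z2 = - 24 * z1 * N2 (z1^2 + z2^2) - 16 * z1 ^ 3 * N3 (z1^2 + z2^2)"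
definition h12 :: "complex => complex => complex" where "h12 z1 z2 = - 8 * z2 * N2 (z1^2 + z2^2) - 16 * z1^2 * z2 * N3 (z1^2 + z2^2)"
definition h22 :: "complex => complex => complex" where "h22 z1 z2 = - 8 * z1 * N2 (z1^2 + z2^2) - 16 * z1 * z2^2 * N3 (z1^2 + z2^2)"

lemma hker_eq_h: "z1^2 + z2^2 ~= 0 ==> hker k z1 z2 = h z1 z2"
 by (simp add: hker_eq h_def)

text \<open>Three strengths are kept: an integrable bound for \<open>G\<close>, a bound for
  \<open>h\<close> whose factor \<open>norm z1\<close> makes it an approximate identity, and the
  inverse square for everything that enters a flux. The sector estimate \<open>SZ_q\<close> converts
  powers of \<open>q\<close> in denominators into powers of the distance.\<close>

lemma kernel_bounds:
 obtains C \<mu> where "C > 0" "\<mu> > 0"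
  "!!z1 z2. z1 \<in> SZ ==> z2 \<in> SZ ==> norm z1 + norm z2 > 0 ==>
    norm (G z1 z2) <= C * (norm z1 + norm z2) powr (-1/4) * exp (- \<mu> * (norm z1 + norm z2)) &
    norm (h z1 z2) <= C * norm z1 / (norm z1 + norm z2)^2 * exp (- \<mu> * (norm z1 + norm z2))"
  "!!K z1 z2. K \<in> {G, G1, G2, h, h1, h2} ==> z1 \<in> SZ ==> z2 \<in> SZ ==> norm z1 + norm z2 > 0 ==>
    norm (K z1 z2) <= C / (norm z1 + norm z2)^2 * exp (- \<mu> * (norm z1 + norm z2))"
proof -
 obtain C \<mu> where C: "C > 0" and \<mu>: "\<mu> > 0" and b: "!!z1 z2. z1 \<in> SZ ==> z2 \<in> SZ ==> norm z1 + norm z2 > 0 ==>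
   norm (NN (z1^2 + z2^2)) <= C * (norm z1 + norm z2) powr (-1/4) * exp (- \<mu> * (norm z1 + norm z2)) &
   norm (PP (z1^2 + z2^2)) <= C * exp (- \<mu> * (norm z1 + norm z2))"
  using NN_decay_bound by blast
 define \<nu> where "\<nu> = \<mu> / 2"
 define c where "c = cos \<theta> / 2"
 have c: "c > 0" using cos_theta by (simp add: c_def)
 define D where "D = (2 / \<nu>) ^ 2 + 1"
 define E1 where "E1 = C / c"
 define E2 where "E2 = (norm al * C * D + E1) / c"
 define L where "L = C * D + C + 4 * E1 + 4 * (E1 / \<nu>) + 8 * E2"
 have E: "E1 > 0" "E2 > 0" "\<nu> > 0" "D > 0" using C c \<mu> by (auto simp: E1_def E2_def \<nu>_def D_def intro!: add_nonneg_pos divide_pos_pos)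
 then have "0 < C * D" "0 < E1 / \<nu>" using C by auto
 then have L: "L > 0" "C <= L" "C * D <= L" "4 * E1 <= L" "4 * (E1 / \<nu>) <= L" "4 * E1 + 8 * E2 <= L" using C E unfolding L_def by linarith+
 have main: "(norm (G z1 z2) <= L * (norm z1 + norm z2) powr (-1/4) * exp (- \<nu> * (norm z1 + norm z2)) &
    norm (h z1 z2) <= L * norm z1 / (norm z1 + norm z2)^2 * exp (- \<nu> * (norm z1 + norm z2))) &
   (\<forall>K\<in>{G, G1, G2, h, h1, h2}. norm (K z1 z2) <= L / (norm z1 + norm z2)^2 * exp (- \<nu> * (norm z1 + norm z2)))"
  if z: "z1 \<in> SZ" "z2 \<in> SZ" and rp: "norm z1 + norm z2 > 0" for z1 z2
 proof -
  define r where "r = norm z1 + norm z2"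
  define q where "q = z1^2 + z2^2"
  define e where "e = exp (- \<nu> * r)"
  have r: "r > 0" using rp by (simp add: r_def)
  have ee: "exp (- \<mu> * r) = e * e" by (simp add: e_def \<nu>_def exp_add[symmetric])
  have e: "0 < e" "e <= 1" using r E by (simp_all add: e_def)
  have bN: "norm (NN q) <= C * r powr (-1/4) * (e * e)" "norm (PP q) <= C * (e * e)"
   using b[OF z rp] unfolding r_def[symmetric] q_def[symmetric] ee by auto
  have qc: "c * r^2 <= norm q" "c * r^2 > 0" using SZ_q(1)[OF z, folded q_def r_def] r c by (auto simp: c_def)
  have n1: "norm (N1 q) <= E1 / r^2 * (e * e)"
  proof -
   have "norm (N1 q) <= C * (e * e) / (c * r^2)" unfolding N1_def norm_divide using bN(2) qc C e by (intro frac_le) auto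
   then show ?thesis by (simp add: E1_def)
  qed
  have pw: "r powr (-1/4) * e <= D / r^2"
  proof -
   have "r powr (-1/4) <= 1 / r^2 + 1"
   proof (cases "r <= 1")
    case True
    then show ?thesis using r powr_mono'[of "-2" "-1/4" r] by (simp add: powr_minus_divide powr_numeral)
   next
    case False
    then show ?thesis using powr_mono[of "-1/4" 0 r] zero_le_divide_1_iff[of "r^2"] by (simp add: add_increasing)
   qed
   then have "r powr (-1/4) * e <= (1 / r^2 + 1) * e" using e by (intro mult_right_mono) auto
   also have "... = 1 / r^2 * e + r^2 * e / r^2" using r by (simp add: field_simps)
   also have "... <= 1 / r^2 * 1 + (2 / \<nu>) ^ 2 / r^2"
    using power_mult_exp_le[of \<nu> r 1] E r e
    by (intro add_mono mult_left_mono divide_right_mono) (auto simp: e_def power2_eq_square)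
   also have "... = D / r^2" by (simp add: D_def add_divide_distrib)
   finally show ?thesis .
  qed
  have n1': "norm (N1 q) <= E1 / r^2 * e"
   by (rule order.trans[OF n1]) (use E e in \<open>simp add: mult_left_le_one_le divide_right_mono\<close>)
  have n2: "norm u * norm v * norm (N2 q) <= E2 / r^2 * e" if "norm u <= r" "norm v <= r" for u v :: complex
  proof -
   have "norm (al * NN q - N1 q) <= norm al * (C * r powr (-1/4) * (e * e)) + E1 / r^2 * e"
    by (rule order.trans[OF norm_triangle_ineq4], unfold norm_mult) (intro add_mono mult_left_mono bN n1', simp)
   also have "... = norm al * C * (r powr (-1/4) * e) * e + E1 / r^2 * e" by (simp add: mult_ac)
   also have "... <= norm al * C * (D / r^2) * e + E1 / r^2 * e"
    using pw C e by (intro add_mono mult_right_mono mult_left_mono) auto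
   also have "... = (norm al * C * D + E1) / r^2 * e" by (simp add: algebra_simps add_divide_distrib)
   finally have "norm (N2 q) <= ((norm al * C * D + E1) / r^2 * e) / (c * r^2)"
    unfolding N2_def norm_divide using qc C c e E by (intro frac_le) auto
   then have "norm u * norm v * norm (N2 q) <= r * r * (((norm al * C * D + E1) / r^2 * e) / (c * r^2))" using that r by (intro mult_mono) auto
   also have "... = E2 / r^2 * e" using r by (simp add: E2_def power2_eq_square)
   finally show ?thesis .
  qed
  have zr: "norm z1 <= r" "norm z2 <= r" by (auto simp: r_def)
  have k1: "norm z * norm (N1 q) <= E1 / \<nu> / r^2 * e" if "norm z <= r" for z :: complex
  proof -
   have "norm z * norm (N1 q) <= r * (E1 / r^2 * (e * e))" using that n1 r by (intro mult_mono) auto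
   also have "... = E1 / r^2 * (r * e) * e" by simp
   also have "... <= E1 / r^2 * (1 / \<nu>) * e"
    using power_mult_exp_le[of \<nu> r 0] E r e by (intro mult_right_mono mult_left_mono) (auto simp: e_def)
   finally show ?thesis by (simp add: mult.commute)
  qed
  have w: "x <= L / r^2 * e" if "x <= M / r^2 * e" "M <= L" for x M
   by (rule order.trans[OF that(1)]) (use that(2) e in \<open>intro mult_right_mono divide_right_mono, auto\<close>)
  have "norm (G z1 z2) <= C * r powr (-1/4) * e * e" using bN(1) by (simp add: G_def q_def[symmetric] mult_ac)
  also have "... <= C * (D / r^2) * e" using mult_left_mono[OF pw, of C] C e by (intro mult_right_mono) (auto simp: mult.assoc)
  finally have Gb: "norm (G z1 z2) <= C * D / r^2 * e" by simp
  have Gc: "norm (G z1 z2) <= L * r powr (-1/4) * e"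
  proof -
   have "C * r powr (-1/4) * (e * e) <= L * r powr (-1/4) * (e * 1)" using C L e by (intro mult_mono mult_left_mono mult_right_mono) auto
   then show ?thesis using bN(1) by (simp add: G_def q_def[symmetric])
  qed
  have hn: "norm (h z1 z2) = 4 * (norm z1 * norm (N1 q))" by (simp add: h_def q_def norm_mult)
  have hc: "norm (h z1 z2) <= L * norm z1 / r^2 * e"
  proof -
   have "4 * (norm z1 * norm (N1 q)) <= 4 * (norm z1 * (E1 / r^2 * e))" using n1' by (intro mult_left_mono) auto
   also have "... = (4 * E1) * (norm z1 / r^2 * e)" by simp
   also have "... <= L * (norm z1 / r^2 * e)" using L e by (intro mult_right_mono) auto
   finally show ?thesis by (simp add: hn)
  qed
  have h1b: "norm (h1 z1 z2) <= (4 * E1 + 8 * E2) / r^2 * e"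
  proof -
   have "norm (h1 z1 z2) <= norm (- 4 * N1 q) + norm (8 * z1^2 * N2 q)"
    unfolding h1_def q_def by (rule norm_triangle_ineq4)
   also have "... = 4 * norm (N1 q) + 8 * (norm z1 * norm z1 * norm (N2 q))" by (simp add: norm_mult power2_eq_square)
   finally show ?thesis using n1' n2[OF zr(1) zr(1)] by (simp add: add_divide_distrib distrib_right)
  qed
  have k4: "2 * (norm z * norm (N1 q)) <= 4 * (E1 / \<nu>) / r^2 * e & 4 * (norm z * norm (N1 q)) <= 4 * (E1 / \<nu>) / r^2 * e" if "norm z <= r" for z :: complex
  proof -
   have "4 * (E1 / \<nu>) / r^2 * e = 4 * (E1 / \<nu> / r^2 * e)" "0 <= norm z * norm (N1 q)" by simp_all
   then show ?thesis using k1[OF that] by linarith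
  qed
  have "norm (G1 z1 z2) = 2 * (norm z1 * norm (N1 q))" "norm (G2 z1 z2) = 2 * (norm z2 * norm (N1 q))" "norm (h2 z1 z2) = 8 * (norm z1 * norm z2 * norm (N2 q))"
   by (simp_all add: G1_def G2_def h2_def q_def norm_mult)
  then have "norm (K z1 z2) <= L / r^2 * e" if "K \<in> {G, G1, G2, h, h1, h2}" for K
   using that w[OF Gb L(3)] w[OF h1b L(6)] w[OF _ L(5)] k4[OF zr(1)] k4[OF zr(2)] hn w[of _ "8 * E2"] n2[OF zr] L(6) E
   by (elim insertE) auto
  then show ?thesis using Gc hc unfolding r_def e_def by blast
 qed
 show thesis by (rule that[OF L(1) E(3)]) (use main in blast)+
qed

end

subsection \<open>Fields and Green's identity\<close>

context hsm begin

lemma continuous_on_N: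
 "continuous_on (- \<real>\<^sub>\<le>\<^sub>0) NN" "continuous_on (- \<real>\<^sub>\<le>\<^sub>0) N1" "continuous_on (- \<real>\<^sub>\<le>\<^sub>0) N2" "continuous_on (- \<real>\<^sub>\<le>\<^sub>0) N3"
proof -
 show 1: "continuous_on (- \<real>\<^sub>\<le>\<^sub>0) NN" "continuous_on (- \<real>\<^sub>\<le>\<^sub>0) N1" "continuous_on (- \<real>\<^sub>\<le>\<^sub>0) N2"
  by (intro continuous_at_imp_continuous_on ballI, rule DERIV_isCont, erule DERIV_NN[OF ComplD] DERIV_N1[OF ComplD] DERIV_N2[OF ComplD])+
 have "continuous_on (- \<real>\<^sub>\<le>\<^sub>0) (%q. (al * N1 q - 2 * N2 q) / q)"
  by (intro continuous_intros 1) auto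
 then show "continuous_on (- \<real>\<^sub>\<le>\<^sub>0) N3" by (simp add: N3_def[abs_def])
qed

lemma continuous_on_kernels:
 fixes f1 f2 :: "'b::topological_space => complex"
 assumes f: "continuous_on A f1" "continuous_on A f2"
  and q: "!!x. x \<in> A ==> (f1 x)^2 + (f2 x)^2 \<notin> \<real>\<^sub>\<le>\<^sub>0"
  and K: "K \<in> {G, G1, G2, h, h1, h2, G11, G12, h11, h12, h22}"
 shows "continuous_on A (%x. K (f1 x) (f2 x))"
proof -
 have N: "continuous_on A (%x. N ((f1 x)^2 + (f2 x)^2))" if "continuous_on (- \<real>\<^sub>\<le>\<^sub>0) N" for N :: "complex => complex"
  by (rule continuous_on_compose2[OF that]) (use q in \<open>auto intro!: continuous_intros f\<close>)
 show ?thesis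
  using K by (auto simp: G_def G1_def G2_def h_def h1_def h2_def G11_def G12_def h11_def h12_def h22_def intro!: continuous_intros f continuous_on_N[THEN N])
qed

lemma kernel_far:
 assumes d: "d > 0"
 obtains B \<mu> where "B > 0" "\<mu> > 0"
  "!!z1 z2 K. z1 \<in> SZ ==> z2 \<in> SZ ==> d <= norm z1 + norm z2 ==> K \<in> {G, G1, G2, h, h1, h2} ==>
    norm (K z1 z2) <= B * exp (- \<mu> * (norm z1 + norm z2))"
proof -
 obtain C \<mu> where C: "C > 0" "\<mu> > 0" and b: "!!K z1 z2. K \<in> {G, G1, G2, h, h1, h2} ==> z1 \<in> SZ ==> z2 \<in> SZ ==> norm z1 + norm z2 > 0 ==>
    norm (K z1 z2) <= C / (norm z1 + norm z2)^2 * exp (- \<mu> * (norm z1 + norm z2))"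
  using kernel_bounds by metis
 show thesis
 proof (rule that[of "C / d^2" \<mu>])
  fix z1 z2 :: complex and K assume z: "z1 \<in> SZ" "z2 \<in> SZ" and r: "d <= norm z1 + norm z2" and K: "K \<in> {G, G1, G2, h, h1, h2}"
  have "d^2 <= (norm z1 + norm z2)^2" using r d by (intro power_mono) auto
  then have "C / (norm z1 + norm z2)^2 * exp (- \<mu> * (norm z1 + norm z2)) <= C / d^2 * exp (- \<mu> * (norm z1 + norm z2))"
   using C d by (intro mult_right_mono divide_left_mono) auto
  then show "norm (K z1 z2) <= C / d^2 * exp (- \<mu> * (norm z1 + norm z2))" using b[OF K z] r d by linarith
 qed (use C d in auto)
qed

text \<open>The components of a field are the function, its first and its second derivatives.\<close>

type_synonym field = "nat => complex => complex => complex"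

abbreviation kG :: field where "kG i \<equiv> [G, G1, G2, G11, G12, G22] ! i"
abbreviation kh :: field where "kh i \<equiv> [h, h1, h2, h11, h12, h22] ! i"
text \<open>\<open>h\<close> with its arguments exchanged, the kernel of a half-plane with
  perpendicular boundary; the derivative slots are exchanged accordingly.\<close>

abbreviation kh' :: field where "kh' i \<equiv> [%z y. h y z, %z y. h2 y z, %z y. h1 y z, %z y. h22 y z, %z y. h12 y z, %z y. h11 y z] ! i"

text \<open>The integrand of Green's second identity for \<open>u\<close> and \<open>g\<close>,
  taken along the normal \<open>(\<beta>, - \<alpha>)\<close> of the complex direction
  \<open>(\<alpha>, \<beta>)\<close>.\<close>

definition flux :: "complex => complex => field => field => complex => complex => complex" where
 "flux \<alpha> \<beta> u g z y = \<beta> * (g 0 z y * u 1 z y - u 0 z y * g 1 z y) - \<alpha> * (g 0 z y * u 2 z y - u 0 z y * g 2 z y)"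

text \<open>Coordinates are relative to one side of the square: \<open>z\<close> is the depth in
  front of it, \<open>y\<close> runs along it. \<open>fG\<close> has its pole at
  \<open>(x1, x2)\<close>, \<open>fS\<close> is the Poisson kernel with source at height
  \<open>w\<close> on the line \<open>z = 0\<close>, and \<open>fR\<close> is the kernel of the
  half-plane bounded by \<open>y = 0\<close>, with source at \<open>z = - \<sigma>\<close>.\<close>

definition fG :: "complex => complex => field" where "fG x1 x2 i z y = kG i (z - x1) (y - x2)"
definition fS :: "complex => field" where "fS w i z y = kh i z (y - w)"
definition fR :: "complex => field" where "fR \<sigma> i z y = kh' i (z + \<sigma>) y"

abbreviation pt :: "(complex => complex => 'z) => complex => complex => complex => real => real => 'z" where
 "pt f \<alpha> \<beta> \<zeta> l s \<equiv> f (rot l + of_real s * \<alpha>) (\<zeta> + of_real s * \<beta>)"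
abbreviation fx :: "complex => complex => complex => field => field => real => real => complex" where
 "fx \<alpha> \<beta> \<zeta> u g l s \<equiv> pt (flux \<alpha> \<beta> u g) \<alpha> \<beta> \<zeta> l s"

text \<open>\<open>fld u \<alpha> \<beta> \<zeta> L S\<close>: the field \<open>u\<close> is a regular and exponentially decaying Helmholtz solution on the
  lines through \<open>(l e\<^sup>i\<^sup>\<theta>, \<zeta>)\<close>, \<open>l \<in> L\<close>, with direction \<open>(\<alpha>, \<beta>)\<close> and parameter in \<open>S\<close>.\<close>

definition fld :: "field => complex => complex => complex => real set => real set => bool" where
 "fld u \<alpha> \<beta> \<zeta> L S \<longleftrightarrow>
  (\<forall>l\<in>L. \<forall>s\<in>S.
   (\<forall>(i, j)\<in>{(0, 1), (1, 3), (2, 4)}. ((%l. pt (u i) \<alpha> \<beta> \<zeta> l s) has_vector_derivative om * pt (u j) \<alpha> \<beta> \<zeta> l s) (at l)) &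
   (\<forall>(i, j, m)\<in>{(0, 1, 2), (2, 4, 5)}. ((%s. pt (u i) \<alpha> \<beta> \<zeta> l s) has_vector_derivative \<alpha> * pt (u j) \<alpha> \<beta> \<zeta> l s + \<beta> * pt (u m) \<alpha> \<beta> \<zeta> l s) (at s)) &
   pt (u 3) \<alpha> \<beta> \<zeta> l s + pt (u 5) \<alpha> \<beta> \<zeta> l s = 4 * al * pt (u 0) \<alpha> \<beta> \<zeta> l s) &
  (\<forall>i<5. continuous_on (L \<times> S) (%x. pt (u i) \<alpha> \<beta> \<zeta> (fst x) (snd x))) &
  (\<exists>B \<mu>. 0 < B & 0 < \<mu> & (\<forall>l\<in>L. \<forall>s\<in>S. \<forall>i<3. norm (pt (u i) \<alpha> \<beta> \<zeta> l s) <= B * exp (- \<mu> * (\<bar>l\<bar> + \<bar>s\<bar>))))"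

lemma fld_cont: "fld u \<alpha> \<beta> \<zeta> L S ==> i < 5 ==> continuous_on (L \<times> S) (%x. pt (u i) \<alpha> \<beta> \<zeta> (fst x) (snd x))"
 unfolding fld_def by blast

lemma nth6: "[v0,v1,v2,v3,v4,v5] ! 0 = v0" "[v0,v1,v2,v3,v4,v5] ! 1 = v1" "[v0,v1,v2,v3,v4,v5] ! 2 = v2"
 "[v0,v1,v2,v3,v4,v5] ! 3 = v3" "[v0,v1,v2,v3,v4,v5] ! 4 = v4" "[v0,v1,v2,v3,v4,v5] ! 5 = v5"
 by simp_all

lemma less_3_cases: "(\<forall>i<3. P i) \<longleftrightarrow> P 0 & P 1 & P (2::nat)" and less_5_cases: "(\<forall>i<5. P i) \<longleftrightarrow> P 0 & P 1 & P (2::nat) & P 3 & P 4"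
 by (auto simp: numeral_eq_Suc less_Suc_eq)

lemma fld_subset: "fld u \<alpha> \<beta> \<zeta> L S ==> L' \<subseteq> L ==> S' \<subseteq> S ==> fld u \<alpha> \<beta> \<zeta> L' S'"
 unfolding fld_def
 apply (elim conjE exE, intro conjI)
  apply (meson subsetD)
  apply (meson Sigma_mono continuous_on_subset)
 apply (meson subsetD)
 done

text \<open>As \<open>4 * al\<close> is \<open>- k^2\<close>, the second claim is the Helmholtz
  equation. It reduces to \<open>q * N2 q = al * NN q - N1 q\<close> and
  \<open>q * N3 q = al * N1 q - 2 * N2 q\<close>.\<close>

lemma kernel_chain:
 fixes c1 c2 :: "real => complex"
 assumes q: "(c1 t)^2 + (c2 t)^2 \<notin> \<real>\<^sub>\<le>\<^sub>0" and c: "(c1 has_vector_derivative d1) (at t)" "(c2 has_vector_derivative d2) (at t)"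
  and k: "K = kG | K = kh"
 shows "(i, j, l) \<in> {(0, 1, 2), (1, 3, 4), (2, 4, 5)} ==>
   ((%t. K i (c1 t) (c2 t)) has_vector_derivative d1 * K j (c1 t) (c2 t) + d2 * K l (c1 t) (c2 t)) (at t)"
  and "K 3 (c1 t) (c2 t) + K 5 (c1 t) (c2 t) = 4 * al * K 0 (c1 t) (c2 t)"
proof -
 have sq: "((%t. (c t)^2) has_vector_derivative 2 * c t * d) (at t)" if "(c has_vector_derivative d) (at t)" for c :: "real => complex" and d
  using has_vector_derivative_mult[OF that that] by (simp add: power2_eq_square algebra_simps)
 have n: "((%t. f ((c1 t)^2 + (c2 t)^2)) has_vector_derivative (2 * c1 t * d1 + 2 * c2 t * d2) * D) (at t)"
  if "(f has_field_derivative D) (at ((c1 t)^2 + (c2 t)^2))" for f D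
  using field_vector_diff_chain_at[OF has_vector_derivative_add[OF sq[OF c(1)] sq[OF c(2)]] that] by (simp add: o_def)
 note vd = n[OF DERIV_NN[OF q]] n[OF DERIV_N1[OF q]] n[OF DERIV_N2[OF q]] sq[OF c(1)] sq[OF c(2)]
  has_vector_derivative_diff has_vector_derivative_mult has_vector_derivative_const c
 show "((%t. K i (c1 t) (c2 t)) has_vector_derivative d1 * K j (c1 t) (c2 t) + d2 * K l (c1 t) (c2 t)) (at t)"
  if "(i, j, l) \<in> {(0, 1, 2), (1, 3, 4), (2, 4, 5)}"
  using k that
  apply (elim insertE emptyE disjE)
  apply (simp_all only: prod.inject)
  apply (elim conjE)+
  apply (simp_all only: nth6 G_def G1_def G2_def G11_def G12_def G22_def h_def h1_def h2_def h11_def h12_def h22_def)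
  by (rule has_vector_derivative_eq_rhs, (rule vd)+, simp add: algebra_simps power2_eq_square power3_eq_cube)+
 define w where "w = (c1 t)^2 + (c2 t)^2"
 have "w ~= 0" using q by (auto simp: w_def)
 then have "w * N2 w = al * NN w - N1 w" "w * N3 w = al * N1 w - 2 * N2 w" by (simp_all add: N2_def N3_def)
 then have a: "((c1 t)^2 + (c2 t)^2) * N2 w = al * NN w - N1 w" "((c1 t)^2 + (c2 t)^2) * N3 w = al * N1 w - 2 * N2 w" by (simp_all only: w_def)
 have "2 * N1 w + 4 * (c1 t)^2 * N2 w + (2 * N1 w + 4 * (c2 t)^2 * N2 w) = 4 * al * NN w"
  "- 24 * c1 t * N2 w - 16 * c1 t ^ 3 * N3 w + (- 8 * c1 t * N2 w - 16 * c1 t * (c2 t)^2 * N3 w) = 4 * al * (- 4 * c1 t * N1 w)"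
  using a by algebra+
 then show "K 3 (c1 t) (c2 t) + K 5 (c1 t) (c2 t) = 4 * al * K 0 (c1 t) (c2 t)"
  using k by (elim disjE; simp only: nth6 G_def G11_def G22_def h_def h11_def h22_def w_def[symmetric])
qed

text \<open>Two lower bounds on the distance are asked for: the constant \<open>d\<close> keeps the
  pole away, and \<open>|l| + |s| - M\<close> turns the decay of the kernel into decay along the
  lines.\<close>

lemma fld_kernel:
 assumes d: "d > 0" and Z: "!!l s. l \<in> L ==> s \<in> S ==>
   (let z1 = \<xi> + rot l + of_real s * \<alpha>; z2 = \<zeta> + of_real s * \<beta>
   in z1 \<in> SZ & z2 \<in> SZ & d <= norm z1 + norm z2 & \<bar>l\<bar> + \<bar>s\<bar> - M <= norm z1 + norm z2)"
  and u: "K = kG | K = kh | K = kh'" "!!i l s. pt (u i) \<alpha> \<beta> \<eta> l s = K i (\<xi> + rot l + of_real s * \<alpha>) (\<zeta> + of_real s * \<beta>)"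
 shows "fld u \<alpha> \<beta> \<eta> L S"
proof -
 define z1 where "z1 = (%l s. \<xi> + rot l + of_real s * \<alpha>)"
 define z2 where "z2 = (%(l::real) (s::real). \<zeta> + of_real s * \<beta>)"
 have Z: "z1 l s \<in> SZ" "z2 l s \<in> SZ" "d <= norm (z1 l s) + norm (z2 l s)" "\<bar>l\<bar> + \<bar>s\<bar> - M <= norm (z1 l s) + norm (z2 l s)"
  if "l \<in> L" "s \<in> S" for l s using Z[OF that] by (auto simp: z1_def z2_def Let_def)
 have q: "(z1 l s)^2 + (z2 l s)^2 \<notin> \<real>\<^sub>\<le>\<^sub>0" "(z2 l s)^2 + (z1 l s)^2 \<notin> \<real>\<^sub>\<le>\<^sub>0" if "l \<in> L" "s \<in> S" for l s
 proof -
  have "0 < norm (z1 l s) + norm (z2 l s)" using Z(3)[OF that] d by linarith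
  then show "(z1 l s)^2 + (z2 l s)^2 \<notin> \<real>\<^sub>\<le>\<^sub>0" by (rule SZ_q(3)[OF Z(1,2)[OF that]])
  then show "(z2 l s)^2 + (z1 l s)^2 \<notin> \<real>\<^sub>\<le>\<^sub>0" by (subst add.commute)
 qed
 have lin: "((%l. c + of_real l * e) has_vector_derivative e) (at l)" for c e :: complex and l
  by (rule has_vector_derivative_real_field) (auto intro!: derivative_eq_intros)
 have zd: "((%l. z1 l s) has_vector_derivative om) (at l)" "((%l. z2 l s) has_vector_derivative 0) (at l)"
  "((%s. z1 l s) has_vector_derivative \<alpha>) (at s)" "((%s. z2 l s) has_vector_derivative \<beta>) (at s)" for l s
  using lin[of "\<xi> + of_real s * \<alpha>" om l] lin[of "\<xi> + rot l" \<alpha> s] lin[of \<zeta> \<beta> s] by (simp_all add: z1_def z2_def algebra_simps)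
 have e: "pt (u i) \<alpha> \<beta> \<eta> l s = K i (z1 l s) (z2 l s)" for i l s unfolding u(2) z1_def z2_def ..
 have chain: "((%l. K i (z1 l s) (z2 l s)) has_vector_derivative om * K j (z1 l s) (z2 l s)) (at l) &
   ((%s. K i (z1 l s) (z2 l s)) has_vector_derivative \<alpha> * K j (z1 l s) (z2 l s) + \<beta> * K m (z1 l s) (z2 l s)) (at s) &
   K 3 (z1 l s) (z2 l s) + K 5 (z1 l s) (z2 l s) = 4 * al * K 0 (z1 l s) (z2 l s)"
  if ls: "l \<in> L" "s \<in> S" and i: "(i, j, m) \<in> {(0, 1, 2), (1, 3, 4), (2, 4, 5)}" for l s i j m
 proof (cases "K = kh'")
  case True
  note x = kernel_chain[where ?c1.0="%l. z2 l s" and ?c2.0="%l. z1 l s" and t=l and K=kh, OF q(2)[OF ls] zd(2,1) disjI2[OF refl]]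
   and y = kernel_chain(1)[where ?c1.0="%s. z2 l s" and ?c2.0="%s. z1 l s" and t=s and K=kh, OF q(2)[OF ls] zd(4,3) disjI2[OF refl]]
  note xy = x(1)[of 0 1 2, simplified] x(1)[of 1 3 4, simplified] x(1)[of 2 4 5, simplified] y[of 0 1 2, simplified] y[of 1 3 4, simplified] y[of 2 4 5, simplified]
  show ?thesis using i xy x(2) unfolding True by (auto simp: add.commute)
 next
  case False
  then have k: "K = kG | K = kh" using u(1) by blast
  show ?thesis
   using kernel_chain(1)[where ?c1.0="%l. z1 l s" and ?c2.0="%l. z2 l s" and t=l, OF q(1)[OF ls] zd(1,2) k i]
    kernel_chain[where ?c1.0="%s. z1 l s" and ?c2.0="%s. z2 l s" and t=s, OF q(1)[OF ls] zd(3,4) k] i by simp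
 qed
 have cz: "continuous_on (L \<times> S) (%x. z1 (fst x) (snd x))" "continuous_on (L \<times> S) (%x. z2 (fst x) (snd x))"
  unfolding z1_def z2_def by (intro continuous_intros)+
 have c: "continuous_on (L \<times> S) (%x. F (z1 (fst x) (snd x)) (z2 (fst x) (snd x)))" "continuous_on (L \<times> S) (%x. F (z2 (fst x) (snd x)) (z1 (fst x) (snd x)))"
  if "F \<in> {G, G1, G2, h, h1, h2, G11, G12, h11, h12, h22}" for F
  by (rule continuous_on_kernels[OF cz _ that] continuous_on_kernels[OF cz(2,1) _ that], use q in auto)+
 have cont: "\<forall>i<5. continuous_on (L \<times> S) (%x. K i (z1 (fst x) (snd x)) (z2 (fst x) (snd x)))"
 proof (cases "K = kh'")
  case True
  show ?thesis unfolding less_5_cases True nth6 by (intro conjI c(2)) auto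
 next
  case False
  then show ?thesis unfolding less_5_cases using u(1) by (elim disjE; simp only: nth6; intro conjI c(1); simp)
 qed
 obtain B \<mu> where B: "B > 0" "\<mu> > 0" "!!z1 z2 F. z1 \<in> SZ ==> z2 \<in> SZ ==> d <= norm z1 + norm z2 ==> F \<in> {G, G1, G2, h, h1, h2} ==>
    norm (F z1 z2) <= B * exp (- \<mu> * (norm z1 + norm z2))" using kernel_far[OF d] by blast
 have bd: "\<forall>i<3. norm (K i (z1 l s) (z2 l s)) <= B * exp (\<mu> * M) * exp (- \<mu> * (\<bar>l\<bar> + \<bar>s\<bar>))" if ls: "l \<in> L" "s \<in> S" for l s
 proof -
  have "\<mu> * (\<bar>l\<bar> + \<bar>s\<bar> - M) <= \<mu> * (norm (z1 l s) + norm (z2 l s))"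
   using B(2) Z(4)[OF ls] by (intro mult_left_mono) auto
  then have "B * exp (- \<mu> * (norm (z1 l s) + norm (z2 l s))) <= B * exp (\<mu> * M + - \<mu> * (\<bar>l\<bar> + \<bar>s\<bar>))"
   using B(1) by (intro mult_left_mono) (auto simp: algebra_simps)
  then have w: "x <= B * exp (\<mu> * M) * exp (- \<mu> * (\<bar>l\<bar> + \<bar>s\<bar>))" if "x <= B * exp (- \<mu> * (norm (z1 l s) + norm (z2 l s)))" for x
   using that unfolding exp_add by (simp add: mult.assoc)
  note b = w[OF B(3)[OF Z(1-3)[OF ls]]] w[OF B(3)[OF Z(2,1)[OF ls], unfolded add.commute[of "norm (z2 l s)"], OF Z(3)[OF ls]]]
  show ?thesis
  proof (cases "K = kh'")
   case True
   show ?thesis unfolding less_3_cases True nth6 by (intro conjI b(2)) auto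
  next
   case False
   then show ?thesis unfolding less_3_cases using u(1) by (elim disjE; simp only: nth6; intro conjI b(1); simp)
  qed
 qed
 show ?thesis
  unfolding fld_def e
 proof (intro conjI cont ballI)
  show "\<exists>C \<mu>. 0 < C & 0 < \<mu> & (\<forall>l\<in>L. \<forall>s\<in>S. \<forall>i<3. norm (K i (z1 l s) (z2 l s)) <= C * exp (- \<mu> * (\<bar>l\<bar> + \<bar>s\<bar>)))"
   using bd B by (intro exI[of _ "B * exp (\<mu> * M)"] exI[of _ \<mu>]) auto
  fix l s assume ls: "l \<in> L" "s \<in> S"
  note ch = chain[OF ls, of 0 1 2] chain[OF ls, of 1 3 4] chain[OF ls, of 2 4 5]
  show "K 3 (z1 l s) (z2 l s) + K 5 (z1 l s) (z2 l s) = 4 * al * K 0 (z1 l s) (z2 l s)" using ch(1) by blast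
  show "case x of (i, j) => ((%l. K i (z1 l s) (z2 l s)) has_vector_derivative om * K j (z1 l s) (z2 l s)) (at l)"
   if "x \<in> {(0, 1), (1, 3), (2, 4)}" for x using that ch by auto
  show "case x of (i, j, m) => ((%s. K i (z1 l s) (z2 l s)) has_vector_derivative \<alpha> * K j (z1 l s) (z2 l s) + \<beta> * K m (z1 l s) (z2 l s)) (at s)"
   if "x \<in> {(0, 1, 2), (2, 4, 5)}" for x using that ch by auto
 qed
qed

lemma fld_kernels:
 assumes "d > 0" "!!l s. l \<in> L ==> s \<in> S ==>
   (let z1 = \<xi> + rot l + of_real s * \<alpha>; z2 = \<zeta> + of_real s * \<beta>
   in z1 \<in> SZ & z2 \<in> SZ & d <= norm z1 + norm z2 & \<bar>l\<bar> + \<bar>s\<bar> - M <= norm z1 + norm z2)"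
 shows "!!x1 x2. \<xi> = - x1 ==> \<zeta> = \<eta> - x2 ==> fld (fG x1 x2) \<alpha> \<beta> \<eta> L S"
  "!!w. \<xi> = 0 ==> \<zeta> = \<eta> - w ==> fld (fS w) \<alpha> \<beta> \<eta> L S"
  "\<zeta> = \<eta> ==> fld (fR \<xi>) \<alpha> \<beta> \<eta> L S"
proof -
 show "fld (fG x1 x2) \<alpha> \<beta> \<eta> L S" if "\<xi> = - x1" "\<zeta> = \<eta> - x2" for x1 x2
  by (rule fld_kernel[OF assms, where K=kG]) (simp_all add: fG_def that algebra_simps)
 show "fld (fS w) \<alpha> \<beta> \<eta> L S" if "\<xi> = 0" "\<zeta> = \<eta> - w" for w
  by (rule fld_kernel[OF assms, where K=kh]) (simp_all add: fS_def that algebra_simps)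
 show "fld (fR \<xi>) \<alpha> \<beta> \<eta> L S" if "\<zeta> = \<eta>"
  by (rule fld_kernel[OF assms, where K=kh']) (simp_all add: fR_def that algebra_simps)
qed

end

text \<open>The Bochner integral of a non-integrable function is 0, and the bound then holds because
  \<open>w\<close> is nonnegative almost everywhere; integrability of \<open>f\<close> need not be
  shown first.\<close>

lemma norm_LINT_le:
 fixes f :: "'b => complex"
 assumes w: "integrable M w" and le: "AE x in M. norm (f x) <= w x"
 shows "norm (LINT x|M. f x) <= (LINT x|M. w x)"
proof (cases "integrable M f")
 case True
 have "norm (LINT x|M. f x) <= (LINT x|M. norm (f x))" by (rule integral_norm_bound)
 also have "... <= (LINT x|M. w x)" using True w le by (intro integral_mono_AE) auto
 finally show ?thesis .
next
 case False
 have "0 <= (LINT x|M. w x)"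
  using le by (intro integral_nonneg_AE) (auto elim!: eventually_mono intro: order.trans[OF norm_ge_zero])
 then show ?thesis using False by (simp add: not_integrable_integral_eq)
qed

context hsm begin

text \<open>Up to the factor \<open>- om\<close> this is the flux for the direction
  \<open>(om, 0)\<close>, that is through the trace left by an end point when a path is
  shifted.\<close>

definition ef :: "field => field => complex => complex => complex" where
 "ef u g z y = g 0 z y * u 2 z y - u 0 z y * g 2 z y"

lemma flux_bound:
 assumes u: "fld u \<alpha> \<beta> \<zeta> L S" and g: "fld g \<alpha> \<beta> \<zeta> L S"
 obtains B \<mu> where "B > 0" "\<mu> > 0"
  "!!l s. l \<in> L ==> s \<in> S ==> norm (fx \<alpha> \<beta> \<zeta> u g l s) <= B * exp (- \<mu> * (\<bar>l\<bar> + \<bar>s\<bar>))"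
  "!!l s. l \<in> L ==> s \<in> S ==> norm (pt (ef u g) \<alpha> \<beta> \<zeta> l s) <= B * exp (- \<mu> * (\<bar>l\<bar> + \<bar>s\<bar>))"
proof -
 let ?m = "%l s. \<bar>l\<bar> + \<bar>s\<bar>"
 obtain B1 \<mu>1 where 1: "B1 > 0" "\<mu>1 > 0" "!!l s i. l \<in> L ==> s \<in> S ==> i < 3 ==>
   norm (pt (u i) \<alpha> \<beta> \<zeta> l s) <= B1 * exp (- \<mu>1 * (?m l s))"
  using u unfolding fld_def by blast
 obtain B2 \<mu>2 where 2: "B2 > 0" "\<mu>2 > 0" "!!l s i. l \<in> L ==> s \<in> S ==> i < 3 ==>
   norm (pt (g i) \<alpha> \<beta> \<zeta> l s) <= B2 * exp (- \<mu>2 * (?m l s))"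
  using g unfolding fld_def by blast
 define M where "M = norm \<alpha> + norm \<beta> + 1"
 have M: "M >= 1" "norm \<alpha> + norm \<beta> <= M" by (simp_all add: M_def)
 show thesis
 proof (rule that[of "2 * M * (B2 * B1)" "\<mu>1 + \<mu>2"])
  fix l s assume ls: "l \<in> L" "s \<in> S"
  define z where "z = rot l + of_real s * \<alpha>"
  define y where "y = \<zeta> + of_real s * \<beta>"
  define E where "E = B2 * B1 * exp (- (\<mu>1 + \<mu>2) * (?m l s))"
  have E0: "E > 0" using 1 2 by (simp add: E_def)
  have p: "norm (g i z y * u j z y) <= E" if "i < 3" "j < 3" for i j
  proof -
   have "norm (g i z y * u j z y) <= (B2 * exp (- \<mu>2 * (?m l s))) * (B1 * exp (- \<mu>1 * (?m l s)))"
    unfolding norm_mult using 1(3)[OF ls that(2)] 2(3)[OF ls that(1)] 2(1) by (intro mult_mono) (auto simp: z_def y_def)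
   also have "... = E" by (simp add: E_def exp_add[symmetric] algebra_simps)
   finally show ?thesis .
  qed
  have q: "norm (g 0 z y * u i z y - u 0 z y * g i z y) <= 2 * E" if "i < 3" for i
   using norm_triangle_ineq4[of "g 0 z y * u i z y" "g i z y * u 0 z y"] p[of 0 i] p[of i 0] that
   by (simp add: mult.commute)
  show "norm (pt (ef u g) \<alpha> \<beta> \<zeta> l s) <= 2 * M * (B2 * B1) * exp (- (\<mu>1 + \<mu>2) * (?m l s))"
  proof -
   have "2 * E <= M * (2 * E)" using M E0 by simp
   then have "norm (ef u g z y) <= M * (2 * E)" using q[of 2] by (simp add: ef_def)
   then show ?thesis by (simp add: z_def y_def E_def mult_ac)
  qed
  have "norm (flux \<alpha> \<beta> u g z y) <= norm \<beta> * (2 * E) + norm \<alpha> * (2 * E)"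
   unfolding flux_def
   by (rule order.trans[OF norm_triangle_ineq4 add_mono]; unfold norm_mult; intro mult_left_mono q) auto
  also have "... <= M * (2 * E)" using M E0 by (simp add: algebra_simps M_def)
  finally show "norm (fx \<alpha> \<beta> \<zeta> u g l s) <= 2 * M * (B2 * B1) * exp (- (\<mu>1 + \<mu>2) * (?m l s))"
   by (simp add: z_def y_def E_def mult_ac)
 qed (use 1 2 M in auto)
qed

lemma fld_continuous:
 assumes "fld u \<alpha> \<beta> \<zeta> L S" "l \<in> L" "i < 3"
 shows "continuous_on S (%s. pt (u i) \<alpha> \<beta> \<zeta> l s)"
proof -
 have c: "continuous_on (L \<times> S) (%x. pt (u i) \<alpha> \<beta> \<zeta> (fst x) (snd x))"
  using fld_cont[OF assms(1)] assms(3) by simp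
 have "continuous_on S (%s. (l, s))" by (intro continuous_intros)
 from continuous_on_compose2[OF c this] show ?thesis using assms(2) by auto
qed

lemma flux_continuous:
 assumes u: "fld u \<alpha> \<beta> \<zeta> L S" and g: "fld g \<alpha> \<beta> \<zeta> L S" and l: "l \<in> L"
 shows "continuous_on S (%s. fx \<alpha> \<beta> \<zeta> u g l s)"
 unfolding flux_def by (intro continuous_intros fld_continuous[OF u l] fld_continuous[OF g l]) auto

lemma set_integrable_continuous_exp:
 fixes f :: "real => complex"
 assumes "continuous_on S f" "S \<in> sets borel" "\<mu> > 0" "!!s. s \<in> S ==> norm (f s) <= B * exp (- \<mu> * \<bar>s\<bar>)"
 shows "set_integrable lborel S f"
 unfolding set_integrable_def
proof (rule Bochner_Integration.integrable_bound)
 show "integrable lborel (%s. \<bar>B\<bar> * exp (- \<mu> * \<bar>s\<bar>))" using integrable_exp_neg_abs[OF assms(3)] by simp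
 have "(%s. indicator S s *\<^sub>R f s) \<in> borel_measurable borel"
  using borel_measurable_continuous_on_indicator[OF assms(2,1)] .
 then show "(%s. indicator S s *\<^sub>R f s) \<in> borel_measurable lborel" by simp
 have "B * exp (- \<mu> * \<bar>s\<bar>) <= \<bar>B\<bar> * exp (- \<mu> * \<bar>s\<bar>)" for s by (intro mult_right_mono) auto
 then show "AE s in lborel. norm (indicator S s *\<^sub>R f s) <= norm (\<bar>B\<bar> * exp (- \<mu> * \<bar>s\<bar>))"
  using order.trans[OF assms(4)] by (auto simp: indicator_def abs_mult intro!: AE_I2)
qed

lemma flux_integrable:
 assumes u: "fld u \<alpha> \<beta> \<zeta> L S" and g: "fld g \<alpha> \<beta> \<zeta> L S" and l: "l \<in> L" and S: "S \<in> sets borel"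
 shows "set_integrable lborel S (%s. fx \<alpha> \<beta> \<zeta> u g l s)"
proof -
 obtain B \<mu> where B: "B > 0" "\<mu> > 0"
  "!!l s. l \<in> L ==> s \<in> S ==> norm (fx \<alpha> \<beta> \<zeta> u g l s) <= B * exp (- \<mu> * (\<bar>l\<bar> + \<bar>s\<bar>))"
  using flux_bound[OF u g] by metis
 show ?thesis
 proof (rule set_integrable_continuous_exp[OF flux_continuous[OF u g l] S B(2)])
  fix s assume s: "s \<in> S"
  have "B * exp (- \<mu> * (\<bar>l\<bar> + \<bar>s\<bar>)) <= B * exp (- \<mu> * \<bar>s\<bar>)" using B by (auto intro!: mult_left_mono)
  with B(3)[OF l s] show "norm (fx \<alpha> \<beta> \<zeta> u g l s) <= B * exp (- \<mu> * \<bar>s\<bar>)" by linarith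
 qed
qed

text \<open>Green's identity on a complex parallelogram. \<open>D\<close> is the
  \<open>l\<close>-derivative of the flux and, after the Helmholtz equation has removed the second
  \<open>y\<close>-derivatives of both fields, also the \<open>s\<close>-derivative of
  \<open>- om * ef\<close>; so a shift changes the flux only by end point terms.\<close>

lemma green_segment:
 assumes u: "fld u \<alpha> \<beta> \<zeta> L S" and g: "fld g \<alpha> \<beta> \<zeta> L S" and l: "{l0..l1} \<subseteq> L" "l0 <= l1" and s: "{s0..s1} \<subseteq> S" "s0 <= s1"
 shows "(LINT s:{s0..s1}|lborel. fx \<alpha> \<beta> \<zeta> u g l1 s) - (LINT s:{s0..s1}|lborel. fx \<alpha> \<beta> \<zeta> u g l0 s) =
   - om * integral {l0..l1} (%l. pt (ef u g) \<alpha> \<beta> \<zeta> l s1 - pt (ef u g) \<alpha> \<beta> \<zeta> l s0)"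
proof -
 define U where "U = (%i. pt (u i) \<alpha> \<beta> \<zeta>)"
 define W where "W = (%i. pt (g i) \<alpha> \<beta> \<zeta>)"
 define E where "E = (%l s. W 0 l s * U 2 l s - U 0 l s * W 2 l s)"
 define F where "F = (%l s. \<beta> * (W 0 l s * U 1 l s - U 0 l s * W 1 l s) - \<alpha> * E l s)"
 define D where "D = (%l s. om * (\<beta> * (W 0 l s * U 3 l s - U 0 l s * W 3 l s)
   - \<alpha> * (W 1 l s * U 2 l s + W 0 l s * U 4 l s - U 1 l s * W 2 l s - U 0 l s * W 4 l s)))"
 have i: "set_integrable lborel {s0..s1} (%s. fx \<alpha> \<beta> \<zeta> u g l s)" if "l \<in> L" for l
  by (rule flux_integrable[OF fld_subset[OF u order.refl s(1)] fld_subset[OF g order.refl s(1)] that]) simp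
 have ll: "l0 \<in> L" "l1 \<in> L" using l by auto
 have "integral {s0..s1} (%s. F l1 s - F l0 s) = integral {l0..l1} (%l. (- om * E l s1) - (- om * E l s0))"
 proof (rule integral_diff_swap[where D=D, OF l(2) s(2)])
  fix l' s' assume "l' \<in> {l0..l1}" "s' \<in> {s0..s1}"
  then have ls: "l' \<in> L" "s' \<in> S" using l s by auto
  have d: "((%l. U i l s') has_vector_derivative om * U j l' s') (at l')" "((%l. W i l s') has_vector_derivative om * W j l' s') (at l')"
   if "(i, j) \<in> {(0, 1), (1, 3), (2, 4)}" for i j
   using u g ls that unfolding fld_def U_def W_def by blast+
  have e: "((%s. U i l' s) has_vector_derivative \<alpha> * U j l' s' + \<beta> * U m l' s') (at s')" "((%s. W i l' s) has_vector_derivative \<alpha> * W j l' s' + \<beta> * W m l' s') (at s')"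
   if "(i, j, m) \<in> {(0, 1, 2), (2, 4, 5)}" for i j m
   using u g ls that unfolding fld_def U_def W_def by blast+
  have h: "U 5 l' s' = 4 * al * U 0 l' s' - U 3 l' s'" "W 5 l' s' = 4 * al * W 0 l' s' - W 3 l' s'"
   using u g ls unfolding fld_def U_def W_def by (simp_all add: algebra_simps)
  note [simp del] = One_nat_def
  note vd = has_vector_derivative_diff has_vector_derivative_mult has_vector_derivative_const
   d[of 0 1, simplified] d[of 1 3, simplified] d[of 2 4, simplified] e[of 0 1 2, simplified] e[of 2 4 5, simplified]
  have "((%l. F l s') has_vector_derivative D l' s') (at l')"
   unfolding F_def E_def by (rule has_vector_derivative_eq_rhs, (rule vd)+) (simp add: D_def algebra_simps)
  then show "((%l. F l s') has_vector_derivative D l' s') (at l' within {l0..l1})" by (rule has_vector_derivative_at_within)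
  have "((%s. - om * E l' s) has_vector_derivative D l' s') (at s')"
   unfolding E_def by (rule has_vector_derivative_eq_rhs, (rule vd)+) (simp add: D_def h algebra_simps)
  then show "((%s. - om * E l' s) has_vector_derivative D l' s') (at s' within {s0..s1})" by (rule has_vector_derivative_at_within)
 next
  have "continuous_on ({l0..l1} \<times> {s0..s1}) (%x. U i (fst x) (snd x))" "continuous_on ({l0..l1} \<times> {s0..s1}) (%x. W i (fst x) (snd x))"
   if "i < 5" for i
   unfolding U_def W_def by (rule fld_cont[OF fld_subset[OF u l(1) s(1)] that] fld_cont[OF fld_subset[OF g l(1) s(1)] that])+
  then show "continuous_on ({l0..l1} \<times> {s0..s1}) (%(l, s). D l s)"
   unfolding D_def case_prod_beta by (intro continuous_intros) auto
 qed
 also have "(%l. (- om * E l s1) - (- om * E l s0)) = (%l. - om * (E l s1 - E l s0))" by (simp add: algebra_simps fun_eq_iff)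
 finally show ?thesis
  using set_borel_integral_eq_integral[OF i[OF ll(1)]] set_borel_integral_eq_integral[OF i[OF ll(2)]]
  by (simp add: integral_diff F_def E_def U_def W_def flux_def ef_def)
qed

text \<open>The far end of a segment is sent to infinity, where exponential decay removes its
  contribution.\<close>

lemma green_ray:
 assumes u: "fld u \<alpha> \<beta> \<zeta> L {0..}" and g: "fld g \<alpha> \<beta> \<zeta> L {0..}" and l: "{l0..l1} \<subseteq> L" "l0 <= l1"
 shows "(LINT s:{0..}|lborel. fx \<alpha> \<beta> \<zeta> u g l1 s) -
   (LINT s:{0..}|lborel. fx \<alpha> \<beta> \<zeta> u g l0 s) =
   om * integral {l0..l1} (%l. ef u g (rot l) \<zeta>)"
proof -
 obtain B \<mu> where B: "B > 0" "\<mu> > 0"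
  "!!l s. l \<in> L ==> s \<in> {0..} ==> norm (pt (ef u g) \<alpha> \<beta> \<zeta> l s) <= B * exp (- \<mu> * (\<bar>l\<bar> + \<bar>s\<bar>))"
  using flux_bound[OF u g] by metis
 have lim: "((%b. LINT s:{0..b}|lborel. fx \<alpha> \<beta> \<zeta> u g l s) \<longlongrightarrow>
   (LINT s:{0..}|lborel. fx \<alpha> \<beta> \<zeta> u g l s)) at_top" if "l \<in> L" for l
  by (rule tendsto_set_lebesgue_integral_at_top[OF _ flux_integrable[OF u g that]]) auto
 have ll: "l0 \<in> L" "l1 \<in> L" using l by auto
 have ic: "(%l. pt (ef u g) \<alpha> \<beta> \<zeta> l s) integrable_on {l0..l1}" if "s >= 0" for s
 proof (rule integrable_continuous_real)
  have c: "continuous_on {l0..l1} (%l. pt (f i) \<alpha> \<beta> \<zeta> l s)" if f: "fld f \<alpha> \<beta> \<zeta> L {0..}" and i: "i < 3" for f i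
  proof -
   have c: "continuous_on (L \<times> {0..}) (%x. pt (f i) \<alpha> \<beta> \<zeta> (fst x) (snd x))"
    using fld_cont[OF f] i by simp
   have "continuous_on {l0..l1} (%l. (l, s))" by (intro continuous_intros)
   from continuous_on_compose2[OF c this] show ?thesis using l(1) \<open>s >= 0\<close> by auto
  qed
  show "continuous_on {l0..l1} (%l. pt (ef u g) \<alpha> \<beta> \<zeta> l s)"
   unfolding ef_def by (intro continuous_intros c u g) auto
 qed
 define I where "I = (%s. integral {l0..l1} (%l. pt (ef u g) \<alpha> \<beta> \<zeta> l s))"
 have "(I \<longlongrightarrow> 0) at_top"
 proof (rule Lim_null_comparison)
  have "norm (I s) <= (B * exp (- \<mu> * s)) * (l1 - l0)" if "s >= 0" for s
  proof -
   have "norm (integral (cbox l0 l1) (%l. pt (ef u g) \<alpha> \<beta> \<zeta> l s)) <= B * exp (- \<mu> * s) * Henstock_Kurzweil_Integration.content (cbox l0 l1)"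
   proof (rule integrable_bound)
    fix x assume x: "x \<in> cbox l0 l1"
    have "B * exp (- \<mu> * (\<bar>x\<bar> + \<bar>s\<bar>)) <= B * exp (- \<mu> * s)" using B that by (auto intro!: mult_left_mono)
    then show "norm (pt (ef u g) \<alpha> \<beta> \<zeta> x s) <= B * exp (- \<mu> * s)"
     using B(3)[of x s] x l(1) that by (auto intro: order.trans)
   qed (use B ic[OF that] in auto)
   then show ?thesis using l(2) by (simp add: I_def)
  qed
  then show "\<forall>\<^sub>F s in at_top. norm (I s) <= (B * exp (- \<mu> * s)) * (l1 - l0)"
   by (rule eventually_mono[OF eventually_ge_at_top])
  show "((%s. (B * exp (- \<mu> * s)) * (l1 - l0)) \<longlongrightarrow> 0) at_top" using B(2) by real_asymp
 qed
 then have "((%b. - om * (I b - I 0)) \<longlongrightarrow> - om * (0 - I 0)) at_top" by (intro tendsto_intros)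
 moreover have "\<forall>\<^sub>F b in at_top. - om * (I b - I 0) = (LINT s:{0..b}|lborel. fx \<alpha> \<beta> \<zeta> u g l1 s) -
   (LINT s:{0..b}|lborel. fx \<alpha> \<beta> \<zeta> u g l0 s)"
  using eventually_ge_at_top[of 0]
 proof eventually_elim
  case (elim b)
  show ?case
   using green_segment[OF u g l, of 0 b] elim integral_diff[OF ic[OF elim] ic[of 0]] by (simp add: I_def)
 qed
 ultimately have "((%b. (LINT s:{0..b}|lborel. fx \<alpha> \<beta> \<zeta> u g l1 s) -
   (LINT s:{0..b}|lborel. fx \<alpha> \<beta> \<zeta> u g l0 s)) \<longlongrightarrow> - om * (0 - I 0)) at_top"
  by (rule Lim_transform_eventually)
 from tendsto_unique[OF _ tendsto_diff[OF lim[OF ll(2)] lim[OF ll(1)]] this]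
 show ?thesis by (simp add: I_def)
qed

text \<open>Total flux through the path formed by the segment from \<open>-b\<close> to \<open>b\<close> and two complex rays from its
  end points, shifted by \<open>l e\<^sup>i\<^sup>\<theta>\<close>. For \<open>(b, c) = (a, 1)\<close> the rays are the diagonals through
  the corners, for \<open>(b, c) = (0, 0)\<close> the path is the line with direction \<open>(0, e\<^sup>i\<^sup>\<theta>)\<close>.\<close>

definition TT :: "real => complex => field => field => real => complex" where
 "TT b c u g l =
   (LINT s:{0..}|lborel. fx (c * om) om (of_real b) u g l s)
  + (LINT s:{-b..b}|lborel. fx 0 1 0 u g l s)
  - (LINT s:{0..}|lborel. fx (c * om) (- om) (- of_real b) u g l s)"

definition pfld :: "field => real => complex => real set => bool" where
 "pfld u b c L \<longleftrightarrow> fld u (c * om) om (of_real b) L {0..} & fld u 0 1 0 L {-b..b} & fld u (c * om) (- om) (- of_real b) L {0..}"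

text \<open>The end point terms of the three pieces cancel at the two joints \<open>b\<close> and
  \<open>- b\<close>, so a shift changes nothing as long as both fields are regular on the shifted
  paths.\<close>

lemma TT_const:
 assumes u: "pfld u b c L" and g: "pfld g b c L" and l: "{l0..l1} \<subseteq> L" "l0 <= l1" and b: "b >= 0"
 shows "TT b c u g l1 = TT b c u g l0"
proof -
 note uu = u[unfolded pfld_def] and gg = g[unfolded pfld_def]
 have c: "continuous_on {l0..l1} (%l. f i (rot l) \<zeta>)" if f: "fld f \<alpha> \<beta> \<zeta> L {0..}" and i: "i < 3" for f i \<alpha> \<beta> \<zeta>
 proof -
  have c: "continuous_on (L \<times> {0..}) (%x. pt (f i) \<alpha> \<beta> \<zeta> (fst x) (snd x))"
   using fld_cont[OF f] i by simp
  have "continuous_on {l0..l1} (%l. (l, 0::real))" by (intro continuous_intros)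
  from continuous_on_compose2[OF c this] show ?thesis using l(1) by auto
 qed
 have i: "(%l. ef u g (rot l) \<zeta>) integrable_on {l0..l1}" if "fld u \<alpha> \<beta> \<zeta> L {0..}" "fld g \<alpha> \<beta> \<zeta> L {0..}" for \<alpha> \<beta> \<zeta>
  unfolding ef_def by (intro integrable_continuous_real continuous_intros c[OF that(1)] c[OF that(2)]) auto
 have "TT b c u g l1 - TT b c u g l0 = om * integral {l0..l1} (%l. ef u g (rot l) (of_real b))
   + - om * integral {l0..l1} (%l. pt (ef u g) 0 1 0 l b - pt (ef u g) 0 1 0 l (-b))
   - om * integral {l0..l1} (%l. ef u g (rot l) (- of_real b))"
  using green_ray[OF conjunct1[OF uu] conjunct1[OF gg] l]
   green_segment[OF conjunct1[OF conjunct2[OF uu]] conjunct1[OF conjunct2[OF gg]] l order.refl] b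
   green_ray[OF conjunct2[OF conjunct2[OF uu]] conjunct2[OF conjunct2[OF gg]] l]
  unfolding TT_def by (simp add: algebra_simps)
 also have "... = 0"
 proof -
  have e: "integral {l0..l1} (%l. ef u g (rot l) (of_real b) - ef u g (rot l) (- of_real b)) =
    integral {l0..l1} (%l. ef u g (rot l) (of_real b)) - integral {l0..l1} (%l. ef u g (rot l) (- of_real b))"
   by (rule integral_diff) (use i uu gg in blast)+
  show ?thesis unfolding of_real_minus mult_zero_right add_0_right mult_1_right add_0_left e by (simp add: algebra_simps)
 qed
 finally show ?thesis by simp
qed

lemma flux_LINT_tendsto_0:
 assumes u: "fld u \<alpha> \<beta> \<zeta> {l0..} S" and g: "fld g \<alpha> \<beta> \<zeta> {l0..} S" and S: "S \<in> sets borel"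
 shows "((%l. LINT s:S|lborel. fx \<alpha> \<beta> \<zeta> u g l s) \<longlongrightarrow> 0) at_top"
proof -
 obtain B \<mu> where B: "B > 0" "\<mu> > 0"
  "!!l s. l \<in> {l0..} ==> s \<in> S ==> norm (fx \<alpha> \<beta> \<zeta> u g l s) <= B * exp (- \<mu> * (\<bar>l\<bar> + \<bar>s\<bar>))"
  using flux_bound[OF u g] by metis
 define C where "C = (LINT s|lborel. exp (- \<mu> * \<bar>s\<bar>))"
 have i: "integrable lborel (%s. exp (- \<mu> * \<bar>s\<bar>))" using integrable_exp_neg_abs[OF B(2)] .
 show ?thesis
 proof (rule Lim_null_comparison)
  have "norm (LINT s:S|lborel. fx \<alpha> \<beta> \<zeta> u g l s) <= B * exp (- \<mu> * l) * C" if "l >= l0" "l >= 0" for l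
  proof -
   have "norm (LINT s:S|lborel. fx \<alpha> \<beta> \<zeta> u g l s) <= (LINT s|lborel. B * exp (- \<mu> * l) * exp (- \<mu> * \<bar>s\<bar>))"
    unfolding set_lebesgue_integral_def
   proof (rule norm_LINT_le, use i in simp, rule AE_I2)
    show "norm (indicat_real S s *\<^sub>R fx \<alpha> \<beta> \<zeta> u g l s) <= B * exp (- \<mu> * l) * exp (- \<mu> * \<bar>s\<bar>)" for s
     using B(3)[of l s] that B(1) by (auto simp: indicator_def exp_add[symmetric] algebra_simps)
   qed
   then show ?thesis by (simp add: C_def)
  qed
  then show "\<forall>\<^sub>F l in at_top. norm (LINT s:S|lborel. fx \<alpha> \<beta> \<zeta> u g l s) <= B * exp (- \<mu> * l) * C"
   by (intro eventually_mono[OF eventually_ge_at_top[of "max l0 0"]]) simp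
  show "((%l. B * exp (- \<mu> * l) * C) \<longlongrightarrow> 0) at_top" using B(2) by real_asymp
 qed
qed

text \<open>The total flux does not depend on the shift and tends to 0 as the path moves off to
  infinity.\<close>

lemma TT_eq_0:
 assumes u: "pfld u b c {l0..}" and g: "pfld g b c {l0..}" and b: "b >= 0"
 shows "TT b c u g l0 = 0"
proof -
 have "((%l. TT b c u g l) \<longlongrightarrow> 0 + 0 - 0) at_top"
  unfolding TT_def using u g unfolding pfld_def by (intro tendsto_intros flux_LINT_tendsto_0) auto
 moreover have "\<forall>\<^sub>F l in at_top. TT b c u g l = TT b c u g l0"
  by (rule eventually_mono[OF eventually_ge_at_top[of l0]], rule TT_const[OF u g _ _ b]) auto
 ultimately have "((%l::real. TT b c u g l0) \<longlongrightarrow> 0) at_top" by (simp add: tendsto_cong)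
 then show ?thesis by (simp add: tendsto_const_iff)
qed

end

section \<open>Jump of the flux across a pole\<close>

lemma LINT_FTC:
 fixes F f :: "real => complex"
 assumes F: "!!x. (F has_vector_derivative f x) (at x)"
  and f: "continuous_on UNIV f" "integrable lborel f"
  and lim: "(F \<longlongrightarrow> B) at_top" "(F \<longlongrightarrow> A) at_bot"
 shows "(LINT x|lborel. f x) = B - A"
proof -
 have "(LBINT x=-\<infinity>..\<infinity>. f x) = B - A"
 proof (rule interval_integral_FTC_integrable[where F=F])
  show "isCont f x" for x using f(1) by (simp add: continuous_on_eq_continuous_at)
  show "set_integrable lborel (einterval (- \<infinity>) \<infinity>) f" using f(2) by (simp add: set_integrable_def)
  show "((F \<circ> real_of_ereal) \<longlongrightarrow> A) (at_right (-\<infinity>))" "((F \<circ> real_of_ereal) \<longlongrightarrow> B) (at_left \<infinity>)"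
   using lim by (simp_all add: ereal_tendsto_simps)
 qed (use F in auto)
 then show ?thesis by (simp add: interval_lebesgue_integral_def set_lebesgue_integral_def)
qed

lemma integrable_powr_exp_abs:
 fixes p \<mu> :: real
 assumes p: "p < 1" and \<mu>: "\<mu> > 0"
 shows "integrable lborel (%t. \<bar>t\<bar> powr (- p) * exp (- \<mu> * \<bar>t\<bar>))"
proof -
 have "(%t. complex_of_real t powr (of_real (1 - p) - 1) / of_real (exp (\<mu> * t))) absolutely_integrable_on {0<..}"
  using absolutely_integrable_Gamma_integral[of "of_real (1 - p)" \<mu>] p \<mu> by simp
 then have "integrable lebesgue (%t. norm (indicator {0<..} t *\<^sub>R (complex_of_real t powr (of_real (1 - p) - 1) / of_real (exp (\<mu> * t)))))"
  unfolding set_integrable_def by (rule integrable_norm)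
 also have "(%t. norm (indicator {0<..} t *\<^sub>R (complex_of_real t powr (of_real (1 - p) - 1) / of_real (exp (\<mu> * t)))))
   = (%t. indicator {0<..} t * (t powr (- p) * exp (- \<mu> * t)))"
  by (auto simp: fun_eq_iff indicator_def norm_divide norm_powr_real_powr exp_minus field_simps)
 finally have i: "integrable lborel (%t. indicator {0<..} t * (t powr (- p) * exp (- \<mu> * t)))"
  by (subst (asm) integrable_completion) auto
 from lborel_integrable_real_affine[OF this, of "-1" 0]
 have "integrable lborel (%t. indicator {0<..} (-t) * ((-t) powr (- p) * exp (\<mu> * t)))" by simp
 from Bochner_Integration.integrable_add[OF i this]
 show ?thesis
  by (rule Bochner_Integration.integrable_cong[THEN iffD1, rotated 2]) (auto simp: indicator_def)
qed

lemma integrable_inverse_1_plus_sq: "integrable lborel (%w::real. 1 / (1 + w^2))"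
 using integrable_inverse_1_plus_square by (simp add: set_integrable_def inverse_eq_divide)

lemma norm_sq_plus_ge:
 assumes "norm \<rho> = 1"
 shows "norm (\<rho>^2 + (of_real w)^2) >= Re \<rho> * (1 + w^2)"
proof -
 have 1: "\<rho> * cnj \<rho> = 1" using assms by (simp add: complex_norm_square[symmetric])
 have "(\<rho>^2 + (of_real w)^2) * cnj \<rho> = \<rho> * (\<rho> * cnj \<rho>) + of_real (w^2) * cnj \<rho>"
  by (simp add: algebra_simps power2_eq_square)
 also have "... = \<rho> + of_real (w^2) * cnj \<rho>" by (simp add: 1)
 finally have R: "Re ((\<rho>^2 + (of_real w)^2) * cnj \<rho>) = Re \<rho> * (1 + w^2)" by (simp add: algebra_simps)
 show ?thesis
  using complex_Re_le_cmod[of "(\<rho>^2 + (of_real w)^2) * cnj \<rho>"] unfolding R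
  by (simp only: norm_mult complex_mod_cnj assms mult_1_right)
qed

text \<open>For \<open>\<rho> = 1\<close> this is the arctangent integral. The antiderivative is a
  difference of logarithms of numbers with real part \<open>Re \<rho> > 0\<close>, which stay off
  the cut, so that complex \<open>\<rho>\<close> requires no deformation of a contour.\<close>

lemma poisson_kernel_integral:
 assumes \<rho>: "norm \<rho> = 1" "Re \<rho> > 0"
 shows "(LINT w|lborel. \<rho> / (\<rho>^2 + (of_real w)^2)) = of_real pi"
proof -
 let ?p = "%w. \<rho>^2 + (of_real w)^2"
 define F where "F = (%w. (Ln (\<rho> + \<i> * of_real w) - Ln (\<rho> - \<i> * of_real w)) / (2 * \<i>))"
 have nz: "\<rho> + \<i> * of_real w \<notin> \<real>\<^sub>\<le>\<^sub>0" "\<rho> - \<i> * of_real w \<notin> \<real>\<^sub>\<le>\<^sub>0" for w :: real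
  using \<rho> by (auto simp: complex_nonpos_Reals_iff)
 have nz': "\<rho> + \<i> * of_real w ~= 0" "\<rho> - \<i> * of_real w ~= 0" for w using nz[of w] by auto
 have fac: "\<rho>^2 + (of_real w)^2 = (\<rho> + \<i> * of_real w) * (\<rho> - \<i> * of_real w)" for w :: real
  by (simp add: power2_eq_square algebra_simps)
 have D: "(F has_vector_derivative \<rho> / (?p w)) (at w)" for w
 proof -
  have "((%z. (Ln (\<rho> + \<i> * z) - Ln (\<rho> - \<i> * z)) / (2 * \<i>)) has_field_derivative
    (\<i> / (\<rho> + \<i> * of_real w) - (- \<i>) / (\<rho> - \<i> * of_real w)) / (2 * \<i>)) (at (of_real w))"
  proof (intro DERIV_cdivide DERIV_diff)
   have "((%z. Ln (\<rho> + \<i> * z)) has_field_derivative inverse (\<rho> + \<i> * of_real w) * \<i>) (at (of_real w))"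
    by (rule DERIV_chain2[where f=Ln], rule has_field_derivative_Ln[OF nz(1)]) (auto intro!: derivative_eq_intros)
   then show "((%z. Ln (\<rho> + \<i> * z)) has_field_derivative \<i> / (\<rho> + \<i> * of_real w)) (at (of_real w))"
    by (simp only: divide_inverse mult.commute)
   have "((%z. Ln (\<rho> - \<i> * z)) has_field_derivative inverse (\<rho> - \<i> * of_real w) * (- \<i>)) (at (of_real w))"
    by (rule DERIV_chain2[where f=Ln], rule has_field_derivative_Ln[OF nz(2)]) (auto intro!: derivative_eq_intros)
   then show "((%z. Ln (\<rho> - \<i> * z)) has_field_derivative (- \<i>) / (\<rho> - \<i> * of_real w)) (at (of_real w))"
    by (simp only: divide_inverse mult.commute)
  qed
  moreover have "(\<i> / (\<rho> + \<i> * of_real w) - (- \<i>) / (\<rho> - \<i> * of_real w)) / (2 * \<i>) = \<rho> / (?p w)"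
  proof -
   have "(\<i> / A - (- \<i>) / B) / (2 * \<i>) = ((A + B) / 2) / (A * B)" if "A ~= 0" "B ~= 0" for A B :: complex
   proof -
    have "(\<i> / A - (- \<i>) / B) = \<i> * ((A + B) / (A * B))" using that by (simp add: field_simps)
    then show ?thesis using that by (simp add: divide_divide_eq_left field_simps)
   qed
   from this[OF nz'[of w]] show ?thesis unfolding fac by simp
  qed
  ultimately have "((%z. (Ln (\<rho> + \<i> * z) - Ln (\<rho> - \<i> * z)) / (2 * \<i>)) has_field_derivative
    \<rho> / (?p w)) (at (of_real w))" by (simp only:)
  from has_vector_derivative_real_field[OF this] show ?thesis unfolding F_def .
 qed
 have i: "integrable lborel (%w. \<rho> / (?p w))"
 proof (rule Bochner_Integration.integrable_bound)
  show "integrable lborel (%w::real. 1 / Re \<rho> * (1 / (1 + w^2)))" using integrable_inverse_1_plus_sq by (rule integrable_mult_right)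
  show "AE w in lborel. norm (\<rho> / (?p w)) <= norm (1 / Re \<rho> * (1 / (1 + w^2)))"
  proof (rule AE_I2)
   fix w :: real
   have "0 < Re \<rho> * (1 + w^2)" using \<rho> by (intro mult_pos_pos) (auto intro: add_pos_nonneg)
   then have "1 / norm (?p w) <= 1 / (Re \<rho> * (1 + w^2))"
    using norm_sq_plus_ge[OF \<rho>(1), of w] by (intro frac_le) auto
   then show "norm (\<rho> / (?p w)) <= norm (1 / Re \<rho> * (1 / (1 + w^2)))"
    using \<rho> by (simp add: norm_divide)
  qed
 qed simp
 have top: "(F \<longlongrightarrow> of_real (pi / 2)) at_top"
 proof -
  have "((%w::real. \<rho> * of_real (1 / w)) \<longlongrightarrow> \<rho> * of_real 0) at_top"
   by (intro tendsto_intros) real_asymp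
  then have r: "((%w::real. \<rho> * of_real (1 / w)) \<longlongrightarrow> 0) at_top" by simp
  have "((%w::real. (Ln (\<rho> * of_real (1 / w) + \<i>) - Ln (\<rho> * of_real (1 / w) - \<i>)) / (2 * \<i>)) \<longlongrightarrow>
    (Ln (0 + \<i>) - Ln (0 - \<i>)) / (2 * \<i>)) at_top"
   by (intro tendsto_intros r tendsto_Ln) (auto simp: complex_nonpos_Reals_iff)
  moreover have "(Ln (0 + \<i>) - Ln (0 - \<i>)) / (2 * \<i>) = of_real (pi / 2)" by (simp add: field_simps)
  moreover have "\<forall>\<^sub>F w in at_top. (Ln (\<rho> * of_real (1 / w) + \<i>) - Ln (\<rho> * of_real (1 / w) - \<i>)) / (2 * \<i>) = F w"
   using eventually_gt_at_top[of 0]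
  proof eventually_elim
   case (elim w)
   have e: "\<rho> + \<i> * of_real w = of_real w * (\<rho> * of_real (1 / w) + \<i>)" "\<rho> - \<i> * of_real w = of_real w * (\<rho> * of_real (1 / w) - \<i>)"
    using elim by (simp_all add: field_simps)
   have n: "\<rho> * of_real (1 / w) + \<i> ~= 0" "\<rho> * of_real (1 / w) - \<i> ~= 0" using nz'[of w] unfolding e by auto
   show ?case unfolding F_def e using elim n by (simp add: Ln_times_of_real)
  qed
  ultimately show ?thesis by (simp only: Lim_transform_eventually)
 qed
 have odd: "F (- w) = - F w" for w by (simp add: F_def field_simps)
 have bot: "(F \<longlongrightarrow> - of_real (pi / 2)) at_bot"
  using tendsto_minus[OF top] by (subst filterlim_at_bot_mirror) (simp only: odd)
 have "continuous_on UNIV (%w::real. \<rho> / (?p w))"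
  by (intro continuous_intros) (use nz' in \<open>auto simp: fac\<close>)
 from LINT_FTC[OF D this i top bot] show ?thesis by simp
qed

context hsm begin

text \<open>Jump relation for a pole at shift \<open>X\<close> and position \<open>s0\<close>,
  approached from both sides. \<open>G\<close> is even and \<open>G1\<close> is odd in the first
  argument; so \<open>G\<close> meets a difference of values of \<open>v1\<close>, which tends to 0,
  while \<open>G1\<close>, a multiple of \<open>h\<close>, meets a sum of values of
  \<open>v0\<close> and acts as an approximate identity.\<close>

lemma pole_limit:
 fixes v0 v1 :: "real => real => complex"
 assumes X: "X > 0" and \<beta>: "norm \<beta> = 1" "Re (om / \<beta>) > 0"
  and S: "S \<in> sets borel" "\<delta> > 0" "{s0-\<delta><..<s0+\<delta>} \<subseteq> S"
  and SZ: "!!s. s \<in> S ==> of_real (s - s0) * \<beta> \<in> SZ"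
  and cont: "continuous_on ({0..2*X} \<times> S) (%x. v0 (fst x) (snd x))" "continuous_on ({0..2*X} \<times> S) (%x. v1 (fst x) (snd x))"
  and bd: "!!l s. l \<in> {0..2*X} ==> s \<in> S ==> norm (v0 l s) <= B & norm (v1 l s) <= B"
 defines "f \<equiv> %l s. \<beta> * (G (rot (l - X)) (of_real (s - s0) * \<beta>) * v1 l s - v0 l s * G1 (rot (l - X)) (of_real (s - s0) * \<beta>))"
 shows "(%n. LINT s:S|lborel. f (X - X / real (n+2)) s - f (X + X / real (n+2)) s) \<longlonglongrightarrow> - v0 X s0"
proof -
 let ?t = "%s. of_real (s - s0) * \<beta>"
 define \<epsilon> where "\<epsilon> = (%n. X / real (n+2))"
 let ?z = "%n. rot (\<epsilon> n)"
 have e: "\<epsilon> n > 0" "X - \<epsilon> n \<in> {0..2*X}" "X + \<epsilon> n \<in> {0..2*X}" for n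
  using X mult_left_mono[of 1 "real n + 2" X] by (auto simp: \<epsilon>_def field_simps)
 have e0: "\<epsilon> \<longlonglongrightarrow> 0" unfolding \<epsilon>_def by real_asymp
 have XI: "X \<in> {0..2*X}" using X by simp
 have s0: "s0 \<in> S" using S by auto
 have B0: "B >= 0" using bd[OF XI s0] norm_ge_zero order.trans by blast
 obtain C \<mu> where C: "C > 0" "\<mu> > 0" and kb: "!!z1 z2. z1 \<in> SZ ==> z2 \<in> SZ ==> norm z1 + norm z2 > 0 ==>
    norm (G z1 z2) <= C * (norm z1 + norm z2) powr (-1/4) * exp (- \<mu> * (norm z1 + norm z2)) &
    norm (h z1 z2) <= C * norm z1 / (norm z1 + norm z2)^2 * exp (- \<mu> * (norm z1 + norm z2))"
  using kernel_bounds by metis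
 define A where "A = (%n s. \<beta> * (G (?z n) (?t s) * (v1 (X - \<epsilon> n) s - v1 (X + \<epsilon> n) s)))"
 define D where "D = (%n s. \<beta> * (h (?z n) (?t s) * ((v0 (X - \<epsilon> n) s + v0 (X + \<epsilon> n) s) / 2)))"
 have fAD: "f (X - \<epsilon> n) s - f (X + \<epsilon> n) s = A n s - D n s" for n s
 proof -
  have "G (rot (- \<epsilon> n)) z = G (?z n) z" "G1 (rot (- \<epsilon> n)) z = h (?z n) z / 2"
   "G1 (?z n) z = - h (?z n) z / 2" for z
   by (simp_all add: G_def G1_def h_def power2_eq_square)
  then show ?thesis by (simp add: f_def A_def D_def algebra_simps add_divide_distrib)
 qed
 have vm: "(%s. indicator S s *\<^sub>R v l s) \<in> borel_measurable borel" if c: "continuous_on ({0..2*X} \<times> S) (%x. v (fst x) (snd x))" and l: "l \<in> {0..2*X}" for v :: "real => real => complex" and l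
 proof (rule borel_measurable_continuous_on_indicator[OF S(1)])
  have "continuous_on S (%s. (l, s))" by (intro continuous_intros)
  moreover have "(%s. (l, s)) ` S \<subseteq> {0..2*X} \<times> S" using l by auto
  ultimately have "continuous_on S (%s. v (fst (l, s)) (snd (l, s)))" by (rule continuous_on_compose2[OF c])
  then show "continuous_on S (v l)" by simp
 qed
 have nz: "om^2 + (of_real w)^2 * \<beta>^2 ~= 0" for w
 proof -
  have b: "\<beta> ~= 0" using \<beta> by auto
  have "0 < Re (om / \<beta>) * (1 + w^2)" using \<beta>(2) by (intro mult_pos_pos) (auto intro: add_pos_nonneg)
  also have "... <= norm ((om / \<beta>)^2 + (of_real w)^2)" using norm_sq_plus_ge[of "om / \<beta>" w] \<beta> by (simp add: norm_divide)
  finally have "(om / \<beta>)^2 + (of_real w)^2 ~= 0" by auto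
  then show ?thesis using b by (simp add: field_simps power2_eq_square)
 qed
 have qn: "(rot e)^2 + (of_real s * \<beta>)^2 \<notin> \<real>\<^sub>\<le>\<^sub>0" if "e > 0" "of_real s * \<beta> \<in> SZ" for e s
  using SZ_q(3)[OF SZ_om[of e] that(2)] that(1) by (simp add: norm_mult add_pos_nonneg)
 have Km: "(%s. indicator S s *\<^sub>R K (?z n) (?t s)) \<in> borel_measurable borel" if "K \<in> {G, h}" for K n
  by (rule borel_measurable_continuous_on_indicator[OF S(1)], rule continuous_on_kernels)
    (use qn[OF e(1) SZ] that in \<open>auto intro!: continuous_intros\<close>)
 have vlim: "(%n. v (X + c * \<epsilon> n) (s + \<epsilon> n * w)) \<longlonglongrightarrow> v X s"
  if c: "continuous_on ({0..2*X} \<times> S) (%x. v (fst x) (snd x))" and "c = 1 | c = -1" "s \<in> S" "w = 0 | s = s0"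
  for v :: "real => real => complex" and c w s
 proof -
  have ev: "\<forall>\<^sub>F n in sequentially. s + \<epsilon> n * w \<in> S"
  proof (cases "w = 0")
   case False
   then have "s = s0" using that by auto
   moreover have "(%n. s0 + \<epsilon> n * w) \<longlonglongrightarrow> s0 + 0 * w" by (intro tendsto_intros e0)
   then have "\<forall>\<^sub>F n in sequentially. s0 + \<epsilon> n * w \<in> {s0-\<delta><..<s0+\<delta>}"
    using S(2) by (intro topological_tendstoD) auto
   then have "\<forall>\<^sub>F n in sequentially. s0 + \<epsilon> n * w \<in> S"
    by (rule eventually_mono) (use S(3) in blast)
   ultimately show ?thesis by simp
  qed (use that in auto)
  have "(%n. (X + c * \<epsilon> n, s + \<epsilon> n * w)) \<longlonglongrightarrow> (X + c * 0, s + 0 * w)" by (intro tendsto_intros e0)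
  then have "(%n. (X + c * \<epsilon> n, s + \<epsilon> n * w)) \<longlonglongrightarrow> (X, s)" by simp
  from continuous_on_tendsto_compose[OF c this] show ?thesis
   using ev e(2,3) that(2,3) XI by (auto elim!: eventually_mono)
 qed
 have ne: "AE s in lborel. s ~= s0" by (rule AE_lborel_singleton)
 have wi: "integrable lborel (%s. C * (2 * B) * (\<bar>s - s0\<bar> powr (-1/4) * exp (- \<mu> * \<bar>s - s0\<bar>)))"
 proof -
  have "integrable lborel (%s. \<bar>s\<bar> powr (-1/4) * exp (- \<mu> * \<bar>s\<bar>))" using integrable_powr_exp_abs[of "1/4" \<mu>] C by simp
  from lborel_integrable_real_affine[OF this, of 1 "- s0"]
  show ?thesis by simp
 qed
 have Am: "(%s. indicator S s *\<^sub>R A n s) \<in> borel_measurable lborel" for n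
  proof -
   have "(%s. \<beta> * ((indicator S s *\<^sub>R G (?z n) (?t s)) * (indicator S s *\<^sub>R v1 (X - \<epsilon> n) s - indicator S s *\<^sub>R v1 (X + \<epsilon> n) s))) \<in> borel_measurable borel"
    by (intro borel_measurable_times borel_measurable_diff borel_measurable_const vm[OF cont(2)] e Km) auto
   also have "(%s. \<beta> * ((indicator S s *\<^sub>R G (?z n) (?t s)) * (indicator S s *\<^sub>R v1 (X - \<epsilon> n) s - indicator S s *\<^sub>R v1 (X + \<epsilon> n) s))) = (%s. indicator S s *\<^sub>R A n s)"
    by (auto simp: A_def indicator_def fun_eq_iff)
   finally show ?thesis by simp
  qed
 have Ab: "AE s in lborel. norm (indicator S s *\<^sub>R A n s) <= C * (2 * B) * (\<bar>s - s0\<bar> powr (-1/4) * exp (- \<mu> * \<bar>s - s0\<bar>))" for n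
   using ne
  proof eventually_elim
   case (elim s)
   show ?case
   proof (cases "s \<in> S")
    case True
    have n1: "norm (?z n) = \<epsilon> n" "norm (?t s) = \<bar>s - s0\<bar>"
     using e(1)[of n] \<beta> by (simp_all add: norm_mult flip: of_real_diff)
    have p: "(\<epsilon> n + \<bar>s - s0\<bar>) powr (-1/4) <= \<bar>s - s0\<bar> powr (-1/4)"
     using elim e(1)[of n] by (intro powr_mono2') auto
    have q: "exp (- \<mu> * (\<epsilon> n + \<bar>s - s0\<bar>)) <= exp (- \<mu> * \<bar>s - s0\<bar>)" using e(1)[of n] C by (simp add: algebra_simps)
    have "norm (G (?z n) (?t s)) <= C * (\<epsilon> n + \<bar>s - s0\<bar>) powr (-1/4) * exp (- \<mu> * (\<epsilon> n + \<bar>s - s0\<bar>))"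
     using kb[OF SZ_om SZ[OF True], of "\<epsilon> n"] e(1)[of n] unfolding n1 by (simp add: add_pos_nonneg)
    also have "... <= C * \<bar>s - s0\<bar> powr (-1/4) * exp (- \<mu> * \<bar>s - s0\<bar>)"
     using p q C by (intro mult_mono) auto
    finally have g: "norm (G (?z n) (?t s)) <= C * \<bar>s - s0\<bar> powr (-1/4) * exp (- \<mu> * \<bar>s - s0\<bar>)" .
    have v: "norm (v1 (X - \<epsilon> n) s - v1 (X + \<epsilon> n) s) <= 2 * B"
     using norm_triangle_ineq4[of "v1 (X - \<epsilon> n) s" "v1 (X + \<epsilon> n) s"] bd[OF e(2) True, of n] bd[OF e(3) True, of n] by linarith
    have "norm (A n s) <= (C * \<bar>s - s0\<bar> powr (-1/4) * exp (- \<mu> * \<bar>s - s0\<bar>)) * (2 * B)"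
     unfolding A_def norm_mult \<beta> using mult_mono[OF g v] C B0 by simp
    then show ?thesis using True by (simp add: mult_ac)
   qed (use C B0 in simp)
  qed
 have ibase: "integrable lborel (%s. indicator S s *\<^sub>R A n s)" for n
  by (rule Bochner_Integration.integrable_bound[OF wi Am]) (use Ab[of n] in \<open>auto elim!: eventually_mono intro: order.trans[OF _ abs_ge_self]\<close>)
 have "(%n. LINT s|lborel. indicator S s *\<^sub>R A n s) \<longlonglongrightarrow> (LINT s::real|lborel. (0::complex))"
 proof (rule integral_dominated_convergence[OF _ Am wi _ Ab])
  show "AE s in lborel. (%n. indicator S s *\<^sub>R A n s) \<longlonglongrightarrow> 0"
   using ne
  proof eventually_elim
   case (elim s)
   show ?case
   proof (cases "s \<in> S")
    case True
    have z: "(rot 0)^2 + (?t s)^2 \<notin> \<real>\<^sub>\<le>\<^sub>0"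
     using SZ_q(3)[OF SZ_om[of 0] SZ[OF True]] elim \<beta> by (auto simp: norm_mult)
    have ic: "isCont NN ((rot 0)^2 + (?t s)^2)"
     using DERIV_isCont[OF DERIV_NN[OF z]] .
    have "(%n. (?z n)^2 + (?t s)^2) \<longlonglongrightarrow> (rot 0)\<^sup>2 + (?t s)^2"
     by (intro tendsto_intros e0)
    from isCont_tendsto_compose[OF ic this]
    have Gl: "(%n. G (?z n) (?t s)) \<longlonglongrightarrow> G (rot 0) (?t s)" unfolding G_def .
    have vl: "(%n. v1 (X - \<epsilon> n) s) \<longlonglongrightarrow> v1 X s" "(%n. v1 (X + \<epsilon> n) s) \<longlonglongrightarrow> v1 X s"
     using vlim[OF cont(2), of "-1" s 0] vlim[OF cont(2), of 1 s 0] True by simp_all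
    have "(%n. A n s) \<longlonglongrightarrow> \<beta> * (G (rot 0) (?t s) * (v1 X s - v1 X s))"
     unfolding A_def by (intro tendsto_intros Gl vl)
    then show ?thesis using True by simp
   qed simp
  qed
 qed auto
 then have LA: "(%n. LINT s|lborel. indicator S s *\<^sub>R A n s) \<longlonglongrightarrow> 0" by simp
 \<comment> \<open>The rescaling \<open>s = s0 + \<epsilon> n * w\<close> turns the concentrating
   kernel into functions with the common majorant \<open>C * B * (1 / (1 + w^2))\<close>.\<close>
 define E where "E = (%n w. \<epsilon> n *\<^sub>R (indicator S (s0 + \<epsilon> n * w) *\<^sub>R D n (s0 + \<epsilon> n * w)))"
 have Dm: "(%s. indicator S s *\<^sub>R D n s) \<in> borel_measurable borel" for n
 proof -
  have "(%s. \<beta> * ((indicator S s *\<^sub>R h (?z n) (?t s)) * ((indicator S s *\<^sub>R v0 (X - \<epsilon> n) s + indicator S s *\<^sub>R v0 (X + \<epsilon> n) s) / 2))) \<in> borel_measurable borel"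
   by (intro borel_measurable_times borel_measurable_add borel_measurable_divide borel_measurable_const vm[OF cont(1)] e Km) auto
  also have "(%s. \<beta> * ((indicator S s *\<^sub>R h (?z n) (?t s)) * ((indicator S s *\<^sub>R v0 (X - \<epsilon> n) s + indicator S s *\<^sub>R v0 (X + \<epsilon> n) s) / 2))) = (%s. indicator S s *\<^sub>R D n s)"
   by (auto simp: D_def indicator_def fun_eq_iff)
  finally show ?thesis .
 qed
 have Em: "E n \<in> borel_measurable lborel" for n
  unfolding E_def using Dm[of n] by measurable
 have Eb: "norm (E n w) <= C * B * (1 / (1 + w^2))" for n w
 proof (cases "s0 + \<epsilon> n * w \<in> S")
  case True
  let ?s = "s0 + \<epsilon> n * w"
  have n1: "norm (?z n) = \<epsilon> n" "norm (?t ?s) = \<epsilon> n * \<bar>w\<bar>"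
   using e(1)[of n] \<beta> by (simp_all add: norm_mult abs_mult)
  have "norm (h (?z n) (?t ?s)) <= C * \<epsilon> n / (\<epsilon> n + \<epsilon> n * \<bar>w\<bar>)^2 * exp (- \<mu> * (\<epsilon> n + \<epsilon> n * \<bar>w\<bar>))"
   using kb[OF SZ_om SZ[OF True], of "\<epsilon> n"] e(1)[of n] unfolding n1 by (simp add: add_pos_nonneg)
  also have "... <= C * \<epsilon> n / (\<epsilon> n + \<epsilon> n * \<bar>w\<bar>)^2 * 1" using e(1)[of n] C by (intro mult_left_mono) auto
  also have "... = C / (1 + \<bar>w\<bar>)^2 / \<epsilon> n"
  proof -
   have "\<epsilon> n + \<epsilon> n * \<bar>w\<bar> = \<epsilon> n * (1 + \<bar>w\<bar>)" by (simp add: algebra_simps)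
   then show ?thesis using e(1)[of n] by (simp add: power2_eq_square)
  qed
  also have "... <= C / (1 + w^2) / \<epsilon> n"
  proof -
   have "1 + w^2 <= (1 + \<bar>w\<bar>)^2" by (simp add: power2_eq_square algebra_simps abs_mult_self_eq)
   then show ?thesis using e(1)[of n] C by (intro divide_right_mono frac_le) (auto intro: add_pos_nonneg)
  qed
  finally have hb: "norm (h (?z n) (?t ?s)) <= C / (1 + w^2) / \<epsilon> n" .
  have v: "norm ((v0 (X - \<epsilon> n) ?s + v0 (X + \<epsilon> n) ?s) / 2) <= B"
   using norm_triangle_ineq[of "v0 (X - \<epsilon> n) ?s" "v0 (X + \<epsilon> n) ?s"] bd[OF e(2) True, of n] bd[OF e(3) True, of n] by (simp add: norm_divide)
  have "norm (E n w) = \<epsilon> n * (norm (h (?z n) (?t ?s)) * norm ((v0 (X - \<epsilon> n) ?s + v0 (X + \<epsilon> n) ?s) / 2))"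
   using True e(1)[of n] \<beta> by (simp add: E_def D_def norm_mult)
  also have "... <= \<epsilon> n * ((C / (1 + w^2) / \<epsilon> n) * B)"
   using mult_mono[OF hb v] e(1)[of n] C by (intro mult_left_mono) (auto intro: add_nonneg_nonneg)
  also have "... = C * B * (1 / (1 + w^2))" using e(1)[of n] by simp
  finally show ?thesis .
 next
  case False
  then show ?thesis using C B0 by (simp add: E_def)
 qed
 have Ewi: "integrable lborel (%w::real. C * B * (1 / (1 + w^2)))" using integrable_inverse_1_plus_sq by (rule integrable_mult_right)
 have Ei: "integrable lborel (E n)" for n
  by (rule Bochner_Integration.integrable_bound[OF Ewi Em]) (use order.trans[OF Eb abs_ge_self] in \<open>simp only: real_norm_def AE_I2\<close>)
 have Di: "integrable lborel (%s. indicator S s *\<^sub>R D n s)" for n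
 proof -
  have "integrable lborel (%w. (1 / \<epsilon> n) *\<^sub>R E n w)" using Ei[of n] by (rule integrable_scaleR_right)
  also have "(%w. (1 / \<epsilon> n) *\<^sub>R E n w) = (%w. indicator S (s0 + \<epsilon> n * w) *\<^sub>R D n (s0 + \<epsilon> n * w))"
   using e(1)[of n] by (auto simp: E_def fun_eq_iff)
  finally show ?thesis using lborel_integrable_real_affine_iff[of "\<epsilon> n" "%s. indicator S s *\<^sub>R D n s" s0] e(1)[of n] by simp
 qed
 have DE: "(LINT s|lborel. indicator S s *\<^sub>R D n s) = (LINT w|lborel. E n w)" for n
  using lborel_integral_real_affine[of "\<epsilon> n" "%s. indicator S s *\<^sub>R D n s" s0] e(1)[of n] unfolding E_def Bochner_Integration.integral_scaleR_right by (simp only: abs_of_pos)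
 \<comment> \<open>The direction \<open>om\<close> of the shift and the direction
   \<open>\<beta>\<close> of the line may differ. Their ratio becomes the complex parameter of the
   limiting Poisson kernel, whose integral is still \<open>pi\<close> because its real part is
   positive.\<close>
 define \<rho> where "\<rho> = om / \<beta>"
 have \<rho>: "norm \<rho> = 1" "Re \<rho> > 0" using \<beta> by (auto simp: \<rho>_def norm_divide)
 have b0: "\<beta> ~= 0" using \<beta> by auto
 have "(%n. LINT w|lborel. E n w) \<longlonglongrightarrow> (LINT w|lborel. (\<rho> / (\<rho>^2 + (of_real w)^2)) * (v0 X s0 / of_real pi))"
 proof (rule integral_dominated_convergence[OF _ Em Ewi])
  show "AE w in lborel. norm (E n w) <= C * B * (1 / (1 + w^2))" for n using Eb by (intro AE_I2)
  show "AE w in lborel. (%n. E n w) \<longlonglongrightarrow> (\<rho> / (\<rho>^2 + (of_real w)^2)) * (v0 X s0 / of_real pi)"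
  proof (rule AE_I2)
   fix w :: real
   define c where "c = om^2 + (of_real w)^2 * \<beta>^2"
   have c: "c ~= 0" using nz by (simp add: c_def)
   have q: "(?z n)^2 + (of_real (s0 + \<epsilon> n * w - s0) * \<beta>)^2 = of_real ((\<epsilon> n)^2) * c" for n
    by (simp add: c_def power_mult_distrib algebra_simps)
   have "filterlim (%n. of_real ((\<epsilon> n)^2) * c) (at 0) sequentially"
   proof (rule filterlim_atI)
    have "(%n. of_real ((\<epsilon> n)^2) * c) \<longlonglongrightarrow> of_real (0^2) * c" by (intro tendsto_intros e0)
    then show "(%n. of_real ((\<epsilon> n)^2) * c) \<longlonglongrightarrow> 0" by simp
    show "\<forall>\<^sub>F n in sequentially. of_real ((\<epsilon> n)^2) * c ~= 0" using c e(1) by (simp add: less_imp_neq[symmetric])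
   qed
   from filterlim_compose[OF PP_tendsto this]
   have P: "(%n. PP (of_real ((\<epsilon> n)^2) * c)) \<longlonglongrightarrow> - 1 / (4 * of_real pi)" .
   have vl: "(%n. v0 (X - \<epsilon> n) (s0 + \<epsilon> n * w)) \<longlonglongrightarrow> v0 X s0" "(%n. v0 (X + \<epsilon> n) (s0 + \<epsilon> n * w)) \<longlonglongrightarrow> v0 X s0"
    using vlim[OF cont(1), of "-1" s0 w] vlim[OF cont(1), of 1 s0 w] s0 by simp_all
   have "(%n. \<beta> * ((- 4 * om * PP (of_real ((\<epsilon> n)^2) * c) / c) * ((v0 (X - \<epsilon> n) (s0 + \<epsilon> n * w) + v0 (X + \<epsilon> n) (s0 + \<epsilon> n * w)) / 2)))
     \<longlonglongrightarrow> \<beta> * ((- 4 * om * (- 1 / (4 * of_real pi)) / c) * ((v0 X s0 + v0 X s0) / 2))"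
    by (intro tendsto_intros P vl c) auto
   moreover have "\<beta> * ((- 4 * om * (- 1 / (4 * of_real pi)) / c) * ((v0 X s0 + v0 X s0) / 2)) = (\<rho> / (\<rho>^2 + (of_real w)^2)) * (v0 X s0 / of_real pi)"
   proof -
    have "c = \<beta>^2 * (\<rho>^2 + (of_real w)^2)" using b0 by (simp add: c_def \<rho>_def field_simps)
    moreover have "om = \<rho> * \<beta>" using b0 by (simp add: \<rho>_def)
    ultimately show ?thesis using b0 by (simp add: power2_eq_square)
   qed
   moreover have "\<forall>\<^sub>F n in sequentially. \<beta> * ((- 4 * om * PP (of_real ((\<epsilon> n)^2) * c) / c) * ((v0 (X - \<epsilon> n) (s0 + \<epsilon> n * w) + v0 (X + \<epsilon> n) (s0 + \<epsilon> n * w)) / 2)) = E n w"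
   proof -
    have "(%n. s0 + \<epsilon> n * w) \<longlonglongrightarrow> s0 + 0 * w" by (intro tendsto_intros e0)
    then have "\<forall>\<^sub>F n in sequentially. s0 + \<epsilon> n * w \<in> {s0-\<delta><..<s0+\<delta>}"
     using S(2) by (intro topological_tendstoD) auto
    then show ?thesis
    proof eventually_elim
     case (elim n)
     have "h (?z n) (of_real (s0 + \<epsilon> n * w - s0) * \<beta>) = - 4 * om * PP (of_real ((\<epsilon> n)^2) * c) / c / of_real (\<epsilon> n)"
      unfolding h_def q N1_def using e(1)[of n] c by (simp add: power2_eq_square mult.commute)
     moreover have "s0 + \<epsilon> n * w \<in> S" using elim S(3) by blast
     ultimately show ?case
      using e(1)[of n] unfolding E_def D_def by (simp add: scaleR_conv_of_real)
    qed
   qed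
   ultimately show "(%n. E n w) \<longlonglongrightarrow> (\<rho> / (\<rho>^2 + (of_real w)^2)) * (v0 X s0 / of_real pi)"
    by (simp only: Lim_transform_eventually)
  qed
 qed simp
 also have "(LINT w|lborel. (\<rho> / (\<rho>^2 + (of_real w)^2)) * (v0 X s0 / of_real pi)) = v0 X s0"
  unfolding integral_mult_left_zero poisson_kernel_integral[OF \<rho>] by simp
 finally have LD: "(%n. LINT s|lborel. indicator S s *\<^sub>R D n s) \<longlonglongrightarrow> v0 X s0" unfolding DE .
 have "(LINT s:S|lborel. f (X - \<epsilon> n) s - f (X + \<epsilon> n) s) = (LINT s|lborel. indicator S s *\<^sub>R A n s) - (LINT s|lborel. indicator S s *\<^sub>R D n s)" for n
  unfolding set_lebesgue_integral_def fAD scaleR_diff_right by (rule Bochner_Integration.integral_diff[OF ibase Di])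
 then have "(%n. LINT s:S|lborel. f (X - \<epsilon> n) s - f (X + \<epsilon> n) s) \<longlonglongrightarrow> 0 - v0 X s0"
  using tendsto_diff[OF LA LD] by (simp only:)
 then show ?thesis by (simp add: \<epsilon>_def)
qed

text \<open>The point \<open>tau a \<theta> (a + s)\<close> of the scaled contour; its negative is
  the point at distance \<open>s\<close> beyond the other end.\<close>

definition cs :: "real => complex" where "cs s = of_real a + rot s"

text \<open>The law of cosines with a nonnegative mixed term, because
  \<open>cos \<theta> > 0\<close>.\<close>

lemma SZ_D:
 assumes "0 <= d" "d <= 2 * a" "0 <= t"
 shows "of_real d + rot t \<in> SZ" "d <= norm (of_real d + rot t)" "t <= norm (of_real d + rot t)"
proof -
 show "of_real d + rot t \<in> SZ" using ZZ_I[OF assms] by (auto simp: SZ_def)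
 have n: "(norm (of_real d + rot t))^2 = d^2 + t^2 + 2 * d * t * cos \<theta>"
 proof -
  have "(norm (of_real d + rot t))^2 = (d + t * cos \<theta>)^2 + (t * sin \<theta>)^2" by (simp add: cmod_power2)
  also have "... = d^2 + t^2 * ((cos \<theta>)^2 + (sin \<theta>)^2) + 2 * d * t * cos \<theta>" by algebra
  finally show ?thesis by simp
 qed
 have "0 <= 2 * d * t * cos \<theta>" using assms cos_theta by simp
 then have "d^2 <= (norm (of_real d + rot t))^2" "t^2 <= (norm (of_real d + rot t))^2"
  unfolding n by (auto simp: add_increasing2)
 then show "d <= norm (of_real d + rot t)" "t <= norm (of_real d + rot t)"
  by (auto intro: power2_le_imp_le)
qed

lemma SZ_real: "\<bar>d\<bar> <= 2 * a ==> of_real d \<in> SZ"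
 using SZ_D(1)[of "\<bar>d\<bar>" 0] SZ_minus[of "of_real d"] by (cases "d >= 0") auto

lemma SZ_cs: "\<sigma> >= 0 ==> \<bar>y\<bar> <= a ==> of_real y - cs \<sigma> \<in> SZ & of_real y + cs \<sigma> \<in> SZ &
  max (a - y) \<sigma> <= norm (of_real y - cs \<sigma>) & max (a + y) \<sigma> <= norm (of_real y + cs \<sigma>)"
proof -
 assume s: "\<sigma> >= 0" and y: "\<bar>y\<bar> <= a"
 have 1: "of_real y - cs \<sigma> = - (of_real (a - y) + rot \<sigma>)" "of_real y + cs \<sigma> = of_real (a + y) + rot \<sigma>"
  by (simp_all add: cs_def)
 show ?thesis unfolding 1 SZ_minus norm_minus_cancel
  using SZ_D[of "a - y" \<sigma>] SZ_D[of "a + y" \<sigma>] s y by auto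
qed

lemma norm_of_real_om [simp]: "norm (rot t) = \<bar>t\<bar>"
 by (simp add: norm_mult)

text \<open>The height difference between a source and a point of a diagonal ray is either a
  multiple of \<open>om\<close> or carries the full side length, so it lies in \<open>SZ\<close> in
  both cases. The lower bounds add the depth \<open>s\<close> of the ray point because source and
  ray point may have the same height.\<close>

lemma SZ_src:
 assumes "\<sigma> > 0" "w = cs \<sigma> | w = - cs \<sigma>" "s >= 0"
 shows "of_real a - w + rot s \<in> SZ" "\<sigma> <= s + norm (of_real a - w + rot s)"
  "- of_real a - w + of_real s * (- om) \<in> SZ" "\<sigma> <= s + norm (- of_real a - w + of_real s * (- om))"
proof -
 have z: "(of_real a - w + rot s = rot (s - \<sigma>) & - of_real a - w + of_real s * (- om) = - (of_real (2*a) + rot (s + \<sigma>)))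
  | (of_real a - w + rot s = of_real (2*a) + rot (s + \<sigma>) & - of_real a - w + of_real s * (- om) = rot (\<sigma> - s))"
  using assms(2)
 proof
  assume w: "w = cs \<sigma>" show ?thesis unfolding w by (rule disjI1) (simp add: cs_def algebra_simps)
 next
  assume w: "w = - cs \<sigma>" show ?thesis unfolding w by (rule disjI2) (simp add: cs_def algebra_simps)
 qed
 have s: "of_real (2*a) + rot (s + \<sigma>) \<in> SZ" "s + \<sigma> <= norm (of_real (2*a) + rot (s + \<sigma>))"
  using SZ_D[of "2*a" "s + \<sigma>"] a_pos assms by auto
 show "of_real a - w + rot s \<in> SZ" "\<sigma> <= s + norm (of_real a - w + rot s)"
  "- of_real a - w + of_real s * (- om) \<in> SZ" "\<sigma> <= s + norm (- of_real a - w + of_real s * (- om))"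
  using z assms s by (elim disjE conjE; simp only: SZ_minus SZ_om norm_minus_cancel norm_of_real_om; linarith)+
qed

lemma pfld_S:
 assumes "\<sigma> > 0" "w = cs \<sigma> | w = - cs \<sigma>"
 shows "pfld (fS w) a 1 {0..}"
 unfolding pfld_def
proof (intro conjI)
 have e1: "0 + rot l + of_real s * (1 * om) = rot (l + s)" for l s by (simp add: algebra_simps)
 show "fld (fS w) (1 * om) om (of_real a) {0..} {0..}"
 proof (rule fld_kernels(2)[where d=\<sigma> and M=0 and \<xi>=0, OF assms(1) _ refl refl], unfold e1 Let_def norm_of_real_om, intro conjI SZ_om)
  fix l s :: real assume "l \<in> {0..}" "s \<in> {0..}"
  then have ls: "l >= 0" "s >= 0" by auto
  show "of_real a - w + rot s \<in> SZ" using SZ_src[OF assms ls(2)] by blast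
  show "\<sigma> <= \<bar>l + s\<bar> + norm (of_real a - w + rot s)" "\<bar>l\<bar> + \<bar>s\<bar> - 0 <= \<bar>l + s\<bar> + norm (of_real a - w + rot s)"
   using SZ_src(2)[OF assms ls(2)] ls by auto
 qed
 show "fld (fS w) (1 * om) (- om) (- of_real a) {0..} {0..}"
 proof (rule fld_kernels(2)[where d=\<sigma> and M=0 and \<xi>=0, OF assms(1) _ refl refl], unfold e1 Let_def norm_of_real_om, intro conjI SZ_om)
  fix l s :: real assume "l \<in> {0..}" "s \<in> {0..}"
  then have ls: "l >= 0" "s >= 0" by auto
  show "- of_real a - w + of_real s * (- om) \<in> SZ" using SZ_src[OF assms ls(2)] by blast
  show "\<sigma> <= \<bar>l + s\<bar> + norm (- of_real a - w + of_real s * (- om))" "\<bar>l\<bar> + \<bar>s\<bar> - 0 <= \<bar>l + s\<bar> + norm (- of_real a - w + of_real s * (- om))"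
   using SZ_src(4)[OF assms ls(2)] ls by auto
 qed
 have e2: "0 + rot l + of_real s * 0 = rot l" "0 - w + of_real s * 1 = of_real s - w" for l s :: real by simp_all
 show "fld (fS w) 0 1 0 {0..} {-a..a}"
 proof (rule fld_kernels(2)[where d=\<sigma> and M=a and \<xi>=0, OF assms(1) _ refl refl], unfold e2 Let_def, intro conjI SZ_om)
  fix l s :: real assume "l \<in> {0..}" "s \<in> {-a..a}"
  then have ls: "l >= 0" "\<bar>s\<bar> <= a" by auto
  show "of_real s - w \<in> SZ" "\<sigma> <= norm (rot l) + norm (of_real s - w)"
   using assms SZ_cs[OF _ ls(2), of \<sigma>] by (auto simp: add_increasing)
  show "\<bar>l\<bar> + \<bar>s\<bar> - a <= norm (rot l) + norm (of_real s - w)" using ls unfolding norm_of_real_om by (simp add: add_increasing2)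
 qed
qed

text \<open>On the two rays the height of the pole alone keeps it away, since
  \<open>|y0| < a\<close>. Only on the side itself must shifts near \<open>X\<close> be
  excluded.\<close>

lemma pfld_G:
 assumes y0: "\<bar>y0\<bar> < a" and X: "X > 0"
 shows "fld (fG (rot X) (of_real y0)) (1 * om) om (of_real a) {0..} {0..}"
  and "fld (fG (rot X) (of_real y0)) (1 * om) (- om) (- of_real a) {0..} {0..}"
  and "e > 0 ==> L \<subseteq> {0..} ==> L \<subseteq> {..X-e} | L \<subseteq> {X+e..} ==> pfld (fG (rot X) (of_real y0)) a 1 L"
proof -
 let ?g = "fG (rot X) (of_real y0)"
 have gen: "fld ?g (1 * om) (of_real c * om) (of_real (c * a)) {0..} {0..}" if c: "c = 1 | c = -1" for c :: real
 proof (rule fld_kernels(1)[where d="a - c * y0" and M=X and \<xi>="- (rot X)" and \<zeta>="of_real (c * a) - of_real y0", OF _ _ refl refl], unfold Let_def)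
  show y: "0 < a - c * y0" using c y0 by auto
  have y2: "a - c * y0 <= 2 * a" using c y0 by auto
  fix l s :: real assume ls: "l \<in> {0..}" "s \<in> {0..}"
  have e: "- (rot X) + rot l + of_real s * (1 * om) = rot (l + s - X)" by (simp add: algebra_simps)
  have e2: "of_real (c * a) - of_real y0 + of_real s * (of_real c * om) = of_real c * (of_real (a - c * y0) + rot s)" using c by (auto simp: algebra_simps)
  have e3: "(of_real c * z \<in> SZ) = (z \<in> SZ)" "norm (of_real c * z) = norm z" for z using c by auto
  show "- (rot X) + rot l + of_real s * (1 * om) \<in> SZ & of_real (c * a) - of_real y0 + of_real s * (of_real c * om) \<in> SZ &
    a - c * y0 <= norm (- (rot X) + rot l + of_real s * (1 * om)) + norm (of_real (c * a) - of_real y0 + of_real s * (of_real c * om)) &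
    \<bar>l\<bar> + \<bar>s\<bar> - X <= norm (- (rot X) + rot l + of_real s * (1 * om)) + norm (of_real (c * a) - of_real y0 + of_real s * (of_real c * om))"
   unfolding e e2 e3 norm_of_real_om using SZ_D[OF less_imp_le[OF y] y2, of s] ls unfolding atLeast_iff
   by (intro conjI SZ_om; linarith?)
 qed
 from gen[of 1] gen[of "-1"]
 show up: "fld ?g (1 * om) om (of_real a) {0..} {0..}" and dn: "fld ?g (1 * om) (- om) (- of_real a) {0..} {0..}" by simp_all
 show "pfld ?g a 1 L" if e: "e > 0" "L \<subseteq> {0..}" "L \<subseteq> {..X-e} | L \<subseteq> {X+e..}"
 proof -
  have "fld ?g 0 1 0 L {-a..a}"
  proof (rule fld_kernels(1)[where d=e and M="X + a" and \<xi>="- (rot X)" and \<zeta>="0 - of_real y0", OF e(1) _ refl refl], unfold Let_def)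
   fix l s :: real assume ls: "l \<in> L" "s \<in> {-a..a}"
   have e1: "- (rot X) + rot l + of_real s * 0 = rot (l - X)" "0 - of_real y0 + of_real s * 1 = complex_of_real (s - y0)" by (simp_all add: algebra_simps)
   have "of_real (s - y0) \<in> SZ" using ls(2) y0 by (intro SZ_real) auto
   moreover have "e <= \<bar>l - X\<bar>" "\<bar>l\<bar> = l" "\<bar>s\<bar> <= a" using e ls by auto
   ultimately show "- (rot X) + rot l + of_real s * 0 \<in> SZ & 0 - of_real y0 + of_real s * 1 \<in> SZ &
     e <= norm (- (rot X) + rot l + of_real s * 0) + norm (0 - of_real y0 + of_real s * 1 :: complex) &
     \<bar>l\<bar> + \<bar>s\<bar> - (X + a) <= norm (- (rot X) + rot l + of_real s * 0) + norm (0 - of_real y0 + of_real s * 1 :: complex)"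
    unfolding e1 norm_of_real_om norm_of_real by (intro conjI SZ_om; linarith?)
  qed
  then show ?thesis unfolding pfld_def using fld_subset[OF up] fld_subset[OF dn] e(2) by blast
 qed
qed

lemma fld_G_straight:
 assumes x: "x > 0" and X: "X > 0" and L: "L \<subseteq> {0..}"
 shows "!!c S. c = 1 | c = -1 ==> fld (fG (- (rot X)) (rot x)) (0 * om) (c * om) 0 L S"
  and "!!c S e. e > 0 ==> L \<subseteq> {0..X-e} | L \<subseteq> {X+e..} ==> c = 1 | c = -1 ==> fld (fG (rot X) (rot x)) (0 * om) (c * om) 0 L S"
  and "fld (fG (rot X) (rot x)) (0 * om) (- om) 0 L {0..}"
  and "fld (fG (rot X) (rot x)) 0 1 0 L {0}"
  and "fld (fG (- (rot X)) (rot x)) 0 1 0 L {0}"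
proof -
 have gen: "fld (fG (rot p) (rot x)) (0 * om) (c * om) 0 L S"
  if c: "c = 1 | c = -1" and d: "d > 0" "!!l s. l \<in> L ==> s \<in> S ==> d <= \<bar>l - p\<bar> + \<bar>s - (if c = 1 then x else -x)\<bar>" for p c d S
 proof (rule fld_kernels(1)[where d=d and M="\<bar>p\<bar> + x" and \<xi>="- (rot p)" and \<zeta>="0 - rot x", OF d(1) _ refl refl], unfold Let_def)
  fix l s assume ls: "l \<in> L" "s \<in> S"
  have e: "- (rot p) + rot l + of_real s * (0 * om) = rot (l - p)" by (simp add: algebra_simps)
  have e': "0 - rot x + of_real s * (c * om) = rot ((if c = 1 then s else - s) - x)" using c by (auto simp: algebra_simps)
  have "\<bar>(if c = 1 then s else - s) - x\<bar> = \<bar>s - (if c = 1 then x else -x)\<bar>" by auto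
  moreover have "\<bar>l\<bar> + \<bar>s\<bar> - (\<bar>p\<bar> + x) <= \<bar>l - p\<bar> + \<bar>s - (if c = 1 then x else -x)\<bar>" using x by auto
  ultimately show "- (rot p) + rot l + of_real s * (0 * om) \<in> SZ & 0 - rot x + of_real s * (c * om) \<in> SZ &
    d <= norm (- (rot p) + rot l + of_real s * (0 * om)) + norm (0 - rot x + of_real s * (c * om)) &
    \<bar>l\<bar> + \<bar>s\<bar> - (\<bar>p\<bar> + x) <= norm (- (rot p) + rot l + of_real s * (0 * om)) + norm (0 - rot x + of_real s * (c * om))"
   unfolding e e' norm_of_real_om using d(2)[OF ls] by (simp only: SZ_om)
 qed
 have L0: "l >= 0" if "l \<in> L" for l using L that by auto
 show "fld (fG (- (rot X)) (rot x)) (0 * om) (c * om) 0 L S" if "c = 1 | c = -1" for c S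
  using gen[of c X S "- X", OF that X] L0 X by (force simp: add_increasing2)
 show "fld (fG (rot X) (rot x)) (0 * om) (c * om) 0 L S" if "e > 0" "L \<subseteq> {0..X-e} | L \<subseteq> {X+e..}" "c = 1 | c = -1" for c S e
  by (rule gen[OF that(3,1)]) (use that(2) in \<open>force simp: add_increasing2\<close>)
 show "fld (fG (rot X) (rot x)) (0 * om) (- om) 0 L {0..}"
  using gen[of "-1" x "{0..}" X] x by (simp add: add_increasing)
 have g0: "fld (fG (rot p) (rot x)) 0 1 0 L {0}" for p
 proof (rule fld_kernels(1)[where d=x and M="\<bar>p\<bar>" and \<xi>="- (rot p)" and \<zeta>="0 - rot x", OF x _ refl refl], unfold Let_def)
  fix l s :: real assume ls: "l \<in> L" "s \<in> {0}"
  have e: "- (rot p) + rot l + of_real s * 0 = rot (l - p)" by (simp add: algebra_simps)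
  have e': "0 - rot x + of_real s * 1 = rot (- x)" using ls by simp
  show "- (rot p) + rot l + of_real s * 0 \<in> SZ & 0 - rot x + of_real s * 1 \<in> SZ &
    x <= norm (- (rot p) + rot l + of_real s * 0) + norm (0 - rot x + of_real s * 1) &
    \<bar>l\<bar> + \<bar>s\<bar> - \<bar>p\<bar> <= norm (- (rot p) + rot l + of_real s * 0) + norm (0 - rot x + of_real s * 1)"
   unfolding e e' norm_of_real_om using ls x by (simp only: SZ_om) auto
 qed
 show "fld (fG (rot X) (rot x)) 0 1 0 L {0}" "fld (fG (- (rot X)) (rot x)) 0 1 0 L {0}"
  using g0[of X] g0[of "- X"] by simp_all
qed

lemma pfld_R:
 assumes s: "\<sigma> > 0" and d: "0 <= d" "d <= 2 * a"
 shows "pfld (fR (of_real d + rot \<sigma>)) 0 0 {0..}"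
proof -
 have g: "fld (fR (of_real d + rot \<sigma>)) (0 * om) \<beta> 0 {0..} S"
  if \<beta>: "!!s. s \<in> S ==> of_real s * \<beta> \<in> SZ & \<bar>s\<bar> <= norm (of_real s * \<beta>)" for \<beta> S
 proof (rule fld_kernels(3)[where d=\<sigma> and M=0 and \<zeta>=0, OF s _ refl], unfold Let_def)
  fix l s' :: real assume ls: "l \<in> {0..}" "s' \<in> S"
  have e: "of_real d + rot \<sigma> + rot l + of_real s' * (0 * om) = of_real d + rot (\<sigma> + l)" by (simp add: algebra_simps)
  show "of_real d + rot \<sigma> + rot l + of_real s' * (0 * om) \<in> SZ & 0 + of_real s' * \<beta> \<in> SZ &
   \<sigma> <= norm (of_real d + rot \<sigma> + rot l + of_real s' * (0 * om)) + norm (0 + of_real s' * \<beta>) &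
   \<bar>l\<bar> + \<bar>s'\<bar> - 0 <= norm (of_real d + rot \<sigma> + rot l + of_real s' * (0 * om)) + norm (0 + of_real s' * \<beta>)"
   unfolding e using SZ_D[OF d, of "\<sigma> + l"] \<beta>[OF ls(2)] ls s by (auto intro: order.trans add_increasing2)
 qed
 show ?thesis
  unfolding pfld_def using g[of "{0..}" om] g[of "{0..}" "- om"] g[of "{0}" 1] SZ_om[of 0] SZ_om[of "- s" for s]
  by (auto simp: norm_mult)
qed

lemma flux_LINT_continuous:
 assumes u: "fld u \<alpha> \<beta> \<zeta> L S" and g: "fld g \<alpha> \<beta> \<zeta> L S" and S: "S \<in> sets borel"
  and l: "!!n. X n \<in> L" "X \<longlonglongrightarrow> l" "l \<in> L"
 shows "(%n. LINT s:S|lborel. fx \<alpha> \<beta> \<zeta> u g (X n) s) \<longlonglongrightarrow>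
  (LINT s:S|lborel. fx \<alpha> \<beta> \<zeta> u g l s)"
proof -
 obtain B \<mu> where B: "B > 0" "\<mu> > 0"
  "!!l s. l \<in> L ==> s \<in> S ==> norm (fx \<alpha> \<beta> \<zeta> u g l s) <= B * exp (- \<mu> * (\<bar>l\<bar> + \<bar>s\<bar>))"
  using flux_bound[OF u g] by metis
 have m: "(%s. indicator S s *\<^sub>R fx \<alpha> \<beta> \<zeta> u g l s) \<in> borel_measurable lborel" if "l \<in> L" for l
  using flux_integrable[OF u g that S] unfolding set_integrable_def by (rule borel_measurable_integrable)
 show ?thesis
  unfolding set_lebesgue_integral_def
 proof (rule integral_dominated_convergence[where w="%s. B * exp (- \<mu> * \<bar>s\<bar>)", OF m[OF l(3)] m[OF l(1)]])
  show "integrable lborel (%s. B * exp (- \<mu> * \<bar>s\<bar>))" using integrable_exp_neg_abs[OF B(2)] by simp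
  show "AE s in lborel. norm (indicator S s *\<^sub>R fx \<alpha> \<beta> \<zeta> u g (X n) s) <= B * exp (- \<mu> * \<bar>s\<bar>)" for n
  proof (rule AE_I2)
   fix s
   have "B * exp (- \<mu> * (\<bar>X n\<bar> + \<bar>s\<bar>)) <= B * exp (- \<mu> * \<bar>s\<bar>)" using B by (auto intro!: mult_left_mono)
   then show "norm (indicator S s *\<^sub>R fx \<alpha> \<beta> \<zeta> u g (X n) s) <= B * exp (- \<mu> * \<bar>s\<bar>)"
    using order.trans[OF B(3)[OF l(1)[of n]]] B(1) by (cases "s \<in> S") auto
  qed
  show "AE s in lborel. (%n. indicator S s *\<^sub>R fx \<alpha> \<beta> \<zeta> u g (X n) s) \<longlonglongrightarrow>
    indicator S s *\<^sub>R fx \<alpha> \<beta> \<zeta> u g l s"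
  proof (rule AE_I2)
   fix s
   show "(%n. indicator S s *\<^sub>R fx \<alpha> \<beta> \<zeta> u g (X n) s) \<longlonglongrightarrow>
    indicator S s *\<^sub>R fx \<alpha> \<beta> \<zeta> u g l s"
   proof (cases "s \<in> S")
    case True
    have p: "(%n. (X n, s)) \<longlonglongrightarrow> (l, s)" by (intro tendsto_intros l(2))
    have c: "(%n. pt (f i) \<alpha> \<beta> \<zeta> (X n) s) \<longlonglongrightarrow> f i (rot l + of_real s * \<alpha>) (\<zeta> + of_real s * \<beta>)"
     if "fld f \<alpha> \<beta> \<zeta> L S" "i < 3" for f i
    proof -
     have c: "continuous_on (L \<times> S) (%x. pt (f i) \<alpha> \<beta> \<zeta> (fst x) (snd x))"
      using fld_cont[OF that(1)] that(2) by simp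
     from continuous_on_tendsto_compose[OF c p] show ?thesis using l True by simp
    qed
    show ?thesis unfolding flux_def by (intro tendsto_intros c u g) auto
   qed simp
  qed
 qed
qed

lemma pole_sequences:
 fixes X :: real
 assumes "X > 0"
 shows "X / real (n+2) > 0" "X - X / real (n+2) \<in> {0..}" "X + X / real (n+2) \<in> {0..}"
  "(%n. X - X / real (n+2)) \<longlonglongrightarrow> X" "(%n. X + X / real (n+2)) \<longlonglongrightarrow> X"
proof -
 show "X / real (n+2) > 0" "X + X / real (n+2) \<in> {0..}" using assms by auto
 show "X - X / real (n+2) \<in> {0..}" using assms mult_left_mono[of 1 "real n + 2" X] by (simp add: field_simps)
 show "(%n. X - X / real (n+2)) \<longlonglongrightarrow> X" "(%n. X + X / real (n+2)) \<longlonglongrightarrow> X" by real_asymp+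
qed

text \<open>The representation formula at the point \<open>(rot X, y0)\<close>. For shifts before
  \<open>X\<close> the total flux equals its value at 0, for shifts beyond \<open>X\<close> it
  vanishes, and the rays contribute no jump; hence the value at 0 is the jump \<open>- u\<close>
  across the side.\<close>

lemma TT_pole:
 assumes y0: "\<bar>y0\<bar> < a" and X: "X > 0" and u: "pfld u a 1 {0..}"
 shows "TT a 1 u (fG (rot X) (of_real y0)) 0 = - u 0 (rot X) (of_real y0)"
proof -
 let ?g = "fG (rot X) (of_real y0)"
 note ps = pole_sequences[OF X]
 define x where "x = (%n. X - X / real (n+2))" define y where "y = (%n. X + X / real (n+2))"
 have uu: "fld u (1 * om) om (of_real a) {0..} {0..}" "fld u 0 1 0 {0..} {-a..a}" "fld u (1 * om) (- om) (- of_real a) {0..} {0..}"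
  using u unfolding pfld_def by auto
 have gx: "pfld ?g a 1 {0..x n}" and gy: "pfld ?g a 1 {y n..}" for n
  unfolding x_def y_def using ps(1-3)[of n] by (auto intro!: pfld_G(3)[OF y0 X ps(1)[of n]])
 have us: "pfld u a 1 L" if "L \<subseteq> {0..}" for L
  using u that unfolding pfld_def by (auto intro: fld_subset)
 have xy: "x n \<in> {0..}" "y n \<in> {0..}" for n using ps(2,3) by (simp_all add: x_def y_def)
 have "TT a 1 u ?g 0 = TT a 1 u ?g (x n) - TT a 1 u ?g (y n)" for n
 proof -
  have "TT a 1 u ?g (x n) = TT a 1 u ?g 0" by (rule TT_const[OF us gx]) (use xy a_pos in auto)
  moreover have "TT a 1 u ?g (y n) = 0" by (rule TT_eq_0[OF us gy]) (use xy[of n] a_pos in auto)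
  ultimately show ?thesis by simp
 qed
 moreover have "(%n. TT a 1 u ?g (x n) - TT a 1 u ?g (y n)) \<longlonglongrightarrow> - u 0 (rot X) (of_real y0)"
 proof -
  let ?F = "%l s. fx 0 1 0 u ?g l s"
  have m: "(%n. LINT s:{-a..a}|lborel. ?F (X - X / real (n+2)) s - ?F (X + X / real (n+2)) s) \<longlonglongrightarrow> - pt (u 0) 0 1 0 X y0"
  proof -
   obtain B \<mu> where B: "B > 0" "\<mu> > 0" "!!l s i. l \<in> {0..} ==> s \<in> {-a..a} ==> i < 3 ==>
     norm (pt (u i) 0 1 0 l s) <= B * exp (- \<mu> * (\<bar>l\<bar> + \<bar>s\<bar>))"
    using uu(2) unfolding fld_def by blast
   have Fe: "?F l s = 1 * (G (rot (l - X)) (of_real (s - y0) * 1) * pt (u 1) 0 1 0 l s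
     - pt (u 0) 0 1 0 l s * G1 (rot (l - X)) (of_real (s - y0) * 1))" for l s
    by (simp add: flux_def fG_def algebra_simps)
   show ?thesis
    unfolding Fe
   proof (rule pole_limit[OF X, where \<delta>="a - \<bar>y0\<bar>" and B=B])
    show "Re (om / 1) > 0" using cos_theta by simp
    show "of_real (s - y0) * 1 \<in> SZ" if "s \<in> {-a..a}" for s unfolding mult_1_right using that y0 by (intro SZ_real) auto
    show "continuous_on ({0..2*X} \<times> {-a..a}) (%x. pt (u 0) 0 1 0 (fst x) (snd x))"
     "continuous_on ({0..2*X} \<times> {-a..a}) (%x. pt (u 1) 0 1 0 (fst x) (snd x))"
     using fld_cont[OF fld_subset[OF uu(2), of "{0..2*X}" "{-a..a}"]] by auto
    show "norm (pt (u 0) 0 1 0 l s) <= B & norm (pt (u 1) 0 1 0 l s) <= B"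
     if "l \<in> {0..2*X}" "s \<in> {-a..a}" for l s
    proof -
     have "B * exp (- \<mu> * (\<bar>l\<bar> + \<bar>s\<bar>)) <= B * 1" using B by (intro mult_left_mono) auto
     then show ?thesis using B(3)[of l s 0] B(3)[of l s 1] that by auto
    qed
   qed (use y0 in auto)
  qed
  have m': "(%n. LINT s:{-a..a}|lborel. ?F (x n) s - ?F (y n) s) \<longlonglongrightarrow> - pt (u 0) 0 1 0 X y0"
   unfolding x_def y_def by (rule m)
  have si: "(LINT s:{-a..a}|lborel. ?F (x n) s - ?F (y n) s) = (LINT s:{-a..a}|lborel. ?F (x n) s) - (LINT s:{-a..a}|lborel. ?F (y n) s)" for n
  proof (rule set_integral_diff)
   show "set_integrable lborel {-a..a} (?F (x n))"
    by (rule flux_integrable[OF fld_subset[OF uu(2)], of "{0..x n}"]) (use gx[of n] xy[of n] in \<open>auto simp: pfld_def\<close>)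
   show "set_integrable lborel {-a..a} (?F (y n))"
    by (rule flux_integrable[OF fld_subset[OF uu(2)], of "{y n..}"]) (use gy[of n] xy[of n] in \<open>auto simp: pfld_def\<close>)
  qed
  have xl: "x \<longlonglongrightarrow> X" "y \<longlonglongrightarrow> X" using ps(4,5) by (simp_all add: x_def y_def)
  have XI: "X \<in> {0..}" using X by simp
  let ?U = "%l. LINT s:{0..}|lborel. fx (1 * om) om (of_real a) u ?g l s" and ?V = "%l. LINT s:{0..}|lborel. fx (1 * om) (- om) (- of_real a) u ?g l s"
  note lims = flux_LINT_continuous[OF uu(1) pfld_G(1)[OF y0 X] _ xy(1) xl(1) XI] flux_LINT_continuous[OF uu(1) pfld_G(1)[OF y0 X] _ xy(2) xl(2) XI]
   flux_LINT_continuous[OF uu(3) pfld_G(2)[OF y0 X] _ xy(1) xl(1) XI] flux_LINT_continuous[OF uu(3) pfld_G(2)[OF y0 X] _ xy(2) xl(2) XI]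
  have "TT a 1 u ?g (x n) - TT a 1 u ?g (y n) = (?U (x n) - ?U (y n)) + (LINT s:{-a..a}|lborel. ?F (x n) s - ?F (y n) s) - (?V (x n) - ?V (y n))" for n
   unfolding TT_def si by (simp only: algebra_simps)
  moreover have "(%n. (?U (x n) - ?U (y n)) + (LINT s:{-a..a}|lborel. ?F (x n) s - ?F (y n) s) - (?V (x n) - ?V (y n)))
    \<longlonglongrightarrow> (?U X - ?U X) + (- pt (u 0) 0 1 0 X y0) - (?V X - ?V X)"
   by (intro tendsto_add tendsto_diff lims m') auto
  ultimately show ?thesis by simp
 qed
 ultimately have "(%n::nat. TT a 1 u ?g 0) \<longlonglongrightarrow> - u 0 (rot X) (of_real y0)" by simp
 then show ?thesis by (simp add: LIMSEQ_const_iff)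
qed

lemma h_even [simp]: "h z1 (- z2) = h z1 z2" "h (- z1) z2 = - h z1 z2"
 by (simp_all add: h_def)

lemma LINT_singleton: "(LINT s:{-0..0::real}|lborel. f s) = (0::complex)"
 unfolding set_lebesgue_integral_def
proof (rule integral_eq_zero_AE)
 show "AE s in lborel. indicator {-0..0::real} s *\<^sub>R f s = 0"
  using AE_lborel_singleton[of 0] by eventually_elim simp
qed

text \<open>The same formula for the straight path, with the pole crossed by the upper ray; the
  middle segment degenerates to a point.\<close>

lemma TT_pole_straight:
 assumes x: "x > 0" and X: "X > 0" and u: "pfld u 0 0 {0..}"
 shows "TT 0 0 u (fG (rot X) (rot x)) 0 = - u 0 (rot X) (rot x)"
proof -
 let ?g = "fG (rot X) (rot x)"
 note ps = pole_sequences[OF X]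
 define p where "p = (%n. X - X / real (n+2))" define q where "q = (%n. X + X / real (n+2))"
 have uu: "fld u (0 * om) om 0 {0..} {0..}" "fld u 0 1 0 {0..} {0}" "fld u (0 * om) (- om) 0 {0..} {0..}"
  using u unfolding pfld_def by auto
 have pq: "p n \<in> {0..}" "q n \<in> {0..}" for n using ps(2,3) by (simp_all add: p_def q_def)
 have pl: "p \<longlonglongrightarrow> X" "q \<longlonglongrightarrow> X" using ps(4,5) by (simp_all add: p_def q_def)
 have XI: "X \<in> {0..}" using X by simp
 have gu: "fld ?g (0 * om) om 0 {0..p n} {0..}" "fld ?g (0 * om) om 0 {q n..} {0..}" for n
  using fld_G_straight(2)[OF x X _ ps(1), of "{0..p n}" n 1 "{0..}"] fld_G_straight(2)[OF x X _ ps(1), of "{q n..}" n 1 "{0..}"] pq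
  by (auto simp: p_def q_def)
 note gd = fld_G_straight(3)[OF x X order.refl]
 have gp: "pfld ?g 0 0 {0..p n}" "pfld ?g 0 0 {q n..}" for n
  unfolding pfld_def using gu[of n] fld_subset[OF gd] fld_G_straight(4)[OF x X] pq by auto
 have us: "pfld u 0 0 L" if "L \<subseteq> {0..}" for L
  using u that unfolding pfld_def by (auto intro: fld_subset)
 let ?U = "%l s. fx (0 * om) om 0 u ?g l s"
 let ?D = "%l s. fx (0 * om) (- om) 0 u ?g l s"
 have TTe: "TT 0 0 u ?g l = (LINT s:{0..}|lborel. ?U l s) - (LINT s:{0..}|lborel. ?D l s)" for l
  unfolding TT_def LINT_singleton by simp
 have "TT 0 0 u ?g 0 = (LINT s:{0..}|lborel. ?U (p n) s - ?U (q n) s) - ((LINT s:{0..}|lborel. ?D (p n) s) - (LINT s:{0..}|lborel. ?D (q n) s))" for n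
 proof -
  have "TT 0 0 u ?g (p n) = TT 0 0 u ?g 0" by (rule TT_const[OF us gp(1)]) (use pq in auto)
  moreover have "TT 0 0 u ?g (q n) = 0" by (rule TT_eq_0[OF us gp(2)]) (use pq[of n] in auto)
  moreover have e: "(LINT s:{0..}|lborel. ?U (p n) s - ?U (q n) s) = (LINT s:{0..}|lborel. ?U (p n) s) - (LINT s:{0..}|lborel. ?U (q n) s)"
   by (intro set_integral_diff flux_integrable[OF fld_subset[OF uu(1)] gu(1)] flux_integrable[OF fld_subset[OF uu(1)] gu(2)]) (use pq in auto)
  ultimately have "TT 0 0 u ?g 0 = TT 0 0 u ?g (p n) - TT 0 0 u ?g (q n)" by simp
  moreover have "(A - C) - (B - D) = (A - B) - (C - D)" for A B C D :: complex by simp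
  ultimately show ?thesis unfolding TTe[of "p n"] TTe[of "q n"] e by (simp only:)
 qed
 moreover have "(%n. (LINT s:{0..}|lborel. ?U (p n) s - ?U (q n) s) - ((LINT s:{0..}|lborel. ?D (p n) s) - (LINT s:{0..}|lborel. ?D (q n) s)))
  \<longlonglongrightarrow> - pt (u 0) (0 * om) om 0 X x - ((LINT s:{0..}|lborel. ?D X s) - (LINT s:{0..}|lborel. ?D X s))"
 proof (intro tendsto_diff flux_LINT_continuous[OF uu(3) gd _ pq(1) pl(1) XI] flux_LINT_continuous[OF uu(3) gd _ pq(2) pl(2) XI])
  obtain B \<mu> where B: "B > 0" "\<mu> > 0" "!!l s i. l \<in> {0..} ==> s \<in> {0..} ==> i < 3 ==>
    norm (pt (u i) (0 * om) om 0 l s) <= B * exp (- \<mu> * (\<bar>l\<bar> + \<bar>s\<bar>))"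
   using uu(1) unfolding fld_def by blast
  have Fe: "?U l s = om * (G (rot (l - X)) (rot (s - x)) * pt (u 1) (0 * om) om 0 l s
    - pt (u 0) (0 * om) om 0 l s * G1 (rot (l - X)) (rot (s - x)))" for l s
   by (simp add: flux_def fG_def algebra_simps)
  show "(%n. LINT s:{0..}|lborel. ?U (p n) s - ?U (q n) s) \<longlonglongrightarrow> - pt (u 0) (0 * om) om 0 X x"
   unfolding Fe p_def q_def
  proof (rule pole_limit[OF X, where \<delta>=x and B=B])
   show "continuous_on ({0..2*X} \<times> {0..}) (%x. pt (u 0) (0 * om) om 0 (fst x) (snd x))"
    "continuous_on ({0..2*X} \<times> {0..}) (%x. pt (u 1) (0 * om) om 0 (fst x) (snd x))"
    using fld_cont[OF fld_subset[OF uu(1), of "{0..2*X}" "{0..}"]] by auto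
   show "norm (pt (u 0) (0 * om) om 0 l s) <= B & norm (pt (u 1) (0 * om) om 0 l s) <= B"
    if "l \<in> {0..2*X}" "s \<in> {0..}" for l s
   proof -
    have "B * exp (- \<mu> * (\<bar>l\<bar> + \<bar>s\<bar>)) <= B * 1" using B that by (intro mult_left_mono) auto
    then show ?thesis using B(3)[of l s 0] B(3)[of l s 1] that by auto
   qed
   show "rot (s - x) \<in> SZ" for s by (rule SZ_om)
  qed (use x cos_theta in auto)
 qed auto
 ultimately have "(%n::nat. TT 0 0 u ?g 0) \<longlonglongrightarrow> - u 0 (rot X) (rot x)" by simp
 then show ?thesis by (simp add: LIMSEQ_const_iff)
qed

text \<open>A kernel of one half-plane restricted to a quarter-plane is reproduced by the Poisson kernel of the
  neighbouring half-plane; this makes the half-plane solutions agree where the half-planes overlap.\<close>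

lemma reproducing:
 assumes x: "x > 0" and X: "X > 0" and \<sigma>: "\<sigma> > 0" and d: "0 <= d" "d <= 2 * a"
 defines "\<sigma>' \<equiv> of_real d + rot \<sigma>"
 shows "om * (LINT t:{0..}|lborel. (h (rot X) (rot (x - t)) - h (rot X) (rot (x + t))) * h (rot t) \<sigma>')
   = h (rot x) (rot X + \<sigma>')"
proof -
 let ?h = "%x t. h (rot X) (rot (x - t)) - h (rot X) (rot (x + t))"
 let ?g = "fG (rot X) (rot x)" and ?g' = "fG (- (rot X)) (rot x)"
 have u: "pfld (fR \<sigma>') 0 0 {0..}" using pfld_R[OF \<sigma> d] by (simp add: \<sigma>'_def)
 have g': "pfld ?g' 0 0 {0..}"
  unfolding pfld_def using fld_G_straight(1)[OF x X order.refl, of 1 "{0..}"] fld_G_straight(1)[OF x X order.refl, of "-1" "{0..}"] fld_G_straight(5)[OF x X order.refl]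
  by auto
 have g: "fld ?g (0 * om) om 0 {0} {0..}" "fld ?g (0 * om) (- om) 0 {0} {0..}"
  using fld_G_straight(2)[OF x X _ X, of "{0}" 1 "{0..}"] fld_subset[OF fld_G_straight(3)[OF x X order.refl], of "{0}" "{0..}"] by auto
 let ?f = "%g c s. fx (0 * om) (c * om) 0 (fR \<sigma>') g 0 s"
 have TTe: "TT 0 0 (fR \<sigma>') g 0 = (LINT s:{0..}|lborel. ?f g 1 s) - (LINT s:{0..}|lborel. ?f g (-1) s)" for g
  unfolding TT_def LINT_singleton by simp
 have i: "set_integrable lborel {0..} (?f ?g 1)" "set_integrable lborel {0..} (?f ?g (-1))"
   "set_integrable lborel {0..} (?f ?g' 1)" "set_integrable lborel {0..} (?f ?g' (-1))"
  using flux_integrable[OF fld_subset g(1), of "fR \<sigma>'" "{0..}" "{0..}" 0] flux_integrable[OF fld_subset g(2), of "fR \<sigma>'" "{0..}" "{0..}" 0]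
   flux_integrable[of "fR \<sigma>'" "0 * om" om 0 "{0..}" "{0..}" ?g' 0] flux_integrable[of "fR \<sigma>'" "0 * om" "- om" 0 "{0..}" "{0..}" ?g' 0] u g'
  by (auto simp: pfld_def)
 \<comment> \<open>Method of images: subtracting the fundamental solution with the mirrored pole at
   depth \<open>- rot X\<close> removes the terms with the normal derivative of the field on the
   path and doubles the other terms, which leaves the kernel \<open>h\<close>. The mirrored pole is
   never crossed, so its flux is 0. On the lower ray the field changes sign, since \<open>h\<close>
   is odd in its first argument; this produces the difference of the kernels at \<open>x - t\<close>
   and \<open>x + t\<close>.\<close>
 have "TT 0 0 (fR \<sigma>') ?g 0 - TT 0 0 (fR \<sigma>') ?g' 0 =
   (LINT s:{0..}|lborel. (?f ?g 1 s - ?f ?g' 1 s) - (?f ?g (-1) s - ?f ?g' (-1) s))"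
  unfolding TTe using i by (simp add: set_integral_diff)
 also have "(%s. (?f ?g 1 s - ?f ?g' 1 s) - (?f ?g (-1) s - ?f ?g' (-1) s)) =
   (%t. (- om) * ((?h x t) * h (rot t) \<sigma>'))"
 proof
  fix t :: real
  have 1: "G1 (- (rot X)) z = h (rot X) z / 2" "G1 (rot X) z = - h (rot X) z / 2"
   "G (- (rot X)) z = G (rot X) z" for z by (simp_all add: G1_def h_def G_def)
  have 2: "rot t - rot x = - (rot (x - t))" "- (rot t) - rot x = - (rot (x + t))"
   by (simp_all add: algebra_simps)
  show "(?f ?g 1 t - ?f ?g' 1 t) - (?f ?g (-1) t - ?f ?g' (-1) t) =
   (- om) * ((?h x t) * h (rot t) \<sigma>')"
   apply (simp add: flux_def fR_def fG_def 1 2 h_even del: of_real_diff of_real_add)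
   apply (simp add: field_simps del: of_real_diff of_real_add)
   done
 qed
 finally have "- fR \<sigma>' 0 (rot X) (rot x) = (- om) *
   (LINT t:{0..}|lborel. (?h x t) * h (rot t) \<sigma>')"
  unfolding set_integral_mult_right TT_pole_straight[OF x X u] TT_eq_0[OF u g' order.refl] by simp
 moreover have "fR \<sigma>' 0 (rot X) (rot x) = h (rot x) (rot X + \<sigma>')" by (simp add: fR_def)
 ultimately show ?thesis by (simp only: minus_mult_left[symmetric] neg_equal_iff_equal)
qed

end

subsection \<open>Corner bounds\<close>

lemma nonneg_has_integral_lborel:
 fixes f :: "real => real"
 assumes f: "f \<in> borel_measurable borel" and S: "S \<in> sets borel" and nn: "!!x. x \<in> S ==> 0 <= f x"
  and I: "(f has_integral I) S"
 shows "set_integrable lborel S f" "(LINT x:S|lborel. f x) = I"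
proof -
 have "f absolutely_integrable_on S"
  using I nn by (intro nonnegative_absolutely_integrable_1) auto
 then have "integrable lebesgue (%x. indicat_real S x *\<^sub>R f x)" by (simp add: set_integrable_def)
 then show s: "set_integrable lborel S f"
  unfolding set_integrable_def using f S by (subst (asm) integrable_completion) auto
 show "(LINT x:S|lborel. f x) = I"
  using set_borel_integral_eq_integral(2)[OF s] I by (simp add: integral_unique)
qed

text \<open>Splitting at 1 gives 1/(p+1) + 1/(1-p), which is 8/3 for both exponents. The exact value
  is pi / sqrt 2; the loss is affordable because 9/(8 pi) times 8/3 is 3/pi, still below 1.\<close>

lemma powr_poisson_integral:
 fixes p :: real
 assumes p: "p = 1/2 | p = -1/2"
 shows "set_integrable lborel {0<..} (%u. u powr p / (1 + u^2))" "(LINT u:{0<..}|lborel. u powr p / (1 + u^2)) <= 8/3"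
proof -
 have hi: "((%u::real. u powr p) has_integral (1 / (p + 1))) {0..1}"
  using has_integral_powr_from_0[of p 1] p by auto
 have ti: "((%u::real. u powr (p - 2)) has_integral (- 1 / (p - 1))) {1..}"
 proof -
  have "((%u::real. u powr (p - 2)) has_integral (- (1 powr (p - 2 + 1)) / (p - 2 + 1))) {1..}"
   by (rule has_integral_powr_to_inf) (use p in auto)
  then show ?thesis by simp
 qed
 note h = nonneg_has_integral_lborel[OF _ _ _ hi] and t = nonneg_has_integral_lborel[OF _ _ _ ti]
 have hs: "integrable lborel (%u. indicator {0..1} u *\<^sub>R u powr p)" "integrable lborel (%u. indicator {1..} u *\<^sub>R u powr (p - 2))"
  using h(1) t(1) by (auto simp: set_integrable_def)
 define w where "w = (%u. indicator {0..1} u *\<^sub>R u powr p + indicator {1..} u *\<^sub>R u powr (p - 2) :: real)"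
 have wi: "integrable lborel w" unfolding w_def using hs by (rule Bochner_Integration.integrable_add)
 have wI: "(LINT u|lborel. w u) = 8/3"
 proof -
  have "(LINT u|lborel. w u) = 1 / (p + 1) + (- 1 / (p - 1))"
   unfolding w_def using Bochner_Integration.integral_add[OF hs] h(2) t(2) by (simp add: set_lebesgue_integral_def)
  then show ?thesis using p by (elim disjE) simp_all
 qed
 have le: "norm (indicator {0<..} u *\<^sub>R (u powr p / (1 + u^2))) <= w u" for u
 proof (cases "u > 0")
  case True
  show ?thesis
  proof (cases "u <= 1")
   case le: True
   have "u powr p / (1 + u^2) <= u powr p / 1" by (intro divide_left_mono) (auto intro: add_pos_nonneg)
   then show ?thesis using True le by (simp add: w_def indicator_def)
  next
   case False
   have "u powr p / (1 + u^2) <= u powr p / u^2" using True by (intro divide_left_mono mult_pos_pos) (auto intro: add_pos_nonneg)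
   also have "... = u powr (p - 2)" using True by (simp add: powr_diff powr_numeral)
   finally show ?thesis using True False by (simp add: w_def indicator_def)
  qed
 qed (simp add: w_def indicator_def)
 show s: "set_integrable lborel {0<..} (%u. u powr p / (1 + u^2))"
  unfolding set_integrable_def
  by (rule Bochner_Integration.integrable_bound[OF wi]) (use le in \<open>auto intro!: AE_I2 intro: order.trans[OF _ abs_ge_self]\<close>)
 have "(LINT u|lborel. indicator {0<..} u *\<^sub>R (u powr p / (1 + u^2))) <= (LINT u|lborel. w u)"
  by (rule integral_mono[OF s[unfolded set_integrable_def] wi]) (use le in \<open>auto intro: order.trans[OF abs_ge_self]\<close>)
 then show "(LINT u:{0<..}|lborel. u powr p / (1 + u^2)) <= 8/3" by (simp add: wI set_lebesgue_integral_def)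
qed

lemma powr_poisson_scaled:
 fixes p :: real
 assumes p: "p = 1/2 | p = -1/2" and r: "r > 0"
 shows "set_integrable lborel {0<..} (%x. r / (r^2 + x^2) * x powr p)"
  "(LINT x:{0<..}|lborel. r / (r^2 + x^2) * x powr p) <= 8/3 * r powr p"
proof -
 define f where "f = (%x. indicator {0<..} x *\<^sub>R (r / (r^2 + x^2) * x powr p))"
 define g where "g = (%u. indicator {0<..} u *\<^sub>R (u powr p / (1 + u^2)) :: real)"
 have gi: "integrable lborel g" "(LINT u|lborel. g u) <= 8/3"
  using powr_poisson_integral[OF p] by (simp_all add: g_def set_integrable_def set_lebesgue_integral_def)
 have fg: "f (0 + r * u) = (r powr p / r) * g u" for u
 proof (cases "u > 0")
  case True
  have "r / (r^2 + (r * u)^2) = 1 / (r * (1 + u^2))"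
  proof -
   have "r^2 + (r * u)^2 = r * (r * (1 + u^2))" by (simp add: power2_eq_square algebra_simps)
   then show ?thesis using r by simp
  qed
  moreover have "f (0 + r * u) = r / (r^2 + (r * u)^2) * (r powr p * u powr p)" using True r by (simp add: f_def powr_mult)
  ultimately have "f (0 + r * u) = 1 / (r * (1 + u^2)) * (r powr p * u powr p)" by (simp only:)
  then show ?thesis using True by (simp add: g_def)
 qed (use r in \<open>simp add: f_def g_def zero_less_mult_iff\<close>)
 have "integrable lborel (%u. f (0 + r * u))" unfolding fg using gi by simp
 then have "integrable lborel f" using lborel_integrable_real_affine_iff[of r f 0] r by simp
 then show "set_integrable lborel {0<..} (%x. r / (r^2 + x^2) * x powr p)" by (simp add: f_def set_integrable_def)
 have "(LINT x|lborel. f x) = r * ((r powr p / r) * (LINT u|lborel. g u))"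
  using lborel_integral_real_affine[of r f 0] r unfolding fg by simp
 also have "... = r powr p * (LINT u|lborel. g u)" using r by simp
 also have "... <= r powr p * (8/3)" by (intro mult_left_mono gi(2)) auto
 finally show "(LINT x:{0<..}|lborel. r / (r^2 + x^2) * x powr p) <= 8/3 * r powr p"
  by (simp add: f_def set_lebesgue_integral_def)
qed

context hsm begin

definition J :: "(real => complex) => (real => complex) => complex" where
 "J f \<phi> = (LINT x:{0<..}|lborel. \<phi> x * f x)"

text \<open>The coupling operator in corner coordinates: the half-plane solution with data
  \<open>f\<close> beyond the near corner and \<open>f'\<close> beyond the far one, evaluated at
  depth \<open>rot r\<close> in front of the near corner. The factor \<open>om\<close> stems from
  \<open>tau'\<close>.\<close>

definition A :: "(real => complex) => (real => complex) => real => complex" where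
 "A f f' r = om * (J f (%x. h (rot r) (rot x)) + J f' (%x. h (rot r) (of_real (2 * a) + rot x)))"

lemma norm_J_le:
 assumes w: "set_integrable lborel {0<..} w" and le: "!!x. x > 0 ==> norm (\<phi> x * f x) <= w x"
 shows "norm (J f \<phi>) <= (LINT x:{0<..}|lborel. w x)"
 unfolding J_def set_lebesgue_integral_def
 by (rule norm_LINT_le[OF w[unfolded set_integrable_def]]) (use le in \<open>auto simp: indicator_def\<close>)

text \<open>Both arguments are multiples of \<open>om\<close>, so the squared distance has norm
  \<open>r^2 + x^2\<close>, and \<open>h\<close> has almost the size of the real Poisson kernel
  \<open>(1 / pi) * (r / (r^2 + x^2))\<close>. The factor 9/8 is the margin gained by choosing
  \<open>\<delta>\<close> small.\<close>

lemma poisson_near: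
 obtains \<delta> where "\<delta> > 0" "!!r x. 0 < r ==> r < \<delta> ==> 0 < x ==> x < \<delta> ==>
  norm (h (rot r) (rot x)) <= 9 / (8 * pi) * (r / (r^2 + x^2))"
proof -
 have "norm (- 1 / (4 * of_real pi) :: complex) < 9 / (32 * pi)"
  using pi_gt_zero by (simp add: norm_divide norm_mult field_simps)
 then have "\<forall>\<^sub>F q in at 0. norm (PP q) < 9 / (32 * pi)"
  by (intro order_tendstoD(2)[OF tendsto_norm[OF PP_tendsto]])
 then obtain e where e: "e > 0" "!!q. q ~= 0 ==> norm q < e ==> norm (PP q) < 9 / (32 * pi)"
  by (auto simp: eventually_at dist_norm)
 define \<delta> where "\<delta> = sqrt (e / 2)"
 show thesis
 proof (rule that[of \<delta>])
  show "\<delta> > 0" using e by (simp add: \<delta>_def)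
  fix r x assume rx: "0 < r" "r < \<delta>" "0 < x" "x < \<delta>"
  define q where "q = (rot r)^2 + (rot x)^2"
  have q: "q = of_real (r^2 + x^2) * om^2" by (simp add: q_def power_mult_distrib algebra_simps)
  have pos: "r^2 + x^2 > 0" using rx by (simp add: add_pos_nonneg)
  have nq: "norm q = r^2 + x^2" unfolding q norm_mult norm_power norm_om norm_of_real using pos by simp
  have "r^2 < \<delta>^2" "x^2 < \<delta>^2" using rx by (auto intro!: power_strict_mono)
  then have "norm q < e" using e unfolding nq by (simp add: \<delta>_def)
  moreover have "q ~= 0" using nq pos by auto
  ultimately have P: "norm (PP q) <= 9 / (32 * pi)" using e(2)[of q] by simp
  have "norm (h (rot r) (rot x)) = 4 * r * (norm (PP q) / (r^2 + x^2))"
   using rx unfolding h_def q_def[symmetric] N1_def by (simp add: norm_mult norm_divide nq)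
  also have "... <= 4 * r * ((9 / (32 * pi)) / (r^2 + x^2))" using P pos rx by (intro mult_left_mono divide_right_mono) auto
  also have "... = 9 / (8 * pi) * (r / (r^2 + x^2))" by simp
  finally show "norm (h (rot r) (rot x)) <= 9 / (8 * pi) * (r / (r^2 + x^2))" .
 qed
qed

lemma h_bound:
 obtains C \<mu> where "C > 0" "\<mu> > 0"
  "!!d r x. 0 <= d ==> d <= 2 * a ==> 0 < r ==> 0 <= x ==>
   norm (h (rot r) (of_real d + rot x)) <= C * r / (r^2 + (max d x)^2) * exp (- \<mu> * x)"
proof -
 obtain C \<mu> where C: "C > 0" "\<mu> > 0" and kb: "!!z1 z2. z1 \<in> SZ ==> z2 \<in> SZ ==> norm z1 + norm z2 > 0 ==>
    norm (h z1 z2) <= C * norm z1 / (norm z1 + norm z2)^2 * exp (- \<mu> * (norm z1 + norm z2))"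
  using kernel_bounds by metis
 show thesis
 proof (rule that[OF C])
  fix d r x :: real assume d: "0 <= d" "d <= 2 * a" "0 < r" "0 <= x"
  let ?z = "of_real d + rot x"
  note Z = SZ_D[OF d(1,2,4)]
  have n: "norm (rot r) = r" using d by (simp add: norm_mult)
  have m: "max d x <= norm ?z" "0 <= max d x" using Z d by auto
  have "r^2 + (max d x)^2 <= (r + norm ?z)^2"
  proof -
   have "(max d x)^2 <= (norm ?z)^2" using m by (intro power_mono) auto
   moreover have "(r + norm ?z)^2 = r^2 + (norm ?z)^2 + 2 * r * norm ?z" by (simp add: power2_sum)
   moreover have "0 <= 2 * r * norm ?z" using d by simp
   ultimately show ?thesis by linarith
  qed
  moreover have "exp (- \<mu> * (r + norm ?z)) <= exp (- \<mu> * x)" using C d m by (auto intro: add_increasing)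
  moreover have "0 < r^2 + (max d x)^2" using d by (auto intro: add_pos_nonneg)
  ultimately have "C * r / (r + norm ?z)^2 * exp (- \<mu> * (r + norm ?z)) <= C * r / (r^2 + (max d x)^2) * exp (- \<mu> * x)"
   using C d by (intro mult_mono frac_le) auto
  then show "norm (h (rot r) ?z) <= C * r / (r^2 + (max d x)^2) * exp (- \<mu> * x)"
   using kb[OF SZ_om Z(1), of r] d unfolding n by (simp add: add_pos_nonneg)
 qed
qed

text \<open>A bootstrap. The equations with L2 data give a bound by \<open>r powr (-1/2)\<close>.
  Feeding a bound with coefficients \<open>c\<close> of \<open>r powr (-1/2)\<close> and
  \<open>N\<close> of \<open>r powr (1/2)\<close> back into them multiplies \<open>c\<close> by 3/pi
  and reproduces \<open>N\<close>, so at each fixed \<open>r\<close> the singular part disappears in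
  the limit. The maps \<open>s\<close> and \<open>s'\<close> select the data that enter the equation
  of index \<open>i\<close>; the common bound \<open>B2\<close> makes all constants independent of
  \<open>i\<close>.\<close>

lemma corner_bound:
 fixes f :: "'i => real => complex"
 assumes meas: "!!i. f i \<in> borel_measurable borel" and N2: "!!i. set_integrable lborel {0<..} (%x. (norm (f i x))^2)"
  and N2b: "!!i. (LINT x:{0<..}|lborel. (norm (f i x))^2) <= B2"
  and eq: "!!i r. r > 0 ==> f i r = A (f (s i)) (f (s' i)) r"
 shows "\<exists>L>0. \<forall>i. \<forall>r>0. norm (f i r) <= L * sqrt r"
proof -
 obtain C \<mu> where C: "C > 0" "\<mu> > 0"
  and hb: "!!d r x. 0 <= d ==> d <= 2 * a ==> 0 < r ==> 0 <= x ==>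
   norm (h (rot r) (of_real d + rot x)) <= C * r / (r^2 + (max d x)^2) * exp (- \<mu> * x)"
  using h_bound by blast
 have tri: "norm (A g g' r) <= norm (J g (%x. h (rot r) (rot x))) + norm (J g' (%x. h (rot r) (of_real (2 * a) + rot x)))" for g g' r
  unfolding A_def norm_mult norm_om using norm_triangle_ineq by simp
 define K where "K = C^2 * pi + B2 + 1"
 let ?q = "%r x. r^2 + x^2" and ?e = "%x. \<bar>x\<bar> powr (-1/2) * exp (- \<mu> * \<bar>x\<bar>)"
 have B20: "B2 >= 0" using order.trans[OF _ N2b] by (auto simp: set_lebesgue_integral_def intro!: Bochner_Integration.integral_nonneg)
 have K: "K > 0" using B20 by (simp add: K_def add_nonneg_pos)
 have half: "norm (J (f i) (%x. h (rot r) (of_real d + rot x))) <= K / 2 * r powr (-1/2)" if d: "0 <= d" "d <= 2 * a" and r: "r > 0" for d r i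
 proof -
  \<comment> \<open>The weight in the inequality
    \<open>b * n <= l / 2 * b^2 + n^2 / (2 * l)\<close>. The value \<open>sqrt r\<close> balances
    the square integral of the kernel, of order 1/r, against the L2 norm of the data, and both parts
    come out of order \<open>r powr (-1/2)\<close>.\<close>
  define l where "l = sqrt r"
  have l: "l > 0" "l * l = r" "1 / l = r powr (-1/2)" using r by (simp_all add: l_def powr_minus_divide powr_half_sqrt)
  define w where "w = (%x::real. l * C^2 / 2 * (1 / (?q r x)) + 1 / (2 * l) * (indicator {0<..} x * (norm (f i x))^2))"
  have i1: "integrable lborel (%x::real. 1 / (?q r x))" "(LINT x|lborel. 1 / (?q r x)) = pi / r"
  proof -
   have e: "1 / (r^2 + (0 + r * u)^2) = 1 / r^2 * (1 / (1 + u^2))" for u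
   proof -
    have "r^2 + (0 + r * u)^2 = r^2 * (1 + u^2)" by (simp add: power2_eq_square algebra_simps)
    then show ?thesis by simp
   qed
   have "integrable lborel (%u. 1 / (r^2 + (0 + r * u)^2))" unfolding e using integrable_inverse_1_plus_sq by (rule integrable_mult_right)
   then show "integrable lborel (%x::real. 1 / (?q r x))" using lborel_integrable_real_affine_iff[of r "%x. 1 / (?q r x)" 0] r by simp
   have P: "(LINT u|lborel. 1 / (1 + u^2)) = pi"
    using LBINT_inverse_1_plus_square by (simp add: interval_lebesgue_integral_def set_lebesgue_integral_def inverse_eq_divide)
   show "(LINT x|lborel. 1 / (?q r x)) = pi / r"
    using lborel_integral_real_affine[of r "%x. 1 / (?q r x)" 0] r unfolding e integral_mult_right_zero P by (simp add: power2_eq_square)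
  qed
  have i2: "integrable lborel (%x. indicator {0<..} x * (norm (f i x))^2)" using N2[of i] by (simp add: set_integrable_def)
  have wi: "integrable lborel w" unfolding w_def by (intro Bochner_Integration.integrable_add integrable_mult_right i1 i2)
  have le: "norm (indicator {0<..} x *\<^sub>R (h (rot r) (of_real d + rot x) * f i x)) <= w x" for x
  proof (cases "x > 0")
   case True
   define b where "b = norm (h (rot r) (of_real d + rot x))"
   have pos: "0 < r^2 + x^2" using r by (auto intro: add_pos_nonneg)
   have "b <= C * r / (r^2 + (max d x)^2) * exp (- \<mu> * x)" unfolding b_def using hb[OF d r] True by simp
   also have "... <= C * r / (?q r x) * 1"
    using C r True pos by (intro mult_mono frac_le add_left_mono power_mono) auto
   finally have b1: "b <= C * r / (?q r x)" by simp
   have b2: "b^2 <= C^2 * (1 / (?q r x))"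
   proof -
    have "b^2 <= (C * r / (?q r x))^2" using b1 by (intro power_mono) (auto simp: b_def)
    also have "... = C^2 * (1 / (?q r x)) * (r^2 / (?q r x))" by (simp add: power2_eq_square)
    also have "... <= C^2 * (1 / (?q r x)) * 1" using pos by (intro mult_left_mono) auto
    finally show ?thesis by simp
   qed
   have "b * norm (f i x) <= l / 2 * b^2 + 1 / (2 * l) * (norm (f i x))^2"
   proof -
    have "0 <= (l * b - norm (f i x))^2" by simp
    then have "2 * l * (b * norm (f i x)) <= l * l * b^2 + (norm (f i x))^2" by (simp add: power2_eq_square algebra_simps)
    then have "b * norm (f i x) <= (l * l * b^2 + (norm (f i x))^2) / (2 * l)" using l(1) by (simp add: pos_le_divide_eq mult_ac)
    also have "... = l / 2 * b^2 + 1 / (2 * l) * (norm (f i x))^2" using l(1) by (simp add: add_divide_distrib)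
    finally show ?thesis .
   qed
   also have "... <= l / 2 * (C^2 * (1 / (?q r x))) + 1 / (2 * l) * (norm (f i x))^2"
    using b2 l by (intro add_mono mult_left_mono) auto
   finally show ?thesis using True by (simp add: b_def w_def norm_mult)
  qed (use l in \<open>simp add: w_def\<close>)
  have "norm (J (f i) (%x. h (rot r) (of_real d + rot x))) <= (LINT x|lborel. w x)"
   unfolding J_def set_lebesgue_integral_def by (rule norm_LINT_le[OF wi AE_I2]) (use le in auto)
  also have "(LINT x|lborel. w x) = l * C^2 / 2 * (pi / r) + 1 / (2 * l) * (LINT x:{0<..}|lborel. (norm (f i x))^2)"
  proof -
   have "(LINT x|lborel. w x) = (LINT x|lborel. l * C^2 / 2 * (1 / (?q r x))) + (LINT x|lborel. 1 / (2 * l) * (indicator {0<..} x * (norm (f i x))^2))"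
    unfolding w_def by (intro Bochner_Integration.integral_add integrable_mult_right i1 i2)
   then show ?thesis unfolding integral_mult_right_zero i1(2) by (simp add: set_lebesgue_integral_def)
  qed
  also have "... <= l * C^2 / 2 * (pi / r) + 1 / (2 * l) * B2" using N2b l by (intro add_mono mult_left_mono) auto
  also have "l * C^2 / 2 * (pi / r) = C^2 * pi / 2 * (1 / l)" using l by (simp add: field_simps flip: l(2))
  also have "C^2 * pi / 2 * (1 / l) + 1 / (2 * l) * B2 = (C^2 * pi + B2) / 2 * (1 / l)" by (simp add: add_divide_distrib)
  also have "... <= K / 2 * (1 / l)" using l by (intro mult_right_mono) (auto simp: K_def)
  finally show ?thesis using l by simp
 qed
 have f0: "norm (f i r) <= K * r powr (-1/2)" if r: "r > 0" for i r
  using tri[of "f (s i)" "f (s' i)" r] half[of 0 r "s i"] half[of "2 * a" r "s' i"] r a_pos eq[OF r, of i] by simp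
 obtain \<delta> where \<delta>: "\<delta> > 0" and near: "!!r x. 0 < r ==> r < \<delta> ==> 0 < x ==> x < \<delta> ==>
  norm (h (rot r) (rot x)) <= 9 / (8 * pi) * (r / (?q r x))" using poisson_near by blast
 define E where "E = (LINT x:{0<..}|lborel. \<bar>x\<bar> powr (-1/2) * exp (- \<mu> * \<bar>x\<bar>))"
 have Ei: "set_integrable lborel {0<..} (%x. \<bar>x\<bar> powr (-1/2) * exp (- \<mu> * \<bar>x\<bar>))"
  unfolding set_integrable_def using integrable_powr_exp_abs[of "1/2" \<mu>] C by (intro integrable_mult_indicator) auto
 have E0: "E >= 0" unfolding E_def set_lebesgue_integral_def by (rule Bochner_Integration.integral_nonneg) auto
 define R where "R = C * K / \<delta>^2 * E + C * K / (2 * a)^2 * E"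
 have R0: "R >= 0" using C K E0 by (simp add: R_def)
 define \<kappa> where "\<kappa> = 3 / pi"
 have \<kappa>: "0 < \<kappa>" "\<kappa> < 1" using pi_gt3 by (auto simp: \<kappa>_def)
 \<comment> \<open>The fixed point of \<open>N = \<kappa> * N + R * sqrt \<delta>\<close>.
   \<open>R\<close> collects the contributions of sources at distance at least
   \<open>\<delta>\<close> and of the far corner; these are of order \<open>r\<close>, hence of
   order \<open>sqrt \<delta> * sqrt r\<close>.\<close>
 define N where "N = R * sqrt \<delta> / (1 - \<kappa>)"
 have N: "N >= 0" "\<kappa> * N + R * sqrt \<delta> = N" using \<kappa> R0 \<delta> by (simp_all add: N_def field_simps)
 have step: "norm (f i r) <= \<kappa> ^ n * K * r powr (-1/2) + N * r powr (1/2)" if r: "0 < r" "r < \<delta>" for i r n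
  using r
 proof (induction n arbitrary: i r)
  case 0
  then show ?case using f0[of r i] N by (simp add: add_increasing2)
 next
  case (Suc n)
  note r = Suc.prems
  let ?M = "\<kappa> ^ n * K"
  define w where "w = (%x. 9 / (8 * pi) * (?M * (r / (?q r x) * x powr (-1/2)) + N * (r / (?q r x) * x powr (1/2)))
    + C * r / \<delta>^2 * K * (?e x))"
  note W = powr_poisson_scaled[of "-1/2" r] powr_poisson_scaled[of "1/2" r]
  have wi: "set_integrable lborel {0<..} w"
   unfolding w_def using W r Ei by (intro set_integral_add set_integrable_mult_right) auto
  have M0: "?M >= 0" using \<kappa> K by simp
  have 1: "norm (J (f (s i)) (%x. h (rot r) (rot x))) <= (LINT x:{0<..}|lborel. w x)"
  proof (rule norm_J_le[OF wi])
   fix x :: real assume x: "x > 0"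
   show "norm (h (rot r) (rot x) * f (s i) x) <= w x"
   proof (cases "x < \<delta>")
    case True
    have "norm (h (rot r) (rot x) * f (s i) x) <= (9 / (8 * pi) * (r / (?q r x))) * (?M * x powr (-1/2) + N * x powr (1/2))"
     unfolding norm_mult using near[OF r x True] Suc.IH[OF x True] r by (intro mult_mono) auto
    also have "... = 9 / (8 * pi) * (?M * (r / (?q r x) * x powr (-1/2)) + N * (r / (?q r x) * x powr (1/2)))"
     by (simp only: distrib_left mult_ac)
    also have "... <= w x" unfolding w_def using C K r by simp
    finally show ?thesis .
   next
    case False
    have "norm (h (rot r) (of_real 0 + rot x)) <= C * r / (r^2 + (max 0 x)^2) * exp (- \<mu> * x)" using hb[of 0 r x] r x a_pos by simp
    also have "... <= C * r / \<delta>^2 * exp (- \<mu> * x)"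
    proof -
     have "\<delta>^2 <= x^2" using False \<delta> by (intro power_mono) auto
     also have "... <= r^2 + (max 0 x)^2" using x by simp
     finally show ?thesis using C r \<delta> by (intro mult_right_mono frac_le) auto
    qed
    finally have "norm (h (rot r) (rot x) * f (s i) x) <= (C * r / \<delta>^2 * exp (- \<mu> * x)) * (K * x powr (-1/2))"
     unfolding norm_mult using f0[OF x] C r by (intro mult_mono) auto
    also have "... = C * r / \<delta>^2 * K * (?e x)" using x by simp
    also have "... <= w x" unfolding w_def using M0 N r by (simp add: add_increasing)
    finally show ?thesis .
   qed
  qed
  have 2: "norm (J (f (s' i)) (%x. h (rot r) (of_real (2 * a) + rot x))) <= (LINT x:{0<..}|lborel. C * r / (2 * a)^2 * K * (?e x))"
  proof (rule norm_J_le)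
   show "set_integrable lborel {0<..} (%x. C * r / (2 * a)^2 * K * (?e x))" using Ei by (intro set_integrable_mult_right) auto
   fix x :: real assume x: "x > 0"
   have "norm (h (rot r) (of_real (2 * a) + rot x)) <= C * r / (r^2 + (max (2 * a) x)^2) * exp (- \<mu> * x)" using hb[of "2 * a" r x] r x a_pos by simp
   also have "... <= C * r / (2 * a)^2 * exp (- \<mu> * x)"
   proof -
    have "(2 * a)^2 <= (max (2 * a) x)^2" using a_pos by (intro power_mono) auto
    also have "... <= r^2 + (max (2 * a) x)^2" by simp
    finally show ?thesis using C r a_pos by (intro mult_right_mono frac_le) auto
   qed
   finally have "norm (h (rot r) (of_real (2 * a) + rot x) * f (s' i) x) <= (C * r / (2 * a)^2 * exp (- \<mu> * x)) * (K * x powr (-1/2))"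
    unfolding norm_mult using f0[OF x] C r by (intro mult_mono) auto
   then show "norm (h (rot r) (of_real (2 * a) + rot x) * f (s' i) x) <= C * r / (2 * a)^2 * K * (?e x)"
    using x by (simp add: mult_ac)
  qed
  have "(LINT x:{0<..}|lborel. w x) = 9 / (8 * pi) * (?M * (LINT x:{0<..}|lborel. r / (?q r x) * x powr (-1/2)) + N * (LINT x:{0<..}|lborel. r / (?q r x) * x powr (1/2)))
    + C * r / \<delta>^2 * K * E"
  proof -
   have i: "set_integrable lborel {0<..} (%x. ?M * (r / (?q r x) * x powr (-1/2)))" "set_integrable lborel {0<..} (%x. N * (r / (?q r x) * x powr (1/2)))"
     "set_integrable lborel {0<..} (%x. C * r / \<delta>^2 * K * (?e x))"
    by (rule set_integrable_mult_right, (use W r Ei in simp)[1])+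
   show ?thesis
    unfolding w_def E_def set_integral_add(2)[OF set_integrable_mult_right[OF set_integral_add(1)[OF i(1,2)]] i(3)]
     set_integral_mult_right set_integral_add(2)[OF i(1,2)] ..
  qed
  also have "... <= 9 / (8 * pi) * (?M * (8/3 * r powr (-1/2)) + N * (8/3 * r powr (1/2))) + C * r / \<delta>^2 * K * E"
   using W r M0 N by (intro add_mono mult_left_mono order.refl) auto
  also have "... = \<kappa> * (?M * r powr (-1/2) + N * r powr (1/2)) + C * r / \<delta>^2 * K * E" by (simp add: \<kappa>_def field_simps)
  finally have "norm (f i r) <= \<kappa> * (?M * r powr (-1/2) + N * r powr (1/2)) + r * R"
   using tri[of "f (s i)" "f (s' i)" r] 1 2 eq[OF r(1), of i] by (simp add: R_def E_def algebra_simps)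
  also have "r * R <= (sqrt \<delta> * r powr (1/2)) * R"
  proof -
   have "r = sqrt r * r powr (1/2)" using r by (simp add: powr_half_sqrt)
   also have "... <= sqrt \<delta> * r powr (1/2)" using r by (intro mult_right_mono) auto
   finally show ?thesis using R0 by (rule mult_right_mono)
  qed
  also have "\<kappa> * (?M * r powr (-1/2) + N * r powr (1/2)) + (sqrt \<delta> * r powr (1/2)) * R = \<kappa> ^ Suc n * K * r powr (-1/2) + (\<kappa> * N + R * sqrt \<delta>) * r powr (1/2)"
   by (simp add: algebra_simps)
  finally show ?case unfolding N(2) by simp
 qed
 have lim: "norm (f i r) <= N * sqrt r" if r: "0 < r" "r < \<delta>" for i r
 proof (rule LIMSEQ_le_const)
  have "(%n. \<kappa> ^ n * K * r powr (-1/2) + N * r powr (1/2)) \<longlonglongrightarrow> 0 * K * r powr (-1/2) + N * r powr (1/2)"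
   using \<kappa> by (intro tendsto_intros LIMSEQ_realpow_zero) auto
  then show "(%n. \<kappa> ^ n * K * r powr (-1/2) + N * r powr (1/2)) \<longlonglongrightarrow> N * sqrt r" using r by (simp add: powr_half_sqrt)
 qed (use step[OF r] in blast)
 show ?thesis
 proof (intro exI[of _ "N + K / \<delta>"] conjI allI impI)
  show "N + K / \<delta> > 0" using N K \<delta> by (simp add: add_nonneg_pos)
  fix i and r :: real assume r: "r > 0"
  show "norm (f i r) <= (N + K / \<delta>) * sqrt r"
  proof (cases "r < \<delta>")
   case True
   then show ?thesis using lim[OF r True, of i] K \<delta> r by (simp add: distrib_right add_increasing2)
  next
   case False
   have "K * r powr (-1/2) = K / r * sqrt r" using r by (simp add: powr_minus_divide powr_half_sqrt real_div_sqrt field_simps)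
   also have "... <= K / \<delta> * sqrt r" using False K \<delta> r by (intro mult_right_mono frac_le) auto
   finally show ?thesis using f0[OF r, of i] N r by (simp add: distrib_right add_increasing)
  qed
 qed
qed

end

section \<open>Exchange of integrals, admissible kernels and data\<close>

lemma swap_LINT_dominated:
 fixes F :: "real => real => complex"
 assumes F: "(%(s, t). F s t) \<in> borel_measurable (lborel \<Otimes>\<^sub>M lborel)"
  and w: "integrable lborel w" and Fi: "!!s. integrable lborel (F s)" and le: "!!s. (LINT t|lborel. norm (F s t)) <= w s"
 shows "(LINT s|lborel. LINT t|lborel. F s t) = (LINT t|lborel. LINT s|lborel. F s t)"
  "integrable lborel (%s. LINT t|lborel. F s t)" "integrable lborel (%t. LINT s|lborel. F s t)"
proof -
 have i: "integrable (lborel \<Otimes>\<^sub>M lborel) (%(s, t). F s t)"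
 proof (rule lborel_pair.Fubini_integrable[OF F])
  show "integrable lborel (%s. LINT t|lborel. norm (case (s, t) of (s, t) => F s t))"
  proof (rule Bochner_Integration.integrable_bound[OF w])
   show "(%s. LINT t|lborel. norm (case (s, t) of (s, t) => F s t)) \<in> borel_measurable lborel"
    by (rule lborel.borel_measurable_lebesgue_integral) (use F in measurable)
   show "AE s in lborel. norm (LINT t|lborel. norm (case (s, t) of (s, t) => F s t)) <= norm (w s)"
    using le by (auto intro!: AE_I2 intro: order.trans[OF _ abs_ge_self])
  qed
 qed (use Fi in simp)
 show "(LINT s|lborel. LINT t|lborel. F s t) = (LINT t|lborel. LINT s|lborel. F s t)"
  using lborel_pair.Fubini_integral[OF i] by simp
 show "integrable lborel (%s. LINT t|lborel. F s t)" "integrable lborel (%t. LINT s|lborel. F s t)"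
  using lborel_pair.integrable_fst[OF i] lborel_pair.integrable_snd[OF i] by simp_all
qed

lemma swap_LINT:
 fixes F :: "real => real => complex"
 assumes F: "(%(s, t). F s t) \<in> borel_measurable (lborel \<Otimes>\<^sub>M lborel)"
  and w: "integrable lborel w1" "integrable lborel w2" and le: "!!s t. norm (F s t) <= w1 s * w2 t"
 shows "(LINT s|lborel. LINT t|lborel. F s t) = (LINT t|lborel. LINT s|lborel. F s t)"
  "integrable lborel (%s. LINT t|lborel. F s t)" "integrable lborel (%t. LINT s|lborel. F s t)"
proof -
 have Fs: "F s \<in> borel_measurable lborel" for s using measurable_compose[OF measurable_Pair1' F, of s] by simp
 have Fi: "integrable lborel (F s)" for s
  by (rule Bochner_Integration.integrable_bound[of _ "%t. w1 s * w2 t"])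
    (use w Fs le[of s] in \<open>auto intro!: AE_I2 intro: order.trans[OF _ abs_ge_self]\<close>)
 have "(LINT t|lborel. norm (F s t)) <= w1 s * (LINT t|lborel. w2 t)" for s
  using integral_mono[of lborel "%t. norm (F s t)" "%t. w1 s * w2 t"] Fi[of s] w le[of s] by simp
 note * = swap_LINT_dominated[OF F integrable_mult_left[OF w(1)] Fi this]
 show "(LINT s|lborel. LINT t|lborel. F s t) = (LINT t|lborel. LINT s|lborel. F s t)"
  "integrable lborel (%s. LINT t|lborel. F s t)" "integrable lborel (%t. LINT s|lborel. F s t)" by (rule *)+
qed

context hsm begin

lemma kernels_measurable [measurable]:
 assumes [measurable]: "f \<in> borel_measurable M" "g \<in> borel_measurable M"
 shows "(%x. G (f x) (g x)) \<in> borel_measurable M" "(%x. G1 (f x) (g x)) \<in> borel_measurable M" "(%x. G2 (f x) (g x)) \<in> borel_measurable M"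
  "(%x. h (f x) (g x)) \<in> borel_measurable M" "(%x. h1 (f x) (g x)) \<in> borel_measurable M" "(%x. h2 (f x) (g x)) \<in> borel_measurable M"
proof -
 have [measurable]: "bI \<in> borel_measurable borel" "bL \<in> borel_measurable borel" "bI' \<in> borel_measurable borel" "bL' \<in> borel_measurable borel"
  by (intro borel_measurable_continuous_onI holomorphic_on_imp_continuous_on holomorphic_bI holomorphic_bL holomorphic_bI' holomorphic_bL')+
 have [measurable]: "NN \<in> borel_measurable borel" "PP \<in> borel_measurable borel"
  unfolding NN_def[abs_def] PP_def[abs_def] by measurable
 have [measurable]: "N1 \<in> borel_measurable borel" unfolding N1_def[abs_def] by measurable
 have [measurable]: "N2 \<in> borel_measurable borel" unfolding N2_def[abs_def] by measurable
 show "(%x. G (f x) (g x)) \<in> borel_measurable M" "(%x. G1 (f x) (g x)) \<in> borel_measurable M" "(%x. G2 (f x) (g x)) \<in> borel_measurable M"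
  "(%x. h (f x) (g x)) \<in> borel_measurable M" "(%x. h1 (f x) (g x)) \<in> borel_measurable M" "(%x. h2 (f x) (g x)) \<in> borel_measurable M"
  unfolding G_def G1_def G2_def h_def h1_def h2_def by measurable
qed

text \<open>The inverse square is split as -11/8 and -5/8 so that two integrations become absolutely
  convergent at once: against data of size \<open>sqrt s\<close> the first power becomes -7/8, and
  the second is integrable in the path parameter.\<close>

lemma kernel_sep:
 obtains C \<mu> where "C > 0" "\<mu> > 0"
  "!!K z1 z2 s t. K \<in> {h, h1, h2} ==> z1 \<in> SZ ==> z2 \<in> SZ ==> 0 < s ==> 0 < t ==> s <= norm z1 + norm z2 ==> t <= norm z1 + norm z2 ==>
    norm (K z1 z2) <= C * (s powr (-11/8) * exp (- \<mu> * s)) * t powr (-5/8)"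
proof -
 obtain C \<mu> where C: "C > 0" "\<mu> > 0" and b: "!!K z1 z2. K \<in> {G, G1, G2, h, h1, h2} ==> z1 \<in> SZ ==> z2 \<in> SZ ==> norm z1 + norm z2 > 0 ==>
    norm (K z1 z2) <= C / (norm z1 + norm z2)^2 * exp (- \<mu> * (norm z1 + norm z2))"
  using kernel_bounds by metis
 show thesis
 proof (rule that[OF C])
  fix K and z1 z2 :: complex and s t :: real
  assume K: "K \<in> {h, h1, h2}" and z: "z1 \<in> SZ" "z2 \<in> SZ" and st: "0 < s" "0 < t" "s <= norm z1 + norm z2" "t <= norm z1 + norm z2"
  define r where "r = norm z1 + norm z2"
  have r: "r > 0" "s <= r" "t <= r" using st by (auto simp: r_def)
  have "norm (K z1 z2) <= C / r^2 * exp (- \<mu> * r)" using b[OF _ z, folded r_def, OF _ r(1)] K by auto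
  also have "... = C * (r powr (-11/8) * exp (- \<mu> * r)) * r powr (-5/8)"
  proof -
   have "r powr (-11/8) * r powr (-5/8) = 1 / r^2" using r by (simp add: powr_add[symmetric] powr_minus_divide powr_numeral)
   then show ?thesis by (simp add: mult_ac)
  qed
  also have "... <= C * (s powr (-11/8) * exp (- \<mu> * s)) * t powr (-5/8)"
   using r st C by (intro mult_mono mult_left_mono powr_mono2') auto
  finally show "norm (K z1 z2) <= C * (s powr (-11/8) * exp (- \<mu> * s)) * t powr (-5/8)" .
 qed
qed

text \<open>Kernels that can be integrated against data of order \<open>sqrt s\<close>: near 0 the
  product is of order \<open>s powr (-7/8)\<close>.\<close>

definition adm :: "(real => complex) => bool" where
 "adm \<phi> \<longleftrightarrow> \<phi> \<in> borel_measurable borel & (\<exists>B \<mu>. 0 <= B & 0 < \<mu> & (\<forall>s>0. norm (\<phi> s) <= B * (s powr (-11/8) * exp (- \<mu> * s))))"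

definition good :: "(real => complex) => bool" where
 "good f \<longleftrightarrow> f \<in> borel_measurable borel & (\<exists>L\<ge>0. \<forall>s>0. norm (f s) <= L * sqrt s)"

lemma weight_integrable:
 assumes "\<mu> > 0" shows "set_integrable lborel {0<..} (%s. C * (s powr (-11/8) * exp (- \<mu> * s)) * (L * sqrt s))"
proof -
 have "integrable lborel (%s. indicator {0<..} s *\<^sub>R (\<bar>s\<bar> powr (-7/8) * exp (- \<mu> * \<bar>s\<bar>)))"
  using integrable_powr_exp_abs[of "7/8" \<mu>] assms by (intro integrable_mult_indicator) auto
 then have "integrable lborel (%s. C * L * (indicator {0<..} s *\<^sub>R (\<bar>s\<bar> powr (-7/8) * exp (- \<mu> * \<bar>s\<bar>))))" by simp
 moreover have "C * L * (indicator {0<..} s *\<^sub>R (\<bar>s\<bar> powr (-7/8) * exp (- \<mu> * \<bar>s\<bar>))) = indicator {0<..} s *\<^sub>R (C * (s powr (-11/8) * exp (- \<mu> * s)) * (L * sqrt s))" for s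
 proof (cases "s > 0")
  case True
  have "s powr (-7/8) = s powr (-11/8) * sqrt s" using True by (simp add: powr_add[symmetric] flip: powr_half_sqrt)
  then show ?thesis using True by simp
 qed simp
 ultimately show ?thesis by (simp only: set_integrable_def)
qed

lemma adm_integrable:
 assumes "adm \<phi>" "good f"
 shows "set_integrable lborel {0<..} (%s. \<phi> s * f s)"
proof -
 obtain B \<mu> L where B: "0 <= B" "0 < \<mu>" "!!s. s > 0 ==> norm (\<phi> s) <= B * (s powr (-11/8) * exp (- \<mu> * s))" "!!s. s > 0 ==> norm (f s) <= L * sqrt s" "L >= 0"
  and m [measurable]: "\<phi> \<in> borel_measurable borel" "f \<in> borel_measurable borel"
  using assms unfolding adm_def good_def by blast
 show ?thesis
  unfolding set_integrable_def
 proof (rule Bochner_Integration.integrable_bound[OF weight_integrable[OF B(2), of B L, unfolded set_integrable_def]])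
  show "AE s in lborel. norm (indicator {0<..} s *\<^sub>R (\<phi> s * f s)) <= norm (indicator {0<..} s *\<^sub>R (B * (s powr (-11/8) * exp (- \<mu> * s)) * (L * sqrt s)))"
   using mult_mono[OF B(3,4)] B by (auto intro!: AE_I2 simp: indicator_def norm_mult abs_mult)
 qed measurable
qed

lemma J_diff: "adm \<phi> ==> adm \<psi> ==> good f ==> J f (%s. \<phi> s - \<psi> s) = J f \<phi> - J f \<psi>"
 unfolding J_def left_diff_distrib by (intro set_integral_diff adm_integrable)

text \<open>Half of the exponential rate is given up to dominate \<open>s powr (11/8)\<close> for
  large \<open>s\<close>; for small \<open>s\<close> the weight \<open>s powr (-11/8)\<close> is at
  least 1 anyway.\<close>

lemma adm_exp:
 assumes [measurable]: "\<phi> \<in> borel_measurable borel" and \<mu>: "\<mu> > 0" and le: "!!s. s > 0 ==> norm (\<phi> s) <= B * exp (- \<mu> * s)"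
 shows "adm \<phi>"
 unfolding adm_def
proof (intro conjI exI allI impI)
 define C where "C = \<bar>B\<bar> * (1 + (4 / \<mu>) ^ 2)"
 show "0 <= C" "0 < \<mu> / 2" using \<mu> by (auto simp: C_def)
 fix s :: real assume s: "s > 0"
 have "exp (- \<mu> * s) = exp (- (\<mu>/2) * s) * exp (- (\<mu>/2) * s)" by (simp add: exp_add[symmetric])
 moreover have "exp (- (\<mu>/2) * s) <= (1 + (4 / \<mu>) ^ 2) * s powr (-11/8)"
 proof (cases "s <= 1")
  case True
  have "1 <= s powr (-11/8)" using s True ge_one_powr_ge_zero[of "1/s" "11/8"] by (simp add: powr_divide powr_minus_divide)
  moreover have "exp (- (\<mu>/2) * s) <= 1" using \<mu> s by simp
  moreover have "1 <= 1 + (4 / \<mu>) ^ 2" by simp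
  ultimately show ?thesis by (smt (verit) mult_le_cancel_right1 mult_mono)
 next
  case False
  have "s^2 * exp (- (\<mu>/2) * s) <= (4 / \<mu>) ^ 2" using power_mult_exp_le[of "\<mu>/2" s 1] \<mu> s by (simp add: power2_eq_square)
  then have "exp (- (\<mu>/2) * s) <= (4 / \<mu>) ^ 2 * s powr (-2)" using s by (simp add: powr_minus_divide powr_numeral pos_le_divide_eq mult.commute)
  also have "... <= (1 + (4 / \<mu>) ^ 2) * s powr (-11/8)" using False by (intro mult_mono powr_mono) auto
  finally show ?thesis .
 qed
 ultimately have "exp (- \<mu> * s) <= (1 + (4 / \<mu>) ^ 2) * s powr (-11/8) * exp (- (\<mu>/2) * s)" by simp
 then have "\<bar>B\<bar> * exp (- \<mu> * s) <= C * (s powr (-11/8) * exp (- (\<mu>/2) * s))"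
  unfolding C_def using mult_left_mono[of "exp (- \<mu> * s)" _ "\<bar>B\<bar>"] by (metis abs_ge_zero mult.assoc)
 moreover have "B * exp (- \<mu> * s) <= \<bar>B\<bar> * exp (- \<mu> * s)" by (intro mult_right_mono) auto
 ultimately show "norm (\<phi> s) <= C * (s powr (-11/8) * exp (- (\<mu>/2) * s))" using le[OF s] by linarith
qed simp

lemma kernel_exp:
 assumes d: "d > 0"
 obtains B \<mu> where "B > 0" "\<mu> > 0" "!!z1 z2 K s. z1 \<in> SZ ==> z2 \<in> SZ ==> d <= norm z1 + norm z2 ==> s - M <= norm z1 + norm z2 ==>
   K \<in> {G, G1, G2, h, h1, h2} ==> norm (K z1 z2) <= B * exp (- \<mu> * s)"
proof -
 obtain B \<mu> where B: "B > 0" "\<mu> > 0" "!!z1 z2 K. z1 \<in> SZ ==> z2 \<in> SZ ==> d <= norm z1 + norm z2 ==> K \<in> {G, G1, G2, h, h1, h2} ==>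
    norm (K z1 z2) <= B * exp (- \<mu> * (norm z1 + norm z2))" using kernel_far[OF d] by metis
 show thesis
 proof (rule that[of "B * exp (\<mu> * M)" \<mu>])
  fix z1 z2 :: complex and K and s :: real assume z: "z1 \<in> SZ" "z2 \<in> SZ" "d <= norm z1 + norm z2" "K \<in> {G, G1, G2, h, h1, h2}" and s: "s - M <= norm z1 + norm z2"
  have "B * exp (- \<mu> * (norm z1 + norm z2)) <= B * exp (- \<mu> * (s - M))" using s B by simp
  also have "... = B * exp (\<mu> * M) * exp (- \<mu> * s)" by (simp add: exp_add[symmetric] algebra_simps)
  finally show "norm (K z1 z2) <= B * exp (\<mu> * M) * exp (- \<mu> * s)" using B(3)[OF z] by linarith
 qed (use B in auto)
qed

lemma adm_kernel:
 assumes [measurable]: "z1 \<in> borel_measurable borel" "z2 \<in> borel_measurable borel" and d: "d > 0"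
  and z: "!!s. s > 0 ==> z1 s \<in> SZ & z2 s \<in> SZ & d <= norm (z1 s) + norm (z2 s) & s - M <= norm (z1 s) + norm (z2 s)"
  and K: "K \<in> {G, G1, G2, h, h1, h2}"
 shows "adm (%s. K (z1 s) (z2 s))"
proof -
 obtain B \<mu> where B: "B > 0" "\<mu> > 0" "!!z1 z2 K s. z1 \<in> SZ ==> z2 \<in> SZ ==> d <= norm z1 + norm z2 ==> s - M <= norm z1 + norm z2 ==>
   K \<in> {G, G1, G2, h, h1, h2} ==> norm (K z1 z2) <= B * exp (- \<mu> * s)" using kernel_exp[OF d, of M] by blast
 show ?thesis by (rule adm_exp[OF _ B(2) B(3)]) (use z K in auto)
qed

end

subsection \<open>Gluing half-plane solutions\<close>

context hsm begin

text \<open>The Poisson kernel of a quarter-plane for data on one edge, obtained from the half-plane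
  kernel by subtracting the mirrored source.\<close>

definition E :: "real => real => real => complex" where
 "E x y s = h (rot x) (rot (y - s)) - h (rot x) (rot (y + s))"

text \<open>For \<open>K = h\<close> this is the half-plane solution seen from its near corner, at
  depth \<open>x\<close> and height \<open>y\<close> beyond the corner, both measured along
  \<open>om\<close>. With \<open>h1\<close> or \<open>h2\<close> in place of \<open>h\<close> it is
  a partial derivative of that solution.\<close>

definition Phi :: "(complex => complex => complex) => (real => complex) => (real => complex) => real => real => complex" where
 "Phi K f g x y = om * (J f (%s. K (rot x) (rot (y - s))) + J g (%s. K (rot x) (of_real (2 * a) + rot (y + s))))"

lemma SZ_2a: "t >= 0 ==> of_real (2 * a) + rot t \<in> SZ & t <= norm (of_real (2 * a) + rot t)"
 using SZ_D[of "2 * a" t] a_pos by auto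

lemma Phi_adm:
 assumes "x > 0" "y > 0" "K \<in> {G, G1, G2, h, h1, h2}"
 shows "adm (%s. K (rot x) (rot (y - s)))" "adm (%s. K (rot x) (rot (y + s)))" "adm (%s. K (rot x) (of_real (2 * a) + rot (y + s)))"
proof -
 have m: "x <= \<bar>x\<bar> + \<bar>y - s\<bar>" "x <= \<bar>x\<bar> + \<bar>y + s\<bar>" "s - y <= \<bar>x\<bar> + \<bar>y - s\<bar>" "s - y <= \<bar>x\<bar> + \<bar>y + s\<bar>" for s using assms by auto
 show "adm (%s. K (rot x) (rot (y - s)))"
  by (intro adm_kernel[of "%s. rot x" _ x y K] assms) (measurable, simp only: SZ_om norm_of_real_om m)
 show "adm (%s. K (rot x) (rot (y + s)))"
  by (intro adm_kernel[of "%s. rot x" _ x y K] assms) (measurable, simp only: SZ_om norm_of_real_om m)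
 show "adm (%s. K (rot x) (of_real (2 * a) + rot (y + s)))"
 proof (intro adm_kernel[of "%s. rot x" _ x y K] assms)
  fix s :: real assume s: "s > 0"
  have n: "0 <= norm (of_real (2 * a) + rot (y + s))" by (rule norm_ge_zero)
  show "rot x \<in> SZ & of_real (2 * a) + rot (y + s) \<in> SZ & x <= norm (rot x) + norm (of_real (2 * a) + rot (y + s)) &
    s - y <= norm (rot x) + norm (of_real (2 * a) + rot (y + s))"
   unfolding norm_of_real_om using SZ_2a[of "y + s"] n s assms SZ_om by auto
 qed measurable
qed

text \<open>In the quarter-plane beyond the corner the solution is the sum of the Poisson integrals
  of its traces on the two edges, \<open>f\<close> on one and \<open>A f g\<close> on the other. The
  second summand results from applying \<open>reproducing\<close> under the source integral and
  exchanging the integrals; it supplies the mirrored sources that \<open>E x y\<close> subtracts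
  from the first.\<close>

lemma half_glue:
 assumes f: "good f" and g: "good g" and x: "x > 0" and y: "y > 0"
 shows "Phi h f g x y = om * J f (E x y) + om * J (A f g) (E y x)"
proof -
 let ?y = "%d s. of_real d + rot s"
 obtain C \<mu> where C: "C > 0" "\<mu> > 0" "!!K z1 z2 s t. K \<in> {h, h1, h2} ==> z1 \<in> SZ ==> z2 \<in> SZ ==> 0 < s ==> 0 < t ==> s <= norm z1 + norm z2 ==> t <= norm z1 + norm z2 ==>
    norm (K z1 z2) <= C * (s powr (-11/8) * exp (- \<mu> * s)) * t powr (-5/8)" using kernel_sep by metis
 obtain B \<nu> where B: "B > 0" "\<nu> > 0" "!!z1 z2 K s. z1 \<in> SZ ==> z2 \<in> SZ ==> y <= norm z1 + norm z2 ==> s - x <= norm z1 + norm z2 ==>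
   K \<in> {G, G1, G2, h, h1, h2} ==> norm (K z1 z2) <= B * exp (- \<nu> * s)" using kernel_exp[OF y, of x] by blast
 have Eb: "norm (E y x t) <= 2 * B * exp (- \<nu> * t)" if "t > 0" for t
 proof -
  have "norm (h (rot y) (rot (x - t))) <= B * exp (- \<nu> * t)" "norm (h (rot y) (rot (x + t))) <= B * exp (- \<nu> * t)"
   using that x y by (intro B(3); simp del: of_real_diff of_real_add)+
  then show ?thesis unfolding E_def by (intro order.trans[OF norm_triangle_ineq4]) linarith
 qed
 have Em [measurable]: "E y x \<in> borel_measurable borel" unfolding E_def[abs_def] by measurable
 have swap: "J F (%s. h (rot x) (rot y + (?y d s))) = om * (LINT t:{0<..}|lborel. E y x t * J F (%s. h (rot t) (?y d s)))"
  "set_integrable lborel {0<..} (%t. E y x t * J F (%s. h (rot t) (?y d s)))"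
  if F: "good F" and d: "0 <= d" "d <= 2 * a" for F d
 proof -
  obtain L where [measurable]: "F \<in> borel_measurable borel" and L: "L >= 0" "!!s. s > 0 ==> norm (F s) <= L * sqrt s" using F unfolding good_def by blast
  define w1 where "w1 = (%s. indicator {0<..} s *\<^sub>R (C * (s powr (-11/8) * exp (- \<mu> * s)) * (L * sqrt s)))"
  define w2 where "w2 = (%t::real. indicator {0<..} t *\<^sub>R (2 * B * (\<bar>t\<bar> powr (-5/8) * exp (- \<nu> * \<bar>t\<bar>))))"
  define H where "H = (%s t. indicator {0<..} s *\<^sub>R (indicator {0<..} t *\<^sub>R (E y x t * h (rot t) (?y d s) * F s)))"
  have w: "integrable lborel w1" "integrable lborel w2"
  proof -
   show "integrable lborel w1" using weight_integrable[OF C(2), of C L] by (simp add: w1_def set_integrable_def)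
   have "integrable lborel (%t. 2 * B * (\<bar>t\<bar> powr (-5/8) * exp (- \<nu> * \<bar>t\<bar>)))" using integrable_powr_exp_abs[of "5/8" \<nu>] B(2) by simp
   then show "integrable lborel w2" unfolding w2_def by (intro integrable_mult_indicator) auto
  qed
  have Hm: "(%(s, t). H s t) \<in> borel_measurable (lborel \<Otimes>\<^sub>M lborel)" unfolding H_def by measurable
  have le: "norm (H s t) <= w1 s * w2 t" for s t
  proof (cases "s > 0 & t > 0")
   case True
   note Z = SZ_D[OF d, of s]
   have "norm (h (rot t) (?y d s)) <= C * (s powr (-11/8) * exp (- \<mu> * s)) * t powr (-5/8)"
    using True Z by (intro C(3)) (auto simp: norm_mult intro: order.trans add_increasing2)
   then have "norm (E y x t) * norm (h (rot t) (?y d s)) * norm (F s) <=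
     (2 * B * exp (- \<nu> * t)) * (C * (s powr (-11/8) * exp (- \<mu> * s)) * t powr (-5/8)) * (L * sqrt s)"
    using Eb[of t] L True B C by (intro mult_mono) auto
   then show ?thesis using True by (simp add: H_def w1_def w2_def norm_mult mult_ac)
  qed (auto simp: H_def w1_def w2_def indicator_def)
  note S = swap_LINT[OF Hm w le]
  have R: "h (rot x) (rot y + (?y d s)) = om * (LINT t:{0<..}|lborel. E y x t * h (rot t) (?y d s))" if "s > 0" for s
  proof -
   have "(LINT t:{0<..}|lborel. k t) = (LINT t:{0..}|lborel. k t)" for k :: "real => complex"
    unfolding set_lebesgue_integral_def
    by (rule integral_discrete_difference[of "{0}"]) (auto simp: indicator_def)
   then show ?thesis using reproducing[OF x y that d] by (simp add: E_def)
  qed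
  have e1: "(LINT t|lborel. H s t) = indicator {0<..} s *\<^sub>R ((LINT t:{0<..}|lborel. E y x t * h (rot t) (?y d s)) * F s)" for s
  proof (cases "s > 0")
   case True
   have "H s t = (indicator {0<..} t *\<^sub>R (E y x t * h (rot t) (?y d s))) * F s" for t
    using True by (simp add: H_def)
   then show ?thesis using True unfolding set_lebesgue_integral_def by (simp only: integral_mult_left_zero) simp
  qed (simp add: H_def)
  have e2: "(LINT s|lborel. H s t) = indicator {0<..} t *\<^sub>R (E y x t * J F (%s. h (rot t) (?y d s)))" for t
  proof -
   have "H s t = indicator {0<..} t *\<^sub>R (E y x t * (indicator {0<..} s *\<^sub>R (h (rot t) (?y d s) * F s)))" for s
    by (simp add: H_def mult_ac)
   then show ?thesis unfolding J_def set_lebesgue_integral_def by (simp only: integral_scaleR_right integral_mult_right_zero)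
  qed
  have "J F (%s. h (rot x) (rot y + (?y d s))) = (LINT s|lborel. om * (LINT t|lborel. H s t))"
   unfolding J_def set_lebesgue_integral_def e1 by (rule Bochner_Integration.integral_cong) (auto simp: R indicator_def set_lebesgue_integral_def)
  also have "... = om * (LINT t|lborel. LINT s|lborel. H s t)" unfolding integral_mult_right_zero S(1) ..
  finally show "J F (%s. h (rot x) (rot y + (?y d s))) = om * (LINT t:{0<..}|lborel. E y x t * J F (%s. h (rot t) (?y d s)))"
   unfolding e2 set_lebesgue_integral_def .
  show "set_integrable lborel {0<..} (%t. E y x t * J F (%s. h (rot t) (?y d s)))"
   using S(3) unfolding e2 set_integrable_def .
 qed
 have 1: "rot y + (?y 0 s) = rot (y + s)" "rot y + (of_real (2 * a) + rot s) = of_real (2 * a) + rot (y + s)" for s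
  by (simp_all add: algebra_simps)
 note sf = swap[OF f, of 0, unfolded 1] and sg = swap[OF g, of "2 * a", unfolded 1]
 have "J (A f g) (E y x) = (LINT t:{0<..}|lborel. om * (E y x t * J f (%s. h (rot t) (?y 0 s))) + om * (E y x t * J g (%s. h (rot t) (of_real (2 * a) + rot s))))"
  unfolding J_def[of "A f g"] A_def by (simp add: algebra_simps)
 also have "... = J f (%s. h (rot x) (rot (y + s))) + J g (%s. h (rot x) (of_real (2 * a) + rot (y + s)))"
  using sf sg a_pos by (subst set_integral_add) auto
 finally have "J (A f g) (E y x) = J f (%s. h (rot x) (rot (y + s))) + J g (%s. h (rot x) (of_real (2 * a) + rot (y + s)))" .
 moreover have "J f (E x y) = J f (%s. h (rot x) (rot (y - s))) - J f (%s. h (rot x) (rot (y + s)))"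
  unfolding E_def[abs_def] by (intro J_diff Phi_adm f x y) auto
 ultimately show ?thesis unfolding Phi_def by (simp only: distrib_left[symmetric]) simp
qed

text \<open>The point moves in the direction (1, -1) or its opposite, so for equal coordinates this
  is the derivative across the diagonal.\<close>

lemma Phi_deriv:
 assumes f: "good f" and g: "good g" and x: "x > 0" and y: "y > 0" and c: "c = 1 | c = -1"
 shows "((%e. Phi h f g (x + c * e) (y - c * e)) has_vector_derivative rot c * (Phi h1 f g x y - Phi h2 f g x y)) (at 0)"
proof -
 define m where "m = min x y / 2"
 have m: "m > 0" using x y by (simp add: m_def)
 obtain B \<mu> where B: "B > 0" "\<mu> > 0" "!!z1 z2 K s. z1 \<in> SZ ==> z2 \<in> SZ ==> m <= norm z1 + norm z2 ==> s - (x + y + m) <= norm z1 + norm z2 ==>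
   K \<in> {G, G1, G2, h, h1, h2} ==> norm (K z1 z2) <= B * exp (- \<mu> * s)" using kernel_exp[OF m, of "x + y + m"] by blast
 have J: "((%e. J F (%s. h (rot (x + c * e)) (of_real d + rot (y - c * e + \<tau> * s)))) has_vector_derivative
   J F (%s. rot c * (h1 (rot x) (of_real d + rot (y + \<tau> * s)) - h2 (rot x) (of_real d + rot (y + \<tau> * s))))) (at 0)"
  if F: "good F" and d: "(d = 0 & \<tau> = -1) | (d = 2 * a & \<tau> = 1)" for F d \<tau>
 proof -
  define z1 z2 where "z1 = (%e. rot (x + c * e))" and "z2 = (%s e. of_real d + rot (y - c * e + \<tau> * s))"
  define D where "D = (%e s. rot c * (h1 (z1 e) (z2 s e) - h2 (z1 e) (z2 s e)))"
  obtain L where [measurable]: "F \<in> borel_measurable borel" and L: "L >= 0" "!!s. s > 0 ==> norm (F s) <= L * sqrt s" using F unfolding good_def by blast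
  have Z: "z1 e \<in> SZ & z2 s e \<in> SZ & m <= norm (z1 e) + norm (z2 s e) & s - (x + y + m) <= norm (z1 e) + norm (z2 s e)"
   if e: "e \<in> {-m<..<m}" and s: "s > 0" for e s
  proof -
   have b: "\<bar>c * e\<bar> < m" "2 * m <= x" "2 * m <= y" using e c by (auto simp: m_def)
   have n1: "norm (z1 e) >= m" unfolding z1_def norm_of_real_om using b by linarith
   have "z2 s e \<in> SZ & s - (x + y + m) <= norm (z2 s e)"
    using d
   proof (elim disjE conjE)
    assume "d = 0" "\<tau> = -1"
    then have "z2 s e = rot (y - c * e - s)" by (simp add: z2_def)
    then show ?thesis using b m x by (simp only: SZ_om norm_of_real_om simp_thms)
   next
    assume d: "d = 2 * a" "\<tau> = 1"
    have "y - c * e + \<tau> * s >= 0" "s <= y - c * e + \<tau> * s" using b s m d by (auto simp: abs_if split: if_splits)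
    then show ?thesis unfolding d(1) z2_def using SZ_2a[of "y - c * e + \<tau> * s"] x y m by linarith
   qed
   then show ?thesis using n1 SZ_om[of "x + c * e", folded z1_def] norm_ge_zero[of "z2 s e"] m unfolding z1_def by linarith
  qed
  have wi: "integrable lborel (%s. indicator {0<..} s *\<^sub>R (2 * B * exp (- \<mu> * s) * (L * sqrt s)))"
  proof -
   have "set_integrable lborel {0<..} (%s. of_real (2 * B * exp (- \<mu> * s)) * of_real (L * sqrt s) :: complex)"
    by (rule adm_integrable[OF adm_exp[OF _ B(2), where B="2 * B"]]) (use B L in \<open>auto simp: good_def norm_mult\<close>)
   from set_integrable_norm[OF this] show ?thesis
    unfolding set_integrable_def by (rule Bochner_Integration.integrable_cong[THEN iffD1, rotated 2]) (use B L in \<open>auto simp: indicator_def norm_mult\<close>)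
  qed
  have "((%e. LINT s|lborel. indicator {0<..} s *\<^sub>R (h (z1 e) (z2 s e) * F s)) has_vector_derivative (LINT s|lborel. indicator {0<..} s *\<^sub>R (D 0 s * F s))) (at 0)"
  proof (rule has_vector_derivative_lebesgue_integral[where S="{-m<..<m}" and f'="%e s. indicator {0<..} s *\<^sub>R (D e s * F s)" and g="%s. indicator {0<..} s *\<^sub>R (2 * B * exp (- \<mu> * s) * (L * sqrt s))"])
   show "integrable lborel (%s. indicator {0<..} s *\<^sub>R (h (z1 e) (z2 s e) * F s))" if "e \<in> {-m<..<m}" for e
    using adm_integrable[OF adm_kernel[OF _ _ m, of "%s. z1 e" "%s. z2 s e" "x + y + m" h] F] Z[OF that]
    unfolding set_integrable_def z2_def by (simp del: of_real_add of_real_diff of_real_mult)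
   fix e s assume e: "e \<in> {-m<..<m}"
   have zd: "(z1 has_vector_derivative rot c) (at e)" "(z2 s has_vector_derivative - (rot c)) (at e)"
    unfolding z1_def z2_def by (auto intro!: derivative_eq_intros simp: has_vector_derivative_def scaleR_conv_of_real algebra_simps)
   show "((%e. indicator {0<..} s *\<^sub>R (h (z1 e) (z2 s e) * F s)) has_vector_derivative indicator {0<..} s *\<^sub>R (D e s * F s)) (at e)"
   proof (cases "s > 0")
    case True
    have "(z1 e)^2 + (z2 s e)^2 \<notin> \<real>\<^sub>\<le>\<^sub>0" using Z[OF e True] m by (intro SZ_q(3)) auto
    from has_vector_derivative_mult_left[OF kernel_chain(1)[OF this zd, of kh 0 1 2, unfolded nth6], of "F s"] show ?thesis
     using True by (simp add: D_def algebra_simps)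
   qed simp
   show "norm (indicator {0<..} s *\<^sub>R (D e s * F s)) <= indicator {0<..} s *\<^sub>R (2 * B * exp (- \<mu> * s) * (L * sqrt s))"
   proof (cases "s > 0")
    case True
    have "norm (h1 (z1 e) (z2 s e)) <= B * exp (- \<mu> * s)" "norm (h2 (z1 e) (z2 s e)) <= B * exp (- \<mu> * s)" using B(3) Z[OF e True] by blast+
    then have "norm (D e s) <= 2 * B * exp (- \<mu> * s)" using norm_triangle_ineq4[of "h1 (z1 e) (z2 s e)" "h2 (z1 e) (z2 s e)"] c by (auto simp: D_def norm_mult)
    from mult_mono[OF this L(2)[OF True]] show ?thesis using True B by (simp add: norm_mult)
   qed simp
  qed (use m wi in \<open>auto simp: D_def z1_def z2_def simp del: of_real_add of_real_diff of_real_mult\<close>)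
  then show ?thesis by (simp add: J_def set_lebesgue_integral_def D_def z1_def z2_def)
 qed
 note Jf = J[OF f, of 0 "-1"] and Jg = J[OF g, of "2 * a" 1]
 have e: "J F (%s. rot c * (p s - q s)) = rot c * (J F p - J F q)" if "adm p" "adm q" "good F" for F p q
  using J_diff[OF that] unfolding J_def by (simp add: mult.assoc del: left_diff_distrib)
 note P = Phi_adm[OF x y]
 have "((%e. om * (J f (%s. h (rot (x + c * e)) (of_real 0 + rot (y - c * e + - 1 * s))) + J g (%s. h (rot (x + c * e)) (of_real (2 * a) + rot (y - c * e + 1 * s))))) has_vector_derivative
   om * (J f (%s. rot c * (h1 (rot x) (of_real 0 + rot (y + - 1 * s)) - h2 (rot x) (of_real 0 + rot (y + - 1 * s))))
    + J g (%s. rot c * (h1 (rot x) (of_real (2 * a) + rot (y + 1 * s)) - h2 (rot x) (of_real (2 * a) + rot (y + 1 * s)))))) (at 0)"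
  by (intro has_vector_derivative_mult_right has_vector_derivative_add Jf Jg) auto
 moreover have e1: "J f (%s. rot c * (h1 (rot x) (of_real 0 + rot (y + - 1 * s)) - h2 (rot x) (of_real 0 + rot (y + - 1 * s)))) =
   rot c * (J f (%s. h1 (rot x) (rot (y - s))) - J f (%s. h2 (rot x) (rot (y - s))))"
  using e[OF P(1) P(1) f, of h1 h2] by simp
 moreover have e2: "J g (%s. rot c * (h1 (rot x) (of_real (2 * a) + rot (y + 1 * s)) - h2 (rot x) (of_real (2 * a) + rot (y + 1 * s)))) =
   rot c * (J g (%s. h1 (rot x) (of_real (2 * a) + rot (y + s))) - J g (%s. h2 (rot x) (of_real (2 * a) + rot (y + s))))"
  using e[OF P(3) P(3) g, of h1 h2] by simp
 have "(%e. om * (J f (%s. h (rot (x + c * e)) (of_real 0 + rot (y - c * e + - 1 * s))) + J g (%s. h (rot (x + c * e)) (of_real (2 * a) + rot (y - c * e + 1 * s)))))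
   = (%e. Phi h f g (x + c * e) (y - c * e))" by (simp add: Phi_def fun_eq_iff)
 moreover have "om * (rot c * (A1 - A2) + rot c * (B1 - B2)) = rot c * (om * (A1 + B1) - om * (A2 + B2))" for A1 A2 B1 B2
  by (simp add: algebra_simps)
 ultimately show ?thesis unfolding e1 e2 Phi_def[of h1] Phi_def[of h2] by (simp only:)
qed

end

subsection \<open>Extinction\<close>

context hsm begin

lemma powr_side_integrable:
 fixes e :: real assumes "e < 1"
 shows "set_integrable lborel {-a<..<a} (%y. \<bar>c - y\<bar> powr (- e))"
 unfolding set_integrable_def
proof (rule Bochner_Integration.integrable_bound)
 have "integrable lborel (%y. \<bar>- c + 1 * y\<bar> powr (- e) * exp (- 1 * \<bar>- c + 1 * y\<bar>))"
  using lborel_integrable_real_affine[OF integrable_powr_exp_abs[OF assms, of 1], of 1 "- c"] by simp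
 then show "integrable lborel (%y. exp (\<bar>c\<bar> + a) * (\<bar>- c + 1 * y\<bar> powr (- e) * exp (- 1 * \<bar>- c + 1 * y\<bar>)))" by (rule integrable_mult_right)
 show "AE y in lborel. norm (indicator {-a<..<a} y *\<^sub>R \<bar>c - y\<bar> powr (- e)) <= norm (exp (\<bar>c\<bar> + a) * (\<bar>- c + 1 * y\<bar> powr (- e) * exp (- 1 * \<bar>- c + 1 * y\<bar>)))"
 proof (rule AE_I2)
  fix y :: real
  show "norm (indicator {-a<..<a} y *\<^sub>R \<bar>c - y\<bar> powr (- e)) <= norm (exp (\<bar>c\<bar> + a) * (\<bar>- c + 1 * y\<bar> powr (- e) * exp (- 1 * \<bar>- c + 1 * y\<bar>)))"
  proof (cases "y \<in> {-a<..<a}")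
   case True
   have "1 <= exp (\<bar>c\<bar> + a) * exp (- 1 * \<bar>- c + 1 * y\<bar>)" using True unfolding exp_add[symmetric] by auto
   from mult_left_mono[OF this, of "\<bar>c - y\<bar> powr (- e)"] show ?thesis
    using True by (simp add: mult_ac abs_minus_commute)
  qed simp
 qed
qed simp

end

text \<open>Data beyond the upper end (\<open>p j\<close>) and beyond the lower end
  (\<open>q j\<close>) of side \<open>j\<close>, with the coupling equations at every
  \<open>r > 0\<close> and not merely almost everywhere. The upper end of side \<open>j\<close> is
  the lower end of side \<open>Suc j\<close>, which fixes the pattern of indices.\<close>

locale hdata = hsm +
 fixes p q :: "nat => real => complex"
 assumes good: "good (p j)" "good (q j)" and per: "p (j + 4) = p j" "q (j + 4) = q j"
  and p_eq: "r > 0 ==> p j r = A (q (Suc j)) (p (Suc j)) r" and q_eq: "r > 0 ==> q (Suc j) r = A (p j) (q j) r"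
begin

lemma J_cong: "(!!r. r > 0 ==> f r = g r) ==> J f = J g"
 unfolding J_def by (intro ext set_lebesgue_integral_cong) auto

text \<open>Both solutions have the traces \<open>p j\<close> and \<open>q (Suc j)\<close> on the
  two edges of the common quarter-plane, so \<open>half_glue\<close> writes them as the same sum
  with the edges exchanged.\<close>

lemma glue: "x > 0 ==> y > 0 ==> Phi h (p j) (q j) x y = Phi h (q (Suc j)) (p (Suc j)) y x"
 unfolding half_glue[OF good] half_glue[OF good(2) good(1)] using J_cong[OF p_eq[of _ j]] J_cong[OF q_eq[of _ j]] by simp

text \<open>The neighbouring half-plane has its two coordinates exchanged; this reverses the
  direction across the diagonal and accounts for the sign.\<close>

lemma glue_deriv:
 assumes t: "t > 0"
 shows "Phi h1 (p j) (q j) t t - Phi h2 (p j) (q j) t t = - (Phi h1 (q (Suc j)) (p (Suc j)) t t - Phi h2 (q (Suc j)) (p (Suc j)) t t)"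
proof -
 have "((%e. Phi h (p j) (q j) (t + 1 * e) (t - 1 * e)) has_vector_derivative rot 1 * (Phi h1 (p j) (q j) t t - Phi h2 (p j) (q j) t t)) (at 0)"
  by (rule Phi_deriv[OF good t t]) simp
 moreover have "((%e. Phi h (p j) (q j) (t + 1 * e) (t - 1 * e)) has_vector_derivative rot (-1) * (Phi h1 (q (Suc j)) (p (Suc j)) t t - Phi h2 (q (Suc j)) (p (Suc j)) t t)) (at 0)"
 proof (rule has_vector_derivative_transform_within_open)
  show "((%e. Phi h (q (Suc j)) (p (Suc j)) (t + -1 * e) (t - -1 * e)) has_vector_derivative rot (-1) * (Phi h1 (q (Suc j)) (p (Suc j)) t t - Phi h2 (q (Suc j)) (p (Suc j)) t t)) (at 0)"
   by (rule Phi_deriv[OF good(2) good(1) t t]) simp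
  show "Phi h (q (Suc j)) (p (Suc j)) (t + -1 * e) (t - -1 * e) = Phi h (p j) (q j) (t + 1 * e) (t - 1 * e)" if "e \<in> {-t<..<t}" for e
   using glue[of "t + e" "t - e" j] that by simp
 qed (use t in auto)
 ultimately have "rot 1 * (Phi h1 (p j) (q j) t t - Phi h2 (p j) (q j) t t) = rot (-1) * (Phi h1 (q (Suc j)) (p (Suc j)) t t - Phi h2 (q (Suc j)) (p (Suc j)) t t)"
  by (rule vector_derivative_unique_at)
 then have "om * (Phi h1 (p j) (q j) t t - Phi h2 (p j) (q j) t t) = om * - (Phi h1 (q (Suc j)) (p (Suc j)) t t - Phi h2 (q (Suc j)) (p (Suc j)) t t)"
  by (simp only: of_real_1 of_real_minus mult_1_left mult_minus_left mult_minus_right)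
 then show ?thesis by (simp only: mult_cancel_left om_nz simp_thms)
qed

text \<open>For \<open>K = h\<close> the half-plane solution of side \<open>j\<close> at depth
  \<open>z\<close> and height \<open>y\<close>; for \<open>h1\<close> and \<open>h2\<close> its
  partial derivatives. The two integrals run over the sources beyond the upper and the lower
  end.\<close>

definition V :: "(complex => complex => complex) => nat => complex => complex => complex" where
 "V K j z y = om * (J (p j) (%s. K z (y - cs s)) + J (q j) (%s. K z (y + cs s)))"

lemma cs_measurable [measurable]: "cs \<in> borel_measurable borel"
 unfolding cs_def[abs_def] by measurable

text \<open>Interchange of the integral over the sources \<open>w s\<close> of the half-plane solution with the integral
  over a piece of the path; \<open>\<tau> t\<close> bounds the distance from the source line.\<close>

lemma source_swap:
 fixes S :: "real set" and w :: "real => complex"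
 assumes f: "good f" and [measurable]: "S \<in> sets borel" "zt \<in> borel_measurable borel" "yt \<in> borel_measurable borel" "w \<in> borel_measurable borel"
  and Z: "!!s t. s > 0 ==> t \<in> S ==> zt t \<in> SZ & yt t - w s \<in> SZ & 0 < \<tau> t & s <= norm (zt t) + norm (yt t - w s) & \<tau> t <= norm (zt t) + norm (yt t - w s)"
  and g: "!!i. i < 3 ==> (%t. g i (zt t) (yt t)) \<in> borel_measurable borel" "!!i t. i < 3 ==> t \<in> S ==> norm (g i (zt t) (yt t)) <= b t"
  and b: "set_integrable lborel S (%t. b t * \<tau> t powr (-5/8))"
 shows "(LINT t:S|lborel. J f (%s. flux \<alpha> \<beta> (fS (w s)) g (zt t) (yt t))) = J f (%s. LINT t:S|lborel. flux \<alpha> \<beta> (fS (w s)) g (zt t) (yt t))"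
  and "set_integrable lborel {0<..} (%s. (LINT t:S|lborel. flux \<alpha> \<beta> (fS (w s)) g (zt t) (yt t)) * f s)"
  and "set_integrable lborel S (%t. J f (%s. flux \<alpha> \<beta> (fS (w s)) g (zt t) (yt t)))"
  and "!!t. t \<in> S ==> J f (%s. flux \<alpha> \<beta> (fS (w s)) g (zt t) (yt t)) =
   \<beta> * (g 0 (zt t) (yt t) * J f (%s. h1 (zt t) (yt t - w s)) - J f (%s. h (zt t) (yt t - w s)) * g 1 (zt t) (yt t))
   - \<alpha> * (g 0 (zt t) (yt t) * J f (%s. h2 (zt t) (yt t - w s)) - J f (%s. h (zt t) (yt t - w s)) * g 2 (zt t) (yt t))"
  and "\<exists>D. \<forall>t\<in>S. \<forall>K\<in>{h, h1, h2}. norm (J f (%s. K (zt t) (yt t - w s))) <= D * \<tau> t powr (-5/8)"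
proof -
 obtain C \<mu> where C: "C > 0" "\<mu> > 0" "!!K z1 z2 s t. K \<in> {h, h1, h2} ==> z1 \<in> SZ ==> z2 \<in> SZ ==> 0 < s ==> 0 < t ==> s <= norm z1 + norm z2 ==> t <= norm z1 + norm z2 ==>
    norm (K z1 z2) <= C * (s powr (-11/8) * exp (- \<mu> * s)) * t powr (-5/8)" using kernel_sep by metis
 obtain L where [measurable]: "f \<in> borel_measurable borel" and L: "L >= 0" "!!s. s > 0 ==> norm (f s) <= L * sqrt s" using f unfolding good_def by blast
 have [measurable]: "(%t. g 0 (zt t) (yt t)) \<in> borel_measurable borel" "(%t. g 1 (zt t) (yt t)) \<in> borel_measurable borel" "(%t. g 2 (zt t) (yt t)) \<in> borel_measurable borel"
  by (rule g(1), simp)+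
 let ?W = "%s. C * (s powr (-11/8) * exp (- \<mu> * s)) * (L * sqrt s)"
 have Kb: "norm (K (zt t) (yt t - w s)) <= C * (s powr (-11/8) * exp (- \<mu> * s)) * \<tau> t powr (-5/8)" if "s > 0" "t \<in> S" "K \<in> {h, h1, h2}" for K s t
  using Z[OF that(1,2)] C(3)[OF that(3), of "zt t" "yt t - w s" s "\<tau> t"] that(1) by blast
 have Ka: "adm (%s. K (zt t) (yt t - w s))" if t: "t \<in> S" and K: "K \<in> {h, h1, h2}" for K t
  unfolding adm_def
 proof (rule conjI)
  show "(%s. K (zt t) (yt t - w s)) \<in> borel_measurable borel" using K by (elim insertE) simp_all
  have "norm (K (zt t) (yt t - w s)) <= C * \<tau> t powr (-5/8) * (s powr (-11/8) * exp (- \<mu> * s))" if "s > 0" for s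
   using Kb[OF that t K] by (simp only: mult_ac)
  moreover have "0 <= C * \<tau> t powr (-5/8)" using C by simp
  ultimately show "\<exists>B \<mu>. 0 <= B & 0 < \<mu> & (\<forall>s>0. norm (K (zt t) (yt t - w s)) <= B * (s powr (-11/8) * exp (- \<mu> * s)))"
   using C(2) by blast
 qed
 show "\<exists>D. \<forall>t\<in>S. \<forall>K\<in>{h, h1, h2}. norm (J f (%s. K (zt t) (yt t - w s))) <= D * \<tau> t powr (-5/8)"
 proof (intro exI[of _ "LINT s:{0<..}|lborel. ?W s"] ballI)
  fix t K assume t: "t \<in> S" and K: "K \<in> {h, h1, h2}"
  have "norm (J f (%s. K (zt t) (yt t - w s))) <= (LINT s:{0<..}|lborel. ?W s * \<tau> t powr (-5/8))"
  proof (rule norm_J_le)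
   show "set_integrable lborel {0<..} (%s. ?W s * \<tau> t powr (-5/8))" using weight_integrable[OF C(2)] by (intro set_integrable_mult_left) auto
   show "norm (K (zt t) (yt t - w s) * f s) <= ?W s * \<tau> t powr (-5/8)" if "s > 0" for s
    using mult_mono[OF Kb[OF that t K] L(2)[OF that]] C by (simp add: norm_mult mult_ac)
  qed
  then show "norm (J f (%s. K (zt t) (yt t - w s))) <= (LINT s:{0<..}|lborel. ?W s) * \<tau> t powr (-5/8)" by simp
 qed
 define F where "F = (%s t. indicator {0<..} s *\<^sub>R (indicator S t *\<^sub>R (flux \<alpha> \<beta> (fS (w s)) g (zt t) (yt t) * f s)))"
 define w1 where "w1 = (%s. indicator {0<..} s *\<^sub>R ?W s)"
 define w2 where "w2 = (%t. 2 * (norm \<alpha> + norm \<beta>) * (indicator S t *\<^sub>R (b t * \<tau> t powr (-5/8))))"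
 have fl: "flux \<alpha> \<beta> (fS (w s)) g (zt t) (yt t) = \<beta> * (g 0 (zt t) (yt t) * h1 (zt t) (yt t - w s) - h (zt t) (yt t - w s) * g 1 (zt t) (yt t))
   - \<alpha> * (g 0 (zt t) (yt t) * h2 (zt t) (yt t - w s) - h (zt t) (yt t - w s) * g 2 (zt t) (yt t))" for s t
  by (simp add: flux_def fS_def)
 have Fm: "(%(s, t). F s t) \<in> borel_measurable (lborel \<Otimes>\<^sub>M lborel)" unfolding F_def fl by measurable
 have wi: "integrable lborel w1" "integrable lborel w2"
  unfolding w1_def w2_def using weight_integrable[OF C(2), of C L] b by (auto simp only: set_integrable_def intro!: integrable_mult_right)
 have le: "norm (F s t) <= w1 s * w2 t" for s t
 proof (cases "s > 0 & t \<in> S")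
  case True
  let ?k = "C * (s powr (-11/8) * exp (- \<mu> * s)) * \<tau> t powr (-5/8)"
  have k0: "?k >= 0" using C by simp
  have b0: "b t >= 0" using g(2)[of 0 t] True norm_ge_zero order.trans by (metis zero_less_numeral)
  have x: "norm (g 0 (zt t) (yt t) * K (zt t) (yt t - w s) - h (zt t) (yt t - w s) * g i (zt t) (yt t)) <= 2 * (b t * ?k)"
   if "K \<in> {h, h1, h2}" "i < 3" for K i
  proof -
   have "norm (g 0 (zt t) (yt t) * K (zt t) (yt t - w s)) <= b t * ?k" "norm (h (zt t) (yt t - w s) * g i (zt t) (yt t)) <= ?k * b t"
    unfolding norm_mult using Kb[of s t] g(2) that True b0 k0 by (intro mult_mono; simp)+
   then show ?thesis by (intro order.trans[OF norm_triangle_ineq4]) (simp add: mult.commute)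
  qed
  have "norm (flux \<alpha> \<beta> (fS (w s)) g (zt t) (yt t)) <= norm \<beta> * (2 * (b t * ?k)) + norm \<alpha> * (2 * (b t * ?k))"
   unfolding fl by (intro order.trans[OF norm_triangle_ineq4] add_mono; unfold norm_mult; intro mult_left_mono x) auto
  also have "... = 2 * (norm \<alpha> + norm \<beta>) * (b t * ?k)" by (simp add: algebra_simps)
  finally have "norm (flux \<alpha> \<beta> (fS (w s)) g (zt t) (yt t)) * norm (f s) <= 2 * (norm \<alpha> + norm \<beta>) * (b t * ?k) * (L * sqrt s)"
   using L True k0 b0 by (intro mult_mono) auto
  then show ?thesis using True by (simp add: F_def w1_def w2_def norm_mult mult_ac)
 qed (auto simp: F_def w1_def w2_def indicator_def)
 note SW = swap_LINT[OF Fm wi le]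
 have e1: "(LINT t|lborel. F s t) = indicator {0<..} s *\<^sub>R ((LINT t:S|lborel. flux \<alpha> \<beta> (fS (w s)) g (zt t) (yt t)) * f s)" for s
 proof (cases "s > 0")
  case True
  have "F s t = (indicator S t *\<^sub>R flux \<alpha> \<beta> (fS (w s)) g (zt t) (yt t)) * f s" for t
   using True by (simp add: F_def)
  then show ?thesis using True unfolding set_lebesgue_integral_def by (simp only: integral_mult_left_zero) simp
 qed (simp add: F_def)
 have e2: "(LINT s|lborel. F s t) = indicator S t *\<^sub>R J f (%s. flux \<alpha> \<beta> (fS (w s)) g (zt t) (yt t))" for t
 proof -
  have "F s t = indicator S t *\<^sub>R (indicator {0<..} s *\<^sub>R (flux \<alpha> \<beta> (fS (w s)) g (zt t) (yt t) * f s))" for s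
   by (simp add: F_def mult_ac)
  then show ?thesis unfolding J_def set_lebesgue_integral_def by (simp only: integral_scaleR_right)
 qed
 show "(LINT t:S|lborel. J f (%s. flux \<alpha> \<beta> (fS (w s)) g (zt t) (yt t))) = J f (%s. LINT t:S|lborel. flux \<alpha> \<beta> (fS (w s)) g (zt t) (yt t))"
  using SW(1) unfolding e1 e2 by (simp only: J_def[of f] set_lebesgue_integral_def)
 show "set_integrable lborel {0<..} (%s. (LINT t:S|lborel. flux \<alpha> \<beta> (fS (w s)) g (zt t) (yt t)) * f s)"
  "set_integrable lborel S (%t. J f (%s. flux \<alpha> \<beta> (fS (w s)) g (zt t) (yt t)))"
  using SW(2,3) unfolding e1 e2 set_integrable_def .
 show "J f (%s. flux \<alpha> \<beta> (fS (w s)) g (zt t) (yt t)) =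
   \<beta> * (g 0 (zt t) (yt t) * J f (%s. h1 (zt t) (yt t - w s)) - J f (%s. h (zt t) (yt t - w s)) * g 1 (zt t) (yt t))
   - \<alpha> * (g 0 (zt t) (yt t) * J f (%s. h2 (zt t) (yt t - w s)) - J f (%s. h (zt t) (yt t - w s)) * g 2 (zt t) (yt t))" if t: "t \<in> S" for t
 proof -
  note i = adm_integrable[OF Ka[OF t] f]
  have fl': "flux \<alpha> \<beta> (fS (w s)) g (zt t) (yt t) * f s = (\<beta> * g 0 (zt t) (yt t)) * (h1 (zt t) (yt t - w s) * f s)
    - (\<alpha> * g 0 (zt t) (yt t)) * (h2 (zt t) (yt t - w s) * f s) - (\<beta> * g 1 (zt t) (yt t) - \<alpha> * g 2 (zt t) (yt t)) * (h (zt t) (yt t - w s) * f s)" for s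
   unfolding fl by (simp add: algebra_simps)
  have m: "set_integrable lborel {0<..} (%s. c * (K (zt t) (yt t - w s) * f s))" if "K \<in> {h, h1, h2}" for K c
   by (intro set_integrable_mult_right i that)
  show ?thesis unfolding J_def fl'
   by (subst set_integral_diff(2), (intro set_integral_diff(1) m; simp)+, subst set_integral_diff(2), (intro m; simp)+)
     (simp only: set_integral_mult_right, simp only: algebra_simps)
 qed
qed

definition Vf :: "nat => nat => complex => complex => complex" where
 "Vf j i = V ([h, h1, h2, h, h, h] ! i) j"

text \<open>The normal derivative of the half-plane solution on its side; it becomes the density of
  the single layer.\<close>

abbreviation v :: "nat => real => complex" where "v j y \<equiv> V h1 j 0 (of_real y)"

text \<open>Flux of the half-plane solution \<open>j\<close> through the upper and the lower diagonal.\<close>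

definition dU :: "nat => (nat => complex => complex => complex) => complex" where
 "dU j g = (LINT t:{0<..}|lborel. flux om om (Vf j) g (rot t) (cs t))"
definition dL :: "nat => (nat => complex => complex => complex) => complex" where
 "dL j g = (LINT t:{0<..}|lborel. flux om (- om) (Vf j) g (rot t) (- cs t))"

lemma LINT_Ici: "(LINT t:{0..}|lborel. F t) = (LINT t:{0<..}|lborel. F t :: complex)" for F :: "real => complex"
 unfolding set_lebesgue_integral_def by (rule integral_discrete_difference[of "{0}"]) (auto simp: indicator_def)

lemma LINT_Icc: "(LINT t:{-a..a}|lborel. F t) = (LINT t:{-a<..<a}|lborel. F t :: complex)" for F :: "real => complex"
 unfolding set_lebesgue_integral_def by (rule integral_discrete_difference[of "{-a, a}"]) (auto simp: indicator_def)

definition meas3 :: "(nat => complex => complex => complex) => bool" where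
 "meas3 g \<longleftrightarrow> (\<forall>i<3. \<forall>zt\<in>borel_measurable borel. \<forall>yt\<in>borel_measurable borel. (%t::real. g i (zt t) (yt t)) \<in> borel_measurable borel)"

text \<open>Flux identities are available for one source at a time; here they are integrated against
  the data. The weight that \<open>source_swap\<close> asks for is the ray parameter on the rays and
  the distance to the corner next to the sources on the side. The last claim is the resulting bound
  of order -5/8 for the normal derivative.\<close>

lemma source_TT:
 assumes f: "good f" and w: "w = cs | w = (%s. - cs s)"
  and g: "fld g (1 * om) om (of_real a) {0} {0..}" "fld g 0 1 0 {0} {-a..a}" "fld g (1 * om) (- om) (- of_real a) {0} {0..}"
  and m3: "meas3 g"
 shows "J f (%s. TT a 1 (fS (w s)) g 0) = (LINT t:{0<..}|lborel. J f (%s. flux om om (fS (w s)) g (rot t) (cs t)))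
   + (LINT y:{-a<..<a}|lborel. J f (%s. flux 0 1 (fS (w s)) g 0 (of_real y)))
   - (LINT t:{0<..}|lborel. J f (%s. flux om (- om) (fS (w s)) g (rot t) (- cs t)))"
  and "set_integrable lborel {0<..} (%s. TT a 1 (fS (w s)) g 0 * f s)"
  and "set_integrable lborel {0<..} (%t. J f (%s. flux om om (fS (w s)) g (rot t) (cs t)))"
  and "set_integrable lborel {-a<..<a} (%y. J f (%s. flux 0 1 (fS (w s)) g 0 (of_real y)))"
  and "set_integrable lborel {0<..} (%t. J f (%s. flux om (- om) (fS (w s)) g (rot t) (- cs t)))"
  and "!!\<alpha> \<beta> z y. (\<exists>t>0. z = rot t & (y = cs t | y = - cs t)) | (\<exists>t\<in>{-a<..<a}. z = 0 & y = of_real t) ==>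
    J f (%s. flux \<alpha> \<beta> (fS (w s)) g z y) = \<beta> * (g 0 z y * J f (%s. h1 z (y - w s)) - J f (%s. h z (y - w s)) * g 1 z y)
     - \<alpha> * (g 0 z y * J f (%s. h2 z (y - w s)) - J f (%s. h z (y - w s)) * g 2 z y)"
  and "\<exists>D. \<forall>y\<in>{-a<..<a}. norm (J f (%s. h1 0 (of_real y - w s))) <= D * (if w = cs then a - y else a + y) powr (-5/8)"
proof -
 let ?d = "%y. if w = cs then a - y else a + y"
 have gm: "(%t::real. g i (zt t) (yt t)) \<in> borel_measurable borel" if "i < 3" "zt \<in> borel_measurable borel" "yt \<in> borel_measurable borel" for i zt yt
  using m3 that unfolding meas3_def by blast
 have ws: "w s = cs s | w s = - cs s" for s using w by auto
 have wm [measurable]: "w \<in> borel_measurable borel" using w by auto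
 have U: "rot t \<in> SZ & cs t - w s \<in> SZ & 0 < t & s <= norm (rot t) + norm (cs t - w s) & t <= norm (rot t) + norm (cs t - w s)"
  "rot t \<in> SZ & - cs t - w s \<in> SZ & 0 < t & s <= norm (rot t) + norm (- cs t - w s) & t <= norm (rot t) + norm (- cs t - w s)"
  if "s > 0" "t \<in> {0<..}" for s t
 proof -
  have e: "cs t - w s = of_real a - w s + rot t" "- cs t - w s = - of_real a - w s + of_real t * (- om)" by (simp_all add: cs_def)
  note SS = SZ_src[OF that(1) ws[of s], of t]
  show "rot t \<in> SZ & cs t - w s \<in> SZ & 0 < t & s <= norm (rot t) + norm (cs t - w s) & t <= norm (rot t) + norm (cs t - w s)"
   "rot t \<in> SZ & - cs t - w s \<in> SZ & 0 < t & s <= norm (rot t) + norm (- cs t - w s) & t <= norm (rot t) + norm (- cs t - w s)"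
   unfolding e norm_of_real_om using SS that SZ_om[of t] norm_ge_zero[of "of_real a - w s + rot t"] norm_ge_zero[of "- of_real a - w s + of_real t * (- om)"] by auto
 qed
 have Y: "0 \<in> SZ & of_real y - w s \<in> SZ & 0 < (?d y) & s <= norm (0::complex) + norm (of_real y - w s) & (?d y) <= norm (0::complex) + norm (of_real y - w s)"
  if "s > 0" "y \<in> {-a<..<a}" for s y
  using SZ_cs[of s y] that w SZ_om[of 0] by (auto split: if_splits)
 have gb: "\<exists>B \<mu>. 0 < B & 0 < \<mu> & (\<forall>s\<in>T. \<forall>i<3. norm (g i (of_real s * \<alpha>) (\<zeta> + of_real s * \<beta>)) <= B * exp (- \<mu> * \<bar>s\<bar>))" if "fld g \<alpha> \<beta> \<zeta> {0} T" for \<alpha> \<beta> \<zeta> T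
  using that unfolding fld_def by simp
 obtain B1 \<mu>1 where 1: "0 < B1" "0 < \<mu>1" "!!s i. s >= 0 ==> i < 3 ==> norm (g i (rot s) (cs s)) <= B1 * exp (- \<mu>1 * \<bar>s\<bar>)"
  using gb[OF g(1)] by (auto simp: cs_def)
 obtain B2 \<mu>2 where 2: "0 < B2" "0 < \<mu>2" "!!s i. s >= 0 ==> i < 3 ==> norm (g i (rot s) (- cs s)) <= B2 * exp (- \<mu>2 * \<bar>s\<bar>)"
  using gb[OF g(3)] by (auto simp: cs_def)
 obtain B3 \<mu>3 where 3: "0 < B3" "0 < \<mu>3" "!!y i. y \<in> {-a..a} ==> i < 3 ==> norm (g i 0 (of_real y)) <= B3 * exp (- \<mu>3 * \<bar>y\<bar>)"
  using gb[OF g(2)] by auto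
 note mu = 1(2) 2(2)
 have 3: "norm (g i 0 (of_real y)) <= B3" if "i < 3" "y \<in> {-a<..<a}" for y i
 proof -
  have "B3 * exp (- \<mu>3 * \<bar>y\<bar>) <= B3 * 1" using 3(1,2) by (intro mult_left_mono) auto
  then show ?thesis using 3(3)[of y i] that by auto
 qed
 have ray: "set_integrable lborel {0<..} (%t. B * exp (- \<mu> * \<bar>t\<bar>) * t powr (-5/8))" if "\<mu> > 0" for B \<mu> :: real
 proof -
  have "integrable lborel (%t. indicator {0<..} t *\<^sub>R (B * (\<bar>t\<bar> powr (-5/8) * exp (- \<mu> * \<bar>t\<bar>))))"
   using integrable_powr_exp_abs[of "5/8" \<mu>] that by (intro integrable_mult_indicator integrable_mult_right) auto
  then show ?thesis unfolding set_integrable_def by (rule Bochner_Integration.integrable_cong[THEN iffD1, rotated 2]) (auto simp: indicator_def)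
 qed
 have side: "set_integrable lborel {-a<..<a} (%y. B3 * (?d y) powr (-5/8))"
 proof (intro set_integrable_mult_right)
  have e: "(?d y) = \<bar>(if w = cs then a else - a) - y\<bar>" if "y \<in> {-a<..<a}" for y using that by auto
  show "set_integrable lborel {-a<..<a} (%y. (?d y) powr (-5/8))"
   by (rule set_integrable_cong[THEN iffD1, OF refl refl _ powr_side_integrable[of "5/8" "if w = cs then a else - a"]])
     (auto simp: e[symmetric])
 qed
 have gm0: "(%t::real. g i 0 (of_real t)) \<in> borel_measurable borel" if "i < 3" for i by (rule gm[OF that]) auto
 have gmu: "(%t::real. g i (rot t) (cs t)) \<in> borel_measurable borel" "(%t::real. g i (rot t) (- cs t)) \<in> borel_measurable borel" if "i < 3" for i
  by (rule gm[OF that]; measurable)+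
 have mb: "{0<..} \<in> sets (borel :: real measure)" "{-a<..<a} \<in> sets (borel :: real measure)" "(%t. rot t) \<in> borel_measurable borel" "(%t. - cs t) \<in> borel_measurable borel"
   "(%t::real. 0 :: complex) \<in> borel_measurable borel" by measurable
 have mr: "complex_of_real \<in> borel_measurable borel" by (intro borel_measurable_continuous_onI continuous_intros)
 have 1: "norm (g i (rot t) (cs t)) <= B1 * exp (- \<mu>1 * \<bar>t\<bar>)" if "i < 3" "t \<in> {0<..}" for i t using 1(3) that by simp
 have 2: "norm (g i (rot t) (- cs t)) <= B2 * exp (- \<mu>2 * \<bar>t\<bar>)" if "i < 3" "t \<in> {0<..}" for i t using 2(3) that by simp
 note up = source_swap[where \<tau>="%t. t" and zt="%t. rot t" and yt=cs and g=g and w=w and b="%t. B1 * exp (- \<mu>1 * \<bar>t\<bar>)", OF f mb(1,3) cs_measurable wm U(1) gmu(1) 1 ray[OF mu(1)], simplified simp_thms implies_True_equals triv_forall_equality True_implies_equals]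
  and dn = source_swap[where \<tau>="%t. t" and zt="%t. rot t" and yt="%t. - cs t" and g=g and w=w and b="%t. B2 * exp (- \<mu>2 * \<bar>t\<bar>)", OF f mb(1,3,4) wm U(2) gmu(2) 2 ray[OF mu(2)], simplified simp_thms implies_True_equals triv_forall_equality True_implies_equals]
  and sd = source_swap[where \<tau>="%y. if w = cs then a - y else a + y" and zt="%t. 0" and yt=complex_of_real and g=g and w=w and b="%t. B3", OF f mb(2,5) mr wm Y gm0 3 side, simplified simp_thms implies_True_equals triv_forall_equality True_implies_equals]
 have TTe: "TT a 1 (fS (w s)) g 0 = (LINT t:{0<..}|lborel. flux om om (fS (w s)) g (rot t) (cs t)) + (LINT y:{-a<..<a}|lborel. flux 0 1 (fS (w s)) g 0 (of_real y))
   - (LINT t:{0<..}|lborel. flux om (- om) (fS (w s)) g (rot t) (- cs t))" for s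
  unfolding TT_def LINT_Ici LINT_Icc by (simp add: cs_def)
 show "J f (%s. TT a 1 (fS (w s)) g 0) = (LINT t:{0<..}|lborel. J f (%s. flux om om (fS (w s)) g (rot t) (cs t)))
   + (LINT y:{-a<..<a}|lborel. J f (%s. flux 0 1 (fS (w s)) g 0 (of_real y)))
   - (LINT t:{0<..}|lborel. J f (%s. flux om (- om) (fS (w s)) g (rot t) (- cs t)))"
 proof -
  have "J f (%s. A s + B s - C s) = J f A + J f B - J f C"
   if "set_integrable lborel {0<..} (%s. A s * f s)" "set_integrable lborel {0<..} (%s. B s * f s)" "set_integrable lborel {0<..} (%s. C s * f s)" for A B C
   unfolding J_def left_diff_distrib distrib_right using that by (simp add: set_integral_add set_integral_diff)
  from this[OF up(2) sd(2) dn(2)] show ?thesis unfolding TTe up(1) sd(1) dn(1) .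
 qed
 show "set_integrable lborel {0<..} (%s. TT a 1 (fS (w s)) g 0 * f s)"
  unfolding TTe left_diff_distrib distrib_right by (intro set_integral_diff(1) set_integral_add(1) up(2) sd(2) dn(2))
 show "set_integrable lborel {0<..} (%t. J f (%s. flux om om (fS (w s)) g (rot t) (cs t)))"
  "set_integrable lborel {-a<..<a} (%y. J f (%s. flux 0 1 (fS (w s)) g 0 (of_real y)))"
  "set_integrable lborel {0<..} (%t. J f (%s. flux om (- om) (fS (w s)) g (rot t) (- cs t)))"
  by (rule up(3) sd(3) dn(3))+
 show "J f (%s. flux \<alpha> \<beta> (fS (w s)) g z y) = \<beta> * (g 0 z y * J f (%s. h1 z (y - w s)) - J f (%s. h z (y - w s)) * g 1 z y)
     - \<alpha> * (g 0 z y * J f (%s. h2 z (y - w s)) - J f (%s. h z (y - w s)) * g 2 z y)"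
  if "(\<exists>t>0. z = rot t & (y = cs t | y = - cs t)) | (\<exists>t\<in>{-a<..<a}. z = 0 & y = of_real t)" for \<alpha> \<beta> z y
  using that up(4) dn(4) sd(4) by auto
 show "\<exists>D. \<forall>y\<in>{-a<..<a}. norm (J f (%s. h1 0 (of_real y - w s))) <= D * (?d y) powr (-5/8)"
  using sd(5) by blast
qed

end

context hdata begin

lemma J_cong2: "(!!s. s > 0 ==> \<phi> s = \<psi> s) ==> J f \<phi> = J f \<psi>"
 unfolding J_def by (intro set_lebesgue_integral_cong) auto

lemma J_minus: "J f (%s. - \<phi> s) = - J f \<phi>"
 by (simp add: J_def set_lebesgue_integral_def)

text \<open>Adds up the sources beyond both ends. On the side the solution itself vanishes, since
  \<open>h 0 z = 0\<close>, so only the product of \<open>g\<close> with the normal derivative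
  remains of the flux there.\<close>

lemma T_V:
 assumes g: "fld g (1 * om) om (of_real a) {0} {0..}" "fld g 0 1 0 {0} {-a..a}" "fld g (1 * om) (- om) (- of_real a) {0} {0..}"
  and gm: "meas3 g"
 shows "dU j g + (LINT y:{-a<..<a}|lborel. g 0 0 (of_real y) * v j y) - dL j g =
  om * (J (p j) (%s. TT a 1 (fS (cs s)) g 0) + J (q j) (%s. TT a 1 (fS (- cs s)) g 0))"
  and "set_integrable lborel {-a<..<a} (%y. g 0 0 (of_real y) * v j y)"
  and "\<exists>D\<ge>0. \<forall>y\<in>{-a<..<a}. norm (v j y) <= D * ((a - y) powr (-5/8) + (a + y) powr (-5/8))"
proof -
 note P = source_TT[where f="p j" and g=g and w=cs, OF good(1) disjI1[OF refl] g gm]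
  and Q = source_TT[where f="q j" and g=g and w="%s. - cs s", OF good(2) disjI2[OF refl] g gm]
 have fl: "flux \<alpha> \<beta> (Vf j) g z y = om * J (p j) (%s. flux \<alpha> \<beta> (fS (cs s)) g z y) + om * J (q j) (%s. flux \<alpha> \<beta> (fS (- cs s)) g z y)"
  if "(\<exists>t>0. z = rot t & (y = cs t | y = - cs t)) | (\<exists>t\<in>{-a<..<a}. z = 0 & y = of_real t)" for \<alpha> \<beta> z y
  unfolding P(6)[OF that] Q(6)[OF that]
  by (simp add: flux_def[of _ _ "Vf j"] Vf_def V_def algebra_simps)
 have h0: "h 0 z = 0" for z by (simp add: h_def)
 have sd: "flux 0 1 (Vf j) g 0 (of_real y) = g 0 0 (of_real y) * v j y" for y
  by (simp add: flux_def Vf_def V_def h0 J_def)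
 have U: "dU j g = om * (LINT t:{0<..}|lborel. J (p j) (%s. flux om om (fS (cs s)) g (rot t) (cs t))) + om * (LINT t:{0<..}|lborel. J (q j) (%s. flux om om (fS (- cs s)) g (rot t) (cs t)))"
 proof -
  have "dU j g = (LINT t:{0<..}|lborel. om * J (p j) (%s. flux om om (fS (cs s)) g (rot t) (cs t)) + om * J (q j) (%s. flux om om (fS (- cs s)) g (rot t) (cs t)))"
   unfolding dU_def by (rule set_lebesgue_integral_cong) (auto intro!: fl)
  then show ?thesis using P(3) Q(3) by (simp add: set_integral_add)
 qed
 have D: "dL j g = om * (LINT t:{0<..}|lborel. J (p j) (%s. flux om (- om) (fS (cs s)) g (rot t) (- cs t))) + om * (LINT t:{0<..}|lborel. J (q j) (%s. flux om (- om) (fS (- cs s)) g (rot t) (- cs t)))"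
 proof -
  have "dL j g = (LINT t:{0<..}|lborel. om * J (p j) (%s. flux om (- om) (fS (cs s)) g (rot t) (- cs t)) + om * J (q j) (%s. flux om (- om) (fS (- cs s)) g (rot t) (- cs t)))"
   unfolding dL_def by (rule set_lebesgue_integral_cong) (auto intro!: fl)
  then show ?thesis using P(5) Q(5) by (simp add: set_integral_add)
 qed
 let ?k = "%y. om * J (p j) (%s. flux 0 1 (fS (cs s)) g 0 (of_real y)) + om * J (q j) (%s. flux 0 1 (fS (- cs s)) g 0 (of_real y))"
 have ke: "g 0 0 (of_real y) * v j y = ?k y" if "y \<in> {-a<..<a}" for y
  unfolding sd[symmetric] by (rule fl) (use that in auto)
 have S: "(LINT y:{-a<..<a}|lborel. g 0 0 (of_real y) * v j y) = om * (LINT y:{-a<..<a}|lborel. J (p j) (%s. flux 0 1 (fS (cs s)) g 0 (of_real y))) + om * (LINT y:{-a<..<a}|lborel. J (q j) (%s. flux 0 1 (fS (- cs s)) g 0 (of_real y)))"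
 proof -
  have "(LINT y:{-a<..<a}|lborel. g 0 0 (of_real y) * v j y) = (LINT y:{-a<..<a}|lborel. ?k y)"
   by (rule set_lebesgue_integral_cong) (auto simp: ke)
  then show ?thesis using P(4) Q(4) by (simp add: set_integral_add)
 qed
 show "dU j g + (LINT y:{-a<..<a}|lborel. g 0 0 (of_real y) * v j y) - dL j g =
  om * (J (p j) (%s. TT a 1 (fS (cs s)) g 0) + J (q j) (%s. TT a 1 (fS (- cs s)) g 0))"
  unfolding U S D P(1) Q(1) by (simp add: algebra_simps)
 have "set_integrable lborel {-a<..<a} ?k" using P(4) Q(4) by (intro set_integral_add set_integrable_mult_right) auto
 then show "set_integrable lborel {-a<..<a} (%y. g 0 0 (of_real y) * v j y)"
  by (rule set_integrable_cong[THEN iffD1, rotated 3]) (auto simp: ke)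
 have ne: "(%s. - cs s) ~= cs"
 proof
  assume "(%s. - cs s) = cs"
  from fun_cong[OF this, of 0] show False using a_pos by (simp add: cs_def)
 qed
 obtain D1 where D1: "!!y. y \<in> {-a<..<a} ==> norm (J (p j) (%s. h1 0 (of_real y - cs s))) <= D1 * (a - y) powr (-5/8)"
  using P(7) unfolding if_P[OF refl] by blast
 obtain D2 where D2: "!!y. y \<in> {-a<..<a} ==> norm (J (q j) (%s. h1 0 (of_real y + cs s))) <= D2 * (a + y) powr (-5/8)"
  using Q(7) unfolding if_not_P[OF ne] diff_minus_eq_add by blast
 show "\<exists>D\<ge>0. \<forall>y\<in>{-a<..<a}. norm (v j y) <= D * ((a - y) powr (-5/8) + (a + y) powr (-5/8))"
 proof (intro exI[of _ "\<bar>D1\<bar> + \<bar>D2\<bar>"] conjI ballI)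
  fix y assume y: "y \<in> {-a<..<a}"
  let ?P = "J (p j) (%s. h1 0 (of_real y - cs s))" and ?Q = "J (q j) (%s. h1 0 (of_real y + cs s))"
  have "norm (v j y) <= norm ?P + norm ?Q" unfolding V_def norm_mult norm_om using norm_triangle_ineq[of ?P ?Q] by simp
  also have "... <= D1 * (a - y) powr (-5/8) + D2 * (a + y) powr (-5/8)" by (intro add_mono D1 D2 y)
  also have "... <= (\<bar>D1\<bar> + \<bar>D2\<bar>) * (a - y) powr (-5/8) + (\<bar>D1\<bar> + \<bar>D2\<bar>) * (a + y) powr (-5/8)" by (intro add_mono mult_right_mono) auto
  finally show "norm (v j y) <= (\<bar>D1\<bar> + \<bar>D2\<bar>) * ((a - y) powr (-5/8) + (a + y) powr (-5/8))" by (simp only: distrib_left)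
 qed auto
qed

lemma fG_measurable: "meas3 (fG x1 x2)"
 unfolding meas3_def less_3_cases by (simp add: fG_def)

text \<open>The pole lies behind the side by at least \<open>d\<close>, so neither the path nor any
  of its shifts meets it.\<close>

lemma pfld_G_reg:
 assumes d: "0 < d" "d <= 2 * a" and X: "X >= 0" and x2: "(\<exists>y0. \<bar>y0\<bar> < a & x2 = of_real y0) | (\<exists>\<sigma>>0. x2 = cs \<sigma> | x2 = - cs \<sigma>)"
 shows "pfld (fG (- (of_real d + rot X)) x2) a 1 {0..}"
proof -
 have e: "- (- (of_real d + rot X)) + rot l + of_real s * (1 * om) = of_real d + rot (X + l + s)"
  "- (- (of_real d + rot X)) + rot l + of_real s * 0 = of_real d + rot (X + l)" for l s by (simp_all add: algebra_simps)
 have Z2: "of_real a - x2 + rot s \<in> SZ" "- of_real a - x2 + of_real s * (- om) \<in> SZ" "\<bar>y\<bar> <= a ==> 0 - x2 + of_real y * 1 \<in> SZ" if s: "s >= 0" for s y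
 proof -
  have "of_real a - x2 + rot s \<in> SZ & - of_real a - x2 + of_real s * (- om) \<in> SZ"
   using x2
  proof (elim disjE exE conjE)
   fix y0 :: real assume y: "\<bar>y0\<bar> < a" "x2 = of_real y0"
   have "of_real a - x2 + rot s = of_real (a - y0) + rot s" "- of_real a - x2 + of_real s * (- om) = - (of_real (a + y0) + rot s)" by (simp_all add: y)
   then show ?thesis using SZ_D(1)[of "a - y0" s] SZ_D(1)[of "a + y0" s] y(1) s by (simp only: SZ_minus)
  qed (use SZ_src[OF _ _ s] in blast)+
  then show "of_real a - x2 + rot s \<in> SZ" "- of_real a - x2 + of_real s * (- om) \<in> SZ" by auto
  show "0 - x2 + of_real y * 1 \<in> SZ" if "\<bar>y\<bar> <= a"
   using x2
  proof (elim disjE exE conjE)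
   fix y0 :: real assume y: "\<bar>y0\<bar> < a" "x2 = of_real y0"
   have "0 - x2 + of_real y * 1 = of_real (y - y0)" by (simp add: y)
   then show ?thesis using that y by (simp only:) (intro SZ_real, auto)
  qed (use SZ_cs[OF less_imp_le that] in \<open>auto simp: algebra_simps\<close>)
 qed
 have b: "d <= norm (of_real d + rot (X + l + s)) + n" "\<bar>l\<bar> + \<bar>s\<bar> - a <= norm (of_real d + rot (X + l + s)) + n"
  if "l >= 0" "s >= 0" "n >= 0" for l s n
  using SZ_D[of d "X + l + s"] that d X a_pos by auto
 note k = fld_kernels(1)[where d=d and M=a and \<xi>="- (- (of_real d + rot X))", OF d(1) _ refl refl]
 show ?thesis
  unfolding pfld_def
 proof (intro conjI)
  show "fld (fG (- (of_real d + rot X)) x2) (1 * om) om (of_real a) {0..} {0..}"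
   by (rule k, unfold Let_def e, intro conjI SZ_D(1) Z2 b) (use d X in auto)
  show "fld (fG (- (of_real d + rot X)) x2) (1 * om) (- om) (- of_real a) {0..} {0..}"
   by (rule k, unfold Let_def e, intro conjI SZ_D(1) Z2 b) (use d X in auto)
  show "fld (fG (- (of_real d + rot X)) x2) 0 1 0 {0..} {-a..a}"
  proof (rule k, unfold Let_def e, intro conjI SZ_D(1) Z2(3)[of 0])
   fix l s :: real assume "l \<in> {0..}" "s \<in> {-a..a}"
   then have "d <= norm (of_real d + rot (X + l))" "X + l <= norm (of_real d + rot (X + l))" "\<bar>l\<bar> = l" "\<bar>s\<bar> <= a"
    using SZ_D(2,3)[of d "X + l"] d X by auto
   then show "d <= norm (of_real d + rot (X + l)) + norm (0 - x2 + of_real s * 1)" "\<bar>l\<bar> + \<bar>s\<bar> - a <= norm (of_real d + rot (X + l)) + norm (0 - x2 + of_real s * 1)"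
    using norm_ge_zero[of "0 - x2 + of_real s * 1"] X by linarith+
  qed (use d X in auto)
 qed
qed

definition sideI :: "nat => complex => complex => complex" where
 "sideI j x1 x2 = (LINT y:{-a<..<a}|lborel. G (of_real a - x1) (of_real y - x2) * v j y)"

text \<open>With the pole behind the side both fields are regular on all shifted paths and the total
  flux is 0: the layer on the side is balanced by the two diagonals.\<close>

lemma extinction_reg:
 assumes "0 < d" "d <= 2 * a" "X >= 0" "(\<exists>y0. \<bar>y0\<bar> < a & x2 = of_real y0) | (\<exists>\<sigma>>0. x2 = cs \<sigma> | x2 = - cs \<sigma>)" and x1: "x1 = of_real a - (of_real d + rot X)"
 shows "dU j (fG (x1 - of_real a) x2) + sideI j x1 x2 - dL j (fG (x1 - of_real a) x2) = 0"
  and "set_integrable lborel {-a<..<a} (%y. G (of_real a - x1) (of_real y - x2) * v j y)"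
  and "\<exists>D\<ge>0. \<forall>y\<in>{-a<..<a}. norm (v j y) <= D * ((a - y) powr (-5/8) + (a + y) powr (-5/8))"
proof -
 have e: "x1 - of_real a = - (of_real d + rot X)" by (simp add: x1)
 have g: "pfld (fG (x1 - of_real a) x2) a 1 {0..}" unfolding e by (rule pfld_G_reg[OF assms(1-4)])
 have f: "fld (fG (x1 - of_real a) x2) (1 * om) om (of_real a) {0} {0..}" "fld (fG (x1 - of_real a) x2) 0 1 0 {0} {-a..a}" "fld (fG (x1 - of_real a) x2) (1 * om) (- om) (- of_real a) {0} {0..}"
  using g unfolding pfld_def by (auto intro: fld_subset)
 note T = T_V[OF f fG_measurable, of j]
 have 1: "fG (x1 - of_real a) x2 0 0 (of_real y) = G (of_real a - x1) (of_real y - x2)" for y by (simp add: fG_def)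
 have z: "TT a 1 (fS w) (fG (x1 - of_real a) x2) 0 = 0" if "s > 0" "w = cs s | w = - cs s" for w s
  by (rule TT_eq_0[OF pfld_S[OF that] g]) (use a_pos in simp)
 have "J f (%s. TT a 1 (fS (cs s)) (fG (x1 - of_real a) x2) 0) = J f (%s. 0)" "J f (%s. TT a 1 (fS (- cs s)) (fG (x1 - of_real a) x2) 0) = J f (%s. 0)" for f
  by (rule J_cong2, rule z, auto)+
 then show "dU j (fG (x1 - of_real a) x2) + sideI j x1 x2 - dL j (fG (x1 - of_real a) x2) = 0"
  using T(1) unfolding 1 sideI_def by (simp add: J_def)
 show "set_integrable lborel {-a<..<a} (%y. G (of_real a - x1) (of_real y - x2) * v j y)" using T(2) unfolding 1 .
 show "\<exists>D\<ge>0. \<forall>y\<in>{-a<..<a}. norm (v j y) <= D * ((a - y) powr (-5/8) + (a + y) powr (-5/8))" by (rule T(3))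
qed

text \<open>The pole now lies in front of the side, and by \<open>TT_pole\<close> each source
  contributes minus its Poisson kernel at the pole. Integrated against the data this is minus the
  solution there.\<close>

lemma extinction_pole:
 assumes X: "X > 0" and y0: "\<bar>y0\<bar> < a"
 shows "dU j (fG (rot X) (of_real y0)) + sideI j (cs X) (of_real y0) - dL j (fG (rot X) (of_real y0)) = - V h j (rot X) (of_real y0)"
proof -
 let ?g = "fG (rot X) (of_real y0)"
 have P: "pfld ?g a 1 {0}" using X by (intro pfld_G(3)[OF y0 X, of X]) auto
 have f: "fld ?g (1 * om) om (of_real a) {0} {0..}" "fld ?g 0 1 0 {0} {-a..a}" "fld ?g (1 * om) (- om) (- of_real a) {0} {0..}"
  using P unfolding pfld_def by auto
 note T = T_V(1)[OF f fG_measurable, of j]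
 have 1: "fG (rot X) (of_real y0) 0 0 (of_real y) = G (of_real a - cs X) (of_real y - of_real y0)" for y by (simp add: fG_def cs_def)
 have z: "TT a 1 (fS w) ?g 0 = - h (rot X) (of_real y0 - w)" if "s > 0" "w = cs s | w = - cs s" for w s
  using TT_pole[OF y0 X pfld_S[OF that]] by (simp add: fS_def)
 have "J f (%s. TT a 1 (fS (cs s)) ?g 0) = J f (%s. - h (rot X) (of_real y0 - cs s))" "J f (%s. TT a 1 (fS (- cs s)) ?g 0) = J f (%s. - h (rot X) (of_real y0 - - cs s))" for f
  by (rule J_cong2, rule z, assumption, blast)+
 then have "om * (J (p j) (%s. TT a 1 (fS (cs s)) ?g 0) + J (q j) (%s. TT a 1 (fS (- cs s)) ?g 0)) = - V h j (rot X) (of_real y0)"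
  unfolding V_def by (simp only: J_minus diff_minus_eq_add) (simp add: algebra_simps)
 then show ?thesis using T unfolding 1 sideI_def by simp
qed

text \<open>Passing to the next side is a quarter turn, which takes the pole \<open>(x1, x2)\<close>
  to \<open>(x2, - x1)\<close> and the upper diagonal to the lower one. By \<open>glue\<close> and
  \<open>glue_deriv\<close> the two solutions agree there together with their derivatives across it,
  so the fluxes are equal.\<close>

lemma diagonals_cancel: "dU j (fG (x1 - of_real a) x2) = dL (Suc j) (fG (x2 - of_real a) (- x1))"
proof -
 have "flux om om (Vf j) (fG (x1 - of_real a) x2) (rot t) (cs t) = flux om (- om) (Vf (Suc j)) (fG (x2 - of_real a) (- x1)) (rot t) (- cs t)" if t: "t > 0" for t
 proof -
  have ph: "V K j (rot t) (cs t) = Phi K (p j) (q j) t t" for K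
  proof -
   have "cs t - cs s = rot (t - s)" "cs t + cs s = of_real (2 * a) + rot (t + s)" for s by (simp_all add: cs_def algebra_simps)
   then show ?thesis unfolding V_def Phi_def by (simp only:)
  qed
  have e: "- cs t - cs s = - (of_real (2 * a) + rot (t + s))" "- cs t + cs s = - rot (t - s)" for s by (simp_all add: cs_def algebra_simps)
  have ph': "V h (Suc j) (rot t) (- cs t) = Phi h (q (Suc j)) (p (Suc j)) t t" "V h1 (Suc j) (rot t) (- cs t) = Phi h1 (q (Suc j)) (p (Suc j)) t t"
   "V h2 (Suc j) (rot t) (- cs t) = - Phi h2 (q (Suc j)) (p (Suc j)) t t"
  proof -
   have "h1 z (- w) = h1 z w" "h2 z (- w) = - h2 z w" for z w by (simp_all add: h1_def h2_def)
   then show "V h (Suc j) (rot t) (- cs t) = Phi h (q (Suc j)) (p (Suc j)) t t" "V h1 (Suc j) (rot t) (- cs t) = Phi h1 (q (Suc j)) (p (Suc j)) t t"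
    "V h2 (Suc j) (rot t) (- cs t) = - Phi h2 (q (Suc j)) (p (Suc j)) t t"
    unfolding V_def Phi_def e by (simp_all only: h_even J_minus) (simp_all add: algebra_simps)
  qed
  define P1 where "P1 = cs t - x1" define P2 where "P2 = cs t - x2"
  have g: "fG (x1 - of_real a) x2 i (rot t) (cs t) = ([G, G1, G2, G11, G12, G22] ! i) P1 P2"
   "fG (x2 - of_real a) (- x1) i (rot t) (- cs t) = ([G, G1, G2, G11, G12, G22] ! i) P2 (- P1)" for i
   by (simp_all add: fG_def P1_def P2_def cs_def algebra_simps)
  have s: "G P2 (- P1) = G P1 P2" "G1 P2 (- P1) = G2 P1 P2" "G2 P2 (- P1) = - G1 P1 P2"
   by (simp_all add: G_def G1_def G2_def add.commute)
  have gd: "Phi h1 (p j) (q j) t t = Phi h2 (p j) (q j) t t - Phi h1 (q (Suc j)) (p (Suc j)) t t + Phi h2 (q (Suc j)) (p (Suc j)) t t"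
   using glue_deriv[OF t, of j] by (simp add: algebra_simps)
  show ?thesis
   unfolding flux_def g Vf_def nth6 ph ph' s gd glue[OF t t, of j] by (simp add: algebra_simps)
 qed
 then show ?thesis unfolding dU_def dL_def by (intro set_lebesgue_integral_cong) auto
qed

text \<open>The single layer potential over the boundary of the square with the normal derivatives of the
  half-plane solutions as density; its argument is a point of $\mathbb{C}^2$.\<close>

definition SV :: "complex => complex => complex" where
 "SV x1 x2 = (\<Sum>j<4. sideI j ([x1, x2, - x1, - x2] ! j) ([x2, - x1, - x2, x1] ! j))"

lemma SV_eq: "SV x1 x2 = sideI 0 x1 x2 + sideI 1 x2 (- x1) + sideI 2 (- x1) (- x2) + sideI 3 (- x2) x1"
 by (simp add: SV_def eval_nat_numeral)

lemma dL_4: "dL 4 g = dL 0 g"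
proof -
 have "p 4 = p 0" "q 4 = q 0" using per[of 0] by simp_all
 then have "Vf 4 = Vf 0" by (intro ext) (simp add: Vf_def V_def)
 then show ?thesis by (simp add: dL_def)
qed

text \<open>Around the four sides the diagonal terms telescope and close up by periodicity; only the
  contribution \<open>c\<close> of a pole in front of side 0 is left.\<close>

lemma SV_eq_sum:
 assumes "dU 0 (fG (x1 - of_real a) x2) + sideI 0 x1 x2 - dL 0 (fG (x1 - of_real a) x2) = c"
  "dU 1 (fG (x2 - of_real a) (- x1)) + sideI 1 x2 (- x1) - dL 1 (fG (x2 - of_real a) (- x1)) = 0"
  "dU 2 (fG (- x1 - of_real a) (- x2)) + sideI 2 (- x1) (- x2) - dL 2 (fG (- x1 - of_real a) (- x2)) = 0"
  "dU 3 (fG (- x2 - of_real a) x1) + sideI 3 (- x2) x1 - dL 3 (fG (- x2 - of_real a) x1) = 0"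
 shows "SV x1 x2 = c"
proof -
 define e0 e1 e2 e3 where e: "e0 = dL 0 (fG (x1 - of_real a) x2)" "e1 = dL 1 (fG (x2 - of_real a) (- x1))"
  "e2 = dL 2 (fG (- x1 - of_real a) (- x2))" "e3 = dL 3 (fG (- x2 - of_real a) x1)"
 have d: "dU 0 (fG (x1 - of_real a) x2) = e1" "dU 1 (fG (x2 - of_real a) (- x1)) = e2" "dU 2 (fG (- x1 - of_real a) (- x2)) = e3"
  "dU 3 (fG (- x2 - of_real a) x1) = e0"
  unfolding e using diagonals_cancel[of 0 x1 x2] diagonals_cancel[of 1 x2 "- x1"] diagonals_cancel[of 2 "- x1" "- x2"] diagonals_cancel[of 3 "- x2" x1]
  using dL_4 by (simp_all add: eval_nat_numeral)
 have "sideI 0 x1 x2 = c - e1 + e0" "sideI 1 x2 (- x1) = e1 - e2" "sideI 2 (- x1) (- x2) = e2 - e3" "sideI 3 (- x2) x1 = e3 - e0"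
  using assms unfolding d e[symmetric] by (simp_all add: algebra_simps)
 then show ?thesis unfolding SV_eq by simp
qed

lemma SV_inside:
 assumes "\<bar>x1\<bar> < a" "\<bar>x2\<bar> < a"
 shows "SV (of_real x1) (of_real x2) = 0"
proof -
 have r: "dU j (fG (of_real y1 - of_real a) (of_real y2)) + sideI j (of_real y1) (of_real y2) - dL j (fG (of_real y1 - of_real a) (of_real y2)) = 0"
  if "\<bar>y1\<bar> < a" "\<bar>y2\<bar> < a" for j y1 y2
  by (rule extinction_reg(1)[of "a - y1" 0]) (use that in auto)
 show ?thesis
  by (rule SV_eq_sum) (use r[of x1 x2 0] r[of x2 "-x1" 1] r[of "-x1" "-x2" 2] r[of "-x2" x1 3] assms in simp_all)
qed

text \<open>A point in front of side 0, at a height within that side, lies behind the lines of the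
  other three sides; only side 0 sees the pole in front.\<close>

lemma SV_outside:
 assumes X: "X > 0" and y0: "\<bar>y0\<bar> < a"
 shows "SV (cs X) (of_real y0) = - V h 0 (rot X) (of_real y0)"
proof (rule SV_eq_sum)
 show "dU 0 (fG (cs X - of_real a) (of_real y0)) + sideI 0 (cs X) (of_real y0) - dL 0 (fG (cs X - of_real a) (of_real y0)) = - V h 0 (rot X) (of_real y0)"
  using extinction_pole[OF X y0, of 0] by (simp add: cs_def)
 show "dU 1 (fG (of_real y0 - of_real a) (- cs X)) + sideI 1 (of_real y0) (- cs X) - dL 1 (fG (of_real y0 - of_real a) (- cs X)) = 0"
  by (rule extinction_reg(1)[of "a - y0" 0]) (use X y0 in auto)
 show "dU 2 (fG (- cs X - of_real a) (- of_real y0)) + sideI 2 (- cs X) (- of_real y0) - dL 2 (fG (- cs X - of_real a) (- of_real y0)) = 0"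
  by (rule extinction_reg(1)[of "2 * a" X]) (use X y0 a_pos in \<open>auto simp: cs_def intro!: exI[of _ "- y0"]\<close>)
 show "dU 3 (fG (- of_real y0 - of_real a) (cs X)) + sideI 3 (- of_real y0) (cs X) - dL 3 (fG (- of_real y0 - of_real a) (cs X)) = 0"
  by (rule extinction_reg(1)[of "a + y0" 0]) (use X y0 in auto)
qed

end

subsection \<open>The single layer potential on the square\<close>

text \<open>Bessel's integral. Cauchy's formula on the unit circle extracts from
  \<open>exp (B * u)\<close> the coefficient that belongs to the m-th power of \<open>A / u\<close>,
  and uniform convergence allows summing under the integral.\<close>

lemma bI_circle_average:
 "bI (A * B) = (LINT t:{0..1}|lborel. exp (A * cnj (cis (2 * pi * t)) + B * cis (2 * pi * t)))"
proof -
 have hd: "(deriv ^^ m) (%z. exp (B * z)) = (%z. B ^ m * exp (B * z))" for m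
 proof (induction m)
  case (Suc m)
  have "deriv (%z. B ^ m * exp (B * z)) z = B ^ Suc m * exp (B * z)" for z
   by (rule DERIV_imp_deriv) (auto intro!: derivative_eq_intros)
  then show ?case by (simp add: Suc)
 qed simp
 define f where "f = (%m u. A ^ m / fact m * (exp (B * u) / u ^ Suc m))"
 have f: "(f m has_contour_integral (2 * pi * \<i> * (cI m * (A * B) ^ m))) (circlepath 0 1)" for m
 proof -
  have "((%u. exp (B * u) / (u - 0) ^ Suc m) has_contour_integral ((2 * pi * \<i>) / fact m * (deriv ^^ m) (%z. exp (B * z)) 0)) (circlepath 0 1)"
   by (rule Cauchy_has_contour_integral_higher_derivative_circlepath) (auto intro!: continuous_intros holomorphic_intros)
  from has_contour_integral_lmul[OF this, of "A ^ m / fact m"] show ?thesis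
   unfolding hd by (simp add: f_def cI_def power2_eq_square power_mult_distrib mult_ac)
 qed
 have ul: "uniform_limit (sphere 0 1) (%n u. \<Sum>m<n. f m u) (%u. \<Sum>m. f m u) sequentially"
 proof (rule Weierstrass_m_test)
  show "norm (f m u) <= norm A ^ m / fact m * exp (norm B)" if "u \<in> sphere 0 1" for m u
   using that norm_exp[of "B * u"] by (simp add: f_def norm_mult norm_divide norm_power mult_left_mono divide_right_mono)
  show "summable (%m. norm A ^ m / fact m * exp (norm B))"
   using summable_exp[of "norm A"] by (intro summable_mult2) (simp add: field_simps)
 qed
 have S: "(\<Sum>m. f m u) = exp (A / u + B * u) / u" if "u \<in> sphere 0 1" for u
 proof -
  have "(%m. (A / u) ^ m /\<^sub>R fact m * (exp (B * u) / u)) sums (exp (A / u) * (exp (B * u) / u))"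
   by (intro sums_mult2 exp_converges)
  then have "(%m. f m u) sums (exp (A / u) * (exp (B * u) / u))"
   by (simp add: f_def scaleR_conv_of_real power_divide field_simps)
  then show ?thesis by (simp add: sums_iff exp_add)
 qed
 have ci: "contour_integral (circlepath 0 1) (%u. \<Sum>m<n. f m u) = (\<Sum>m<n. 2 * pi * \<i> * (cI m * (A * B) ^ m))" for n
  by (intro contour_integral_unique has_contour_integral_sum f) auto
 have "(%u. \<Sum>m<n. f m u) contour_integrable_on circlepath 0 1" for n
  unfolding contour_integrable_on_def by (rule exI, rule has_contour_integral_sum) (auto intro: f)
 from contour_integral_uniform_limit_circlepath[OF always_eventually[OF allI, OF this] ul]
 have l: "(%u. \<Sum>m. f m u) contour_integrable_on circlepath 0 1" "(%n. \<Sum>m<n. 2 * pi * \<i> * (cI m * (A * B) ^ m)) \<longlonglongrightarrow> contour_integral (circlepath 0 1) (%u. \<Sum>m. f m u)"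
  by (simp_all add: ci)
 have "(%n. \<Sum>m<n. 2 * pi * \<i> * (cI m * (A * B) ^ m)) \<longlonglongrightarrow> 2 * pi * \<i> * bI (A * B)"
  using sums_mult[OF summable_sums[OF summable_cI[of "A * B"]], of "2 * pi * \<i>"] by (simp add: sums_def bI_def)
 from LIMSEQ_unique[OF l(2) this] have "((%u. \<Sum>m. f m u) has_contour_integral 2 * pi * \<i> * bI (A * B)) (circlepath 0 1)"
  using has_contour_integral_integral[OF l(1)] by (simp only:)
 then have "((%t. (\<Sum>m. f m (circlepath 0 1 t)) * vector_derivative (circlepath 0 1) (at t within {0..1})) has_integral 2 * pi * \<i> * bI (A * B)) {0..1}"
  by (simp only: has_contour_integral_def)
 then have "((%t. (\<Sum>m. f m (cis (2 * pi * t))) * (2 * pi * \<i> * cis (2 * pi * t))) has_integral 2 * pi * \<i> * bI (A * B)) {0..1}"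
 proof (rule has_integral_eq[rotated])
  fix t :: real assume "t \<in> {0..1}"
  then have "vector_derivative (circlepath 0 1) (at t within {0..1}) = 2 * pi * \<i> * cis (2 * pi * t)"
   using vector_derivative_circlepath01[of t 0 1] by (simp add: cis_conv_exp mult_ac)
  moreover have "circlepath 0 1 t = cis (2 * pi * t)" by (simp add: circlepath cis_conv_exp mult_ac)
  ultimately show "(\<Sum>m. f m (circlepath 0 1 t)) * vector_derivative (circlepath 0 1) (at t within {0..1}) = (\<Sum>m. f m (cis (2 * pi * t))) * (2 * pi * \<i> * cis (2 * pi * t))"
   by simp
 qed
 from has_integral_divide[OF this, of "2 * pi * \<i>"]
 have I: "((%t. (\<Sum>m. f m (cis (2 * pi * t))) * (2 * pi * \<i> * cis (2 * pi * t)) / (2 * pi * \<i>)) has_integral bI (A * B)) {0..1}"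
  by simp
 have e: "(\<Sum>m. f m (cis (2 * pi * t))) * (2 * pi * \<i> * cis (2 * pi * t)) / (2 * pi * \<i>) = exp (A * cnj (cis (2 * pi * t)) + B * cis (2 * pi * t))" for t
 proof -
  have "A / cis (2 * pi * t) = A * cnj (cis (2 * pi * t))" by (simp add: cis_cnj divide_inverse)
  then show ?thesis by (simp add: S)
 qed
 have i: "set_integrable lborel {0..1} (%t. exp (A * cnj (cis (2 * pi * t)) + B * cis (2 * pi * t)))"
  by (rule borel_integrable_atLeastAtMost') (intro continuous_intros)
 show ?thesis unfolding set_borel_integral_eq_integral(2)[OF i] using integral_unique[OF I] unfolding e by (rule sym)
qed

context hsm begin

text \<open>The plane is identified with the complex numbers. Side 0 is the segment with real part
  \<open>a\<close>, and multiplication by the power of the imaginary unit carries the local frame of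
  side 0 to that of side \<open>j\<close>.\<close>

definition bpt :: "nat => real => complex" where "bpt j y = \<i> ^ j * Complex a y"
text \<open>Majorant for the normal derivatives on a side, singular at both ends with the exponent
  provided by \<open>kernel_sep\<close>, and 0 off the side.\<close>

definition Wt :: "real => real" where "Wt y = indicator {-a<..<a} y * ((a - y) powr (-5/8) + (a + y) powr (-5/8))"
definition Kd :: "complex => complex => complex" where "Kd X Y = G (of_real (norm (X - Y))) 0"

lemma Wt_nonneg [simp]: "Wt y >= 0" by (simp add: Wt_def)

lemma i_power_cases: "\<i> ^ j \<in> {1, -1, \<i>, -\<i>}"
 by (induction j) auto

lemma quarter_turn:
 assumes "w \<in> {1, -1, \<i>, -\<i>}" "\<bar>Re z\<bar> <= m" "\<bar>Im z\<bar> <= m"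
 shows "\<bar>Re (w * z)\<bar> <= m & \<bar>Im (w * z)\<bar> <= m"
 using assms by auto

lemma i_power_inverse [simp]: "\<i> ^ (3 * j) * (\<i> ^ j * z) = z"
proof -
 have "\<i> ^ (3 * j) * \<i> ^ j = (\<i> ^ 4) ^ j" by (simp only: power_add[symmetric] power_mult[symmetric]) simp
 then show ?thesis by (simp add: mult.assoc[symmetric] power4_eq_xxxx)
qed

text \<open>Replacing the larger of two distances by the smaller bounds the product of their powers
  -1/4 and -5/8 by the sum of their powers -7/8. This is integrable uniformly in \<open>c\<close>,
  even when \<open>c\<close> is an end of the side and the singularities coincide.\<close>

lemma Wt_convolution_bound:
 "\<exists>M\<ge>0. \<forall>c. \<bar>c\<bar> <= a --> integrable lborel (%y. \<bar>c - y\<bar> powr (-1/4) * Wt y) & (LINT y|lborel. \<bar>c - y\<bar> powr (-1/4) * Wt y) <= M"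
proof -
 define g where "g = (%c y. exp (2 * a) * (\<bar>c + (-1) * y\<bar> powr (- (7/8)) * exp (- 1 * \<bar>c + (-1) * y\<bar>)))"
 have "integrable lborel (%x::real. \<bar>x\<bar> powr (- (7/8)) * exp (- 1 * \<bar>x\<bar>))" by (rule integrable_powr_exp_abs) auto
 note aff = lborel_integrable_real_affine[OF this, of "-1"] lborel_integral_real_affine[of "-1" "%x::real. \<bar>x\<bar> powr (- (7/8)) * exp (- 1 * \<bar>x\<bar>)"]
 define I where "I = (LINT x::real|lborel. \<bar>x\<bar> powr (- (7/8)) * exp (- 1 * \<bar>x\<bar>))"
 have gi: "integrable lborel (g c)" "(LINT y|lborel. g c y) = exp (2 * a) * I" for c
  using aff[of c] unfolding g_def I_def by simp_all
 have le: "\<bar>c - y\<bar> powr (-1/4) * Wt y <= 2 * g c y + (g a y + g (-a) y)" if c: "\<bar>c\<bar> <= a" for c y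
 proof (cases "y \<in> {-a<..<a}")
  case True
  have mn: "A powr (-1/4) * B powr (-5/8) <= A powr (-(7/8)) + B powr (-(7/8))" if "A >= 0" "B > 0" for A B :: real
  proof (cases "A = 0 | A >= B")
   case True
   then have "A powr (-1/4) <= B powr (-1/4)" using that by (auto intro: powr_mono2')
   then have "A powr (-1/4) * B powr (-5/8) <= B powr (-1/4) * B powr (-5/8)" by (rule mult_right_mono) simp
   then show ?thesis by (simp add: powr_add[symmetric] add_increasing)
  next
   case False
   then have "B powr (-5/8) <= A powr (-5/8)" using that by (intro powr_mono2') auto
   then have "A powr (-1/4) * B powr (-5/8) <= A powr (-1/4) * A powr (-5/8)" by (rule mult_left_mono) simp
   then show ?thesis by (simp add: powr_add[symmetric] add_increasing2)
  qed
  have gl: "\<bar>c' - y\<bar> powr (- (7/8)) <= g c' y" if "\<bar>c'\<bar> <= a" for c'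
  proof -
   have "1 <= exp (2 * a) * exp (- 1 * \<bar>c' + (-1) * y\<bar>)" using True that unfolding exp_add[symmetric] by auto
   from mult_left_mono[OF this, of "\<bar>c' - y\<bar> powr (- (7/8))"] show ?thesis unfolding g_def by (simp add: mult_ac)
  qed
  have "\<bar>c - y\<bar> powr (-1/4) * Wt y = \<bar>c - y\<bar> powr (-1/4) * \<bar>a - y\<bar> powr (-5/8) + \<bar>c - y\<bar> powr (-1/4) * \<bar>- a - y\<bar> powr (-5/8)"
   using True by (simp add: Wt_def distrib_left abs_if add.commute)
  also have "... <= (g c y + g a y) + (g c y + g (-a) y)"
  proof (intro add_mono)
   show "\<bar>c - y\<bar> powr (-1/4) * \<bar>a - y\<bar> powr (-5/8) <= g c y + g a y"
    using mn[of "\<bar>c - y\<bar>" "\<bar>a - y\<bar>"] gl[OF c] gl[of a] True a_pos by auto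
   show "\<bar>c - y\<bar> powr (-1/4) * \<bar>- a - y\<bar> powr (-5/8) <= g c y + g (-a) y"
    using mn[of "\<bar>c - y\<bar>" "\<bar>- a - y\<bar>"] gl[OF c] gl[of "-a"] True a_pos by auto
  qed
  finally show ?thesis by simp
 qed (simp add: Wt_def g_def)
 have I0: "I >= 0" unfolding I_def by (rule integral_nonneg_AE) simp
 have i: "integrable lborel (%y. 2 * g c y + (g a y + g (-a) y))" "(LINT y|lborel. 2 * g c y + (g a y + g (-a) y)) = 4 * (exp (2 * a) * I)" for c
  using gi by auto
 have b: "integrable lborel (%y. \<bar>c - y\<bar> powr (-1/4) * Wt y)" if "\<bar>c\<bar> <= a" for c
  by (rule Bochner_Integration.integrable_bound[OF i(1)[of c]])
    (use le[OF that] in \<open>auto intro!: AE_I2 intro: order.trans[OF _ abs_ge_self] simp: Wt_def\<close>)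
 show ?thesis
 proof (intro exI[of _ "4 * (exp (2 * a) * I)"] conjI allI impI)
  show "(LINT y|lborel. \<bar>c - y\<bar> powr (-1/4) * Wt y) <= 4 * (exp (2 * a) * I)" if "\<bar>c\<bar> <= a" for c
   unfolding i(2)[of c, symmetric] by (rule integral_mono[OF b[OF that] i(1) le[OF that]])
 qed (use b I0 in auto)
qed

lemma Wt_integrable: "integrable lborel Wt"
proof -
 have "set_integrable lborel {-a<..<a} (%y. \<bar>a - y\<bar> powr (-(5/8)) + \<bar>- a - y\<bar> powr (-(5/8)))"
  by (intro set_integral_add powr_side_integrable) auto
 then show ?thesis unfolding set_integrable_def
  by (rule Bochner_Integration.integrable_cong[THEN iffD1, OF refl, rotated]) (auto simp: Wt_def indicator_def abs_if add.commute)
qed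

lemma Kd_sym: "Kd X Y = Kd Y X" by (simp add: Kd_def norm_minus_commute)

lemma Kd_minus_cnj: "X ~= Y ==> Kd X Y - cnj (Kd X Y) = (\<i> / 2) * bI (- (of_real (k * norm (X - Y)))\<^sup>2 / 4)"
 using NN_minus_cnj[of "norm (X - Y)"] by (simp add: Kd_def G_def)

lemma Kd_bound: "\<exists>C\<ge>0. \<forall>X Y r. 0 < r & r <= norm (X - Y) & norm X <= 2 * a & norm Y <= 2 * a --> norm (Kd X Y) <= C * r powr (-1/4)"
proof -
 obtain C where C: "C > 0" "!!q. q ~= 0 ==> norm q <= (4 * a)^2 ==> norm (NN q) <= C * norm q powr (-1/8)"
  using NN_local_bound[of "(4 * a)^2"] a_pos by auto
 show ?thesis
 proof (intro exI[of _ C] conjI allI impI)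
  fix X Y :: complex and r :: real
  assume H: "0 < r & r <= norm (X - Y) & norm X <= 2 * a & norm Y <= 2 * a"
  have le: "norm (X - Y) <= 4 * a" using norm_triangle_ineq4[of X Y] H by linarith
  have "norm (Kd X Y) <= C * norm ((of_real (norm (X - Y)))^2 + 0^2 :: complex) powr (-1/8)"
   unfolding Kd_def G_def using H le power_mono[OF le, of 2] by (intro C(2)) (auto simp: norm_power)
  also have "norm ((of_real (norm (X - Y)))^2 + 0^2 :: complex) powr (-1/8) = norm (X - Y) powr (-1/4)"
   using H by (simp add: norm_power powr_powr powr_numeral[symmetric] del: powr_numeral)
  also have "C * norm (X - Y) powr (-1/4) <= C * r powr (-1/4)" using H C(1) by (intro mult_left_mono powr_mono2') auto
  finally show "norm (Kd X Y) <= C * r powr (-1/4)" .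
 qed (use C in simp)
qed

lemma Kd_measurable [measurable]:
 assumes [measurable]: "f \<in> borel_measurable M" "g \<in> borel_measurable M"
 shows "(%x. Kd (f x) (g x)) \<in> borel_measurable M"
 unfolding Kd_def by measurable

lemma Kd_cont: "X ~= Y ==> isCont (%X. Kd X Y) X"
proof -
 assume "X ~= Y"
 then have "(of_real (norm (X - Y)))^2 + 0^2 \<notin> \<real>\<^sub>\<le>\<^sub>0" by (simp add: complex_nonpos_Reals_iff flip: of_real_power)
 from DERIV_isCont[OF DERIV_NN[OF this]] show ?thesis
  unfolding Kd_def G_def by (intro isCont_o2[of X _ NN] continuous_intros)
qed

lemma bpt_measurable [measurable]: "bpt j \<in> borel_measurable borel"
 unfolding bpt_def[abs_def] Complex_eq by measurable

lemma norm_bpt: "\<bar>y\<bar> <= a ==> norm (bpt j y) <= 2 * a"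
 using cmod_le[of "Complex a y"] a_pos unfolding bpt_def norm_mult norm_power norm_ii power_one mult_1_left by simp

text \<open>The power with exponent \<open>3 * j\<close> undoes the rotation of side
  \<open>j\<close> and makes that side vertical; \<open>c\<close> is the height of the rotated
  point, and a height difference never exceeds the distance.\<close>

lemma bpt_dist:
 assumes "\<bar>s\<bar> <= a"
 obtains c where "\<bar>c\<bar> <= a" "!!t. \<bar>c - t\<bar> <= norm (bpt i s - bpt j t)"
proof
 let ?z = "\<i> ^ (3 * j) * (\<i> ^ i * Complex a s)"
 show "\<bar>Im ?z\<bar> <= a"
  using quarter_turn[OF i_power_cases, of "\<i> ^ i * Complex a s" a "3 * j"] quarter_turn[OF i_power_cases, of "Complex a s" a i] assms a_pos by auto
 fix t
 have "\<bar>Im ?z - t\<bar> = \<bar>Im (\<i> ^ (3 * j) * (bpt i s - bpt j t))\<bar>"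
  by (simp add: bpt_def right_diff_distrib)
 also have "... <= norm (\<i> ^ (3 * j) * (bpt i s - bpt j t))" by (rule abs_Im_le_cmod)
 finally show "\<bar>Im ?z - t\<bar> <= norm (bpt i s - bpt j t)" by (simp add: norm_mult norm_power)
qed

end

section \<open>Vanishing of the far field of the layer density\<close>

locale layer = hsm +
 fixes u :: "nat => real => complex" and D :: real
 assumes um [measurable]: "u j \<in> borel_measurable borel" and D: "D >= 0" and ule: "norm (u j y) <= D * Wt y"
  and ext: "\<bar>x1\<bar> < a ==> \<bar>x2\<bar> < a ==> (\<Sum>j<4. LINT y|lborel. Kd (Complex x1 x2) (bpt j y) * u j y) = 0"
begin

lemma u_0: "\<not> \<bar>y\<bar> < a ==> u j y = 0"
proof -
 assume "\<not> \<bar>y\<bar> < a"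
 then have "Wt y = 0" by (auto simp: Wt_def indicator_def)
 then show ?thesis using ule[of j y] by simp
qed

lemma u_integrable: "integrable lborel (u j)"
 by (rule Bochner_Integration.integrable_bound[OF integrable_mult_right[OF Wt_integrable, of D]])
   (use ule D in \<open>auto intro!: AE_I2\<close>)

text \<open>The factor 2 leaves room for points that approach the boundary from inside: their
  distance to a boundary point may be half of that of the limit point.\<close>

lemma Kd_u_dominated:
 obtains C where "C >= 0" "!!i j s t c X. \<bar>s\<bar> < a ==> norm X <= 2 * a ==> c ~= t ==> \<bar>c - t\<bar> <= 2 * norm (X - bpt j t) ==>
  norm (Kd X (bpt j t) * u j t) <= C * (\<bar>c - t\<bar> powr (-1/4) * Wt t)"
proof -
 obtain C where C: "C >= 0" "!!X Y r. 0 < r ==> r <= norm (X - Y) ==> norm X <= 2 * a ==> norm Y <= 2 * a ==> norm (Kd X Y) <= C * r powr (-1/4)"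
  using Kd_bound by metis
 show thesis
 proof (rule that[of "C * 2 powr (1/4) * D"])
  fix i j s t c X assume H: "\<bar>s\<bar> < a" "norm X <= 2 * a" "c ~= t" "\<bar>c - t\<bar> <= 2 * norm (X - bpt j t)"
  show "norm (Kd X (bpt j t) * u j t) <= C * 2 powr (1/4) * D * (\<bar>c - t\<bar> powr (-1/4) * Wt t)"
  proof (cases "\<bar>t\<bar> < a")
   case True
   have "norm (Kd X (bpt j t)) <= C * (\<bar>c - t\<bar> / 2) powr (-1/4)" using H True by (intro C(2) norm_bpt) auto
   also have "(\<bar>c - t\<bar> / 2) powr (-1/4) = 2 powr (1/4) * \<bar>c - t\<bar> powr (-1/4)"
    by (simp add: powr_divide powr_minus divide_simps)
   finally have "norm (Kd X (bpt j t)) <= C * (2 powr (1/4) * \<bar>c - t\<bar> powr (-1/4))" .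
   from mult_mono[OF this ule[of j t]] C(1) show ?thesis by (simp add: norm_mult mult_ac)
  qed (use C(1) D in \<open>simp add: u_0\<close>)
 qed (use C D in simp)
qed

text \<open>The potential vanishes inside, and its weakly singular kernel makes it continuous up to
  the boundary. The approach is along the normal, where one integrable majorant serves the whole
  sequence.\<close>

lemma boundary_zero:
 assumes s: "\<bar>s\<bar> < a"
 shows "(\<Sum>j<4. LINT t|lborel. Kd (bpt i s) (bpt j t) * u j t) = 0"
proof -
 obtain C where C: "C >= 0" "!!j t c X. norm X <= 2 * a ==> c ~= t ==> \<bar>c - t\<bar> <= 2 * norm (X - bpt j t) ==>
  norm (Kd X (bpt j t) * u j t) <= C * (\<bar>c - t\<bar> powr (-1/4) * Wt t)" using Kd_u_dominated s by metis
 obtain M where M: "!!c. \<bar>c\<bar> <= a ==> integrable lborel (%y. \<bar>c - y\<bar> powr (-1/4) * Wt y)" using Wt_convolution_bound by auto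
 \<comment> \<open>Less than \<open>a - |s|\<close>, so that both coordinates of the inner point are
   at most \<open>a - e n\<close> in modulus and its distance to every side is at least
   \<open>e n\<close>, the length of the displacement. This is where the factor 2 of the majorant
   comes from.\<close>
 define e where "e = (%n::nat. (a - \<bar>s\<bar>) / real (n + 2))"
 have e: "0 < e n" "\<bar>s\<bar> < a - e n" "e n < a" for n
 proof -
  show "0 < e n" unfolding e_def using s by simp
  have "(a - \<bar>s\<bar>) / real (n + 2) < (a - \<bar>s\<bar>) / 1" using s by (intro divide_strict_left_mono) auto
  then show "\<bar>s\<bar> < a - e n" "e n < a" unfolding e_def using s by auto
 qed
 define X where "X = (%n. \<i> ^ i * Complex (a - e n) s)"
 have e0: "e \<longlonglongrightarrow> 0" unfolding e_def by real_asymp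
 have X: "X \<longlonglongrightarrow> bpt i s" unfolding X_def bpt_def Complex_eq
  by (rule tendsto_eq_intros refl e0 | simp)+
 have Xm: "\<bar>Re (w * X n)\<bar> <= a - e n & \<bar>Im (w * X n)\<bar> <= a - e n" if "w \<in> {1, -1, \<i>, -\<i>}" for w n
  unfolding X_def using e[of n] by (intro quarter_turn[OF that] quarter_turn[OF i_power_cases, THEN conjunct1] quarter_turn[OF i_power_cases, THEN conjunct2]) auto
 have Xb: "norm (X n) <= 2 * a" for n using cmod_le[of "X n"] Xm[of 1 n] e[of n] by auto
 have Xd: "norm (bpt i s - bpt j t) <= 2 * norm (X n - bpt j t)" for n j t
 proof -
  have "X n - bpt i s = \<i> ^ i * of_real (- e n)" unfolding X_def bpt_def right_diff_distrib[symmetric] by (simp add: Complex_eq)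
  then have d: "norm (X n - bpt i s) = e n" using e(1)[of n] by (simp add: norm_mult norm_power)
  have "Re (\<i> ^ (3 * j) * (X n - bpt j t)) = Re (\<i> ^ (3 * j) * X n) - a"
   unfolding bpt_def right_diff_distrib i_power_inverse by simp
  then have "e n <= \<bar>Re (\<i> ^ (3 * j) * (X n - bpt j t))\<bar>"
   using Xm[OF i_power_cases, of "3 * j" n] e[of n] by linarith
  also have "... <= norm (\<i> ^ (3 * j) * (X n - bpt j t))" by (rule abs_Re_le_cmod)
  finally have "e n <= norm (X n - bpt j t)" by (simp add: norm_mult norm_power)
  then show ?thesis using norm_triangle_sub[of "bpt i s - bpt j t" "X n - bpt j t"] d by (simp add: norm_minus_commute)
 qed
 have lim: "(%n. LINT t|lborel. Kd (X n) (bpt j t) * u j t) \<longlonglongrightarrow> (LINT t|lborel. Kd (bpt i s) (bpt j t) * u j t)" for j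
 proof -
  obtain c where c: "\<bar>c\<bar> <= a" "!!t. \<bar>c - t\<bar> <= norm (bpt i s - bpt j t)" using bpt_dist s by (metis less_imp_le)
  have ne: "AE t in lborel. t ~= c" by (rule AE_lborel_singleton)
  show ?thesis
  proof (rule integral_dominated_convergence[where w="%t. C * (\<bar>c - t\<bar> powr (-1/4) * Wt t)"])
   show "integrable lborel (%t. C * (\<bar>c - t\<bar> powr (-1/4) * Wt t))" by (intro integrable_mult_right M c)
   show "AE t in lborel. (%n. Kd (X n) (bpt j t) * u j t) \<longlonglongrightarrow> Kd (bpt i s) (bpt j t) * u j t"
    using ne
   proof eventually_elim
    case (elim t)
    have "bpt i s ~= bpt j t" using c(2)[of t] elim by auto
    then show ?case by (intro tendsto_mult_right isCont_tendsto_compose[OF Kd_cont X])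
   qed
   show "AE t in lborel. norm (Kd (X n) (bpt j t) * u j t) <= C * (\<bar>c - t\<bar> powr (-1/4) * Wt t)" for n
    using ne
   proof eventually_elim
    case (elim t)
    show ?case using elim order.trans[OF c(2) Xd] by (intro C(2) Xb) auto
   qed
  qed measurable
 qed
 have "(%n. \<Sum>j<4. LINT t|lborel. Kd (X n) (bpt j t) * u j t) \<longlonglongrightarrow> (\<Sum>j<4. LINT t|lborel. Kd (bpt i s) (bpt j t) * u j t)"
  by (intro tendsto_sum lim)
 moreover have "(\<Sum>j<4. LINT t|lborel. Kd (X n) (bpt j t) * u j t) = 0" for n
  using ext[of "Re (X n)" "Im (X n)"] Xm[of 1 n] e[of n] by auto
 ultimately show ?thesis by (simp add: LIMSEQ_const_iff)
qed

text \<open>For \<open>\<zeta>\<close> on the unit circle this is the plane wave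
  \<open>exp (- i * k * Re (b * cnj \<zeta>))\<close>; the other nonzero \<open>\<zeta>\<close>
  parametrise the complex directions. \<open>Fh\<close> is, up to a constant factor, the far field
  of the layer. Writing the exponent with \<open>1 / \<zeta>\<close> in place of the conjugate makes
  it holomorphic in \<open>\<zeta>\<close>.\<close>

definition wave :: "complex => complex => complex" where
 "wave \<zeta> b = exp (- (\<i> * of_real k / 2) * (b / \<zeta> + cnj b * \<zeta>))"
definition Fh :: "complex => complex" where
 "Fh \<zeta> = (\<Sum>j<4. LINT y|lborel. wave \<zeta> (bpt j y) * u j y)"

lemma wave_measurable [measurable]:
 assumes [measurable]: "f \<in> borel_measurable M" "g \<in> borel_measurable M"
 shows "(%x. wave (f x) (g x)) \<in> borel_measurable M"
proof -
 have [measurable]: "cnj \<in> borel_measurable borel" by (intro borel_measurable_continuous_onI continuous_intros)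
 show ?thesis unfolding wave_def by measurable
qed

lemma norm_wave_le:
 assumes "norm b <= 2 * a" "\<zeta> ~= 0"
 shows "norm (wave \<zeta> b) <= exp (k * a * (1 / norm \<zeta> + norm \<zeta>))"
proof -
 have "norm (wave \<zeta> b) <= exp (norm (- (\<i> * of_real k / 2) * (b / \<zeta> + cnj b * \<zeta>)))" unfolding wave_def by (rule norm_exp)
 also have "norm (- (\<i> * of_real k / 2) * (b / \<zeta> + cnj b * \<zeta>)) <= k / 2 * (norm b / norm \<zeta> + norm b * norm \<zeta>)"
  using k_pos norm_triangle_ineq[of "b / \<zeta>" "cnj b * \<zeta>"] by (simp add: norm_mult norm_divide)
 also have "... <= k / 2 * (2 * a / norm \<zeta> + 2 * a * norm \<zeta>)"
  using k_pos assms by (intro mult_left_mono add_mono mult_right_mono divide_right_mono) auto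
 also have "... = k * a * (1 / norm \<zeta> + norm \<zeta>)" by (simp add: algebra_simps)
 finally show ?thesis by simp
qed

lemma wave_circle: "cnj (wave (cis x) b) * wave (cis x) c = exp ((\<i> * of_real k / 2 * (b - c)) * cnj (cis x) + (\<i> * of_real k / 2 * cnj (b - c)) * cis x)"
 and norm_wave_circle: "norm (wave (cis x) b) = 1"
proof -
 have i: "b / cis x = b * cnj (cis x)" for b by (simp add: cis_cnj divide_inverse)
 have r: "b * cnj (cis x) + cnj b * cis x = of_real (2 * Re (b * cnj (cis x)))" for b
  using complex_add_cnj[of "b * cnj (cis x)"] by simp
 have w: "wave (cis x) b = exp (- (\<i> * of_real (k * Re (b * cnj (cis x)))))" for b
 proof -
  have "exp (- (\<i> * of_real k / 2) * of_real (2 * R)) = exp (- (\<i> * of_real (k * R)))" for R :: real by simp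
  then show ?thesis unfolding wave_def i r .
 qed
 show "norm (wave (cis x) b) = 1" unfolding w by simp
 have "cnj (wave (cis x) b) = exp (\<i> * of_real k / 2 * (b * cnj (cis x) + cnj b * cis x))"
 proof -
  have "cnj (exp (- (\<i> * of_real (k * R)))) = exp (\<i> * of_real k / 2 * of_real (2 * R))" for R :: real
   by (simp add: exp_cnj)
  then show ?thesis unfolding w r .
 qed
 then show "cnj (wave (cis x) b) * wave (cis x) c = exp ((\<i> * of_real k / 2 * (b - c)) * cnj (cis x) + (\<i> * of_real k / 2 * cnj (b - c)) * cis x)"
  unfolding wave_def i by (simp only: exp_add[symmetric]) (rule arg_cong[where f=exp], simp add: algebra_simps diff_divide_distrib add_divide_distrib)
qed

lemma Fh_holomorphic: "Fh holomorphic_on - {0}"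
 unfolding Fh_def[abs_def]
proof (intro holomorphic_on_sum holomorphic_on_lebesgue_integral(1))
 fix j
 show "(%y. wave z (bpt j y) * u j y) \<in> borel_measurable lborel" for z by measurable
 show "\<exists>r>0. \<exists>g. integrable lborel g & (\<forall>z\<in>ball w r. \<forall>y\<in>space lborel. norm (wave z (bpt j y) * u j y) <= g y)" if w: "w \<in> - {0}" for w
 proof (intro exI conjI ballI)
  show "norm w / 2 > 0" using w by simp
  show "integrable lborel (%y. exp (k * a * (1 / (norm w / 2) + 2 * norm w)) * norm (u j y))" using u_integrable by simp
  fix z y assume z: "z \<in> ball w (norm w / 2)"
  then have n: "norm w / 2 <= norm z" "norm z <= 2 * norm w" using norm_triangle_ineq2[of w z] norm_triangle_ineq2[of z w] norm_ge_zero[of w]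
   by (auto simp: dist_norm norm_minus_commute)
  then have z0: "z ~= 0" using w by auto
  have "norm (wave z (bpt j y)) <= exp (k * a * (1 / (norm w / 2) + 2 * norm w))" if "\<bar>y\<bar> < a"
  proof (rule order.trans[OF norm_wave_le[OF norm_bpt z0]])
   have "1 / norm z <= 1 / (norm w / 2)" using n w z0 by (intro divide_left_mono) auto
   then show "exp (k * a * (1 / norm z + norm z)) <= exp (k * a * (1 / (norm w / 2) + 2 * norm w))"
    using n k_pos a_pos by (auto intro!: mult_left_mono add_mono)
  qed (use that in simp)
  then show "norm (wave z (bpt j y) * u j y) <= exp (k * a * (1 / (norm w / 2) + 2 * norm w)) * norm (u j y)"
   by (cases "\<bar>y\<bar> < a") (auto simp: u_0 norm_mult mult_right_mono)
 qed
qed (auto simp: wave_def intro!: holomorphic_intros)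

text \<open>\<open>boundary_zero\<close> is multiplied by the conjugate density and integrated. By
  symmetry of the kernel, subtracting the conjugate double integral with the two points exchanged
  leaves \<open>Kd - cnj Kd\<close>, a multiple of J_0. Coinciding points, where
  \<open>Kd_minus_cnj\<close> is silent, form a null set.\<close>

lemma layer_energy:
 "(\<Sum>i<4. \<Sum>j<4. LINT t|lborel. LINT s|lborel. cnj (u j t) * bI (- (of_real (k * norm (bpt j t - bpt i s)))\<^sup>2 / 4) * u i s) = 0"
proof -
 let ?b = "%j t i s. - (of_real (k * norm (bpt j t - bpt i s)))\<^sup>2 / 4"
 have bm [measurable]: "bI \<in> borel_measurable borel" by (intro borel_measurable_continuous_onI holomorphic_on_imp_continuous_on holomorphic_bI)
 define F where "F = (%i j s t. cnj (u i s) * (Kd (bpt i s) (bpt j t) * u j t))"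
 have cm [measurable]: "cnj \<in> borel_measurable borel" by (intro borel_measurable_continuous_onI continuous_intros)
 have Fm [measurable]: "(%(s, t). F i j s t) \<in> borel_measurable (lborel \<Otimes>\<^sub>M lborel)" for i j
  unfolding F_def by measurable
 obtain M where M: "M >= 0" "!!c. \<bar>c\<bar> <= a ==> integrable lborel (%y. \<bar>c - y\<bar> powr (-1/4) * Wt y)" "!!c. \<bar>c\<bar> <= a ==> (LINT y|lborel. \<bar>c - y\<bar> powr (-1/4) * Wt y) <= M"
  using Wt_convolution_bound by auto
 obtain C where C: "C >= 0" "!!i j s t c X. \<bar>s\<bar> < a ==> norm X <= 2 * a ==> c ~= t ==> \<bar>c - t\<bar> <= 2 * norm (X - bpt j t) ==>
  norm (Kd X (bpt j t) * u j t) <= C * (\<bar>c - t\<bar> powr (-1/4) * Wt t)" using Kd_u_dominated by metis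
 have Fb: "integrable lborel (F i j s) & (LINT t|lborel. norm (F i j s t)) <= norm (u i s) * (C * M)" for i j s
 proof (cases "\<bar>s\<bar> < a")
  case True
  obtain c where c: "\<bar>c\<bar> <= a" "!!t. \<bar>c - t\<bar> <= norm (bpt i s - bpt j t)" using bpt_dist True by (metis less_imp_le)
  let ?w = "%t. norm (u i s) * (C * (\<bar>c - t\<bar> powr (-1/4) * Wt t))"
  have wi: "integrable lborel ?w" by (intro integrable_mult_right M c)
  have le: "AE t in lborel. norm (F i j s t) <= ?w t"
   using AE_lborel_singleton[of c]
  proof eventually_elim
   case (elim t)
   have "norm (Kd (bpt i s) (bpt j t) * u j t) <= C * (\<bar>c - t\<bar> powr (-1/4) * Wt t)"
    using c(2)[of t] elim True norm_bpt[of s i] by (intro C(2)[OF True]) auto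
   then show ?case unfolding F_def norm_mult complex_mod_cnj by (intro mult_left_mono) auto
  qed
  have i: "integrable lborel (F i j s)"
   by (rule Bochner_Integration.integrable_bound[OF wi])
     (use le in \<open>auto simp: F_def elim!: eventually_mono intro: order.trans[OF _ abs_ge_self]\<close>)
  have "(LINT t|lborel. norm (F i j s t)) <= (LINT t|lborel. ?w t)"
   by (rule integral_mono_AE) (use i wi le in auto)
  also have "... <= norm (u i s) * (C * M)" using C(1) M(3)[OF c(1)] by (auto intro!: mult_left_mono)
  finally show ?thesis using i by simp
 qed (simp add: F_def[abs_def] u_0)
 have wi: "integrable lborel (%s. norm (u i s) * (C * M))" for i using u_integrable by simp
 have Fcm: "(%(s, t). cnj (F i j s t)) \<in> borel_measurable (lborel \<Otimes>\<^sub>M lborel)" for i j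
  using measurable_compose[OF Fm cm] by (simp add: split_beta')
 have sw: "(LINT s|lborel. LINT t|lborel. cnj (F i j s t)) = (LINT t|lborel. LINT s|lborel. cnj (F i j s t))"
  "integrable lborel (%t. LINT s|lborel. cnj (F i j s t))" for i j
  by (rule swap_LINT_dominated(1,3)[OF Fcm wi[of i]]; use Fb[of i j] in simp)+
 have Fi: "integrable lborel (%s. LINT t|lborel. F i j s t)" for i j
  by (rule swap_LINT_dominated(2)[OF Fm wi[of i]]; use Fb[of i j] in simp)
 have z: "(\<Sum>i<4. \<Sum>j<4. LINT s|lborel. LINT t|lborel. F i j s t) = 0"
 proof -
  have "(\<Sum>j<4. LINT s|lborel. LINT t|lborel. F i j s t) = 0" for i
  proof -
   have "(\<Sum>j<4. LINT s|lborel. LINT t|lborel. F i j s t) = (LINT s|lborel. (\<Sum>j<4. LINT t|lborel. F i j s t))"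
    using Fi by simp
   also have "(%s. \<Sum>j<4. LINT t|lborel. F i j s t) = (%s. 0)"
   proof
    fix s show "(\<Sum>j<4. LINT t|lborel. F i j s t) = 0"
     using boundary_zero[of s i] by (cases "\<bar>s\<bar> < a") (simp_all add: F_def u_0 sum_distrib_left[symmetric])
   qed
   finally show ?thesis by simp
  qed
  then show ?thesis by simp
 qed
 have E: "(LINT t|lborel. LINT s|lborel. F j i t s) - cnj (LINT s|lborel. LINT t|lborel. F i j s t)
   = (\<i> / 2) * (LINT t|lborel. LINT s|lborel. cnj (u j t) * bI (?b j t i s) * u i s)" for i j
 proof -
  let ?B = "%s t. bI (?b j t i s)"
  have d: "F j i t s - cnj (F i j s t) = cnj (u j t) * ((Kd (bpt j t) (bpt i s) - cnj (Kd (bpt j t) (bpt i s))) * u i s)" for s t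
   unfolding F_def by (subst Kd_sym[of "bpt i s"]) (simp add: algebra_simps)
  have ci: "integrable lborel (%s. cnj (F i j s t))" for t
  proof (rule Bochner_Integration.integrable_bound[OF conjunct1[OF Fb[of j i t]]])
   show "AE s in lborel. norm (cnj (F i j s t)) <= norm (F j i t s)"
    unfolding F_def by (subst Kd_sym) (auto simp: norm_mult)
  qed (simp add: F_def)
  have e: "(LINT s|lborel. F j i t s) - (LINT s|lborel. cnj (F i j s t)) = (\<i> / 2) * (LINT s|lborel. cnj (u j t) * ?B s t * u i s)" for t
  proof (cases "\<bar>t\<bar> < a")
   case True
   obtain c where c: "\<bar>c\<bar> <= a" "!!s. \<bar>c - s\<bar> <= norm (bpt j t - bpt i s)" using bpt_dist True by (metis less_imp_le)
   have "(LINT s|lborel. F j i t s) - (LINT s|lborel. cnj (F i j s t)) = (LINT s|lborel. F j i t s - cnj (F i j s t))"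
    using Fb[of j i t] ci by simp
   also have "... = (LINT s|lborel. (\<i> / 2) * (cnj (u j t) * ?B s t * u i s))"
   proof (rule integral_cong_AE)
    show "AE s in lborel. F j i t s - cnj (F i j s t) = (\<i> / 2) * (cnj (u j t) * ?B s t * u i s)"
     using AE_lborel_singleton[of c]
    proof eventually_elim
     case (elim s)
     then have "bpt j t ~= bpt i s" using c(2)[of s] by auto
     then show ?case unfolding d by (simp add: Kd_minus_cnj)
    qed
   qed (simp_all add: F_def)
   finally show ?thesis by simp
  qed (simp add: F_def[abs_def] u_0)
  have "(LINT t|lborel. LINT s|lborel. F j i t s) - cnj (LINT s|lborel. LINT t|lborel. F i j s t)
    = (LINT t|lborel. LINT s|lborel. F j i t s) - (LINT t|lborel. LINT s|lborel. cnj (F i j s t))"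
   unfolding sw(1)[symmetric] by (simp only: Bochner_Integration.integral_cnj)
  also have "... = (LINT t|lborel. (LINT s|lborel. F j i t s) - (LINT s|lborel. cnj (F i j s t)))"
   using Fi sw(2) by simp
  also have "... = (LINT t|lborel. (\<i> / 2) * (LINT s|lborel. cnj (u j t) * bI (?b j t i s) * u i s))"
   by (simp only: e)
  finally show ?thesis by simp
 qed
 have "(\<Sum>i<4. \<Sum>j<4. (\<i> / 2) * (LINT t|lborel. LINT s|lborel. cnj (u j t) * bI (?b j t i s) * u i s))
  = (\<Sum>i<4. \<Sum>j<4. LINT t|lborel. LINT s|lborel. F j i t s) - cnj (\<Sum>i<4. \<Sum>j<4. LINT s|lborel. LINT t|lborel. F i j s t)"
  unfolding E[symmetric] by (simp only: sum_subtractf cnj_sum)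
 also have "... = 0" unfolding z sum.swap[of "%i j. LINT t|lborel. LINT s|lborel. F j i t s" "{..<4}"] by simp
 finally show ?thesis unfolding sum_distrib_left[symmetric] by simp
qed

text \<open>J_0 of a distance is the circle average of a product of two plane waves, one for each
  point. Exchanging the integrals therefore factors the energy into the average of the squared
  modulus of \<open>Fh\<close>.\<close>

lemma Fh_circle_0: "(LINT x:{0..1}|lborel. cnj (Fh (cis (2 * pi * x))) * Fh (cis (2 * pi * x))) = 0"
proof -
 let ?c = "%x::real. cis (2 * pi * x)"
 have [measurable]: "cnj \<in> borel_measurable borel" "(%x. ?c x) \<in> borel_measurable borel"
  by (intro borel_measurable_continuous_onI continuous_intros)+
 define f where "f = (%i x. LINT s|lborel. wave (?c x) (bpt i s) * u i s)"
 have fm [measurable]: "f i \<in> borel_measurable borel" for i unfolding f_def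
  using lborel.borel_measurable_lebesgue_integral[of "%x s. wave (?c x) (bpt i s) * u i s" borel] by simp
 have nc: "norm (wave (?c x) b) = 1" for x b by (rule norm_wave_circle)
 have fb: "norm (f i x) <= (LINT s|lborel. norm (u i s))" for i x
  unfolding f_def by (rule order.trans[OF integral_norm_bound]) (simp add: norm_mult nc)
 have ind: "integrable lborel (indicator {0..1} :: real => real)" by simp
 have one: "(LINT t|lborel. LINT s|lborel. cnj (u j t) * bI (- (of_real (k * norm (bpt j t - bpt i s)))\<^sup>2 / 4) * u i s)
  = (LINT x:{0..1}|lborel. cnj (f j x) * f i x)" for i j
 proof -
  have B: "bI (- (of_real (k * norm (bpt j t - bpt i s)))\<^sup>2 / 4) = (LINT x|lborel. indicator {0..1} x *\<^sub>R (cnj (wave (?c x) (bpt j t)) * wave (?c x) (bpt i s)))" for s t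
  proof -
   let ?Z = "bpt j t - bpt i s"
   have "- (of_real (k * norm ?Z))\<^sup>2 / 4 = (\<i> * of_real k / 2 * ?Z) * (\<i> * of_real k / 2 * cnj ?Z)"
    using complex_norm_square[of ?Z] by (simp add: power_mult_distrib power2_eq_square mult_ac)
   then show ?thesis by (simp only: bI_circle_average wave_circle set_lebesgue_integral_def)
  qed
  have 1: "(LINT s|lborel. cnj (u j t) * bI (- (of_real (k * norm (bpt j t - bpt i s)))\<^sup>2 / 4) * u i s)
   = (LINT x|lborel. cnj (u j t) * (indicator {0..1} x *\<^sub>R (cnj (wave (?c x) (bpt j t)) * f i x)))" for t
  proof -
   have "(LINT s|lborel. cnj (u j t) * bI (- (of_real (k * norm (bpt j t - bpt i s)))\<^sup>2 / 4) * u i s)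
    = cnj (u j t) * (LINT s|lborel. LINT x|lborel. (indicator {0..1} x *\<^sub>R (cnj (wave (?c x) (bpt j t)) * wave (?c x) (bpt i s))) * u i s)"
    unfolding B by (simp only: integral_mult_left_zero mult.assoc integral_mult_right_zero)
   also have "(LINT s|lborel. LINT x|lborel. (indicator {0..1} x *\<^sub>R (cnj (wave (?c x) (bpt j t)) * wave (?c x) (bpt i s))) * u i s)
    = (LINT x|lborel. LINT s|lborel. (indicator {0..1} x *\<^sub>R (cnj (wave (?c x) (bpt j t)) * wave (?c x) (bpt i s))) * u i s)"
    by (rule swap_LINT(1)[where ?w1.0="%s. norm (u i s)" and ?w2.0="indicator {0..1}"]) (use u_integrable in \<open>auto simp: norm_mult nc intro!: integrable_norm mult_right_mono split: split_indicator\<close>)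
   also have "... = (LINT x|lborel. indicator {0..1} x *\<^sub>R (cnj (wave (?c x) (bpt j t)) * f i x))"
    unfolding f_def by (simp add: mult.assoc)
   finally show ?thesis by (simp only: integral_mult_right_zero)
  qed
  have "(LINT t|lborel. LINT x|lborel. cnj (u j t) * (indicator {0..1} x *\<^sub>R (cnj (wave (?c x) (bpt j t)) * f i x)))
    = (LINT x|lborel. LINT t|lborel. cnj (u j t) * (indicator {0..1} x *\<^sub>R (cnj (wave (?c x) (bpt j t)) * f i x)))"
   by (rule swap_LINT(1)[where ?w1.0="%s. norm (u j s)" and ?w2.0="%x. indicator {0..1} x * (LINT s|lborel. norm (u i s))"])
     (use u_integrable fb ind in \<open>auto simp: norm_mult nc intro!: integrable_norm mult_left_mono split: split_indicator\<close>)
  also have "... = (LINT x|lborel. indicator {0..1} x *\<^sub>R (cnj (f j x) * f i x))"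
  proof (rule Bochner_Integration.integral_cong[OF refl])
   fix x
   have "cnj (f j x) = (LINT t|lborel. cnj (wave (?c x) (bpt j t) * u j t))" unfolding f_def by (rule Bochner_Integration.integral_cnj[symmetric])
   then show "(LINT t|lborel. cnj (u j t) * (indicator {0..1} x *\<^sub>R (cnj (wave (?c x) (bpt j t)) * f i x))) = indicator {0..1} x *\<^sub>R (cnj (f j x) * f i x)"
    by (cases "x \<in> {0..1}") (simp_all add: mult.commute[of "cnj (u j _)"] mult.assoc mult.left_commute)
  qed
  finally show ?thesis unfolding 1 set_lebesgue_integral_def .
 qed
 have m: "norm (f j x) * norm (f i x) <= (LINT s|lborel. norm (u j s)) * (LINT s|lborel. norm (u i s))" for i j x
  by (intro mult_mono fb) (auto intro: integral_nonneg_AE)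
 have fi: "set_integrable lborel {0..1} (%x. cnj (f j x) * f i x)" for i j
  unfolding set_integrable_def
  by (rule Bochner_Integration.integrable_bound[of _ "%x. indicator {0..1} x *\<^sub>R ((LINT s|lborel. norm (u j s)) * (LINT s|lborel. norm (u i s)))"])
    (use m ind in \<open>auto simp: norm_mult intro!: AE_I2 order.trans[OF m abs_ge_self] split: split_indicator\<close>)
 have "0 = (\<Sum>i<4. \<Sum>j<4. LINT x:{0..1}|lborel. cnj (f j x) * f i x)" using layer_energy unfolding one by simp
 also have "... = (LINT x:{0..1}|lborel. (\<Sum>i<4. \<Sum>j<4. cnj (f j x) * f i x))"
  unfolding set_lebesgue_integral_def scaleR_sum_right
  by (simp only: Bochner_Integration.integral_sum Bochner_Integration.integrable_sum fi[unfolded set_integrable_def])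
 also have "... = (LINT x:{0..1}|lborel. cnj (Fh (?c x)) * Fh (?c x))"
 proof -
  have "Fh (?c x) = (\<Sum>i<4. f i x)" for x by (simp add: Fh_def f_def)
  then show ?thesis by (simp only: cnj_sum sum_product) (subst sum.swap, rule refl)
 qed
 finally show ?thesis by simp
qed

text \<open>A continuous nonnegative function with integral 0 vanishes, so \<open>Fh\<close> is 0 on
  the unit circle; the identity theorem in the punctured plane gives all other directions.\<close>

lemma Fh_0:
 assumes "\<zeta> ~= 0"
 shows "Fh \<zeta> = 0"
proof -
 let ?c = "%x::real. cis (2 * pi * x)"
 let ?g = "%x. (norm (Fh (?c x)))^2"
 have c: "continuous_on {0..1} (%x. Fh (?c x))"
  by (rule continuous_on_compose2[OF holomorphic_on_imp_continuous_on[OF Fh_holomorphic]]) (auto intro!: continuous_intros)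
 have gi: "set_integrable lborel {0..1} (%x. ?g x)" by (rule borel_integrable_atLeastAtMost') (intro continuous_intros c)
 have "of_real (LINT x:{0..1}|lborel. ?g x) = (LINT x:{0..1}|lborel. cnj (Fh (?c x)) * Fh (?c x))"
  unfolding set_integral_complex_of_real[symmetric] by (simp only: complex_norm_square mult.commute)
 then have "(LINT x:{0..1}|lborel. ?g x) = 0" using Fh_circle_0 by simp
 then have "((%x. ?g x) has_integral 0) {0..1}"
  using set_borel_integral_eq_integral[OF gi] by (simp add: has_integral_integrable_integral)
 then have z: "Fh (?c x) = 0" if "x \<in> {0..1}" for x
  using has_integral_0_cbox_imp_0[of 0 1 "%x. ?g x" x] that continuous_on_power[OF continuous_on_norm[OF c], of 2] by simp
 show ?thesis
 proof (rule analytic_continuation[of Fh "- {0}" "sphere 0 1" 1 \<zeta>])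
  show "connected (- {0::complex})" by (rule connected_punctured_universe) simp
  show "(1::complex) islimpt sphere 0 1"
  proof (rule connected_imp_perfect)
   have "- 1 \<in> sphere (0::complex) 1" "1 \<in> sphere (0::complex) 1" by auto
   then show "sphere (0::complex) 1 ~= {x}" for x by (metis singletonD neg_equal_iff_equal one_neq_neg_one)
  qed (auto intro: connected_sphere)
  fix w :: complex assume "w \<in> sphere 0 1"
  then have "norm w = 1" by simp
  then have "w = ?c (Arg2pi w / (2 * pi))" using Arg2pi_eq[of w] by (simp add: cis_conv_exp)
  moreover have "Arg2pi w / (2 * pi) \<in> {0..1}" using Arg2pi[of w] by (simp add: field_simps)
  ultimately show "Fh w = 0" using z by metis
 qed (use Fh_holomorphic assms in auto)
qed

lemma cosh_sinh_ge: "\<bar>w * sinh t\<bar> <= \<bar>w\<bar> * cosh (t::real)"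
 unfolding abs_mult by (intro mult_left_mono norm_sinh_le) simp

lemma Re_csqrt_pos:
 assumes "q \<notin> \<real>\<^sub>\<le>\<^sub>0"
 shows "Re (csqrt q) > 0"
proof (rule ccontr)
 assume "\<not> Re (csqrt q) > 0"
 then have "Re (csqrt q) = 0" using csqrt_principal[of q] by auto
 then have "Re ((csqrt q)^2) <= 0" "Im ((csqrt q)^2) = 0" unfolding Re_power2 Im_power2 by auto
 then show False using assms by (simp add: complex_nonpos_Reals_iff)
qed

text \<open>For real \<open>\<zeta>\<close> the exponent combines into a single hyperbolic cosine,
  shifted by the \<open>s\<close> with \<open>tanh s = w / \<zeta>\<close>, and the integral over
  the line does not notice the shift. Both sides are holomorphic in \<open>\<zeta>\<close> on the
  half-plane of the hypothesis, which extends the identity.\<close>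

lemma coshK_plane_wave:
 assumes z: "Re \<zeta> > \<bar>w\<bar>"
 shows "coshK (of_real k * csqrt (\<zeta>^2 - (of_real w)^2)) = (LINT t|lborel. exp (- complex_of_real k * (\<zeta> * of_real (cosh t) + of_real (w * sinh t)))) / 2"
proof -
 let ?r = "%\<zeta> w. of_real k * csqrt (\<zeta>^2 - (of_real w)^2)" and ?c = "%\<zeta> w. \<zeta>^2 - (of_real w)^2"
 define S where "S = {\<zeta>. Re \<zeta> > \<bar>w\<bar>}"
 define \<Phi> where "\<Phi> = (%\<zeta>. LINT t|lborel. exp (- complex_of_real k * (\<zeta> * of_real (cosh t) + of_real (w * sinh t))))"
 have op: "open S" unfolding S_def by (rule open_halfspace_Re_gt)
 have S: "\<zeta>^2 - (of_real w)^2 \<notin> \<real>\<^sub>\<le>\<^sub>0" if "\<zeta> \<in> S" for \<zeta>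
 proof
  assume "\<zeta>^2 - (of_real w)^2 \<in> \<real>\<^sub>\<le>\<^sub>0"
  then have "(Re \<zeta>)^2 - (Im \<zeta>)^2 - w^2 <= 0" "Re \<zeta> * Im \<zeta> = 0" unfolding complex_nonpos_Reals_iff
   by (auto simp: power2_eq_square)
  moreover have "Re \<zeta> > 0" "w^2 < (Re \<zeta>)^2" using that power_strict_mono[of "\<bar>w\<bar>" "Re \<zeta>" 2] by (auto simp: S_def)
  ultimately show False by simp
 qed
 have h1: "\<Phi> holomorphic_on S"
  unfolding \<Phi>_def
 proof (rule holomorphic_on_lebesgue_integral(1)[OF op])
  show "(%t. exp (- complex_of_real k * (z * of_real (cosh t) + of_real (w * sinh t)))) \<in> borel_measurable lborel" for z
   by (simp, intro borel_measurable_continuous_onI continuous_intros)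
  show "\<exists>r>0. \<exists>g. integrable lborel g & (\<forall>z\<in>ball \<zeta> r. \<forall>t\<in>space lborel. norm (exp (- complex_of_real k * (z * of_real (cosh t) + of_real (w * sinh t)))) <= g t)" if z: "\<zeta> \<in> S" for \<zeta>
  proof (intro exI conjI ballI)
   define \<delta> where "\<delta> = (Re \<zeta> - \<bar>w\<bar>) / 2"
   show d: "\<delta> > 0" using z by (simp add: \<delta>_def S_def)
   show "integrable lborel (%t. cosh t ^ 0 * exp (- (k * \<delta>) * cosh t))" using d k_pos by (intro integrable_cosh_exp) simp
   fix z t assume "z \<in> ball \<zeta> \<delta>"
   then have "\<bar>Re (\<zeta> - z)\<bar> < \<delta>" using abs_Re_le_cmod[of "\<zeta> - z"] by (simp add: dist_norm)
   then have "\<bar>w\<bar> + \<delta> <= Re z" by (auto simp: \<delta>_def field_simps abs_if split: if_splits)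
   then have "(\<bar>w\<bar> + \<delta>) * cosh t <= Re z * cosh t" by (intro mult_right_mono) auto
   then have "\<delta> * cosh t <= Re z * cosh t + w * sinh t" using cosh_sinh_ge[of w t] by (simp add: distrib_right)
   from mult_left_mono[OF this, of k] show "norm (exp (- complex_of_real k * (z * of_real (cosh t) + of_real (w * sinh t)))) <= cosh t ^ 0 * exp (- (k * \<delta>) * cosh t)"
    using k_pos by simp
  qed
 qed (intro holomorphic_intros)
 have h2: "(%\<zeta>. coshK (?r \<zeta> w)) holomorphic_on S"
  unfolding holomorphic_on_def
 proof
  fix \<zeta> assume z: "\<zeta> \<in> S"
  have ne: "csqrt (?c \<zeta> w) ~= 0" using S[OF z] by auto
  have "Re (csqrt (?c \<zeta> w)) > 0"
   by (rule Re_csqrt_pos[OF S[OF z]])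
  then have "Re (?r \<zeta> w) > 0" using k_pos by simp
  from DERIV_coshK[OF this] have "coshK field_differentiable at (?r \<zeta> w)"
   unfolding field_differentiable_def by (rule exI)
  moreover have "(%\<zeta>. of_real k * csqrt (?c \<zeta> w)) field_differentiable at \<zeta>"
  proof -
   have "(csqrt \<circ> (%\<zeta>. \<zeta>^2 - (of_real w)^2)) field_differentiable at \<zeta>"
    by (intro field_differentiable_compose field_differentiable_at_csqrt S[OF z] derivative_intros)
   then show ?thesis by (intro field_differentiable_mult) (auto simp: o_def)
  qed
  ultimately have "(coshK \<circ> (%\<zeta>. of_real k * csqrt (?c \<zeta> w))) field_differentiable at \<zeta>"
   by (intro field_differentiable_compose)
  then show "(%\<zeta>. coshK (?r \<zeta> w)) field_differentiable at \<zeta> within S"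
   by (simp add: o_def field_differentiable_at_within)
 qed
 let ?U = "complex_of_real ` {\<bar>w\<bar><..}"
 have r: "coshK (of_real k * csqrt ((of_real x)^2 - (of_real w)^2)) - \<Phi> (of_real x) / 2 = 0" if x: "x > \<bar>w\<bar>" for x
 proof -
  define \<rho> where "\<rho> = sqrt (x^2 - w^2)"
  define s where "s = arsinh (w / \<rho>)"
  have xw: "w^2 < x^2" using x power_strict_mono[of "\<bar>w\<bar>" x 2] by simp
  then have rho: "\<rho> > 0" "\<rho>^2 = x^2 - w^2" by (simp_all add: \<rho>_def)
  have sh: "\<rho> * sinh s = w" using rho by (simp add: s_def)
  have "(\<rho> * cosh s)^2 = x^2" using cosh_square_eq[of s] sh rho(2) by (simp add: power_mult_distrib distrib_left sh[symmetric])
  then have ch: "\<rho> * cosh s = x" using rho x by (simp add: power2_eq_iff_nonneg)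
  have e: "x * cosh t + w * sinh t = \<rho> * cosh (s + 1 * t)" for t
   unfolding ch[symmetric] sh[symmetric] by (simp add: cosh_add algebra_simps)
  have cs: "csqrt ((of_real x)^2 - (of_real w)^2) = of_real \<rho>"
   using xw by (simp add: \<rho>_def flip: of_real_power of_real_diff of_real_sqrt)
  have "\<Phi> (of_real x) = (LINT t|lborel. exp (- complex_of_real k * of_real (\<rho> * cosh (s + 1 * t))))"
   unfolding \<Phi>_def e[symmetric] by simp
  also have "... = (LINT t|lborel. exp (- complex_of_real k * of_real (\<rho> * cosh t)))"
   using lborel_integral_real_affine[of 1 "%t. exp (- complex_of_real k * complex_of_real (\<rho> * cosh t))" s] by simp
  finally show ?thesis unfolding cs coshK_def by (simp add: mult.assoc)
 qed
 have "coshK (?r \<zeta> w) - \<Phi> \<zeta> / 2 = 0"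
 proof (rule analytic_continuation[where S=S and U="?U" and \<xi>="of_real (\<bar>w\<bar> + 1)" and f="%\<zeta>. coshK (?r \<zeta> w) - \<Phi> \<zeta> / 2"])
  show "(%\<zeta>. coshK (?r \<zeta> w) - \<Phi> \<zeta> / 2) holomorphic_on S" by (intro holomorphic_intros h1 h2) simp
  show "connected S" unfolding S_def by (intro convex_connected convex_halfspace_Re_gt)
  show "of_real (\<bar>w\<bar> + 1) islimpt ?U"
  proof (rule connected_imp_perfect)
   show "connected ?U" by (intro connected_continuous_image continuous_intros) simp
   show 1: "complex_of_real (\<bar>w\<bar> + 1) \<in> ?U" by (rule imageI) simp
   have 2: "complex_of_real (\<bar>w\<bar> + 2) \<in> ?U" by (rule imageI) simp
   show "?U ~= {x}" for x
   proof
    assume "?U = {x}"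
    then have "complex_of_real (\<bar>w\<bar> + 1) = complex_of_real (\<bar>w\<bar> + 2)" using 1 2 by (simp only: singleton_iff)
    then show False unfolding of_real_eq_iff by simp
   qed
  qed
  show "complex_of_real (\<bar>w\<bar> + 1) \<in> S" by (simp add: S_def)
  show "coshK (of_real k * csqrt (x^2 - (of_real w)^2)) - \<Phi> x / 2 = 0" if "x \<in> ?U" for x using r that by blast
  show "?U \<subseteq> S" by (auto simp: S_def)
  show "\<zeta> \<in> S" using z by (simp add: S_def)
 qed (rule op)
 then show ?thesis by (simp add: \<Phi>_def)
qed

lemma csqrt_upper:
 assumes "Im q > 0"
 shows "Re (csqrt q) > 0" "Im (csqrt q) > 0"
proof -
 obtain c where c: "c = csqrt q" "c^2 = q" "0 < Re c | Re c = 0 & 0 <= Im c" using csqrt_principal[of q] power2_csqrt[of q] by blast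
 have "Im q = 2 * Re c * Im c" unfolding c(2)[symmetric] by (rule Im_power2)
 then have "0 < Re c * Im c" using assms by (simp add: mult.commute)
 then have "Re c > 0 & Im c > 0" using c(3) by (auto simp: zero_less_mult_iff)
 then show "Re (csqrt q) > 0" "Im (csqrt q) > 0" unfolding c(1) by auto
qed

text \<open>The previous lemma at \<open>- i * z\<close>. The condition that \<open>Im z\<close>
  exceeds the height difference is what confines the plane wave representation to points far from
  the layer.\<close>

lemma NN_plane_wave:
 assumes z: "Re z > 0" "Im z > \<bar>w\<bar>"
 shows "NN (z^2 + (of_real w)^2) = (LINT t|lborel. exp (complex_of_real k * (\<i> * z * of_real (cosh t) - of_real (w * sinh t)))) / (4 * of_real pi)"
proof -
 let ?q = "z^2 + (of_real w)^2"
 have "Im ?q = 2 * Re z * Im z" by (simp add: power2_eq_square)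
 also have "... > 0" using z by simp
 finally have q: "Re (csqrt ?q) > 0" "Im (csqrt ?q) > 0" by (rule csqrt_upper)+
 have "csqrt ((- \<i> * z)^2 - (of_real w)^2) = - \<i> * csqrt ?q"
  by (rule csqrt_unique) (use q in \<open>simp_all add: power_mult_distrib\<close>)
 then have "NN ?q = coshK (of_real k * csqrt ((- \<i> * z)^2 - (of_real w)^2)) / (2 * of_real pi)"
  using NN_eq_coshK(1)[OF q] by (simp add: mult_ac)
 also have "... = (LINT t|lborel. exp (- complex_of_real k * (- \<i> * z * of_real (cosh t) + of_real (w * sinh t)))) / (4 * of_real pi)"
  by (subst coshK_plane_wave) (use z in simp_all)
 also have "(%t. exp (- complex_of_real k * (- \<i> * z * of_real (cosh t) + of_real (w * sinh t)))) = (%t. exp (complex_of_real k * (\<i> * z * of_real (cosh t) - of_real (w * sinh t))))"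
  by (simp add: algebra_simps)
 finally show ?thesis .
qed

end

context layer begin

definition TL :: "complex => real => complex" where
 "TL x1 x2 = (\<Sum>j<4. LINT y|lborel. G (x1 - of_real (Re (bpt j y))) (of_real (x2 - Im (bpt j y))) * u j y)"

lemma bpt_le: "\<bar>y\<bar> < a ==> \<bar>Re (bpt j y)\<bar> <= a & \<bar>Im (bpt j y)\<bar> <= a"
 unfolding bpt_def using a_pos by (intro quarter_turn[OF i_power_cases]) auto

lemma Re_Im_measurable [measurable]: "Re \<in> borel_measurable borel" "Im \<in> borel_measurable borel" "cosh \<in> borel_measurable (borel :: real measure)" "sinh \<in> borel_measurable (borel :: real measure)"
 by (intro borel_measurable_continuous_onI continuous_intros)+

text \<open>With \<open>t\<close> as parameter, the kernel is a superposition of plane waves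
  \<open>wave\<close> in the directions \<open>exp (- t)\<close>. Exchanging the integrals makes
  \<open>Fh\<close> at these directions the amplitude, and it is 0. The threshold
  \<open>2 * a\<close> exceeds every height difference between \<open>x2\<close> and the boundary,
  so all waves decay.\<close>

lemma TL_far:
 assumes x1: "Re x1 > a" "Im x1 > 2 * a" and x2: "\<bar>x2\<bar> < a"
 shows "TL x1 x2 = 0"
proof -
 let ?e = "%t. exp (complex_of_real k * (\<i> * x1 * of_real (cosh t) - of_real (x2 * sinh t)))"
 define \<delta> where "\<delta> = k * (Im x1 - 2 * a)"
 have d: "\<delta> > 0" using x1 k_pos by (simp add: \<delta>_def)
 let ?x = "%j y. Re (bpt j y)" and ?y = "%j y. Im (bpt j y)" and ?w = "%j t y. wave (of_real (exp (- t))) (bpt j y)"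
 have ew: "?e t * ?w j t y = exp (complex_of_real k * (\<i> * (x1 - of_real (?x j y)) * of_real (cosh t) - of_real ((x2 - ?y j y) * sinh t)))" for j t y
 proof -
  have "bpt j y / of_real (exp (- t)) = bpt j y * of_real (exp t)" by (simp add: exp_minus divide_inverse)
  then have "bpt j y / of_real (exp (- t)) + cnj (bpt j y) * of_real (exp (- t)) = 2 * of_real (?x j y * cosh t) + 2 * \<i> * of_real (?y j y * sinh t)"
   by (simp only:) (simp add: complex_eq_iff cosh_def sinh_def algebra_simps del: of_real_exp)
  then show ?thesis unfolding wave_def exp_add[symmetric] by (simp add: algebra_simps)
 qed
 have K: "G (x1 - of_real (?x j y)) (of_real (x2 - ?y j y)) * u j y = (LINT t|lborel. ?e t * (?w j t y * u j y)) / (4 * of_real pi)" for j y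
 proof (cases "\<bar>y\<bar> < a")
  case True
  have "G (x1 - of_real (?x j y)) (of_real (x2 - ?y j y)) = (LINT t|lborel. ?e t * ?w j t y) / (4 * of_real pi)"
   unfolding G_def ew by (rule NN_plane_wave) (use bpt_le[OF True, of j] x1 x2 in auto)
  then show ?thesis by (simp add: mult.assoc[symmetric])
 qed (simp add: u_0)
 have le: "norm (?e t * (?w j t y * u j y)) <= norm (u j y) * exp (- \<delta> * cosh t)" for t j y
 proof (cases "\<bar>y\<bar> < a")
  case True
  have "\<bar>(x2 - ?y j y) * sinh t\<bar> <= \<bar>x2 - ?y j y\<bar> * cosh t" by (rule cosh_sinh_ge)
  also have "... <= 2 * a * cosh t" using bpt_le[OF True, of j] x2 by (intro mult_right_mono) auto
  finally have "k * ((Im x1 - 2 * a) * cosh t) <= k * (Im x1 * cosh t + (x2 - ?y j y) * sinh t)"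
   using k_pos by (intro mult_left_mono) (auto simp: left_diff_distrib)
  then have "norm (?e t * ?w j t y) <= exp (- \<delta> * cosh t)"
   unfolding ew by (simp add: \<delta>_def algebra_simps)
  from mult_left_mono[OF this, of "norm (u j y)"] show ?thesis by (simp add: norm_mult mult_ac)
 qed (simp add: u_0)
 have i: "integrable lborel (%t. exp (- \<delta> * cosh t))" using integrable_cosh_exp[OF d, of 0] by simp
 have [measurable]: "?e \<in> borel_measurable borel" "(%t::real. complex_of_real (exp (- t))) \<in> borel_measurable borel"
  by (intro borel_measurable_continuous_onI continuous_intros)+
 have m: "(%(y, t). ?e t * (?w j t y * u j y)) \<in> borel_measurable (lborel \<Otimes>\<^sub>M lborel)" for j by measurable
 note sw = swap_LINT[OF m integrable_norm[OF u_integrable] i le]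
 have I: "(LINT y|lborel. ?e t * (?w j t y * u j y)) = ?e t * (LINT y|lborel. ?w j t y * u j y)" for j t
  by (rule integral_mult_right_zero)
 have "TL x1 x2 = (\<Sum>j<4. LINT t|lborel. ?e t * (LINT y|lborel. ?w j t y * u j y)) / (4 * of_real pi)"
  unfolding TL_def K by (simp only: integral_divide_zero sw(1) I sum_divide_distrib)
 also have "(\<Sum>j<4. LINT t|lborel. ?e t * (LINT y|lborel. ?w j t y * u j y)) = (LINT t|lborel. (\<Sum>j<4. ?e t * (LINT y|lborel. ?w j t y * u j y)))"
  by (rule Bochner_Integration.integral_sum[symmetric]) (use sw(3) in \<open>simp only: I\<close>)
 also have "... = (LINT t|lborel. ?e t * Fh (of_real (exp (- t))))"
  by (simp only: Fh_def sum_distrib_left)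
 also have "... = 0" by (simp add: Fh_0)
 finally show ?thesis by simp
qed

text \<open>In the open quadrant the squared distance has imaginary part at least
  \<open>2 * Re Z * Im Z\<close>. This keeps it off the cut and bounds the kernel uniformly near
  each point, although the density is singular at the corners.\<close>

lemma TL_holomorphic: "(%Z. TL (of_real a + Z) x2) holomorphic_on {Z. Re Z > 0 & Im Z > 0}"
 unfolding TL_def
proof (intro holomorphic_on_sum holomorphic_on_lebesgue_integral(1))
 let ?b = "%Z j y. of_real a + Z - of_real (Re (bpt j y))"
 let ?S = "{Z. Re Z > 0 & Im Z > 0}"
 show "open ?S" by (intro open_Collect_conj open_Collect_less continuous_intros)
 fix j
 let ?q = "%Z y. (?b Z j y)^2 + (of_real (x2 - Im (bpt j y)))^2"
 show "(%y. G (?b Z j y) (of_real (x2 - Im (bpt j y))) * u j y) \<in> borel_measurable lborel" for Z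
  by measurable
 have q: "Im (?q Z y) >= 2 * Re Z * Im Z" if "Z \<in> ?S" "\<bar>y\<bar> < a" for Z y
 proof -
  have "Im (?q Z y) = 2 * (a - Re (bpt j y) + Re Z) * Im Z" by (simp add: power2_eq_square algebra_simps)
  then show ?thesis using that bpt_le[of y j] by (auto intro!: mult_right_mono)
 qed
 show "(%Z. G (?b Z j y) (of_real (x2 - Im (bpt j y))) * u j y) holomorphic_on ?S" for y
 proof (cases "\<bar>y\<bar> < a")
  case True
  have "?q Z y \<notin> \<real>\<^sub>\<le>\<^sub>0" if "Z \<in> ?S" for Z
  proof -
   have "0 < 2 * Re Z * Im Z" using that by simp
   then have "Im (?q Z y) ~= 0" using q[OF that True] by linarith
   then show ?thesis by (simp only: complex_nonpos_Reals_iff simp_thms)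
  qed
  moreover have "NN field_differentiable at q within A" if "q \<notin> \<real>\<^sub>\<le>\<^sub>0" for q A
   using has_field_derivative_at_within[OF DERIV_NN[OF that]] unfolding field_differentiable_def by (rule exI)
  ultimately have "NN holomorphic_on ((%Z. ?q Z y) ` ?S)" unfolding holomorphic_on_def by blast
  then have "(NN \<circ> (%Z. ?q Z y)) holomorphic_on ?S" by (intro holomorphic_on_compose holomorphic_intros)
  then show ?thesis unfolding G_def by (intro holomorphic_intros) (simp add: o_def)
 qed (simp add: u_0)
 show "\<exists>r>0. \<exists>g. integrable lborel g & (\<forall>Z\<in>ball W r. \<forall>y\<in>space lborel. norm (G (?b Z j y) (of_real (x2 - Im (bpt j y))) * u j y) <= g y)"
  if W: "W \<in> ?S" for W
 proof -
  define r where "r = min (Re W) (Im W) / 2"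
  define M where "M = (2 * a + norm W + r)^2 + (\<bar>x2\<bar> + a)^2"
  have r: "r > 0" "2 * r <= Re W" "2 * r <= Im W" using W by (auto simp: r_def)
  have M: "M > 0" unfolding M_def using a_pos r by (intro add_pos_nonneg zero_less_power) auto
  obtain C where C: "C > 0" "!!q. q ~= 0 ==> norm q <= M ==> norm (NN q) <= C * norm q powr (-1/8)"
   using NN_local_bound[OF M] by auto
  show ?thesis
  proof (intro exI conjI ballI)
   show "integrable lborel (%y. C * (2 * r * r) powr (-1/8) * norm (u j y))" using u_integrable by simp
   fix Z y assume "Z \<in> ball W r"
   then have n: "norm (W - Z) < r" by (simp add: dist_norm)
   have Z: "r <= Re Z" "r <= Im Z" "norm Z <= norm W + r"
    using abs_Re_le_cmod[of "W - Z"] abs_Im_le_cmod[of "W - Z"] norm_triangle_ineq2[of Z W] n r by (auto simp: norm_minus_commute)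
   show "norm (G (?b Z j y) (of_real (x2 - Im (bpt j y))) * u j y) <= C * (2 * r * r) powr (-1/8) * norm (u j y)"
   proof (cases "\<bar>y\<bar> < a")
    case True
    have "2 * r * r <= 2 * Re Z * Im Z" using Z r by (intro mult_mono) auto
    also have "... <= norm (?q Z y)" using q[OF _ True, of Z] Z r abs_Im_le_cmod[of "?q Z y"] by auto
    finally have lo: "2 * r * r <= norm (?q Z y)" .
    have "norm (?q Z y) <= (norm (?b Z j y))^2 + \<bar>x2 - Im (bpt j y)\<bar>\<^sup>2"
     by (rule order.trans[OF norm_triangle_ineq]) (simp add: norm_power del: of_real_diff)
    also have "... <= M" unfolding M_def
    proof (intro add_mono power_mono)
     have "norm (?b Z j y) <= norm (of_real a + Z) + norm (complex_of_real (Re (bpt j y)))" by (rule norm_triangle_ineq4)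
     also have "... <= norm (complex_of_real a) + norm Z + norm (complex_of_real (Re (bpt j y)))" by (intro add_mono norm_triangle_ineq order.refl)
     finally show "norm (?b Z j y) <= 2 * a + norm W + r" using bpt_le[OF True, of j] Z a_pos by simp
    qed (use bpt_le[OF True, of j] in auto)
    finally have "norm (NN (?q Z y)) <= C * norm (?q Z y) powr (-1/8)" using lo mult_pos_pos[OF r(1) r(1)] by (intro C(2)) auto
    also have "... <= C * (2 * r * r) powr (-1/8)" using lo r C(1) by (intro mult_left_mono powr_mono2') auto
    finally show ?thesis unfolding G_def norm_mult by (intro mult_right_mono) auto
   qed (simp add: u_0)
  qed (rule r)
 qed
qed

text \<open>The open quadrant is connected and contains both the region of \<open>TL_far\<close> and
  the ray in direction \<open>om\<close>, on which the half-plane solution is known.\<close>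

lemma TL_0:
 assumes X: "X > 0" and x2: "\<bar>x2\<bar> < a"
 shows "TL (of_real a + rot X) x2 = 0"
proof -
 let ?S = "{Z. Re Z > 0 & Im Z > 0}" and ?U = "{Z. Re Z > 0 & Im Z > 2 * a}"
 show ?thesis
 proof (rule analytic_continuation[of "%Z. TL (of_real a + Z) x2" ?S ?U "Complex 1 (2 * a + 1)"])
  have o: "open ?U" by (intro open_Collect_conj open_Collect_less continuous_intros)
  show "open ?S" by (intro open_Collect_conj open_Collect_less continuous_intros)
  have "?S = {Z. Re Z > 0} \<inter> {Z. Im Z > 0}" by auto
  then show "connected ?S" by (intro convex_connected) (simp add: convex_Int convex_halfspace_Re_gt convex_halfspace_Im_gt)
  show "Complex 1 (2 * a + 1) islimpt ?U" by (rule interior_limit_point) (simp add: interior_open[OF o])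
 qed (use TL_holomorphic TL_far x2 a_pos X cos_theta sin_theta in auto)
qed

end

section \<open>Vanishing of the corner data\<close>

context hdata begin

text \<open>Extended by 0 off the open side and for indices from 4 on, so that integrals run over
  the whole line and one bound serves every index.\<close>

definition u :: "nat => real => complex" where
 "u j y = (if j < 4 & y \<in> {-a<..<a} then v j y else 0)"

lemma u_measurable [measurable]: "u j \<in> borel_measurable borel"
proof -
 have [measurable]: "p j \<in> borel_measurable borel" "q j \<in> borel_measurable borel" "complex_of_real \<in> borel_measurable borel" for j
  using good unfolding good_def by (auto intro!: borel_measurable_continuous_onI continuous_intros)
 have "(%y. V h1 j 0 (complex_of_real y)) \<in> borel_measurable borel"
  unfolding V_def J_def set_lebesgue_integral_def
  by (intro borel_measurable_times borel_measurable_add borel_measurable_const lborel.borel_measurable_lebesgue_integral) measurable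
 then show ?thesis unfolding u_def[abs_def] by measurable
qed

lemma u_bound: "\<exists>D\<ge>0. \<forall>j y. norm (u j y) <= D * Wt y"
proof -
 have "\<exists>D\<ge>0. \<forall>y\<in>{-a<..<a}. norm (v j y) <= D * ((a - y) powr (-5/8) + (a + y) powr (-5/8))" for j
  by (rule extinction_reg(3)[of a 0 0]) (use a_pos in \<open>auto intro!: exI[of _ 0]\<close>)
 then obtain D where D: "!!j. D j >= 0" "!!j y. y \<in> {-a<..<a} ==> norm (v j y) <= D j * ((a - y) powr (-5/8) + (a + y) powr (-5/8))" by metis
 show ?thesis
 proof (intro exI[of _ "sum D {..<4}"] conjI allI)
  show "norm (u j y) <= sum D {..<4} * Wt y" for j y
  proof (cases "j < 4 & y \<in> {-a<..<a}")
   case True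
   have "D j <= sum D {..<4}" using True D(1) by (intro member_le_sum) auto
   then have "D j * ((a - y) powr (-5/8) + (a + y) powr (-5/8)) <= sum D {..<4} * ((a - y) powr (-5/8) + (a + y) powr (-5/8))"
    by (rule mult_right_mono) simp
   then show ?thesis using D(2)[of y j] True by (simp add: u_def Wt_def)
  next
   case False
   then have "u j y = 0" by (auto simp: u_def)
   then show ?thesis using D(1) by (simp add: sum_nonneg)
  qed
 qed (use D in \<open>simp add: sum_nonneg\<close>)
qed

lemma SV_layer: "SV x1 (of_real x2) = (\<Sum>j<4. LINT y|lborel. G (x1 - of_real (Re (bpt j y))) (of_real (x2 - Im (bpt j y))) * u j y)"
proof -
 have "sideI j ([x1, of_real x2, - x1, - of_real x2] ! j) ([of_real x2, - x1, - of_real x2, x1] ! j) =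
   (LINT y|lborel. G (x1 - of_real (Re (bpt j y))) (of_real (x2 - Im (bpt j y))) * u j y)" if "j < 4" for j
 proof -
  have "j = 0 | j = 1 | j = 2 | j = 3" using that by auto
  then have "G (of_real a - [x1, of_real x2, - x1, - of_real x2] ! j) (of_real y - [of_real x2, - x1, - of_real x2, x1] ! j)
   = G (x1 - of_real (Re (bpt j y))) (of_real (x2 - Im (bpt j y)))" for y
   by (elim disjE) (simp_all add: G_def bpt_def eval_nat_numeral power2_eq_square algebra_simps)
  then show ?thesis using that unfolding sideI_def set_lebesgue_integral_def
   by (intro Bochner_Integration.integral_cong) (auto simp: u_def indicator_def)
 qed
 then show ?thesis unfolding SV_def by (intro sum.cong) auto
qed

lemma V_side_0:
 assumes X: "X > 0" and y: "\<bar>y\<bar> < a"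
 shows "V h 0 (rot X) (of_real y) = 0"
proof -
 obtain D where D: "D >= 0" "!!j y. norm (u j y) <= D * Wt y" using u_bound by auto
 interpret layer a k \<theta> u D
 proof unfold_locales
  fix x1 x2 assume x: "\<bar>x1\<bar> < a" "\<bar>x2\<bar> < a"
  have "Kd (Complex x1 x2) b = G (of_real x1 - of_real (Re b)) (of_real (x2 - Im b))" for b
   unfolding Kd_def G_def by (simp add: cmod_power2 flip: of_real_power of_real_diff of_real_add)
  then show "(\<Sum>j<4. LINT y|lborel. Kd (Complex x1 x2) (bpt j y) * u j y) = 0"
   using SV_inside[OF x] unfolding SV_layer by simp
 qed (use D in auto)
 have "SV (cs X) (of_real y) = 0" unfolding SV_layer TL_def[symmetric] cs_def by (rule TL_0[OF X y])
 then show ?thesis using SV_outside[OF X y] by simp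
qed

text \<open>Dominated convergence carries the vanishing to the corner heights, which the
  representation formula has to leave out because a pole there would lie on a diagonal path.\<close>

lemma V_edge_0:
 assumes X: "X > 0" and y: "\<bar>y\<bar> <= a"
 shows "V h 0 (rot X) (of_real y) = 0"
proof -
 define Y where "Y = (%n::nat. y * (1 - 1 / real (n + 2)))"
 have lim: "Y \<longlonglongrightarrow> y" unfolding Y_def by real_asymp
 have Y: "\<bar>Y n\<bar> < a" for n
 proof -
  have "\<bar>Y n\<bar> = \<bar>y\<bar> * (1 - 1 / real (n + 2))" unfolding Y_def abs_mult by simp
  also have "... <= a * (1 - 1 / real (n + 2))" using y by (intro mult_right_mono) auto
  also have "... < a" using a_pos by simp
  finally show ?thesis .
 qed
 obtain C \<mu> where C: "C > 0" "\<mu> > 0" "!!K z1 z2 s t. K \<in> {h, h1, h2} ==> z1 \<in> SZ ==> z2 \<in> SZ ==> 0 < s ==> 0 < t ==> s <= norm z1 + norm z2 ==> t <= norm z1 + norm z2 ==>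
    norm (K z1 z2) <= C * (s powr (-11/8) * exp (- \<mu> * s)) * t powr (-5/8)" using kernel_sep by metis
 have Jl: "(%n. J f (%s. h (rot X) (of_real (Y n) + \<sigma> * cs s))) \<longlonglongrightarrow> J f (%s. h (rot X) (of_real y + \<sigma> * cs s))"
  if f: "good f" and \<sigma>: "\<sigma> = 1 | \<sigma> = - 1" for f \<sigma>
 proof -
  obtain L where [measurable]: "f \<in> borel_measurable borel" and L: "L >= 0" "!!s. s > 0 ==> norm (f s) <= L * sqrt s" using f unfolding good_def by blast
  have S: "of_real t + \<sigma> * cs s \<in> SZ & s <= norm (of_real t + \<sigma> * cs s)" if "s > 0" "\<bar>t\<bar> <= a" for s t
   using SZ_cs[of s t] that \<sigma> by auto
  define w where "w = (%s. indicator {0<..} s *\<^sub>R (C * X powr (-5/8) * (s powr (-11/8) * exp (- \<mu> * s)) * (L * sqrt s)))"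
  show ?thesis unfolding J_def set_lebesgue_integral_def
  proof (rule integral_dominated_convergence[where w=w])
   show "integrable lborel w" using weight_integrable[OF C(2)] unfolding w_def set_integrable_def by blast
   show "AE s in lborel. (%n. indicator {0<..} s *\<^sub>R (h (rot X) (of_real (Y n) + \<sigma> * cs s) * f s)) \<longlonglongrightarrow> indicator {0<..} s *\<^sub>R (h (rot X) (of_real y + \<sigma> * cs s) * f s)"
   proof (rule AE_I2)
    fix s
    show "(%n. indicator {0<..} s *\<^sub>R (h (rot X) (of_real (Y n) + \<sigma> * cs s) * f s)) \<longlonglongrightarrow> indicator {0<..} s *\<^sub>R (h (rot X) (of_real y + \<sigma> * cs s) * f s)"
    proof (cases "s > 0")
     case True
     have "(rot X)^2 + (of_real y + \<sigma> * cs s)^2 \<notin> \<real>\<^sub>\<le>\<^sub>0"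
      by (rule SZ_q(3)) (use S[OF True y] X SZ_om[of X] norm_ge_zero[of "of_real y + \<sigma> * cs s"] in \<open>auto simp: norm_mult intro: add_pos_nonneg\<close>)
     from DERIV_isCont[OF DERIV_N1[OF this]]
     have "(%n. N1 ((rot X)^2 + (of_real (Y n) + \<sigma> * cs s)^2)) \<longlonglongrightarrow> N1 ((rot X)^2 + (of_real y + \<sigma> * cs s)^2)"
      by (rule isCont_tendsto_compose) (intro tendsto_intros lim)
     then show ?thesis unfolding h_def by (intro tendsto_intros)
    qed simp
   qed
   show "AE s in lborel. norm (indicator {0<..} s *\<^sub>R (h (rot X) (of_real (Y n) + \<sigma> * cs s) * f s)) <= w s" for n
   proof (rule AE_I2)
    fix s
    show "norm (indicator {0<..} s *\<^sub>R (h (rot X) (of_real (Y n) + \<sigma> * cs s) * f s)) <= w s"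
    proof (cases "s > 0")
     case True
     have "norm (h (rot X) (of_real (Y n) + \<sigma> * cs s)) <= C * (s powr (-11/8) * exp (- \<mu> * s)) * X powr (-5/8)"
      using S[OF True less_imp_le[OF Y], of n] X True SZ_om[of X] norm_ge_zero[of "of_real (Y n) + \<sigma> * cs s"]
      by (intro C(3)) (auto simp: norm_mult)
     from mult_mono[OF this L(2)[OF True]] show ?thesis using True C(1) by (simp add: w_def norm_mult mult_ac)
    qed (simp add: w_def)
   qed
  qed measurable
 qed
 have "(%n. V h 0 (rot X) (of_real (Y n))) \<longlonglongrightarrow> V h 0 (rot X) (of_real y)"
  unfolding V_def using Jl[OF good(1), of "-1" 0] Jl[OF good(2), of 1 0] by (intro tendsto_intros) simp_all
 then show ?thesis using V_side_0[OF X Y] by (simp add: LIMSEQ_const_iff)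
qed

text \<open>At the two corner heights the half-plane solution of side 0 is \<open>A\<close> applied
  to its data, which the coupling equations identify with data of the neighbouring sides.\<close>

lemma corner_0: "X > 0 ==> q 1 X = 0 & p 3 X = 0"
proof -
 assume X: "X > 0"
 have e: "of_real a - cs s = - rot s" "of_real a + cs s = of_real (2 * a) + rot s" "of_real (- a) - cs s = - (of_real (2 * a) + rot s)" "of_real (- a) + cs s = rot s" for s
  by (simp_all add: cs_def)
 have "V h 0 (rot X) (of_real a) = A (p 0) (q 0) X" "V h 0 (rot X) (of_real (- a)) = A (q 0) (p 0) X"
  unfolding V_def A_def e h_even by (simp_all add: add.commute)
 moreover have "V h 0 (rot X) (of_real a) = 0" "V h 0 (rot X) (of_real (- a)) = 0" using a_pos by (intro V_edge_0 X; simp)+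
 moreover have "p 4 = p 0" "q 4 = q 0" using per[of 0] by simp_all
 ultimately show ?thesis using p_eq[OF X, of 3] q_eq[OF X, of 0] by (simp add: eval_nat_numeral)
qed

text \<open>The assumptions are invariant under cyclic relabelling of the sides, so the result for
  one side gives all data.\<close>

lemma data_0: "X > 0 ==> p j X = 0 & q j X = 0"
proof -
 assume X: "X > 0"
 have s: "hdata a k \<theta> (%j. p (j + i)) (%j. q (j + i))" for i
  by unfold_locales (use good per p_eq q_eq in \<open>simp_all add: add.commute[of _ "4::nat"] add.assoc\<close>)
 have "p (j + 4) X = 0" using hdata.corner_0[OF s X, of "j + 1"] by (simp add: add.commute)
 moreover have "q (j + 4) X = 0" using hdata.corner_0[OF s X, of "j + 3"] by (simp add: add.commute)
 ultimately show ?thesis by (simp add: per)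
qed

end

section \<open>From the contour equations to the corner data\<close>

lemma AE_lborel_affine:
 fixes P :: "real => bool"
 assumes "AE t in lborel. P t" "c ~= 0"
 shows "AE r in lborel. P (t0 + c * r)"
proof -
 obtain N where N: "N \<in> null_sets lborel" "{t \<in> space lborel. \<not> P t} \<subseteq> N" using assms(1) by (rule AE_E3) auto
 have "AE t in lborel. t \<notin> N" by (rule AE_not_in[OF N(1)])
 moreover have "Measurable.pred borel (%t. t \<notin> N)" using N(1) by auto
 ultimately have "AE r in lborel. t0 + c * r \<notin> N" using AE_borel_affine[of c "%t. t \<notin> N" t0] assms(2) by simp
 then show ?thesis by eventually_elim (use N(2) in auto)
qed

context hsm begin

text \<open>For a fixed \<open>r > 0\<close> the kernel is bounded and decays exponentially in
  \<open>x\<close>, so it is square integrable and the product is controlled by the sum of the two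
  squares.\<close>

lemma kernel_L2_integrable:
 assumes r: "r > 0" and d: "0 <= d" "d <= 2 * a" and fm [measurable]: "f \<in> borel_measurable borel" and f: "set_integrable lborel {0<..} (%x. (norm (f x))^2)"
 shows "set_integrable lborel {0<..} (%x. h (rot r) (of_real d + rot x) * f x)"
proof -
 obtain C \<mu> where C: "C > 0" "\<mu> > 0" "!!d r x. 0 <= d ==> d <= 2 * a ==> 0 < r ==> 0 <= x ==>
   norm (h (rot r) (of_real d + rot x)) <= C * r / (r^2 + (max d x)^2) * exp (- \<mu> * x)" using h_bound by blast
 have "integrable lborel (%x. indicator {0<..} x *\<^sub>R ((C / r)^2 * exp (- (2 * \<mu>) * \<bar>x\<bar>)))"
  using integrable_exp_neg_abs[of "2 * \<mu>"] C(2) by (intro integrable_mult_indicator integrable_mult_right) auto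
 then have "integrable lborel (%x. indicator {0<..} x *\<^sub>R ((C / r)^2 * exp (- (2 * \<mu>) * \<bar>x\<bar>)) + indicator {0<..} x *\<^sub>R (norm (f x))^2)"
  using f unfolding set_integrable_def by (intro Bochner_Integration.integrable_add)
 then show ?thesis unfolding set_integrable_def
 proof (rule Bochner_Integration.integrable_bound)
  show "AE x in lborel. norm (indicator {0<..} x *\<^sub>R (h (rot r) (of_real d + rot x) * f x)) <=
   norm (indicator {0<..} x *\<^sub>R ((C / r)^2 * exp (- (2 * \<mu>) * \<bar>x\<bar>)) + indicator {0<..} x *\<^sub>R (norm (f x))^2)"
  proof (rule AE_I2)
   fix x :: real
   show "norm (indicator {0<..} x *\<^sub>R (h (rot r) (of_real d + rot x) * f x)) <=
    norm (indicator {0<..} x *\<^sub>R ((C / r)^2 * exp (- (2 * \<mu>) * \<bar>x\<bar>)) + indicator {0<..} x *\<^sub>R (norm (f x))^2)"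
   proof (cases "x > 0")
    case True
    define e where "e = C / r * exp (- \<mu> * x)"
    have "r / (r^2 + (max d x)^2) <= r / r^2" using r by (intro divide_left_mono mult_pos_pos add_pos_nonneg) auto
    then have "C * (r / (r^2 + (max d x)^2)) * exp (- \<mu> * x) <= C * (r / r^2) * exp (- \<mu> * x)" using C by (intro mult_right_mono mult_left_mono) auto
    then have "norm (h (rot r) (of_real d + rot x)) <= e" using C(3)[OF d r, of x] True r by (simp add: e_def power2_eq_square)
    then have "norm (h (rot r) (of_real d + rot x)) * norm (f x) <= e * norm (f x)" by (rule mult_right_mono) simp
    also have "... <= e^2 + (norm (f x))^2" using sum_squares_bound[of e "norm (f x)"] zero_le_power2[of e] zero_le_power2[of "norm (f x)"] by linarith
    also have "e^2 = (C / r)^2 * exp (- (2 * \<mu>) * \<bar>x\<bar>)" using True by (simp add: e_def power_mult_distrib power_divide exp_double[symmetric] mult_ac)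
    finally show ?thesis using True by (simp add: norm_mult)
   qed simp
  qed
 qed measurable
qed

text \<open>The second argument of the kernel is \<open>- rot (s - a)\<close> beyond the upper end,
  real on the side, and \<open>of_real (2 * a) + rot (- a - s)\<close> beyond the lower end. The
  middle piece drops out as the data vanish there; evenness of \<open>h\<close> in its second
  argument brings the upper piece into the form used by \<open>A\<close>. The squared distance never
  vanishes on the contour, so \<open>hker\<close> may be replaced by \<open>h\<close>
  throughout.\<close>

lemma Dop_eq_A:
 assumes r: "r > 0" and \<psi>m [measurable]: "\<psi> \<in> borel_measurable borel" and \<psi>: "integrable lborel (%t. (norm (\<psi> t))^2)"
  and mid: "AE t in lborel. -a < t & t < a --> \<psi> t = 0"
 shows "Dop a k \<theta> \<psi> (a + r) = A (%x. \<psi> (a + x)) (%x. \<psi> (- a - x)) r"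
proof -
 define g1 g2 where "g1 = (%x. indicator {0<..} x *\<^sub>R (h (rot r) (of_real 0 + rot x) * \<psi> (a + x)))"
  and "g2 = (%x. indicator {0<..} x *\<^sub>R (h (rot r) (of_real (2 * a) + rot x) * \<psi> (- a - x)))"
 have L2: "set_integrable lborel {0<..} (%x. (norm (\<psi> (a + x)))^2)" "set_integrable lborel {0<..} (%x. (norm (\<psi> (- a - x)))^2)"
  using lborel_integrable_real_affine[OF \<psi>, of 1 a] lborel_integrable_real_affine[OF \<psi>, of "-1" "- a"]
  unfolding set_integrable_def by (intro integrable_mult_indicator; simp)+
 have i: "integrable lborel g1" "integrable lborel g2"
  using kernel_L2_integrable[OF r _ _ _ L2(1), of 0] kernel_L2_integrable[OF r _ _ _ L2(2), of "2 * a"] a_pos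
  unfolding g1_def g2_def set_integrable_def by simp_all
 have ia: "integrable lborel (%s. g1 (- a + 1 * s))" "integrable lborel (%s. g2 (- a + -1 * s))"
  using lborel_integrable_real_affine[OF i(1), of 1 "- a"] lborel_integrable_real_affine[OF i(2), of "-1" "- a"] by simp_all
 have la: "(LINT s|lborel. g1 (- a + 1 * s)) = (LINT s|lborel. g1 s)" "(LINT s|lborel. g2 (- a + -1 * s)) = (LINT s|lborel. g2 s)"
  using lborel_integral_real_affine[of 1 g1 "- a"] lborel_integral_real_affine[of "-1" g2 "- a"] by simp_all
 have hk: "hker k (rot r) z = h (rot r) z" if "z \<in> SZ" for z
 proof (rule hker_eq_h)
  have "(rot r)^2 + z^2 \<notin> \<real>\<^sub>\<le>\<^sub>0" by (rule SZ_q(3)) (use that r SZ_om[of r] in \<open>auto simp: norm_mult intro: add_pos_nonneg\<close>)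
  then show "(rot r)^2 + z^2 ~= 0" by auto
 qed
 have tau: "of_real a - tau a \<theta> s = (if s < - a then of_real (2 * a) + rot (- a - s) else if s <= a then of_real (a - s) else - rot (s - a))" for s
  by (simp add: tau_def om_def algebra_simps)
 have SZ: "of_real a - tau a \<theta> s \<in> SZ" for s
  unfolding tau using a_pos by (auto intro!: SZ_real SZ_D(1) simp del: of_real_diff of_real_mult)
 have F: "h (rot r) (of_real a - tau a \<theta> s) * \<psi> s * tau' a \<theta> s = om * (g1 (- a + 1 * s) + g2 (- a + -1 * s))"
  if s: "s ~= a" "s ~= - a" "- a < s & s < a --> \<psi> s = 0" for s
 proof -
  consider "s > a" | "s < - a" | "- a < s & s < a" using s(1,2) by linarith
  then show ?thesis
   by cases (use a_pos s(3) in \<open>simp_all add: tau g1_def g2_def tau'_def om_def[symmetric] h_even del: of_real_diff of_real_mult\<close>)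
 qed
 have "Dop a k \<theta> \<psi> (a + r) = (LINT s|lborel. hker k (rot r) (of_real a - tau a \<theta> s) * \<psi> s * tau' a \<theta> s)"
  using r a_pos by (simp add: Dop_def tau_def[of a \<theta> "a + r"] om_def)
 also have "... = (LINT s|lborel. h (rot r) (of_real a - tau a \<theta> s) * \<psi> s * tau' a \<theta> s)" by (simp only: hk[OF SZ])
 also have "... = (LINT s|lborel. om * (g1 (- a + 1 * s) + g2 (- a + -1 * s)))"
 proof (rule integral_cong_AE)
  show "AE s in lborel. h (rot r) (of_real a - tau a \<theta> s) * \<psi> s * tau' a \<theta> s = om * (g1 (- a + 1 * s) + g2 (- a + -1 * s))"
   using mid AE_lborel_singleton[of a] AE_lborel_singleton[of "- a"] by eventually_elim (rule F)
  show "(%s. h (rot r) (of_real a - tau a \<theta> s) * \<psi> s * tau' a \<theta> s) \<in> borel_measurable lborel"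
   unfolding tau tau'_def by measurable
 qed (use ia in \<open>simp add: borel_measurable_integrable\<close>)
 also have "... = om * ((LINT s|lborel. g1 s) + (LINT s|lborel. g2 s))" using ia la by simp
 finally show ?thesis by (simp add: A_def J_def set_lebesgue_integral_def g1_def g2_def)
qed

end

theorem theorem5p2:
  fixes a k \<theta> :: real and \<phi> :: "nat \<Rightarrow> real \<Rightarrow> complex"
  assumes "a > 0" and "k > 0" and "0 < \<theta>" and "\<theta> < pi / 2"
    and L2: "\<And>j. j < 4 \<Longrightarrow> \<phi> j \<in> borel_measurable lborel
                         \<and> integrable lborel (\<lambda>t. (cmod (\<phi> j t))^2)"
    and left: "\<And>j. j < 4 \<Longrightarrow>
       AE t in lborel. t < -a \<longrightarrow> \<phi> j t = Sop (Dop a k \<theta> (\<phi> ((j + 3) mod 4))) t"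
    and right: "\<And>j. j < 4 \<Longrightarrow>
       AE t in lborel. t > a \<longrightarrow> \<phi> j t = Dop a k \<theta> (Sop (\<phi> ((j + 1) mod 4))) t"
    and mid: "\<And>j. j < 4 \<Longrightarrow> AE t in lborel. -a < t \<and> t < a \<longrightarrow> \<phi> j t = 0"
  shows "\<forall>j < 4. AE t in lborel. \<phi> j t = 0"
proof -
 interpret hsm a k \<theta> using assms by unfold_locales
 \<comment> \<open>The variable is now the distance beyond the end of a side. Indices are reduced
   modulo 4 so that \<open>Suc j\<close> and \<open>j + 3\<close> serve as successor and predecessor
   for every \<open>j\<close>.\<close>
 define P where "P = (%j r. \<phi> (j mod 4) (a + r))"
 define Q where "Q = (%j r. \<phi> (j mod 4) (- a - r))"
 have n1: "(1::real) ~= 0" and n2: "(- 1::real) ~= 0" by simp_all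
 have m: "(j::nat) mod 4 < 4" for j by simp
 have \<phi>m [measurable]: "\<phi> (j mod 4) \<in> borel_measurable borel" and \<phi>2: "integrable lborel (%t. (norm (\<phi> (j mod 4) t))^2)" for j
  using L2[OF m, of j] by auto
 have PQm [measurable]: "P j \<in> borel_measurable borel" "Q j \<in> borel_measurable borel" for j
  unfolding P_def Q_def by measurable
 have Pr: "AE r in lborel. r > 0 --> P j r = A (Q (Suc j)) (P (Suc j)) r" for j
 proof -
  have md: "AE t in lborel. -a < t & t < a --> \<phi> (Suc j mod 4) t = 0" by (rule mid[OF m])
  have md': "AE t in lborel. -a < t & t < a --> Sop (\<phi> (Suc j mod 4)) t = 0"
   using AE_lborel_affine[OF md n2, of 0] unfolding Sop_def by (simp add: conj_commute minus_less_iff less_minus_iff)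
  have "AE t in lborel. t > a --> \<phi> (j mod 4) t = Dop a k \<theta> (Sop (\<phi> (Suc j mod 4))) t"
   using right[OF m, of j] by (simp add: mod_Suc_eq)
  from AE_lborel_affine[OF this n1, of a] show ?thesis
  proof eventually_elim
   case (elim r)
   show ?case
   proof
    assume r: "r > 0"
    have "Dop a k \<theta> (Sop (\<phi> (Suc j mod 4))) (a + r) = A (%x. Sop (\<phi> (Suc j mod 4)) (a + x)) (%x. Sop (\<phi> (Suc j mod 4)) (- a - x)) r"
     by (rule Dop_eq_A[OF r _ _ md'])
       (use lborel_integrable_real_affine[OF \<phi>2[of "Suc j"], of "-1" 0] in \<open>simp_all add: Sop_def[abs_def]\<close>)
    moreover have "(%x. Sop (\<phi> (Suc j mod 4)) (a + x)) = Q (Suc j)" "(%x. Sop (\<phi> (Suc j mod 4)) (- a - x)) = P (Suc j)"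
     by (auto simp: Sop_def P_def Q_def fun_eq_iff intro!: arg_cong[where f="\<phi> (Suc j mod 4)"])
    ultimately show "P j r = A (Q (Suc j)) (P (Suc j)) r" using elim r by (simp add: P_def[THEN fun_cong, of j])
   qed
  qed
 qed
 have Qr: "AE r in lborel. r > 0 --> Q j r = A (P (j + 3)) (Q (j + 3)) r" for j
 proof -
  have "AE t in lborel. t < - a --> \<phi> (j mod 4) t = Sop (Dop a k \<theta> (\<phi> ((j + 3) mod 4))) t"
   using left[OF m, of j] by (simp only: mod_add_left_eq)
  from AE_lborel_affine[OF this n2, of "- a"] show ?thesis
  proof eventually_elim
   case (elim r)
   show ?case
   proof
    assume r: "r > 0"
    have "Dop a k \<theta> (\<phi> ((j + 3) mod 4)) (a + r) = A (P (j + 3)) (Q (j + 3)) r"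
     unfolding P_def Q_def by (rule Dop_eq_A[OF r \<phi>m \<phi>2 mid[OF m]])
    then show "Q j r = A (P (j + 3)) (Q (j + 3)) r" using elim r by (simp add: Sop_def Q_def add.commute)
   qed
  qed
 qed
 \<comment> \<open>\<open>P\<close> and \<open>Q\<close> satisfy the equations only almost
   everywhere. The right-hand sides themselves are taken as new representatives; as \<open>A\<close>
   does not see null sets, these satisfy the equations at every \<open>r > 0\<close>.\<close>
 define p where "p = (%j r. if r > 0 then A (Q (Suc j)) (P (Suc j)) r else 0)"
 define q where "q = (%j r. if r > 0 then A (P (j + 3)) (Q (j + 3)) r else 0)"
 have Am: "A f g \<in> borel_measurable borel" if [measurable]: "f \<in> borel_measurable borel" "g \<in> borel_measurable borel" for f g
  unfolding A_def[abs_def] J_def set_lebesgue_integral_def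
  by (intro borel_measurable_times borel_measurable_add borel_measurable_const lborel.borel_measurable_lebesgue_integral) measurable
 have pqm [measurable]: "p j \<in> borel_measurable borel" "q j \<in> borel_measurable borel" for j
  unfolding p_def q_def using Am[OF PQm(2,1)] Am[OF PQm(1,2)] by measurable
 have ae: "AE r in lborel. r > 0 --> P j r = p j r" "AE r in lborel. r > 0 --> Q j r = q j r" for j
  using Pr[of j] Qr[of j] by (auto simp: p_def q_def elim!: eventually_mono)
 have SL: "(LINT x:{0<..}|lborel. F x (f x)) = (LINT x:{0<..}|lborel. F x (g x))"
  if "AE r in lborel. r > 0 --> f r = g r" "(%x. F x (f x)) \<in> borel_measurable borel" "(%x. F x (g x)) \<in> borel_measurable borel"
  for f g :: "real => complex" and F :: "real => complex => 'z::{banach, second_countable_topology}"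
  using that unfolding set_lebesgue_integral_def
  by (intro integral_cong_AE) (auto elim!: eventually_mono simp: indicator_def)
 have JA: "A f g r = A f' g' r" if "AE r in lborel. r > 0 --> f r = f' r" "AE r in lborel. r > 0 --> g r = g' r"
  and [measurable]: "f \<in> borel_measurable borel" "g \<in> borel_measurable borel" "f' \<in> borel_measurable borel" "g' \<in> borel_measurable borel" for f f' g g' r
  unfolding A_def J_def
  by (intro arg_cong2[where f=times] arg_cong2[where f=plus] refl SL[OF that(1), of "%x y. h (rot r) (rot x) * y"] SL[OF that(2), of "%x y. h (rot r) (of_real (2 * a) + rot x) * y"]; measurable)
 have per: "P (j + 4) = P j" "Q (j + 4) = Q j" for j by (simp_all add: P_def Q_def)
 have pe: "p j r = A (q (Suc j)) (p (Suc j)) r" if "r > 0" for j r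
  using JA[OF ae(2,1) PQm(2,1) pqm(2,1), of "Suc j" "Suc j" r] that by (simp only: p_def[of] if_P)
 have qe: "q j r = A (p (j + 3)) (q (j + 3)) r" if "r > 0" for j r
  using JA[OF ae PQm pqm, of "j + 3" "j + 3" r] that by (simp only: q_def if_P)
 \<comment> \<open>A bound for the L2 norm of any single component, hence uniform over the
   unrestricted index \<open>j\<close>.\<close>
 define B2 where "B2 = (\<Sum>j<4. LINT t|lborel. (norm (\<phi> j t))^2)"
 have sq: "set_integrable lborel {0<..} (%x. (norm (f x))^2) & (LINT x:{0<..}|lborel. (norm (f x))^2) <= B2"
  if e: "AE x in lborel. x > 0 --> \<phi> (j mod 4) (t + c * x) = f x" and c: "\<bar>c\<bar> = 1" and [measurable]: "f \<in> borel_measurable borel" for f j t c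
 proof -
  let ?g = "%x. \<phi> (j mod 4) (t + c * x)"
  have c0: "c ~= 0" using c by auto
  have i: "integrable lborel (%x. (norm (?g x))^2)" by (rule lborel_integrable_real_affine[OF \<phi>2 c0])
  then have i': "integrable lborel (%x. indicator {0<..} x *\<^sub>R (norm (?g x))^2)" by (intro integrable_mult_indicator) auto
  have si: "set_integrable lborel {0<..} (%x. (norm (f x))^2)" unfolding set_integrable_def
   by (rule integrable_cong_AE_imp[OF i']) (use e in \<open>auto elim!: eventually_mono simp: indicator_def\<close>)
  have "(LINT x:{0<..}|lborel. (norm (f x))^2) = (LINT x:{0<..}|lborel. (norm (?g x))^2)"
   by (rule SL[OF e, of "%x y. (norm y)^2", symmetric]) measurable
  also have "... <= (LINT x|lborel. (norm (?g x))^2)" unfolding set_lebesgue_integral_def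
   by (rule integral_mono[OF i' i]) (auto simp: indicator_def)
  also have "... = (LINT t|lborel. (norm (\<phi> (j mod 4) t))^2)"
   using lborel_integral_real_affine[OF c0, of "%t. (norm (\<phi> (j mod 4) t))^2" t] c by simp
  also have "... <= B2" unfolding B2_def by (rule member_le_sum) (auto intro: integral_nonneg_AE)
  finally show ?thesis using si by simp
 qed
 have sp: "set_integrable lborel {0<..} (%x. (norm (p j x))^2) & (LINT x:{0<..}|lborel. (norm (p j x))^2) <= B2" for j
  by (rule sq[of j a 1]) (use ae(1)[of j] in \<open>simp_all add: P_def\<close>)
 have sq': "set_integrable lborel {0<..} (%x. (norm (q j x))^2) & (LINT x:{0<..}|lborel. (norm (q j x))^2) <= B2" for j
  by (rule sq[of j "- a" "- 1"]) (use ae(2)[of j] in \<open>simp_all add: Q_def\<close>)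
 \<comment> \<open>Both kinds of data form one family, so that \<open>corner_bound\<close> iterates
   the whole coupled system at once and returns a single constant.\<close>
 define f where "f = (%(b, j). if b then p j else q j)"
 have "\<exists>L>0. \<forall>i. \<forall>r>0. norm (f i r) <= L * sqrt r"
 proof (rule corner_bound[where s="%(b, j). if b then (False, Suc j) else (True, j + 3)" and s'="%(b, j). if b then (True, Suc j) else (False, j + 3)" and ?B2.0=B2])
  show "f i r = A (f (case i of (b, j) => if b then (False, Suc j) else (True, j + 3))) (f (case i of (b, j) => if b then (True, Suc j) else (False, j + 3))) r"
   if "r > 0" for i r
   using pe[OF that] qe[OF that] by (simp add: f_def split: prod.splits)
 qed (use sp sq' in \<open>simp_all add: f_def split: prod.splits\<close>)
 then obtain L where L: "L > 0" "!!i r. r > 0 ==> norm (f i r) <= L * sqrt r" by blast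
 have gd: "good (p j)" "good (q j)" for j
  unfolding good_def using L(2)[of _ "(True, j)"] L(2)[of _ "(False, j)"] L(1) by (auto simp: f_def intro!: exI[of _ L])
 have per': "p (j + 4) = p j" "q (j + 4) = q j" for j
 proof -
  have "Suc (j + 4) = Suc j + 4" "j + 4 + 3 = j + 3 + 4" by simp_all
  then show "p (j + 4) = p j" "q (j + 4) = q j" by (simp_all only: p_def q_def per)
 qed
 interpret hdata a k \<theta> p q
 proof unfold_locales
  show "q (Suc j) r = A (p j) (q j) r" if "r > 0" for j r
   using qe[OF that, of "Suc j"] per'[of j] by (simp add: eval_nat_numeral)
 qed (use gd per' pe in auto)
 have z: "AE r in lborel. r > 0 --> P j r = 0" "AE r in lborel. r > 0 --> Q j r = 0" for j
  using ae[of j] data_0 by (auto elim!: eventually_mono)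
 show ?thesis
 proof (intro allI impI)
  fix j :: nat assume j: "j < 4"
  show "AE t in lborel. \<phi> j t = 0"
   using AE_lborel_affine[OF z(1)[of j] n1, of "- a"] AE_lborel_affine[OF z(2)[of j] n2, of "- a"] mid[OF j] AE_lborel_singleton[of a] AE_lborel_singleton[of "- a"]
  proof eventually_elim
   case (elim t)
   consider "t > a" | "t < - a" | "- a < t & t < a" using elim(4,5) by linarith
   then show ?case by cases (use elim j in \<open>simp_all add: P_def Q_def\<close>)
  qed
 qed
qed

end
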